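(* Suppose there is $(\beta^*,\theta^* )\in\mathbb R^q\times\Theta$ such that for all $\mathbf X$ the distribution of $\mathbf y\mid\mathbf X$ under $P$ has the elliptically contoured density $f_{\mu,\Sigma}$ with $\mu=\mathbf X\beta^*$ and $\Sigma=\mathbf V(\theta^* )$, and suppose $\mathbb E\|\mathbf s\|^2<\infty$. Suppose $\rho_1$ is symmetric around zero with $\rho_1(0)=0$, that for some finite $c_1>0$ it is constant on $[c_1,\infty)$ and strictly increasing on $[0,c_1]$, that it is twice continuously differentiable, and that $u_1(s)=\rho_1'(s)/s$ is continuous and of bounded variation. Suppose $\mathbf V$ is twice continuously differentiable and has the linear structure $\mathbf V(\gamma)=\sum_{j=1}^l\gamma_j\mathbf L_j$. Let $\sigma_n$ and $\sigma(P)$ be solutions of the scale equations at $\mathbb P_n$ and at $P$, respectively, and suppose $\sigma_n-\sigma(P)=O_P(1/\sqrt n)$. Let $\xi_n=(\beta_{1,n},\gamma_n)\in\mathfrak D$ and $\xi(P)=(\beta_1(P),\gamma(P))\in\mathfrak D$ be local minima of $R_n(\beta,\mathbf V(\gamma))$ and $R_P(\beta,\mathbf V(\gamma))$, respectively, and suppose $\xi_n\to\xi(P)$ in probability. Suppose that $\beta_1(P)=\beta^*$ and $\mathbf V(\gamma(P))=\Sigma/|\Sigma|^{1/k}$. Put $c_\sigma=|\Sigma|^{1/(2k)}/\sigma(P)$, $$\alpha_1=\mathbb E_{\mathbf 0,\mathbf I_k}\left[\left(1-\frac1k\right)\frac{\rho_1'(c_\sigma\|\mathbf z\|)}{c_\sigma\|\mathbf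 z\|}+\frac1k\rho_1''(c_\sigma\|\mathbf z\|)\right],$$ $$\gamma_1=\frac{\mathbb E_{\mathbf 0,\mathbf I_k}\left[\rho_1''(c_\sigma\|\mathbf z\|)(c_\sigma\|\mathbf z\|)^2+(k+1)\rho_1'(c_\sigma\|\mathbf z\|)c_\sigma\|\mathbf z\|\right]}{k+2},\qquad \sigma_1=\frac{k\,\mathbb E_{\mathbf 0,\mathbf I_k}\left[\rho_1'(c_\sigma\|\mathbf z\|)^2(c_\sigma\|\mathbf z\|)^2\right]}{(k+2)\gamma_1^2},$$ and suppose $\alpha_1\ne0$ and $\gamma_1>0$. Suppose $\mathbf X$ has full rank with probability one (so that $\mathbb E[\mathbf X^T\Sigma^{-1}\mathbf X]$ is non-singular) and that the $k^2\times l$ matrix $\mathbf L=[\mathrm{vec}(\mathbf L_1)\ \cdots\ \mathrm{vec}(\mathbf L_l)]$ has full rank. Then $\sqrt n(\beta_{1,n}-\beta^* )$ and $\sqrt n(\gamma_n-\gamma(P))$ are asymptotically independent. Furthermore, $\sqrt n(\beta_{1,n}-\beta^* )$ is asymptotically normal with mean zero and variance $$\frac{\mathbb E_{\mathbf 0,\mathbf I_k}\left[\rho_1'(c_\sigma\|\mathbf z\|)^2\right]}{c_\sigma^2k\alpha_1^2}\left(\mathbb E[\mathbf X^T\Sigma^{-1}\mathbf X]\right)^{-1},$$ and $\sqrt n(\gamma_n-\gamma(P))$ is asymptotically normal with mean zero and variance $$\frac{2\sigma_1}{|\Sigma|^{2/k}}\left\{\left(\mathbf L^T(\Sigma^{-1}\otimes\Sigma^{-1})\mathbf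 L\right)^{-1}-\frac1k\theta^*(\theta^* )^T\right\}.$$
   Context: Fix positive integers $k,q,l$. A point $\mathbf s=(\mathbf y,\mathbf X)$, with $\mathbf y\in\mathbb R^k$ and $\mathbf X\in\mathbb R^{k\times q}$, is identified with a point of $\mathbb R^k\times\mathbb R^{kq}$; $P$ is a probability measure on this space, $\mathbb E$ is expectation under $P$. The observations $\mathbf s_1,\mathbf s_2,\dots$ are independent with distribution $P$, and $\mathbb P_n$ is the empirical measure of $\mathbf s_1,\dots,\mathbf s_n$. $\mathrm{PDS}(k)$ is the set of positive definite symmetric $k\times k$ matrices; $|\mathbf A|$ is the determinant; $\mathrm{vec}$ stacks the columns of a matrix; $\otimes$ is the Kronecker product. $\Theta\subset\mathbb R^l$ and $\mathbf V:\Theta\to\mathrm{PDS}(k)$ is a known injective (identifiable) map; in the linear structure $\mathbf L_1,\dots,\mathbf L_l$ are known symmetric $k\times k$ matrices. Put $\Gamma(\theta)=\mathbf V(\theta)/|\mathbf V(\theta)|^{1/k}$ and $\mathfrak D=\{(\beta,\gamma)\in\mathbb R^q\times\Theta:\mathbf V(\gamma)\in\mathrm{PDS}(k),\ |\mathbf V(\gamma)|=1\}$. $\rho_0,\rho_1:\mathbb R\to[0,\infty)$ are the loss functions and $0<b_0<\sup\rho_0$. Initial functionals $Q\mapsto(\beta_0(Q),\theta_0(Q))\in\mathbb R^q\times\Theta$ are given, with initial estimators $(\beta_{0,n},\theta_{0,n})=(\beta_0(\mathbb P_n),\theta_0(\mathbb P_n))$. The scale equation at a probability measure $Q$, to be solved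 for $\sigma>0$, is $$\int\rho_0\left(\frac{\sqrt{(\mathbf y-\mathbf X\beta_0(Q))^T\Gamma(\theta_0(Q))^{-1}(\mathbf y-\mathbf X\beta_0(Q))}}{\sigma}\right)dQ(\mathbf s)=b_0;$$ $\sigma(P)$ is a solution for $Q=P$ and $\sigma_n=\sigma(\mathbb P_n)$ for $Q=\mathbb P_n$. Further $R_Q(\beta,\mathbf C)=\int\rho_1\big(\sqrt{(\mathbf y-\mathbf X\beta)^T\mathbf C^{-1}(\mathbf y-\mathbf X\beta)}/\sigma(Q)\big)\,dQ(\mathbf s)$ and $R_n=R_{\mathbb P_n}$. Local minima are over $(\beta,\gamma)\in\mathfrak D$. The elliptically contoured density is $f_{\mu,\Sigma}(\mathbf y)=|\Sigma|^{-1/2}m\big((\mathbf y-\mu)^T\Sigma^{-1}(\mathbf y-\mu)\big)$ for a fixed $m:[0,\infty)\to[0,\infty)$; $\mathbb E_{\mathbf 0,\mathbf I_k}$ denotes expectation for $\mathbf z$ with density $f_{\mathbf 0,\mathbf I_k}$.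
   Formalization: Θ is taken to be open, since with γ(P) on the boundary of Θ the limit can be one-sided rather than normal; and for k<q the non-singularity of E[X^TΣ^{-1}X], which full rank of X does not then imply, is assumed. *)

theory Defs
  imports "HOL-Probability.Probability"
begin

section \<open>Matrices\<close>

definition PDS :: "(real^'k^'k) set" where
  "PDS = {A. transpose A = A \<and> (\<forall>x. x \<noteq> 0 \<longrightarrow> 0 < x \<bullet> (A *v x))}"

definition full_rank :: "real^'n^'m \<Rightarrow> bool" where
  "full_rank A \<longleftrightarrow> rank A = min CARD('m) CARD('n)"

text \<open>
  Vectors of length \<open>k\<^sup>2\<close> are indexed by pairs.  The pair \<open>(j, i)\<close> stands for the position
  \<open>(j - 1) k + i\<close>, so that stacking the columns of \<open>A\<close> puts the entry in row \<open>i\<close> and column \<open>j\<close>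
  at \<open>(j, i)\<close>; the Kronecker product uses the same numbering.
\<close>

definition vec_cols :: "real^'n^'m \<Rightarrow> real^('n \<times> 'm)" where
  "vec_cols A = (\<chi> p. A $ snd p $ fst p)"

definition kronecker :: "real^'n^'m \<Rightarrow> real^'b^'a \<Rightarrow> real^('n \<times> 'b)^('m \<times> 'a)" where
  "kronecker A B = (\<chi> p r. A $ fst p $ fst r * B $ snd p $ snd r)"

definition vec_matrix :: "('l \<Rightarrow> real^'k^'k) \<Rightarrow> real^'l^('k \<times> 'k)" where
  "vec_matrix L = (\<chi> p j. vec_cols (L j) $ p)"

definition outer :: "real^'l \<Rightarrow> real^'l^'l" where
  "outer v = (\<chi> i j. v $ i * v $ j)"

definition shape :: "real^'k^'k \<Rightarrow> real^'k^'k" where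
  "shape A = (1 / det A powr (1 / real CARD('k))) *\<^sub>R A"

definition mahalanobis :: "real^'k^'k \<Rightarrow> real^'k \<Rightarrow> real" where
  "mahalanobis C r = sqrt (r \<bullet> (matrix_inv C *v r))"

section \<open>Real analysis\<close>

definition C2_on :: "('a::real_normed_vector) set \<Rightarrow> ('a \<Rightarrow> 'b::real_normed_vector) \<Rightarrow> bool" where
  "C2_on S f \<longleftrightarrow>
     (\<exists>(f' :: 'a \<Rightarrow> 'a \<Rightarrow>\<^sub>L 'b) (f'' :: 'a \<Rightarrow> 'a \<Rightarrow>\<^sub>L ('a \<Rightarrow>\<^sub>L 'b)).
        (\<forall>x\<in>S. (f has_derivative blinfun_apply (f' x)) (at x)) \<and>
        (\<forall>x\<in>S. (f' has_derivative blinfun_apply (f'' x)) (at x)) \<and>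
        continuous_on S f'')"

definition bounded_variation :: "(real \<Rightarrow> real) \<Rightarrow> bool" where
  "bounded_variation f \<longleftrightarrow>
     (\<exists>B. \<forall>(n::nat) t. mono t \<longrightarrow> (\<Sum>i<n. \<bar>f (t (Suc i)) - f (t i)\<bar>) \<le> B)"

definition local_min_on :: "'a::topological_space set \<Rightarrow> ('a \<Rightarrow> real) \<Rightarrow> 'a \<Rightarrow> bool" where
  "local_min_on D f x \<longleftrightarrow> x \<in> D \<and> (\<forall>\<^sub>F y in at x within D. f x \<le> f y)"

section \<open>Probability\<close>

text \<open>For \<open>n = 0\<close> the empirical measure is the null measure.\<close>

definition empirical_measure :: "nat \<Rightarrow> (nat \<Rightarrow> 'a::topological_space) \<Rightarrow> 'a measure" where
  "empirical_measure n x = distr (uniform_count_measure {..<n}) borel x"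

definition conditional_density ::
  "('a::euclidean_space \<times> 'b::euclidean_space) measure \<Rightarrow> ('b \<Rightarrow> 'a \<Rightarrow> real) \<Rightarrow> bool" where
  "conditional_density P f \<longleftrightarrow>
     (\<forall>x. (\<integral>\<^sup>+ y. ennreal (f x y) \<partial>lborel) = 1) \<and>
     (\<forall>A\<in>sets borel. \<forall>B\<in>sets borel.
        emeasure P (A \<times> B) =
          (\<integral>\<^sup>+ x\<in>B. (\<integral>\<^sup>+ y\<in>A. ennreal (f x y) \<partial>lborel) \<partial>distr P borel snd))"

definition ec_density :: "(real \<Rightarrow> real) \<Rightarrow> real^'k \<Rightarrow> real^'k^'k \<Rightarrow> real^'k \<Rightarrow> real" where
  "ec_density m \<mu> \<Sigma> y =
     det \<Sigma> powr (- 1 / 2) * m ((y - \<mu>) \<bullet> (matrix_inv \<Sigma> *v (y - \<mu>)))"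

definition ec_expectation :: "(real \<Rightarrow> real) \<Rightarrow> (real^'k \<Rightarrow> real) \<Rightarrow> real" where
  "ec_expectation m g = (\<integral>z. g z \<partial>density lborel (\<lambda>z. ennreal (ec_density m 0 (mat 1) z)))"

definition converges_in_probability ::
  "'w measure \<Rightarrow> (nat \<Rightarrow> 'w \<Rightarrow> 'a::metric_space) \<Rightarrow> 'a \<Rightarrow> bool" where
  "converges_in_probability M X c \<longleftrightarrow>
     (\<forall>\<epsilon>>0. (\<lambda>n. measure M {\<omega> \<in> space M. dist (X n \<omega>) c > \<epsilon>}) \<longlonglongrightarrow> 0)"

definition O_P :: "'w measure \<Rightarrow> (nat \<Rightarrow> real) \<Rightarrow> (nat \<Rightarrow> 'w \<Rightarrow> real) \<Rightarrow> bool" where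
  "O_P M r X \<longleftrightarrow>
     (\<forall>\<epsilon>>0. \<exists>K. \<forall>\<^sub>F n in sequentially. measure M {\<omega> \<in> space M. \<bar>X n \<omega>\<bar> > K * r n} < \<epsilon>)"

definition converges_in_distribution ::
  "'w measure \<Rightarrow> (nat \<Rightarrow> 'w \<Rightarrow> 'a::topological_space) \<Rightarrow> 'a measure \<Rightarrow> bool" where
  "converges_in_distribution M X N \<longleftrightarrow>
     (\<forall>f :: 'a \<Rightarrow> real. continuous_on UNIV f \<and> bounded (range f) \<longrightarrow>
        (\<lambda>n. \<integral>\<omega>. f (X n \<omega>) \<partial>M) \<longlonglongrightarrow> (\<integral>x. f x \<partial>N))"

definition std_normal_vector :: "(real^'n) measure" where
  "std_normal_vector = density lborel (\<lambda>z. ennreal (\<Prod>i\<in>UNIV. std_normal_density (z $ i)))"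

text \<open>The covariance matrix may be singular.\<close>

definition multivariate_normal :: "real^'n \<Rightarrow> real^'n^'n \<Rightarrow> (real^'n) measure \<Rightarrow> bool" where
  "multivariate_normal \<mu> S N \<longleftrightarrow>
     (\<exists>B :: real^'n^'n. S = B ** transpose B \<and>
        N = distr std_normal_vector borel (\<lambda>z. \<mu> + B *v z))"

definition asymptotically_normal ::
  "'w measure \<Rightarrow> (nat \<Rightarrow> 'w \<Rightarrow> real^'n) \<Rightarrow> real^'n \<Rightarrow> real^'n^'n \<Rightarrow> bool" where
  "asymptotically_normal M X \<mu> S \<longleftrightarrow>
     (\<exists>N. multivariate_normal \<mu> S N \<and> converges_in_distribution M X N)"

definition asymptotically_independent ::
  "'w measure \<Rightarrow> (nat \<Rightarrow> 'w \<Rightarrow> 'a::euclidean_space) \<Rightarrow> (nat \<Rightarrow> 'w \<Rightarrow> 'b::euclidean_space) \<Rightarrow> bool" where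
  "asymptotically_independent M X Y \<longleftrightarrow>
     (\<exists>N1 N2. prob_space N1 \<and> sets N1 = sets borel \<and> prob_space N2 \<and> sets N2 = sets borel \<and>
        converges_in_distribution M X N1 \<and> converges_in_distribution M Y N2 \<and>
        converges_in_distribution M (\<lambda>n \<omega>. (X n \<omega>, Y n \<omega>)) (N1 \<Otimes>\<^sub>M N2))"

section \<open>Linear models with structured covariance\<close>

text \<open>A point \<open>(y, X)\<close> consists of a response vector and a design matrix with \<open>k\<close> rows and \<open>q\<close> columns.\<close>

type_synonym ('k, 'q) obs = "(real^'k) \<times> (real^'q^'k)"

definition scale_solution ::
  "(real \<Rightarrow> real) \<Rightarrow> real \<Rightarrow> (real^'l \<Rightarrow> real^'k^'k) \<Rightarrow>
   (('k, 'q) obs measure \<Rightarrow> real^'q) \<Rightarrow> (('k, 'q) obs measure \<Rightarrow> real^'l) \<Rightarrow>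
   ('k, 'q) obs measure \<Rightarrow> real \<Rightarrow> bool" where
  "scale_solution \<rho> b V \<beta>\<^sub>0 \<theta>\<^sub>0 Q \<sigma> \<longleftrightarrow>
     0 < \<sigma> \<and>
     (\<integral>(y, X). \<rho> (mahalanobis (shape (V (\<theta>\<^sub>0 Q))) (y - X *v \<beta>\<^sub>0 Q) / \<sigma>) \<partial>Q) = b"

definition objective ::
  "(real \<Rightarrow> real) \<Rightarrow> (('k, 'q) obs measure \<Rightarrow> real) \<Rightarrow> ('k, 'q) obs measure \<Rightarrow>
   real^'q \<Rightarrow> real^'k^'k \<Rightarrow> real" where
  "objective \<rho> \<sigma> Q \<beta> C = (\<integral>(y, X). \<rho> (mahalanobis C (y - X *v \<beta>) / \<sigma> Q) \<partial>Q)"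

definition feasible :: "(real^'l) set \<Rightarrow> (real^'l \<Rightarrow> real^'k^'k) \<Rightarrow> ((real^'q) \<times> (real^'l)) set" where
  "feasible \<Theta> V = {(\<beta>, \<gamma>). \<gamma> \<in> \<Theta> \<and> V \<gamma> \<in> PDS \<and> det (V \<gamma>) = 1}"

end

theory Submission
  imports Defs
begin

text \<open>
  Write \<open>V \<theta>\<^sub>s = B ** transpose B\<close> and let \<open>c = c\<^sub>\<sigma>\<close>.  The standardized observation \<open>(z, X)\<close>, with
  \<open>z = c B\<^sup>-\<^sup>1 (y - X \<beta>\<^sub>s)\<close> and with the design multiplied by \<open>c B\<^sup>-\<^sup>1\<close>, has a spherical error that is
  independent of the design.  A parameter becomes a pair \<open>(b, E)\<close>, where \<open>b\<close> is the error of the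
  coefficients and \<open>mat 1 + E\<close> is the inverse of the fitted covariance in units of the estimated scale; the
  truth is \<open>(0, 0)\<close>.  A local minimum of the objective on the surface of determinant one annihilates the
  average score in every direction tangent to that surface.  The tangent directions come from moving the
  coefficients, and from moving \<open>\<gamma>\<close> along a line and rescaling to determinant one; because of the linear
  structure the latter path stays feasible (\<open>stationary_mean\<close>, \<open>stationary_shape\<close>,
  \<open>standardized_score_equations\<close>).

  The score is the product of a weight \<open>u\<close> and a polynomial in the residual.  As a function of the
  parameter it is Lipschitz near the truth, with a constant quadratic in the size of the design, and it is
  differentiable at the truth unless \<open>z = 0\<close>.  By dominated convergence its remainder, relative to
  the size of the parameter and uniformly in a small ball, has small expectation, so
  the average score at a random parameter \<open>\<tau>\<close> near the truth is the average score at the truth plus the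
  expected derivative at \<open>\<tau>\<close>, up to \<open>o(norm \<tau>)\<close> (\<open>avg_expansion\<close>).  The Lipschitz
  constant is integrable because the design has second moments.

  Spherical symmetry makes the expected derivatives explicit.  For the coefficients it is a multiple of the
  Gram form of the design and does not see \<open>E\<close> (\<open>expected_mean_deriv\<close>); for the shape it is a multiple of
  the deviator of \<open>E\<close> and does not see \<open>b\<close> (\<open>expected_shape_deriv\<close>).  The scale estimate multiplies
  \<open>mat 1 + E\<close> by a number, and the deviator ignores multiples of the identity; so the error of the
  scale, being of order \<open>1 / sqrt n\<close>, drops out to first order.  On determinant one
  the trace of the shape error is of second order, so that the deviator carries the full information
  (\<open>shape_linearization\<close>).

  Hence each linear functional of the errors is an average of centred independent terms up to a relative
  error \<open>o(1)\<close>, which gives both the rate and the limit of the characteristic functions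
  (\<open>char_of_asymptotically_linear\<close>, \<open>char_limit\<close>).  The two scores have opposite parity in \<open>z\<close>, so they are
  uncorrelated and the limiting characteristic function is a product of Gaussian ones; the continuity theorem
  of Levy in Euclidean space (\<open>converges_in_distribution_of_char\<close>) turns this into asymptotic independence and
  normality.  The covariances are moments of a spherical law up to degree four (\<open>score_moments\<close>).
\<close>

section \<open>Characteristic functions determine weak limits in Euclidean space\<close>

text \<open>Coordinate-free, since the continuity theorem is applied to a product of two Euclidean spaces.\<close>

definition standard_gaussian :: "'a::euclidean_space measure" where
  "standard_gaussian = density lborel (\<lambda>z. ennreal (\<Prod>b\<in>Basis. std_normal_density (z \<bullet> b)))"

lemma std_normal_vector_eq: "(std_normal_vector :: (real^'n) measure) = standard_gaussian"
proof -
  have B: "(Basis :: (real^'n) set) = range (\<lambda>i. axis i 1)"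
    by (auto simp: Basis_vec_def)
  have "inj (\<lambda>i. axis i (1::real) :: real^'n)"
    by (auto simp: inj_on_def axis_eq_axis)
  then have "(\<Prod>b\<in>Basis. std_normal_density (z \<bullet> b)) = (\<Prod>i\<in>UNIV. std_normal_density (z $ i))" for z :: "real^'n"
    unfolding B by (subst prod.reindex) (auto simp: inner_axis)
  then show ?thesis by (simp add: std_normal_vector_def standard_gaussian_def)
qed

lemma sets_standard_gaussian [simp, measurable_cong]: "sets standard_gaussian = sets borel"
  by (simp add: standard_gaussian_def)

lemma space_standard_gaussian [simp]: "space standard_gaussian = UNIV"
  by (simp add: standard_gaussian_def)

lemma gaussian_density_eq:
  fixes z :: "'a::euclidean_space"
  shows "(\<Prod>b\<in>Basis. std_normal_density (z \<bullet> b)) = (1 / sqrt (2 * pi)) ^ DIM('a) * exp (- (norm z)\<^sup>2 / 2)"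
proof -
  have "(\<Prod>b\<in>(Basis::'a set). std_normal_density (z \<bullet> b)) = (\<Prod>b\<in>(Basis::'a set). (1 / sqrt (2 * pi)) * exp (- (z \<bullet> b)\<^sup>2 / 2))"
    by (simp add: std_normal_density_def)
  also have "\<dots> = (1 / sqrt (2 * pi)) ^ DIM('a) * exp (\<Sum>b\<in>(Basis::'a set). - (z \<bullet> b)\<^sup>2 / 2)"
    by (simp add: prod_dividef power_divide exp_sum)
  also have "(\<Sum>b\<in>(Basis::'a set). - (z \<bullet> b)\<^sup>2 / 2) = - (norm z)\<^sup>2 / 2"
    by (simp add: norm_eq_sqrt_inner euclidean_inner[of z z] sum_negf sum_divide_distrib[symmetric]
        power2_eq_square sum_nonneg)
  finally show ?thesis .
qed

lemma prob_space_standard_gaussian: "prob_space (standard_gaussian :: 'a::euclidean_space measure)"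
proof
  interpret product_sigma_finite "\<lambda>b::'a. (lborel :: real measure)" ..
  have 1: "(\<integral>\<^sup>+ x. ennreal (std_normal_density x) \<partial>lborel) = 1"
    using prob_space.emeasure_space_1[OF prob_space_normal_density[of 1 0]] by (simp add: emeasure_density)
  have "emeasure (standard_gaussian :: 'a measure) UNIV
      = (\<integral>\<^sup>+ z. ennreal (\<Prod>b\<in>Basis. std_normal_density (z \<bullet> b)) \<partial>(lborel :: 'a measure))"
    by (simp add: standard_gaussian_def emeasure_density)
  also have "\<dots> = (\<integral>\<^sup>+ f. (\<Prod>b\<in>Basis. ennreal (std_normal_density (f b))) \<partial>(\<Pi>\<^sub>M b\<in>(Basis::'a set). lborel))"
    unfolding lborel_eq[where 'a='a]
    by (subst nn_integral_distr) (auto simp: prod_ennreal)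
  also have "\<dots> = (\<Prod>b\<in>(Basis::'a set). 1)"
    by (subst product_nn_integral_prod) (auto simp: 1)
  finally show "emeasure (standard_gaussian :: 'a measure) (space standard_gaussian) = 1" by simp
qed

lemma char_standard_gaussian:
  fixes t :: "'a::euclidean_space"
  shows "(\<integral>z. iexp (t \<bullet> z) \<partial>standard_gaussian) = of_real (exp (- (norm t)\<^sup>2 / 2))"
proof -
  interpret product_sigma_finite "\<lambda>b::'a. (lborel :: real measure)" ..
  let ?f = "\<lambda>b x. std_normal_density x *\<^sub>R iexp ((t \<bullet> b) * x) :: complex"
  have int: "integrable lborel (?f b)" for b
  proof (rule Bochner_Integration.integrable_bound[where f="std_normal_density"])
    show "integrable lborel std_normal_density"
      using integrable_normal_density[of 1 0] by simp
  qed auto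
  have 1: "(\<integral>x. ?f b x \<partial>lborel) = of_real (exp (- (t \<bullet> b)\<^sup>2 / 2))" for b
    using fun_cong[OF char_std_normal_distribution, of "t \<bullet> b"] unfolding char_def
    by (simp add: integral_density)
  have "(\<integral>z. iexp (t \<bullet> z) \<partial>standard_gaussian)
     = (\<integral>z. (\<Prod>b\<in>Basis. std_normal_density (z \<bullet> b)) *\<^sub>R iexp (t \<bullet> z) \<partial>lborel)"
    unfolding standard_gaussian_def by (subst integral_density) (auto intro!: prod_nonneg)
  also have "\<dots> = (\<integral>f. (\<Prod>b\<in>Basis. ?f b (f b)) \<partial>(\<Pi>\<^sub>M b\<in>(Basis::'a set). lborel))"
    unfolding lborel_eq[where 'a='a]
  proof (subst integral_distr, goal_cases)
    case 3
    show ?case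
    proof (intro Bochner_Integration.integral_cong refl)
      fix f :: "'a \<Rightarrow> real"
      have "t \<bullet> (\<Sum>b\<in>Basis. f b *\<^sub>R b) = (\<Sum>b\<in>Basis. (t \<bullet> b) * f b)"
        by (simp add: inner_sum_right mult.commute)
      then have "iexp (t \<bullet> (\<Sum>b\<in>Basis. f b *\<^sub>R b)) = (\<Prod>b\<in>Basis. iexp ((t \<bullet> b) * f b))"
        by (simp add: exp_sum[symmetric] sum_distrib_left)
      then show "(\<Prod>b\<in>Basis. std_normal_density ((\<Sum>b\<in>Basis. f b *\<^sub>R b) \<bullet> b)) *\<^sub>R iexp (t \<bullet> (\<Sum>b\<in>Basis. f b *\<^sub>R b))
         = (\<Prod>b\<in>Basis. ?f b (f b))"
        by (simp add: scaleR_conv_of_real prod.distrib)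
    qed
  qed auto
  also have "\<dots> = (\<Prod>b\<in>(Basis::'a set). of_real (exp (- (t \<bullet> b)\<^sup>2 / 2)))"
    by (subst product_integral_prod) (use int 1 in auto)
  also have "\<dots> = of_real (exp (\<Sum>b\<in>(Basis::'a set). - (t \<bullet> b)\<^sup>2 / 2))"
    by (simp add: exp_sum)
  also have "(\<Sum>b\<in>(Basis::'a set). - (t \<bullet> b)\<^sup>2 / 2) = - (norm t)\<^sup>2 / 2"
    by (simp add: norm_eq_sqrt_inner euclidean_inner[of t t] sum_negf sum_divide_distrib[symmetric]
        power2_eq_square sum_nonneg)
  finally show ?thesis .
qed

text \<open>
  The Gaussian kernel is, up to scaling, its own characteristic function.  So the integral of a Gaussian
  bump is a Gaussian average of the characteristic function.
\<close>

lemma gaussian_kernel_integral: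
  fixes \<nu> :: "'a::euclidean_space measure"
  assumes "prob_space \<nu>" and [simp, measurable_cong]: "sets \<nu> = sets borel"
  shows "of_real (\<integral>x. exp (- (norm (c *\<^sub>R (x - y)))\<^sup>2 / 2) \<partial>\<nu>)
    = (\<integral>z. iexp (- ((c *\<^sub>R y) \<bullet> z)) * (\<integral>x. iexp ((c *\<^sub>R z) \<bullet> x) \<partial>\<nu>) \<partial>standard_gaussian)"
proof -
  interpret \<nu>: prob_space \<nu> by fact
  interpret G: prob_space "standard_gaussian :: 'a measure" by (rule prob_space_standard_gaussian)
  interpret pair_prob_space \<nu> "standard_gaussian :: 'a measure" ..
  have "of_real (\<integral>x. exp (- (norm (c *\<^sub>R (x - y)))\<^sup>2 / 2) \<partial>\<nu>)
      = (\<integral>x. of_real (exp (- (norm (c *\<^sub>R (x - y)))\<^sup>2 / 2)) \<partial>\<nu> :: complex)"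
    by simp
  also have "\<dots> = (\<integral>x. (\<integral>z. iexp ((c *\<^sub>R (x - y)) \<bullet> z) \<partial>standard_gaussian) \<partial>\<nu>)"
    by (simp only: char_standard_gaussian)
  also have "\<dots> = (\<integral>z. (\<integral>x. iexp ((c *\<^sub>R (x - y)) \<bullet> z) \<partial>\<nu>) \<partial>standard_gaussian)"
    by (rule Fubini_integral[symmetric], rule integrable_const_bound[where B=1])
       (auto simp: split_beta')
  also have "\<dots> = (\<integral>z. (\<integral>x. iexp (- ((c *\<^sub>R y) \<bullet> z)) * iexp ((c *\<^sub>R z) \<bullet> x) \<partial>\<nu>) \<partial>standard_gaussian)"
    by (intro Bochner_Integration.integral_cong refl)
       (simp add: exp_add[symmetric] algebra_simps inner_diff_left inner_commute)
  finally show ?thesis by simp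
qed

lemma gaussian_kernel_integral_tendsto:
  fixes \<mu> :: "nat \<Rightarrow> 'a::euclidean_space measure"
  assumes \<mu>: "\<And>n. prob_space (\<mu> n)" "\<And>n. sets (\<mu> n) = sets borel"
    and N: "prob_space N" "sets N = sets borel"
    and lim: "\<And>t. (\<lambda>n. \<integral>x. iexp (t \<bullet> x) \<partial>\<mu> n) \<longlonglongrightarrow> (\<integral>x. iexp (t \<bullet> x) \<partial>N)"
  shows "(\<lambda>n. \<integral>x. exp (- (norm (c *\<^sub>R (x - y)))\<^sup>2 / 2) \<partial>\<mu> n) \<longlonglongrightarrow> (\<integral>x. exp (- (norm (c *\<^sub>R (x - y)))\<^sup>2 / 2) \<partial>N)"
proof -
  interpret G: prob_space "standard_gaussian :: 'a measure" by (rule prob_space_standard_gaussian)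
  have meas: "(\<lambda>z. iexp (- ((c *\<^sub>R y) \<bullet> z)) * (\<integral>x. iexp ((c *\<^sub>R z) \<bullet> x) \<partial>\<nu>)) \<in> borel_measurable standard_gaussian"
    if "prob_space \<nu>" and [measurable_cong]: "sets \<nu> = sets borel" for \<nu> :: "'a measure"
  proof -
    interpret \<nu>: prob_space \<nu> by fact
    show ?thesis by measurable
  qed
  have bd: "norm (\<integral>x. iexp (t \<bullet> x) \<partial>\<nu>) \<le> 1"
    if "prob_space \<nu>" and [measurable_cong]: "sets \<nu> = sets borel" for \<nu> :: "'a measure" and t
  proof -
    interpret \<nu>: prob_space \<nu> by fact
    have "norm (\<integral>x. iexp (t \<bullet> x) \<partial>\<nu>) \<le> (\<integral>x. norm (iexp (t \<bullet> x)) \<partial>\<nu>)" by (rule integral_norm_bound)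
    then show ?thesis by (simp add: \<nu>.prob_space)
  qed
  have "(\<lambda>n. complex_of_real (\<integral>x. exp (- (norm (c *\<^sub>R (x - y)))\<^sup>2 / 2) \<partial>\<mu> n)) \<longlonglongrightarrow>
       of_real (\<integral>x. exp (- (norm (c *\<^sub>R (x - y)))\<^sup>2 / 2) \<partial>N)"
    unfolding gaussian_kernel_integral[OF \<mu>] gaussian_kernel_integral[OF N]
  proof (rule integral_dominated_convergence[where w="\<lambda>_. 1"])
    show "AE z in standard_gaussian. (\<lambda>n. iexp (- ((c *\<^sub>R y) \<bullet> z)) * (\<integral>x. iexp ((c *\<^sub>R z) \<bullet> x) \<partial>\<mu> n))
        \<longlonglongrightarrow> iexp (- ((c *\<^sub>R y) \<bullet> z)) * (\<integral>x. iexp ((c *\<^sub>R z) \<bullet> x) \<partial>N)"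
      by (intro AE_I2 tendsto_mult tendsto_const lim)
    show "AE z in standard_gaussian. norm (iexp (- ((c *\<^sub>R y) \<bullet> z)) * (\<integral>x. iexp ((c *\<^sub>R z) \<bullet> x) \<partial>\<mu> n)) \<le> 1" for n
      by (intro AE_I2) (simp only: norm_mult norm_exp_i_times mult_1 bd[OF \<mu>])
  qed (use meas[OF \<mu>] meas[OF N] in auto)
  then show ?thesis by (simp only: tendsto_of_real_iff)
qed

text \<open>
  Averaging \<open>f\<close> over a Gaussian neighbourhood of \<open>x\<close> is integration of \<open>f\<close> against the Gaussian
  kernel; this form lets the order of integration be exchanged.
\<close>

lemma gaussian_smoothing_eq:
  fixes f :: "'a::euclidean_space \<Rightarrow> real"
  assumes c: "c > 0" and [measurable]: "f \<in> borel_measurable borel"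
  shows "(\<integral>z. f (x + (1 / c) *\<^sub>R z) \<partial>standard_gaussian)
    = (c / sqrt (2 * pi)) ^ DIM('a) * (\<integral>y. f y * exp (- (norm (c *\<^sub>R (x - y)))\<^sup>2 / 2) \<partial>lborel)"
proof -
  let ?k = "\<lambda>z::'a. exp (- (norm z)\<^sup>2 / 2)"
  have "(\<integral>y. f y * ?k (c *\<^sub>R (x - y)) \<partial>lborel)
     = (\<integral>y. f y * ?k (c *\<^sub>R (x - y)) \<partial>density (distr lborel borel (\<lambda>z. x + (1/c) *\<^sub>R z)) (\<lambda>_. ennreal (\<bar>1/c\<bar>^DIM('a))))"
    using lborel_affine[of "1/c" x] c by simp
  also have "\<dots> = (\<bar>1/c\<bar>^DIM('a)) * (\<integral>z. f (x + (1/c) *\<^sub>R z) * ?k z \<partial>lborel)"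
    using c by (subst integral_density, simp, simp, simp, subst integral_distr) auto
  finally have *: "(\<integral>y. f y * ?k (c *\<^sub>R (x - y)) \<partial>lborel) = (\<bar>1/c\<bar>^DIM('a)) * (\<integral>z. f (x + (1/c) *\<^sub>R z) * ?k z \<partial>lborel)" .
  have "(\<integral>z. f (x + (1 / c) *\<^sub>R z) \<partial>standard_gaussian)
     = (\<integral>z. (1 / sqrt (2 * pi)) ^ DIM('a) * (f (x + (1 / c) *\<^sub>R z) * ?k z) \<partial>lborel)"
    unfolding standard_gaussian_def
    by (subst integral_density)
       (simp, simp, simp add: prod_nonneg, intro Bochner_Integration.integral_cong refl, simp add: gaussian_density_eq mult_ac)
  also have "\<dots> = (1 / sqrt (2 * pi)) ^ DIM('a) * (\<integral>z. (f (x + (1 / c) *\<^sub>R z) * ?k z) \<partial>lborel)"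
    by simp
  finally show ?thesis unfolding * using c by (simp add: power_divide)
qed

lemma gaussian_smoothing_tendsto:
  fixes \<mu> :: "nat \<Rightarrow> 'a::euclidean_space measure" and f :: "'a \<Rightarrow> real"
  assumes \<mu>: "\<And>n. prob_space (\<mu> n)" "\<And>n. sets (\<mu> n) = sets borel"
    and N: "prob_space N" "sets N = sets borel"
    and lim: "\<And>t. (\<lambda>n. \<integral>x. iexp (t \<bullet> x) \<partial>\<mu> n) \<longlonglongrightarrow> (\<integral>x. iexp (t \<bullet> x) \<partial>N)"
    and c: "c > 0" and f [measurable]: "f \<in> borel_measurable borel" and B: "\<And>x. \<bar>f x\<bar> \<le> B"
    and supp: "\<And>x. norm x > R \<Longrightarrow> f x = 0"
  shows "(\<lambda>n. \<integral>x. (\<integral>z. f (x + (1 / c) *\<^sub>R z) \<partial>standard_gaussian) \<partial>\<mu> n)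
     \<longlonglongrightarrow> (\<integral>x. (\<integral>z. f (x + (1 / c) *\<^sub>R z) \<partial>standard_gaussian) \<partial>N)"
proof -
  let ?k = "\<lambda>x y. exp (- (norm (c *\<^sub>R (x - y)))\<^sup>2 / 2)"
  let ?K = "(c / sqrt (2 * pi)) ^ DIM('a)"
  have B0: "0 \<le> B" using B[of 0] by simp
  have fin: "emeasure lborel (cball (0::'a) R) < \<infinity>"
    by (rule emeasure_bounded_finite) auto
  have intf: "integrable lborel f"
    by (rule integrableI_bounded_set[where A="cball 0 R" and B=B]) (use fin B supp in auto)
  have swap: "(\<integral>x. (\<integral>z. f (x + (1 / c) *\<^sub>R z) \<partial>standard_gaussian) \<partial>\<nu>) = ?K * (\<integral>y. f y * (\<integral>x. ?k x y \<partial>\<nu>) \<partial>lborel)"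
    if "prob_space \<nu>" and [measurable_cong]: "sets \<nu> = sets borel" for \<nu> :: "'a measure"
  proof -
    interpret \<nu>: prob_space \<nu> by fact
    interpret pair_sigma_finite \<nu> "lborel :: 'a measure" ..
    have UN: "space \<nu> = UNIV" using sets_eq_imp_space_eq[OF that(2)] by simp
    have "integrable (\<nu> \<Otimes>\<^sub>M (lborel :: 'a measure)) (\<lambda>(x, y). f y * ?k x y)"
    proof (rule integrableI_bounded_set[where A="UNIV \<times> cball 0 R" and B=B])
      show "UNIV \<times> cball 0 R \<in> sets (\<nu> \<Otimes>\<^sub>M (lborel :: 'a measure))"
        using UN by (metis pair_measureI sets.top sets_lborel borel_closed closed_cball)
      have "emeasure (\<nu> \<Otimes>\<^sub>M (lborel :: 'a measure)) (UNIV \<times> cball 0 R) = emeasure \<nu> UNIV * emeasure lborel (cball (0::'a) R)"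
        by (rule lborel.emeasure_pair_measure_Times) (use UN sets.top[of \<nu>] in auto)
      then show "emeasure (\<nu> \<Otimes>\<^sub>M (lborel :: 'a measure)) (UNIV \<times> cball 0 R) < \<infinity>"
        using fin \<nu>.emeasure_space_1 UN by simp
      have "\<bar>f y\<bar> * ?k x y \<le> B * 1" for x y
        by (intro mult_mono B B0) auto
      then show "AE xy in \<nu> \<Otimes>\<^sub>M lborel. xy \<in> UNIV \<times> cball 0 R \<longrightarrow> norm (case xy of (x, y) \<Rightarrow> f y * ?k x y) \<le> B"
        by (intro AE_I2) (auto simp: abs_mult)
      show "AE xy in \<nu> \<Otimes>\<^sub>M lborel. xy \<notin> UNIV \<times> cball 0 R \<longrightarrow> (case xy of (x, y) \<Rightarrow> f y * ?k x y) = 0"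
        by (intro AE_I2) (auto, metis supp not_le)
    qed measurable
    then have "(\<integral>y. (\<integral>x. f y * ?k x y \<partial>\<nu>) \<partial>lborel) = (\<integral>x. (\<integral>y. f y * ?k x y \<partial>lborel) \<partial>\<nu>)"
      by (rule Fubini_integral)
    then show ?thesis by (simp add: gaussian_smoothing_eq[OF c f])
  qed
  show ?thesis
    unfolding swap[OF \<mu>] swap[OF N]
  proof (intro tendsto_mult tendsto_const integral_dominated_convergence[where w="\<lambda>y. \<bar>f y\<bar>"])
    have meas: "(\<lambda>y. f y * (\<integral>x. ?k x y \<partial>\<nu>)) \<in> borel_measurable lborel"
      if "prob_space \<nu>" and [measurable_cong]: "sets \<nu> = sets borel" for \<nu> :: "'a measure"
    proof -
      interpret \<nu>: prob_space \<nu> by fact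
      show ?thesis by measurable
    qed
    show "(\<lambda>y. f y * (\<integral>x. ?k x y \<partial>\<mu> n)) \<in> borel_measurable lborel" for n by (rule meas[OF \<mu>])
    show "(\<lambda>y. f y * (\<integral>x. ?k x y \<partial>N)) \<in> borel_measurable lborel" by (rule meas[OF N])
    show "AE y in lborel. (\<lambda>n. f y * (\<integral>x. ?k x y \<partial>\<mu> n)) \<longlonglongrightarrow> f y * (\<integral>x. ?k x y \<partial>N)"
      by (intro AE_I2 tendsto_mult tendsto_const gaussian_kernel_integral_tendsto \<mu> N lim)
    show "AE y in lborel. norm (f y * (\<integral>x. ?k x y \<partial>\<mu> n)) \<le> \<bar>f y\<bar>" for n
    proof (intro AE_I2)
      fix y :: 'a
      interpret m: prob_space "\<mu> n" by (rule \<mu>)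
      have [measurable_cong]: "sets (\<mu> n) = sets borel" by (rule \<mu>)
      have "norm (\<integral>x. ?k x y \<partial>\<mu> n) \<le> (\<integral>x. norm (?k x y) \<partial>\<mu> n)" by (rule integral_norm_bound)
      also have "\<dots> \<le> (\<integral>x. 1 \<partial>\<mu> n)"
        by (intro integral_mono m.integrable_const_bound[where B=1]) auto
      finally have "\<bar>\<integral>x. ?k x y \<partial>\<mu> n\<bar> \<le> 1" by (simp add: m.prob_space)
      from mult_left_mono[OF this, of "\<bar>f y\<bar>"]
      show "norm (f y * (\<integral>x. ?k x y \<partial>\<mu> n)) \<le> \<bar>f y\<bar>" by (simp add: abs_mult)
    qed
    show "integrable lborel (\<lambda>y. \<bar>f y\<bar>)" using intf by simp
  qed
qed

lemma tail_measure_tendsto_0: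
  fixes N :: "'a::euclidean_space measure"
  assumes "prob_space N" and [measurable_cong]: "sets N = sets borel"
  shows "(\<lambda>k. measure N {x. norm x > real k}) \<longlonglongrightarrow> 0"
proof -
  interpret prob_space N by fact
  have sp: "space N = UNIV" using sets_eq_imp_space_eq[OF assms(2)] by simp
  have "(\<lambda>k. measure N {x. norm x > real k}) \<longlonglongrightarrow> measure N (\<Inter>k::nat. {x. norm x > real k})"
    using sp by (intro finite_Lim_measure_decseq) (auto simp: decseq_def)
  also have "(\<Inter>k::nat. {x::'a. norm x > real k}) = {}"
    by (auto, metis not_less real_arch_simple)
  finally show ?thesis by simp
qed

text \<open>
  A uniformly continuous function is uniformly close to its Gaussian smoothing of small bandwidth, for
  which convergence is known.
\<close>

lemma weak_limit_of_char_compact_support: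
  fixes \<mu> :: "nat \<Rightarrow> 'a::euclidean_space measure" and f :: "'a \<Rightarrow> real"
  assumes \<mu>: "\<And>n. prob_space (\<mu> n)" "\<And>n. sets (\<mu> n) = sets borel"
    and N: "prob_space N" "sets N = sets borel"
    and lim: "\<And>t. (\<lambda>n. \<integral>x. iexp (t \<bullet> x) \<partial>\<mu> n) \<longlonglongrightarrow> (\<integral>x. iexp (t \<bullet> x) \<partial>N)"
    and f: "continuous_on UNIV f" and B: "\<And>x. \<bar>f x\<bar> \<le> B" and supp: "\<And>x. norm x > R \<Longrightarrow> f x = 0"
  shows "(\<lambda>n. \<integral>x. f x \<partial>\<mu> n) \<longlonglongrightarrow> (\<integral>x. f x \<partial>N)"
proof (rule LIMSEQ_I)
  fix e :: real assume e: "e > 0"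
  interpret G: prob_space "standard_gaussian :: 'a measure" by (rule prob_space_standard_gaussian)
  have fm [measurable]: "f \<in> borel_measurable borel" using f by (rule borel_measurable_continuous_onI)
  have B0: "0 \<le> B" using B[of 0] by simp
  define e' where "e' = e / 8"
  have e': "e' > 0" using e by (simp add: e'_def)
  obtain d where d: "d > 0" "\<And>x y. dist x y < d \<Longrightarrow> \<bar>f x - f y\<bar> \<le> e'"
  proof -
    have "uniformly_continuous_on (cball 0 (R + 1)) f"
      by (intro compact_uniformly_continuous continuous_on_subset[OF f]) auto
    then obtain d where d: "d > 0" "\<And>x y. x \<in> cball 0 (R+1) \<Longrightarrow> y \<in> cball 0 (R+1) \<Longrightarrow> dist x y < d \<Longrightarrow> dist (f x) (f y) < e'"
      using e' unfolding uniformly_continuous_on_def by (metis dist_commute)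
    show ?thesis
    proof (rule that[of "min d 1"])
      fix x y :: 'a assume xy: "dist x y < min d 1"
      show "\<bar>f x - f y\<bar> \<le> e'"
      proof (cases "x \<in> cball 0 (R+1) \<and> y \<in> cball 0 (R+1)")
        case True
        then show ?thesis using d(2)[of x y] xy by (auto simp: dist_real_def)
      next
        case False
        have "norm x \<le> norm y + dist x y" "norm y \<le> norm x + dist x y"
          by norm+
        then have "norm x > R" "norm y > R" using False xy by auto
        then show ?thesis using e' supp by simp
      qed
    qed (use d in auto)
  qed
  obtain k :: nat where k: "measure (standard_gaussian :: 'a measure) {z. norm z > real k} < e' / (2 * B + 1)"
  proof -
    have "e' / (2 * B + 1) > 0" using e' B0 by simp
    from order_tendstoD(2)[OF tail_measure_tendsto_0[OF prob_space_standard_gaussian sets_standard_gaussian] this]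
    show ?thesis using that by (auto simp: eventually_sequentially)
  qed
  \<comment> \<open>The Gaussian variable exceeds \<open>k\<close> with small probability only; otherwise the displacement \<open>z / c\<close> is shorter than \<open>d\<close>.\<close>
  define c where "c = (real k + 1) / d"
  have c: "c > 0" using d by (simp add: c_def)
  define h where "h x = (\<integral>z. f (x + (1 / c) *\<^sub>R z) \<partial>standard_gaussian)" for x
  have hm [measurable]: "h \<in> borel_measurable borel" unfolding h_def by measurable
  have fi: "integrable standard_gaussian (\<lambda>z. f (x + (1 / c) *\<^sub>R z))" for x
    by (rule G.integrable_const_bound[where B=B]) (auto simp: B)
  have hf: "\<bar>h x - f x\<bar> \<le> 2 * e'" for x
  proof -
    let ?A = "{z::'a. norm z > real k}"
    have [measurable]: "?A \<in> sets borel" by measurable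
    have ind: "integrable standard_gaussian (\<lambda>z. indicator ?A z :: real)"
      by (rule G.integrable_const_bound[where B=1]) auto
    have "h x - f x = (\<integral>z. f (x + (1 / c) *\<^sub>R z) - f x \<partial>standard_gaussian)"
      using fi[of x] by (simp add: h_def G.prob_space[unfolded space_standard_gaussian])
    also have "\<bar>\<dots>\<bar> \<le> (\<integral>z. \<bar>f (x + (1 / c) *\<^sub>R z) - f x\<bar> \<partial>standard_gaussian)"
      by (rule integral_abs_bound)
    also have "\<dots> \<le> (\<integral>z. e' + (2 * B) * indicator ?A z \<partial>standard_gaussian)"
    proof (intro integral_mono)
      show "integrable standard_gaussian (\<lambda>z. \<bar>f (x + (1 / c) *\<^sub>R z) - f x\<bar>)"
        using fi[of x] by simp
      show "integrable standard_gaussian (\<lambda>z. e' + (2 * B) * indicator ?A z)"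
        by (intro Bochner_Integration.integrable_add integrable_mult_right G.integrable_const ind)
      fix z :: 'a
      show "\<bar>f (x + (1 / c) *\<^sub>R z) - f x\<bar> \<le> e' + (2 * B) * indicator ?A z"
      proof (cases "z \<in> ?A")
        case True
        have "\<bar>f (x + (1 / c) *\<^sub>R z) - f x\<bar> \<le> B + B" using B[of x] B[of "x + (1 / c) *\<^sub>R z"] by linarith
        then show ?thesis using True e' by auto
      next
        case False
        have "norm z / c \<le> real k / c" using False c by (simp add: divide_right_mono)
        also have "\<dots> < d" using d by (simp add: c_def field_simps)
        finally have "dist (x + (1 / c) *\<^sub>R z) x < d" using c by (simp add: dist_norm)
        from d(2)[OF this] show ?thesis using False by simp
      qed
    qed
    also have "\<dots> = e' + 2 * B * measure standard_gaussian ?A"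
      by (subst Bochner_Integration.integral_add)
         (auto simp: G.prob_space[unfolded space_standard_gaussian] G.emeasure_eq_measure)
    also have "\<dots> \<le> e' + (2 * B + 1) * measure standard_gaussian ?A"
      by (intro add_left_mono mult_right_mono) auto
    also have "\<dots> \<le> e' + e'"
      using k B0 by (simp add: field_simps)
    finally show ?thesis by simp
  qed
  have hB: "\<bar>h x\<bar> \<le> B + 2 * e'" for x using hf[of x] B[of x] by linarith
  have int: "\<bar>(\<integral>x. h x \<partial>\<nu>) - (\<integral>x. f x \<partial>\<nu>)\<bar> \<le> 2 * e'"
    if "prob_space \<nu>" and [measurable_cong]: "sets \<nu> = sets borel" for \<nu> :: "'a measure"
  proof -
    interpret \<nu>: prob_space \<nu> by fact
    have i1: "integrable \<nu> h" by (rule \<nu>.integrable_const_bound[where B="B + 2 * e'"]) (auto simp: hB)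
    have i2: "integrable \<nu> f" by (rule \<nu>.integrable_const_bound[where B="B"]) (auto simp: B)
    have "\<bar>(\<integral>x. h x \<partial>\<nu>) - (\<integral>x. f x \<partial>\<nu>)\<bar> = \<bar>\<integral>x. h x - f x \<partial>\<nu>\<bar>"
      using i1 i2 by simp
    also have "\<dots> \<le> (\<integral>x. \<bar>h x - f x\<bar> \<partial>\<nu>)" by (rule integral_abs_bound)
    also have "\<dots> \<le> (\<integral>x. 2 * e' \<partial>\<nu>)" using i1 i2 by (intro integral_mono) (auto simp: hf)
    finally show ?thesis by (simp add: \<nu>.prob_space)
  qed
  have "(\<lambda>n. \<integral>x. h x \<partial>\<mu> n) \<longlonglongrightarrow> (\<integral>x. h x \<partial>N)"
    unfolding h_def by (rule gaussian_smoothing_tendsto[OF \<mu> N lim c fm B supp])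
  from LIMSEQ_D[OF this e'] obtain n0 where n0: "\<And>n. n \<ge> n0 \<Longrightarrow> \<bar>(\<integral>x. h x \<partial>\<mu> n) - (\<integral>x. h x \<partial>N)\<bar> < e'" by auto
  show "\<exists>n0. \<forall>n\<ge>n0. norm ((\<integral>x. f x \<partial>\<mu> n) - (\<integral>x. f x \<partial>N)) < e"
  proof (intro exI[of _ n0] allI impI)
    fix n assume "n \<ge> n0"
    then show "norm ((\<integral>x. f x \<partial>\<mu> n) - (\<integral>x. f x \<partial>N)) < e"
      using int[OF \<mu>, of n] int[OF N] n0[of n] e' unfolding e'_def real_norm_def by linarith
  qed
qed

text \<open>
  Cutting a bounded continuous function off outside a large ball loses little under the limit,
  because the limit is a probability measure; and it loses little along the sequence, because the
  cut-off is itself a continuous function of compact support.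
\<close>

lemma weak_limit_of_char:
  fixes \<mu> :: "nat \<Rightarrow> 'a::euclidean_space measure" and f :: "'a \<Rightarrow> real"
  assumes \<mu>: "\<And>n. prob_space (\<mu> n)" "\<And>n. sets (\<mu> n) = sets borel"
    and N: "prob_space N" "sets N = sets borel"
    and lim: "\<And>t. (\<lambda>n. \<integral>x. iexp (t \<bullet> x) \<partial>\<mu> n) \<longlonglongrightarrow> (\<integral>x. iexp (t \<bullet> x) \<partial>N)"
    and f: "continuous_on UNIV f" and B: "\<And>x. \<bar>f x\<bar> \<le> B"
  shows "(\<lambda>n. \<integral>x. f x \<partial>\<mu> n) \<longlonglongrightarrow> (\<integral>x. f x \<partial>N)"
proof (rule LIMSEQ_I)
  fix e :: real assume e: "e > 0"
  interpret N: prob_space N by fact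
  have [measurable_cong]: "sets N = sets borel" by fact
  have spN: "space N = UNIV" using sets_eq_imp_space_eq[OF N(2)] by simp
  have fm [measurable]: "f \<in> borel_measurable borel" using f by (rule borel_measurable_continuous_onI)
  have B0: "0 \<le> B" using B[of 0] by simp
  define e' where "e' = e / (4 * (B + 1))"
  have e': "e' > 0" using e B0 by (simp add: e'_def)
  obtain k :: nat where k: "measure N {z. norm z > real k} < e'"
    using order_tendstoD(2)[OF tail_measure_tendsto_0[OF N] e'] by (auto simp: eventually_sequentially)
  define \<psi> where "\<psi> x = max 0 (min 1 (real k + 1 - norm x))" for x :: 'a
  have \<psi>c: "continuous_on UNIV \<psi>" unfolding \<psi>_def by (intro continuous_intros)
  have \<psi>m [measurable]: "\<psi> \<in> borel_measurable borel" using \<psi>c by (rule borel_measurable_continuous_onI)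
  have \<psi>01: "0 \<le> \<psi> x" "\<psi> x \<le> 1" for x by (auto simp: \<psi>_def)
  have \<psi>s: "norm x > real k + 1 \<Longrightarrow> \<psi> x = 0" for x by (auto simp: \<psi>_def)
  have \<psi>1: "norm x \<le> real k \<Longrightarrow> \<psi> x = 1" for x by (auto simp: \<psi>_def)
  have lim\<psi>: "(\<lambda>n. \<integral>x. \<psi> x \<partial>\<mu> n) \<longlonglongrightarrow> (\<integral>x. \<psi> x \<partial>N)"
    by (rule weak_limit_of_char_compact_support[OF \<mu> N lim \<psi>c, where B=1]) (use \<psi>01 \<psi>s in \<open>auto simp: abs_le_iff le_minus_iff intro: order_trans[of _ 0]\<close>)
  have f\<psi>B: "\<bar>f x * \<psi> x\<bar> \<le> B" for x
    using mult_mono[OF B[of x] \<psi>01(2)[of x] B0 \<psi>01(1)] by (simp add: abs_mult \<psi>01)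
  have limf: "(\<lambda>n. \<integral>x. f x * \<psi> x \<partial>\<mu> n) \<longlonglongrightarrow> (\<integral>x. f x * \<psi> x \<partial>N)"
    by (rule weak_limit_of_char_compact_support[OF \<mu> N lim _ f\<psi>B, where R="real k + 1"])
       (auto simp: \<psi>s intro!: continuous_intros f \<psi>c)
  have cut: "\<bar>(\<integral>x. f x \<partial>\<nu>) - (\<integral>x. f x * \<psi> x \<partial>\<nu>)\<bar> \<le> B * (1 - (\<integral>x. \<psi> x \<partial>\<nu>))"
    if "prob_space \<nu>" and [measurable_cong]: "sets \<nu> = sets borel" for \<nu> :: "'a measure"
  proof -
    interpret \<nu>: prob_space \<nu> by fact
    have i1: "integrable \<nu> f" by (rule \<nu>.integrable_const_bound[where B="B"]) (auto simp: B)
    have i2: "integrable \<nu> (\<lambda>x. f x * \<psi> x)" by (rule \<nu>.integrable_const_bound[where B="B"]) (auto simp: f\<psi>B[unfolded abs_mult] abs_mult)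
    have i3: "integrable \<nu> \<psi>" by (rule \<nu>.integrable_const_bound[where B="1"]) (auto simp: \<psi>01)
    have "\<bar>(\<integral>x. f x \<partial>\<nu>) - (\<integral>x. f x * \<psi> x \<partial>\<nu>)\<bar> = \<bar>\<integral>x. f x * (1 - \<psi> x) \<partial>\<nu>\<bar>"
      using i1 i2 by (simp add: right_diff_distrib)
    also have "\<dots> \<le> (\<integral>x. \<bar>f x * (1 - \<psi> x)\<bar> \<partial>\<nu>)" by (rule integral_abs_bound)
    also have "\<dots> \<le> (\<integral>x. B * (1 - \<psi> x) \<partial>\<nu>)"
    proof (rule integral_mono)
      show "integrable \<nu> (\<lambda>x. \<bar>f x * (1 - \<psi> x)\<bar>)" using i1 i2 by (simp add: right_diff_distrib)
      show "integrable \<nu> (\<lambda>x. B * (1 - \<psi> x))" using i3 by simp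
      show "\<bar>f x * (1 - \<psi> x)\<bar> \<le> B * (1 - \<psi> x)" for x
        using B[of x] \<psi>01[of x] by (simp add: abs_mult mult_right_mono)
    qed
    also have "\<dots> = B * (1 - (\<integral>x. \<psi> x \<partial>\<nu>))" using i3 by (simp add: \<nu>.prob_space)
    finally show ?thesis .
  qed
  have \<psi>N: "1 - (\<integral>x. \<psi> x \<partial>N) < e'"
  proof -
    have i3: "integrable N \<psi>" by (rule N.integrable_const_bound[where B="1"]) (auto simp: \<psi>01)
    have "1 - (\<integral>x. \<psi> x \<partial>N) = (\<integral>x. 1 - \<psi> x \<partial>N)" using i3 by (simp add: N.prob_space)
    also have "\<dots> \<le> (\<integral>x. indicator {z. norm z > real k} x \<partial>N)"
      using i3 by (intro integral_mono) (auto simp: \<psi>01 \<psi>1 not_less N.emeasure_eq_measure spN split: split_indicator)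
    also have "\<dots> = measure N {z. norm z > real k}" by (simp add: spN)
    finally show ?thesis using k by simp
  qed
  define e'' where "e'' = e' - (1 - (\<integral>x. \<psi> x \<partial>N))"
  have e'': "e'' > 0" using \<psi>N by (simp add: e''_def)
  from LIMSEQ_D[OF lim\<psi> e''] obtain n1 where n1: "\<And>n. n \<ge> n1 \<Longrightarrow> \<bar>(\<integral>x. \<psi> x \<partial>\<mu> n) - (\<integral>x. \<psi> x \<partial>N)\<bar> < e''" by auto
  from LIMSEQ_D[OF limf e'] obtain n2 where n2: "\<And>n. n \<ge> n2 \<Longrightarrow> \<bar>(\<integral>x. f x * \<psi> x \<partial>\<mu> n) - (\<integral>x. f x * \<psi> x \<partial>N)\<bar> < e'" by auto
  show "\<exists>n0. \<forall>n\<ge>n0. norm ((\<integral>x. f x \<partial>\<mu> n) - (\<integral>x. f x \<partial>N)) < e"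
  proof (intro exI[of _ "max n1 n2"] allI impI)
    fix n assume n: "n \<ge> max n1 n2"
    have "1 - (\<integral>x. \<psi> x \<partial>\<mu> n) \<le> e'" using n1[of n] n by (simp add: e''_def)
    then have a: "B * (1 - (\<integral>x. \<psi> x \<partial>\<mu> n)) \<le> B * e'" using B0 by (rule mult_left_mono)
    have b: "B * (1 - (\<integral>x. \<psi> x \<partial>N)) \<le> B * e'" using \<psi>N B0 by (intro mult_left_mono) auto
    have "\<bar>(\<integral>x. f x \<partial>\<mu> n) - (\<integral>x. f x \<partial>N)\<bar> < B * e' + B * e' + e'"
      using cut[OF \<mu>, of n] cut[OF N] n2[of n] n a b by linarith
    also have "\<dots> \<le> 4 * (B + 1) * e'" using B0 e' by (simp add: algebra_simps)
    also have "\<dots> = e" using B0 by (simp add: e'_def field_simps)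
    finally show "norm ((\<integral>x. f x \<partial>\<mu> n) - (\<integral>x. f x \<partial>N)) < e" by simp
  qed
qed

text \<open>
  The continuity theorem in the case where the limit is known to be a characteristic function, so that
  tightness comes from the limit law.
\<close>

theorem converges_in_distribution_of_char:
  fixes X :: "nat \<Rightarrow> 'w \<Rightarrow> 'a::euclidean_space"
  assumes M: "prob_space M" and X [measurable]: "\<And>n. X n \<in> borel_measurable M"
    and N: "prob_space N" "sets N = sets borel"
    and lim: "\<And>t. (\<lambda>n. \<integral>\<omega>. iexp (t \<bullet> X n \<omega>) \<partial>M) \<longlonglongrightarrow> (\<integral>x. iexp (t \<bullet> x) \<partial>N)"
  shows "converges_in_distribution M X N"
  unfolding converges_in_distribution_def
proof (intro allI impI, elim conjE)
  fix f :: "'a \<Rightarrow> real" assume f: "continuous_on UNIV f" "bounded (range f)"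
  then obtain B where B: "\<And>x. \<bar>f x\<bar> \<le> B" by (auto simp: bounded_iff)
  have fm [measurable]: "f \<in> borel_measurable borel" using f(1) by (rule borel_measurable_continuous_onI)
  have "(\<lambda>n. \<integral>x. f x \<partial>distr M borel (X n)) \<longlonglongrightarrow> (\<integral>x. f x \<partial>N)"
  proof (rule weak_limit_of_char[OF _ _ N _ f(1) B])
    show "prob_space (distr M borel (X n))" for n using M X by (rule prob_space.prob_space_distr)
    show "(\<lambda>n. \<integral>x. iexp (t \<bullet> x) \<partial>distr M borel (X n)) \<longlonglongrightarrow> (\<integral>x. iexp (t \<bullet> x) \<partial>N)" for t
      using lim[of t] by (simp add: integral_distr)
  qed simp
  then show "(\<lambda>n. \<integral>\<omega>. f (X n \<omega>) \<partial>M) \<longlonglongrightarrow> (\<integral>x. f x \<partial>N)" by (simp add: integral_distr)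
qed

section \<open>Convergence in probability and averages of independent observations\<close>

text \<open>
  Formulated by measurable inner approximations, because events such as being a local minimum need not be
  measurable.
\<close>

definition with_high_probability :: "'w measure \<Rightarrow> (nat \<Rightarrow> 'w \<Rightarrow> bool) \<Rightarrow> bool" where
  "with_high_probability M Q \<longleftrightarrow>
     (\<exists>A. (\<forall>n. A n \<in> sets M) \<and> (\<lambda>n. measure M (A n)) \<longlonglongrightarrow> 1 \<and> (\<forall>n. \<forall>\<omega>\<in>A n. Q n \<omega>))"

definition bounded_in_probability :: "'w measure \<Rightarrow> (nat \<Rightarrow> 'w \<Rightarrow> real) \<Rightarrow> bool" where
  "bounded_in_probability M Y \<longleftrightarrow>
     (\<forall>\<eta>>0. \<exists>K. \<forall>\<^sub>F n in sequentially. \<exists>A\<in>sets M. measure M A \<ge> 1 - \<eta> \<and> (\<forall>\<omega>\<in>A. \<bar>Y n \<omega>\<bar> \<le> K))"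

context prob_space begin

lemma whp_mono:
  assumes "with_high_probability M Q" "\<And>n \<omega>. \<omega> \<in> space M \<Longrightarrow> Q n \<omega> \<Longrightarrow> R n \<omega>"
  shows "with_high_probability M R"
  using assms unfolding with_high_probability_def by (meson sets.sets_into_space subsetD)

lemma whp_eventually_mono:
  assumes "with_high_probability M Q"
    and ev: "\<forall>\<^sub>F n in sequentially. \<forall>\<omega>\<in>space M. Q n \<omega> \<longrightarrow> R n \<omega>"
  shows "with_high_probability M R"
proof -
  obtain A where A: "\<And>n. A n \<in> sets M" "(\<lambda>n. measure M (A n)) \<longlonglongrightarrow> 1" "\<And>n \<omega>. \<omega> \<in> A n \<Longrightarrow> Q n \<omega>"
    using assms(1) unfolding with_high_probability_def by blast
  obtain n0 where n0: "\<And>n \<omega>. n \<ge> n0 \<Longrightarrow> \<omega> \<in> space M \<Longrightarrow> Q n \<omega> \<Longrightarrow> R n \<omega>"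
    using ev unfolding eventually_sequentially by blast
  define B where "B n = (if n \<ge> n0 then A n else {})" for n
  have "(\<lambda>n. measure M (B n)) \<longlonglongrightarrow> 1"
    by (rule Lim_transform_eventually[OF A(2)])
       (auto simp: eventually_sequentially B_def intro!: exI[of _ n0])
  moreover have "R n \<omega>" if "\<omega> \<in> B n" for n \<omega>
    using that n0[of n \<omega>] A(3)[of \<omega> n] sets.sets_into_space[OF A(1), of n] by (auto simp: B_def split: if_splits)
  ultimately show ?thesis
    unfolding with_high_probability_def using A(1) by (intro exI[of _ B]) (auto simp: B_def)
qed

lemma whp_conj:
  assumes "with_high_probability M Q" "with_high_probability M R"
  shows "with_high_probability M (\<lambda>n \<omega>. Q n \<omega> \<and> R n \<omega>)"
proof -
  obtain A where A: "\<And>n. A n \<in> sets M" "(\<lambda>n. measure M (A n)) \<longlonglongrightarrow> 1" "\<And>n \<omega>. \<omega> \<in> A n \<Longrightarrow> Q n \<omega>"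
    using assms(1) unfolding with_high_probability_def by blast
  obtain B where B: "\<And>n. B n \<in> sets M" "(\<lambda>n. measure M (B n)) \<longlonglongrightarrow> 1" "\<And>n \<omega>. \<omega> \<in> B n \<Longrightarrow> R n \<omega>"
    using assms(2) unfolding with_high_probability_def by blast
  have lower: "measure M (A n) + measure M (B n) - 1 \<le> measure M (A n \<inter> B n)" for n
  proof -
    have "measure M (A n \<union> B n) = measure M (A n) + measure M (B n - A n)"
      using A B by (intro finite_measure_Union') auto
    moreover have "measure M (B n - A n) = measure M (B n) - measure M (A n \<inter> B n)"
      using A B by (simp add: finite_measure_Diff' Int_commute)
    moreover have "measure M (A n \<union> B n) \<le> 1" by simp
    ultimately show ?thesis by linarith
  qed
  have "(\<lambda>n. measure M (A n) + measure M (B n) - 1) \<longlonglongrightarrow> 1 + 1 - 1"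
    by (intro tendsto_intros A B)
  then have lim: "(\<lambda>n. measure M (A n) + measure M (B n) - 1) \<longlonglongrightarrow> 1" by simp
  have "(\<lambda>n. measure M (A n \<inter> B n)) \<longlonglongrightarrow> 1"
    by (rule tendsto_sandwich[OF _ _ lim tendsto_const]; rule always_eventually) (use lower in auto)
  then show ?thesis
    unfolding with_high_probability_def using A B by (intro exI[of _ "\<lambda>n. A n \<inter> B n"]) auto
qed

lemma whp_all_finite:
  assumes "finite I" "\<And>i. i \<in> I \<Longrightarrow> with_high_probability M (Q i)"
  shows "with_high_probability M (\<lambda>n \<omega>. \<forall>i\<in>I. Q i n \<omega>)"
  using assms
proof (induction I)
  case empty
  have "(\<lambda>n::nat. measure M (space M)) \<longlonglongrightarrow> 1" by (simp add: prob_space)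
  then show ?case unfolding with_high_probability_def by (intro exI[of _ "\<lambda>_. space M"]) auto
next
  case (insert i I)
  then have "with_high_probability M (\<lambda>n \<omega>. Q i n \<omega> \<and> (\<forall>j\<in>I. Q j n \<omega>))" by (intro whp_conj) auto
  then show ?case by (rule whp_mono) auto
qed

lemma whp_AE:
  assumes "\<forall>\<^sub>F n in sequentially. AE \<omega> in M. Q n \<omega>"
  shows "with_high_probability M Q"
proof -
  obtain n0 where n0: "\<And>n. n \<ge> n0 \<Longrightarrow> AE \<omega> in M. Q n \<omega>" using assms by (auto simp: eventually_sequentially)
  have "\<exists>A. A \<in> sets M \<and> (n \<ge> n0 \<longrightarrow> measure M A = 1) \<and> (\<forall>\<omega>\<in>A. Q n \<omega>)" for n
  proof (cases "n \<ge> n0")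
    case True
    from AE_E[OF n0[OF True]] obtain N where N: "{\<omega>\<in>space M. \<not> Q n \<omega>} \<subseteq> N" "emeasure M N = 0" "N \<in> sets M" by blast
    then have "measure M (space M - N) = 1" using prob_compl[OF N(3)] by (simp add: measure_def)
    then show ?thesis using N by (intro exI[of _ "space M - N"]) auto
  qed (auto intro!: exI[of _ "{}"])
  then obtain A where A: "\<And>n. A n \<in> sets M" "\<And>n. n \<ge> n0 \<Longrightarrow> measure M (A n) = 1" "\<And>n \<omega>. \<omega> \<in> A n \<Longrightarrow> Q n \<omega>"
    by metis
  have "(\<lambda>n. measure M (A n)) \<longlonglongrightarrow> 1"
    by (rule tendsto_eventually) (use A(2) in \<open>auto simp: eventually_sequentially\<close>)
  then show ?thesis unfolding with_high_probability_def using A by blast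
qed

lemma whp_of_compl:
  assumes "\<And>n. {\<omega>\<in>space M. \<not> Q n \<omega>} \<in> sets M"
    and "(\<lambda>n. measure M {\<omega>\<in>space M. \<not> Q n \<omega>}) \<longlonglongrightarrow> 0"
  shows "with_high_probability M Q"
  unfolding with_high_probability_def
proof (intro exI[of _ "\<lambda>n. space M - {\<omega>\<in>space M. \<not> Q n \<omega>}"] conjI allI)
  have "(\<lambda>n. 1 - measure M {\<omega>\<in>space M. \<not> Q n \<omega>}) \<longlonglongrightarrow> 1 - 0"
    by (intro tendsto_intros assms)
  then show "(\<lambda>n. measure M (space M - {\<omega>\<in>space M. \<not> Q n \<omega>})) \<longlonglongrightarrow> 1"
    using assms(1) by (simp add: prob_compl)
qed (use assms in auto)

lemma whp_of_eventually:
  assumes meas: "\<And>n. {\<omega>\<in>space M. Q n \<omega>} \<in> sets M"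
    and ev: "\<And>\<eta>. \<eta> > 0 \<Longrightarrow> \<forall>\<^sub>F n in sequentially. \<exists>A\<in>sets M. measure M A \<ge> 1 - \<eta> \<and> (\<forall>\<omega>\<in>A. Q n \<omega>)"
  shows "with_high_probability M Q"
  unfolding with_high_probability_def
proof (intro exI[of _ "\<lambda>n. {\<omega>\<in>space M. Q n \<omega>}"] conjI allI meas ballI)
  show "(\<lambda>n. measure M {\<omega>\<in>space M. Q n \<omega>}) \<longlonglongrightarrow> 1"
  proof (rule LIMSEQ_I)
    fix e :: real assume e: "e > 0"
    then have "e / 2 > 0" by simp
    from ev[OF this] obtain n0 where
      n0: "\<And>n. n \<ge> n0 \<Longrightarrow> \<exists>A\<in>sets M. measure M A \<ge> 1 - e / 2 \<and> (\<forall>\<omega>\<in>A. Q n \<omega>)"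
      by (auto simp: eventually_sequentially)
    show "\<exists>n0. \<forall>n\<ge>n0. norm (measure M {\<omega>\<in>space M. Q n \<omega>} - 1) < e"
    proof (intro exI[of _ n0] allI impI)
      fix n assume "n \<ge> n0"
      from n0[OF this] obtain A where A: "A \<in> sets M" "measure M A \<ge> 1 - e / 2" "\<And>\<omega>. \<omega> \<in> A \<Longrightarrow> Q n \<omega>" by blast
      have "A \<subseteq> {\<omega>\<in>space M. Q n \<omega>}" using A(3) sets.sets_into_space[OF A(1)] by auto
      from finite_measure_mono[OF this meas] have "measure M {\<omega>\<in>space M. Q n \<omega>} \<ge> 1 - e / 2" using A(2) by linarith
      moreover have "measure M {\<omega>\<in>space M. Q n \<omega>} \<le> 1" by simp
      ultimately show "norm (measure M {\<omega>\<in>space M. Q n \<omega>} - 1) < e" using e by simp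
    qed
  qed
qed auto

lemma whp_converges_in_probability:
  fixes X :: "nat \<Rightarrow> 'a \<Rightarrow> 'b::{metric_space, second_countable_topology}"
  assumes "converges_in_probability M X c" and [measurable]: "\<And>n. X n \<in> borel_measurable M" and e: "e > 0"
  shows "with_high_probability M (\<lambda>n \<omega>. dist (X n \<omega>) c \<le> e)"
proof (rule whp_of_compl)
  show "{\<omega>\<in>space M. \<not> dist (X n \<omega>) c \<le> e} \<in> sets M" for n by measurable
  show "(\<lambda>n. measure M {\<omega>\<in>space M. \<not> dist (X n \<omega>) c \<le> e}) \<longlonglongrightarrow> 0"
    using assms(1) e unfolding converges_in_probability_def by (simp add: not_le)
qed

lemma bounded_in_probability_O_P:
  assumes "O_P M (\<lambda>n. 1 / sqrt (real n)) X" and [measurable]: "\<And>n. X n \<in> borel_measurable M"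
  shows "bounded_in_probability M (\<lambda>n \<omega>. sqrt (real n) * X n \<omega>)"
  unfolding bounded_in_probability_def
proof (intro allI impI)
  fix \<eta> :: real assume "\<eta> > 0"
  with assms(1) obtain K where K: "\<forall>\<^sub>F n in sequentially. measure M {\<omega>\<in>space M. \<bar>X n \<omega>\<bar> > K * (1 / sqrt (real n))} < \<eta>"
    unfolding O_P_def by blast
  show "\<exists>K. \<forall>\<^sub>F n in sequentially. \<exists>A\<in>sets M. 1 - \<eta> \<le> prob A \<and> (\<forall>\<omega>\<in>A. \<bar>sqrt (real n) * X n \<omega>\<bar> \<le> K)"
  proof (rule exI[of _ K], rule eventually_mono[OF eventually_conj[OF K eventually_gt_at_top[of 0]]], elim conjE)
    fix n :: nat
    let ?B = "{\<omega>\<in>space M. \<bar>X n \<omega>\<bar> > K * (1 / sqrt (real n))}"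
    assume n: "measure M ?B < \<eta>" "0 < n"
    show "\<exists>A\<in>sets M. 1 - \<eta> \<le> prob A \<and> (\<forall>\<omega>\<in>A. \<bar>sqrt (real n) * X n \<omega>\<bar> \<le> K)"
    proof (intro bexI[of _ "space M - ?B"] conjI ballI)
      show "1 - \<eta> \<le> prob (space M - ?B)" using n by (subst prob_compl) auto
      fix \<omega> assume "\<omega> \<in> space M - ?B"
      then have "\<bar>X n \<omega>\<bar> \<le> K / sqrt (real n)" by auto
      then show "\<bar>sqrt (real n) * X n \<omega>\<bar> \<le> K" using n by (simp add: abs_mult field_simps)
    qed simp
  qed
qed

lemma bounded_in_probability_add:
  assumes "bounded_in_probability M X" "bounded_in_probability M Y"
  shows "bounded_in_probability M (\<lambda>n \<omega>. \<bar>X n \<omega>\<bar> + \<bar>Y n \<omega>\<bar>)"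
  unfolding bounded_in_probability_def
proof (intro allI impI)
  fix \<eta> :: real assume "\<eta> > 0"
  then have h: "\<eta> / 2 > 0" by simp
  obtain K where K: "\<forall>\<^sub>F n in sequentially. \<exists>A\<in>sets M. measure M A \<ge> 1 - \<eta> / 2 \<and> (\<forall>\<omega>\<in>A. \<bar>X n \<omega>\<bar> \<le> K)"
    using assms(1) h unfolding bounded_in_probability_def by blast
  obtain L where L: "\<forall>\<^sub>F n in sequentially. \<exists>A\<in>sets M. measure M A \<ge> 1 - \<eta> / 2 \<and> (\<forall>\<omega>\<in>A. \<bar>Y n \<omega>\<bar> \<le> L)"
    using assms(2) h unfolding bounded_in_probability_def by blast
  show "\<exists>K. \<forall>\<^sub>F n in sequentially. \<exists>A\<in>sets M. 1 - \<eta> \<le> prob A \<and> (\<forall>\<omega>\<in>A. \<bar>\<bar>X n \<omega>\<bar> + \<bar>Y n \<omega>\<bar>\<bar> \<le> K)"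
  proof (rule exI[of _ "K + L"], rule eventually_mono[OF eventually_conj[OF K L]], elim conjE bexE)
    fix n A B
    assume A: "A \<in> sets M" "1 - \<eta> / 2 \<le> prob A" "\<forall>\<omega>\<in>A. \<bar>X n \<omega>\<bar> \<le> K"
      and B: "B \<in> sets M" "1 - \<eta> / 2 \<le> prob B" "\<forall>\<omega>\<in>B. \<bar>Y n \<omega>\<bar> \<le> L"
    have "measure M (A \<union> B) = measure M A + measure M (B - A)"
      using A B by (intro finite_measure_Union') auto
    moreover have "measure M (B - A) = measure M B - measure M (A \<inter> B)"
      using A B by (simp add: finite_measure_Diff' Int_commute)
    moreover have "measure M (A \<union> B) \<le> 1" by simp
    ultimately have "1 - \<eta> \<le> prob (A \<inter> B)" using A(2) B(2) by linarith
    then show "\<exists>A\<in>sets M. 1 - \<eta> \<le> prob A \<and> (\<forall>\<omega>\<in>A. \<bar>\<bar>X n \<omega>\<bar> + \<bar>Y n \<omega>\<bar>\<bar> \<le> K + L)"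
      using A B by (intro bexI[of _ "A \<inter> B"]) (auto intro: add_mono)
  qed
qed

lemma bounded_in_probability_second_moment:
  assumes "\<And>n. integrable M (\<lambda>\<omega>. (Y n \<omega>)\<^sup>2)" "\<And>n. (\<integral>\<omega>. (Y n \<omega>)\<^sup>2 \<partial>M) \<le> C"
    and [measurable]: "\<And>n. Y n \<in> borel_measurable M"
  shows "bounded_in_probability M Y"
  unfolding bounded_in_probability_def
proof (intro allI impI)
  fix \<eta> :: real assume \<eta>: "\<eta> > 0"
  have "0 \<le> (\<integral>\<omega>. (Y 0 \<omega>)\<^sup>2 \<partial>M)" by (intro integral_nonneg_AE) auto
  then have C: "0 \<le> C" using assms(2)[of 0] by linarith
  define K where "K = sqrt ((C + 1) / \<eta>)"
  have pos: "(C + 1) / \<eta> > 0" using \<eta> C by (intro divide_pos_pos) auto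
  from pos have K: "K > 0" "K\<^sup>2 = (C + 1) / \<eta>" by (auto simp: K_def)
  show "\<exists>K. \<forall>\<^sub>F n in sequentially. \<exists>A\<in>sets M. 1 - \<eta> \<le> prob A \<and> (\<forall>\<omega>\<in>A. \<bar>Y n \<omega>\<bar> \<le> K)"
  proof (intro exI[of _ K] always_eventually allI)
    fix n
    let ?B = "{\<omega>\<in>space M. (Y n \<omega>)\<^sup>2 \<ge> K\<^sup>2}"
    have "measure M ?B \<le> (\<integral>\<omega>. (Y n \<omega>)\<^sup>2 \<partial>M) / K\<^sup>2"
      by (rule integral_Markov_inequality_measure[where A="{}"]) (use assms K(1) in auto)
    also have "\<dots> \<le> C / K\<^sup>2" by (intro divide_right_mono assms) auto
    also have "\<dots> \<le> \<eta>" unfolding K(2) using C \<eta> by (simp add: field_simps)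
    finally have B: "measure M ?B \<le> \<eta>" .
    show "\<exists>A\<in>sets M. 1 - \<eta> \<le> prob A \<and> (\<forall>\<omega>\<in>A. \<bar>Y n \<omega>\<bar> \<le> K)"
    proof (intro bexI[of _ "space M - ?B"] conjI ballI)
      show "1 - \<eta> \<le> prob (space M - ?B)" using B by (subst prob_compl) auto
      fix \<omega> assume "\<omega> \<in> space M - ?B"
      then have "(Y n \<omega>)\<^sup>2 \<le> K\<^sup>2" by auto
      then have "\<bar>Y n \<omega>\<bar> \<le> \<bar>K\<bar>" by (rule abs_le_square_iff[THEN iffD2])
      then show "\<bar>Y n \<omega>\<bar> \<le> K" using K(1) by simp
    qed simp
  qed
qed

lemma whp_mult_bounded_in_probability:
  assumes small: "\<And>e. e > 0 \<Longrightarrow> with_high_probability M (\<lambda>n \<omega>. \<bar>X n \<omega>\<bar> \<le> e * \<bar>Z n \<omega>\<bar>)"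
    and Z: "bounded_in_probability M Z"
    and [measurable]: "\<And>n. X n \<in> borel_measurable M" and e: "e > 0"
  shows "with_high_probability M (\<lambda>n \<omega>. \<bar>X n \<omega>\<bar> \<le> e)"
proof (rule whp_of_eventually)
  show "{\<omega>\<in>space M. \<bar>X n \<omega>\<bar> \<le> e} \<in> sets M" for n by measurable
  fix \<eta> :: real assume "\<eta> > 0"
  then have h: "\<eta> / 2 > 0" by simp
  obtain K where K: "\<forall>\<^sub>F n in sequentially. \<exists>A\<in>sets M. measure M A \<ge> 1 - \<eta> / 2 \<and> (\<forall>\<omega>\<in>A. \<bar>Z n \<omega>\<bar> \<le> K)"
    using Z h unfolding bounded_in_probability_def by blast
  define e' where "e' = e / (\<bar>K\<bar> + 1)"
  have e': "e' > 0" using e by (simp add: e'_def add_nonneg_pos)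
  obtain A where A: "\<And>n. A n \<in> sets M" "(\<lambda>n. measure M (A n)) \<longlonglongrightarrow> 1" "\<And>n \<omega>. \<omega> \<in> A n \<Longrightarrow> \<bar>X n \<omega>\<bar> \<le> e' * \<bar>Z n \<omega>\<bar>"
    using small[OF e'] unfolding with_high_probability_def by blast
  have "\<forall>\<^sub>F n in sequentially. measure M (A n) > 1 - \<eta> / 2"
    using order_tendstoD(1)[OF A(2)] h by auto
  then show "\<forall>\<^sub>F n in sequentially. \<exists>A\<in>sets M. 1 - \<eta> \<le> prob A \<and> (\<forall>\<omega>\<in>A. \<bar>X n \<omega>\<bar> \<le> e)"
  proof (rule eventually_mono[OF eventually_conj[OF _ K]], elim conjE bexE)
    fix n B
    assume An: "1 - \<eta> / 2 < prob (A n)"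
      and B: "B \<in> sets M" "1 - \<eta> / 2 \<le> prob B" "\<forall>\<omega>\<in>B. \<bar>Z n \<omega>\<bar> \<le> K"
    have "measure M (A n \<union> B) = measure M (A n) + measure M (B - A n)"
      using A B by (intro finite_measure_Union') auto
    moreover have "measure M (B - A n) = measure M B - measure M (A n \<inter> B)"
      using A B by (simp add: finite_measure_Diff' Int_commute)
    moreover have "measure M (A n \<union> B) \<le> 1" by simp
    ultimately have P: "1 - \<eta> \<le> prob (A n \<inter> B)" using An B(2) by linarith
    show "\<exists>A\<in>sets M. 1 - \<eta> \<le> prob A \<and> (\<forall>\<omega>\<in>A. \<bar>X n \<omega>\<bar> \<le> e)"
    proof (intro bexI[of _ "A n \<inter> B"] conjI P ballI)
      fix \<omega> assume \<omega>: "\<omega> \<in> A n \<inter> B"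
      have "\<bar>X n \<omega>\<bar> \<le> e' * \<bar>Z n \<omega>\<bar>" using A \<omega> by auto
      also have "\<dots> \<le> e' * (\<bar>K\<bar> + 1)" using B \<omega> e' by (intro mult_left_mono) force+
      also have "\<dots> = e"
      proof -
        have "\<bar>K\<bar> + 1 \<noteq> 0" by linarith
        then show ?thesis unfolding e'_def by (metis nonzero_eq_divide_eq)
      qed
      finally show "\<bar>X n \<omega>\<bar> \<le> e" .
    qed (use A B in auto)
  qed
qed

lemma norm_iexp_diff_le: "norm (iexp x - iexp y) \<le> \<bar>x - y\<bar>"
proof -
  have "iexp x = iexp y * iexp (x - y)"
    unfolding exp_add[symmetric] by (simp add: algebra_simps)
  then have "iexp x - iexp y = iexp y * (iexp (x - y) - 1)" by (simp add: right_diff_distrib)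
  then have "norm (iexp x - iexp y) = norm (iexp (x - y) - 1)" by (simp add: norm_mult)
  also have "\<dots> \<le> \<bar>x - y\<bar>" using iexp_approx1[of "x - y" 0] by simp
  finally show ?thesis .
qed

text \<open>Slutsky's lemma for characteristic functions: \<open>iexp\<close> is bounded, and Lipschitz with constant one.\<close>

lemma char_tendsto_of_whp_close:
  fixes X Y :: "nat \<Rightarrow> 'a \<Rightarrow> real"
  assumes [measurable]: "\<And>n. X n \<in> borel_measurable M" "\<And>n. Y n \<in> borel_measurable M"
    and close: "\<And>e. e > 0 \<Longrightarrow> with_high_probability M (\<lambda>n \<omega>. \<bar>X n \<omega> - Y n \<omega>\<bar> \<le> e)"
    and lim: "(\<lambda>n. \<integral>\<omega>. iexp (Y n \<omega>) \<partial>M) \<longlonglongrightarrow> c"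
  shows "(\<lambda>n. \<integral>\<omega>. iexp (X n \<omega>) \<partial>M) \<longlonglongrightarrow> c"
proof -
  have int: "integrable M (\<lambda>\<omega>. iexp (X n \<omega>))" "integrable M (\<lambda>\<omega>. iexp (Y n \<omega>))" for n
    by (rule integrable_const_bound[where B=1], simp, measurable)+
  have "(\<lambda>n. (\<integral>\<omega>. iexp (X n \<omega>) \<partial>M) - (\<integral>\<omega>. iexp (Y n \<omega>) \<partial>M)) \<longlonglongrightarrow> 0"
  proof (rule LIMSEQ_I)
    fix r :: real assume r: "r > 0"
    then have r4: "r / 4 > 0" by simp
    obtain A where A: "\<And>n. A n \<in> sets M" "(\<lambda>n. measure M (A n)) \<longlonglongrightarrow> 1" "\<And>n \<omega>. \<omega> \<in> A n \<Longrightarrow> \<bar>X n \<omega> - Y n \<omega>\<bar> \<le> r / 4"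
      using close[OF r4] unfolding with_high_probability_def by blast
    obtain n0 where n0: "\<And>n. n \<ge> n0 \<Longrightarrow> measure M (A n) > 1 - r / 4"
      using order_tendstoD(1)[OF A(2), of "1 - r / 4"] r4 by (auto simp: eventually_sequentially)
    show "\<exists>n0. \<forall>n\<ge>n0. norm ((\<integral>\<omega>. iexp (X n \<omega>) \<partial>M) - (\<integral>\<omega>. iexp (Y n \<omega>) \<partial>M) - 0) < r"
    proof (intro exI[of _ n0] allI impI)
      fix n assume n: "n \<ge> n0"
      have "norm ((\<integral>\<omega>. iexp (X n \<omega>) \<partial>M) - (\<integral>\<omega>. iexp (Y n \<omega>) \<partial>M))
          = norm (\<integral>\<omega>. iexp (X n \<omega>) - iexp (Y n \<omega>) \<partial>M)" using int by simp
      also have "\<dots> \<le> (\<integral>\<omega>. norm (iexp (X n \<omega>) - iexp (Y n \<omega>)) \<partial>M)" by (rule integral_norm_bound)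
      also have "\<dots> \<le> (\<integral>\<omega>. r / 4 + 2 * indicator (space M - A n) \<omega> \<partial>M)"
      proof (rule integral_mono)
        show "integrable M (\<lambda>\<omega>. norm (iexp (X n \<omega>) - iexp (Y n \<omega>)))" using int by simp
        show "integrable M (\<lambda>\<omega>. r / 4 + 2 * indicator (space M - A n) \<omega>)"
          using A(1) by (intro integrable_const_bound[where B="r + 2"]) (use r in \<open>auto split: split_indicator\<close>)
        fix \<omega> assume "\<omega> \<in> space M"
        show "norm (iexp (X n \<omega>) - iexp (Y n \<omega>)) \<le> r / 4 + 2 * indicator (space M - A n) \<omega>"
        proof (cases "\<omega> \<in> A n")
          case True
          then show ?thesis using norm_iexp_diff_le[of "X n \<omega>" "Y n \<omega>"] A(3)[OF True] by simp
        next
          case False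
          have "norm (iexp (X n \<omega>) - iexp (Y n \<omega>)) \<le> norm (iexp (X n \<omega>)) + norm (iexp (Y n \<omega>))" by (rule norm_triangle_ineq4)
          then show ?thesis using False \<open>\<omega> \<in> space M\<close> r by simp
        qed
      qed
      also have "\<dots> = r / 4 + 2 * measure M (space M - A n)"
        using A(1)[of n] by (subst Bochner_Integration.integral_add) (auto simp: prob_space emeasure_eq_measure)
      also have "\<dots> < r" using n0[OF n] A(1)[of n] r by (simp add: prob_compl)
      finally show "norm ((\<integral>\<omega>. iexp (X n \<omega>) \<partial>M) - (\<integral>\<omega>. iexp (Y n \<omega>) \<partial>M) - 0) < r" by simp
    qed
  qed
  from tendsto_add[OF this lim] show ?thesis by simp
qed

end

subsection \<open>Averages\<close>

locale iid_sample = prob_space M for M :: "'w measure" +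
  fixes T :: "nat \<Rightarrow> 'w \<Rightarrow> 'a::euclidean_space" and P :: "'a measure"
  assumes indep: "indep_vars (\<lambda>_. borel) T UNIV"
    and law: "\<And>i. distr M borel (T i) = P"
begin

definition avg :: "nat \<Rightarrow> ('a \<Rightarrow> real) \<Rightarrow> 'w \<Rightarrow> real" where
  "avg n g \<omega> = (\<Sum>i<n. g (T i \<omega>)) / real n"

lemma T_measurable [measurable]: "T i \<in> borel_measurable M"
  using indep unfolding indep_vars_def2 by auto

lemma sets_P [simp, measurable_cong]: "sets P = sets borel"
  using law[of 0] by (metis sets_distr)

lemma space_P [simp]: "space P = UNIV"
  using sets_eq_imp_space_eq[OF sets_P] by simp

lemma prob_space_P: "prob_space P"
  using prob_space_distr[OF T_measurable] law[of 0] by metis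

lemma integral_T: "g \<in> borel_measurable borel \<Longrightarrow> (\<integral>\<omega>. g (T i \<omega>) \<partial>M) = (\<integral>x. g x \<partial>P)"
  for g :: "'a \<Rightarrow> 'c::{banach, second_countable_topology}"
  by (simp add: law[of i, symmetric] integral_distr)

lemma integrable_T:
  "g \<in> borel_measurable borel \<Longrightarrow> integrable M (\<lambda>\<omega>. g (T i \<omega>)) \<longleftrightarrow> integrable P g"
  for g :: "'a \<Rightarrow> 'c::{banach, second_countable_topology}"
  by (simp add: law[of i, symmetric] integrable_distr_eq)

lemma avg_measurable [measurable]:
  assumes [measurable]: "g \<in> borel_measurable borel"
  shows "avg n g \<in> borel_measurable M"
  unfolding avg_def by simp

lemma avg_add: "avg n (\<lambda>x. f x + g x) \<omega> = avg n f \<omega> + avg n g \<omega>"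
  by (simp add: avg_def sum.distrib add_divide_distrib)

lemma avg_cmult: "avg n (\<lambda>x. c * f x) \<omega> = c * avg n f \<omega>"
  by (simp add: avg_def sum_distrib_left)

lemma integrable_avg:
  assumes [measurable]: "g \<in> borel_measurable borel" and g: "integrable P g"
  shows "integrable M (avg n g)"
proof -
  have "integrable M (\<lambda>\<omega>. \<Sum>i<n. g (T i \<omega>))"
    using g by (intro Bochner_Integration.integrable_sum) (simp add: integrable_T)
  then show ?thesis unfolding avg_def by simp
qed

lemma integral_avg:
  "g \<in> borel_measurable borel \<Longrightarrow> integrable P g \<Longrightarrow> n > 0 \<Longrightarrow> (\<integral>\<omega>. avg n g \<omega> \<partial>M) = (\<integral>x. g x \<partial>P)"
  unfolding avg_def by (simp add: integrable_T integral_T)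

lemma integral_abs_avg_le:
  assumes [measurable]: "g \<in> borel_measurable borel" and g: "integrable P g"
  shows "(\<integral>\<omega>. \<bar>avg n g \<omega>\<bar> \<partial>M) \<le> (\<integral>x. \<bar>g x\<bar> \<partial>P)"
proof (cases "n = 0")
  case True
  then show ?thesis by (simp add: avg_def integral_nonneg_AE)
next
  case False
  have "(\<integral>\<omega>. \<bar>avg n g \<omega>\<bar> \<partial>M) \<le> (\<integral>\<omega>. avg n (\<lambda>x. \<bar>g x\<bar>) \<omega> \<partial>M)"
    using g by (intro integral_mono integrable_abs integrable_avg)
               (auto simp: avg_def intro!: divide_right_mono)
  also have "\<dots> = (\<integral>x. \<bar>g x\<bar> \<partial>P)" using False g by (intro integral_avg) auto
  finally show ?thesis .
qed

lemma indep_g: "g \<in> borel_measurable borel \<Longrightarrow> indep_vars (\<lambda>_. borel) (\<lambda>i \<omega>. (g (T i \<omega>) :: real)) UNIV"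
  using indep_vars_compose2[OF indep, of "\<lambda>_. g" "\<lambda>_. borel"] by simp

text \<open>Orthogonality: centred independent summands are uncorrelated.\<close>

lemma second_moment_sum:
  assumes [measurable]: "g \<in> borel_measurable borel" and g2: "integrable P (\<lambda>x. (g x)\<^sup>2)" and g0: "(\<integral>x. g x \<partial>P) = 0"
  shows "integrable M (\<lambda>\<omega>. (\<Sum>i<n. g (T i \<omega>))\<^sup>2) \<and> (\<integral>\<omega>. (\<Sum>i<n. g (T i \<omega>))\<^sup>2 \<partial>M) = real n * (\<integral>x. (g x)\<^sup>2 \<partial>P)"
proof (induction n)
  case (Suc n)
  interpret P: prob_space P by (rule prob_space_P)
  let ?S = "\<lambda>\<omega>. \<Sum>i<n. g (T i \<omega>)"
  have g1: "integrable P g" by (rule P.square_integrable_imp_integrable[OF _ g2]) simp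
  have iT: "integrable M (\<lambda>\<omega>. g (T i \<omega>))" "integrable M (\<lambda>\<omega>. (g (T i \<omega>))\<^sup>2)" for i
    using g1 g2 integrable_T[of g i] integrable_T[of "\<lambda>x. (g x)\<^sup>2" i] by auto
  have iS: "integrable M ?S" using iT by auto
  have ind: "indep_var borel (\<lambda>\<omega>. g (T n \<omega>)) borel ?S"
    by (rule indep_vars_sum) (auto intro: indep_vars_subset[OF indep_g])
  have prod: "integrable M (\<lambda>\<omega>. g (T n \<omega>) * ?S \<omega>)" "(\<integral>\<omega>. g (T n \<omega>) * ?S \<omega> \<partial>M) = 0"
    using indep_var_integrable[OF ind iT(1) iS] indep_var_lebesgue_integral[OF ind iT(1) iS]
    by (auto simp: integral_T g0)
  have eq: "(\<lambda>\<omega>. (\<Sum>i<Suc n. g (T i \<omega>))\<^sup>2) = (\<lambda>\<omega>. (?S \<omega>)\<^sup>2 + 2 * (g (T n \<omega>) * ?S \<omega>) + (g (T n \<omega>))\<^sup>2)"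
    by (auto simp: power2_eq_square algebra_simps)
  show ?case unfolding eq using Suc prod iT by (auto simp: integral_T[of "\<lambda>x. (g x)\<^sup>2"] algebra_simps)
qed simp

lemma bounded_in_probability_scaled_avg:
  assumes [measurable]: "g \<in> borel_measurable borel" and g2: "integrable P (\<lambda>x. (g x)\<^sup>2)" and g0: "(\<integral>x. g x \<partial>P) = 0"
  shows "bounded_in_probability M (\<lambda>n \<omega>. sqrt (real n) * avg n g \<omega>)"
proof (rule bounded_in_probability_second_moment[where C="\<integral>x. (g x)\<^sup>2 \<partial>P"])
  fix n
  have eq: "(\<lambda>\<omega>. (sqrt (real n) * avg n g \<omega>)\<^sup>2) = (\<lambda>\<omega>. (1 / real n) * (\<Sum>i<n. g (T i \<omega>))\<^sup>2)"
    by (auto simp: avg_def power_mult_distrib power_divide power2_eq_square[of "real n"])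
  show "integrable M (\<lambda>\<omega>. (sqrt (real n) * avg n g \<omega>)\<^sup>2)"
    unfolding eq using second_moment_sum[OF assms, of n] by (intro integrable_mult_right) blast
  have "(\<integral>\<omega>. (sqrt (real n) * avg n g \<omega>)\<^sup>2 \<partial>M) = (1 / real n) * (real n * (\<integral>x. (g x)\<^sup>2 \<partial>P))"
    unfolding eq using second_moment_sum[OF assms, of n] by simp
  also have "\<dots> \<le> (\<integral>x. (g x)\<^sup>2 \<partial>P)" by (auto simp: integral_nonneg_AE)
  finally show "(\<integral>\<omega>. (sqrt (real n) * avg n g \<omega>)\<^sup>2 \<partial>M) \<le> (\<integral>x. (g x)\<^sup>2 \<partial>P)" .
qed measurable

text \<open>Bounded terms have second moments, so the centred average is of order \<open>1 / sqrt n\<close>.\<close>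

lemma whp_avg_bounded_close:
  assumes [measurable]: "g \<in> borel_measurable borel" and B: "\<And>x. \<bar>g x\<bar> \<le> B" and e: "e > 0"
  shows "with_high_probability M (\<lambda>n \<omega>. \<bar>avg n g \<omega> - (\<integral>x. g x \<partial>P)\<bar> \<le> e)"
proof -
  interpret P: prob_space P by (rule prob_space_P)
  define h where "h x = g x - (\<integral>x. g x \<partial>P)" for x
  have [measurable]: "h \<in> borel_measurable borel" unfolding h_def by measurable
  have ig: "integrable P g" by (rule P.integrable_const_bound[where B=B]) (auto simp: B)
  have hB: "\<bar>h x\<bar> \<le> 2 * B" for x
  proof -
    have "\<bar>\<integral>x. g x \<partial>P\<bar> \<le> (\<integral>x. \<bar>g x\<bar> \<partial>P)" by (rule integral_abs_bound)
    also have "\<dots> \<le> (\<integral>x. B \<partial>P)" using ig by (intro integral_mono) (auto simp: B)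
    finally show ?thesis using B[of x] P.prob_space by (simp add: h_def)
  qed
  have h0: "(\<integral>x. h x \<partial>P) = 0" using ig P.prob_space by (simp add: h_def)
  have h2: "integrable P (\<lambda>x. (h x)\<^sup>2)"
  proof (rule P.integrable_const_bound[where B="(2 * B)\<^sup>2"])
    have "(h x)\<^sup>2 \<le> (2 * B)\<^sup>2" for x
      using hB[of x] by (intro abs_le_square_iff[THEN iffD1]) linarith
    then show "AE x in P. norm ((h x)\<^sup>2) \<le> (2 * B)\<^sup>2" by simp
  qed measurable
  have b: "bounded_in_probability M (\<lambda>n \<omega>. sqrt (real n) * avg n h \<omega>)"
    by (rule bounded_in_probability_scaled_avg) (use h2 h0 in auto)
  have "with_high_probability M (\<lambda>n \<omega>. \<bar>avg n h \<omega>\<bar> \<le> e)"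
  proof (rule whp_mult_bounded_in_probability[OF _ b _ e])
    fix r :: real assume r: "r > 0"
    have "\<forall>\<^sub>F n in sequentially. sqrt (real n) \<ge> 1 / r"
      by (intro eventually_sequentiallyI[of "nat \<lceil>(1 / r)\<^sup>2\<rceil>"] real_le_rsqrt) linarith
    then have ev: "\<forall>\<^sub>F n in sequentially. \<forall>\<omega>\<in>space M. True \<longrightarrow> \<bar>avg n h \<omega>\<bar> \<le> r * \<bar>sqrt (real n) * avg n h \<omega>\<bar>"
    proof (rule eventually_mono, intro ballI impI)
      fix n \<omega> assume "1 / r \<le> sqrt (real n)"
      then have "1 \<le> r * sqrt (real n)" using r by (simp add: field_simps)
      from mult_right_mono[OF this, of "\<bar>avg n h \<omega>\<bar>"]
      show "\<bar>avg n h \<omega>\<bar> \<le> r * \<bar>sqrt (real n) * avg n h \<omega>\<bar>" by (simp add: abs_mult mult.assoc)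
    qed
    show "with_high_probability M (\<lambda>n \<omega>. \<bar>avg n h \<omega>\<bar> \<le> r * \<bar>sqrt (real n) * avg n h \<omega>\<bar>)"
      by (rule whp_eventually_mono[OF _ ev], rule whp_AE) simp
  qed measurable
  moreover have "\<forall>\<^sub>F n in sequentially. \<forall>\<omega>\<in>space M. \<bar>avg n h \<omega>\<bar> \<le> e \<longrightarrow> \<bar>avg n g \<omega> - (\<integral>x. g x \<partial>P)\<bar> \<le> e"
    using eventually_gt_at_top[of 0]
    by (rule eventually_mono) (auto simp: avg_def h_def sum_subtractf diff_divide_distrib)
  ultimately show ?thesis by (rule whp_eventually_mono)
qed

text \<open>
  The weak law of large numbers under a first moment only: the truncated summands are bounded, and
  Markov's inequality controls the average of the remainders uniformly in the sample size.
\<close>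

lemma weak_law_of_large_numbers:
  assumes [measurable]: "g \<in> borel_measurable borel" and g: "integrable P g" and e: "e > 0"
  shows "with_high_probability M (\<lambda>n \<omega>. \<bar>avg n g \<omega> - (\<integral>x. g x \<partial>P)\<bar> \<le> e)"
proof (rule whp_of_eventually)
  show "{\<omega> \<in> space M. \<bar>avg n g \<omega> - (\<integral>x. g x \<partial>P)\<bar> \<le> e} \<in> events" for n by measurable
  fix \<eta> :: real assume \<eta>: "\<eta> > 0"
  define d where "d = min (e / 3) (\<eta> * (e / 3) / 2)"
  have d: "d > 0" using e \<eta> by (simp add: d_def)
  define t where "t k x = (if \<bar>g x\<bar> \<le> real k then g x else 0)" for k x
  have [measurable]: "t k \<in> borel_measurable borel" for k unfolding t_def by measurable
  have it: "integrable P (t k)" for k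
    by (rule Bochner_Integration.integrable_bound[OF g]) (auto simp: t_def)
  have "(\<lambda>k. \<integral>x. \<bar>g x - t k x\<bar> \<partial>P) \<longlonglongrightarrow> (\<integral>x. 0 \<partial>P)"
  proof (rule integral_dominated_convergence[where w="\<lambda>x. \<bar>g x\<bar>"])
    show "AE x in P. (\<lambda>k. \<bar>g x - t k x\<bar>) \<longlonglongrightarrow> 0"
    proof (intro AE_I2 tendsto_eventually)
      fix x
      show "\<forall>\<^sub>F k in sequentially. \<bar>g x - t k x\<bar> = 0"
      proof (rule eventually_sequentiallyI[of "nat \<lceil>\<bar>g x\<bar>\<rceil>"])
        fix k assume "nat \<lceil>\<bar>g x\<bar>\<rceil> \<le> k"
        then have "\<bar>g x\<bar> \<le> real k" by linarith
        then show "\<bar>g x - t k x\<bar> = 0" by (simp add: t_def)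
      qed
    qed
  qed (use g in \<open>auto simp: t_def\<close>)
  from order_tendstoD(2)[OF this, of d] obtain k where k: "(\<integral>x. \<bar>g x - t k x\<bar> \<partial>P) < d"
    using d by (auto simp: eventually_sequentially)
  let ?R = "\<lambda>x. g x - t k x"
  have iR: "integrable P ?R" using g it by auto
  have tk: "with_high_probability M (\<lambda>n \<omega>. \<bar>avg n (t k) \<omega> - (\<integral>x. t k x \<partial>P)\<bar> \<le> e / 3)"
    by (rule whp_avg_bounded_close[where B="real k"]) (use e in \<open>auto simp: t_def\<close>)
  obtain A where A: "\<And>n. A n \<in> sets M" "(\<lambda>n. measure M (A n)) \<longlonglongrightarrow> 1"
     "\<And>n \<omega>. \<omega> \<in> A n \<Longrightarrow> \<bar>avg n (t k) \<omega> - (\<integral>x. t k x \<partial>P)\<bar> \<le> e / 3"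
    using tk unfolding with_high_probability_def by blast
  have "\<forall>\<^sub>F n in sequentially. measure M (A n) > 1 - \<eta> / 2"
    using order_tendstoD(1)[OF A(2), of "1 - \<eta> / 2"] \<eta> by auto
  then show "\<forall>\<^sub>F n in sequentially. \<exists>A\<in>events. 1 - \<eta> \<le> prob A \<and> (\<forall>\<omega>\<in>A. \<bar>avg n g \<omega> - (\<integral>x. g x \<partial>P)\<bar> \<le> e)"
  proof (rule eventually_mono)
    fix n assume An: "1 - \<eta> / 2 < prob (A n)"
    let ?B = "{\<omega>\<in>space M. \<bar>avg n ?R \<omega>\<bar> \<ge> e / 3}"
    have "measure M ?B \<le> (\<integral>\<omega>. \<bar>avg n ?R \<omega>\<bar> \<partial>M) / (e / 3)"
      by (rule integral_Markov_inequality_measure[where A="{}"]) (use iR e integrable_avg in auto)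
    also have "\<dots> \<le> d / (e / 3)"
      using integral_abs_avg_le[OF _ iR, of n] k e by (intro divide_right_mono) auto
    also have "\<dots> \<le> \<eta> / 2" using e by (simp add: d_def field_simps min_le_iff_disj)
    finally have B: "measure M ?B \<le> \<eta> / 2" .
    have [measurable]: "?B \<in> sets M" by measurable
    have "measure M (A n \<union> ?B) = measure M (A n - ?B) + measure M ?B"
      using finite_measure_Union'[of ?B "A n"] A by (simp add: Un_commute)
    moreover have "measure M (A n) \<le> measure M (A n \<union> ?B)" using A by (intro finite_measure_mono) auto
    ultimately have P: "1 - \<eta> \<le> prob (A n - ?B)" using An B by linarith
    show "\<exists>A\<in>events. 1 - \<eta> \<le> prob A \<and> (\<forall>\<omega>\<in>A. \<bar>avg n g \<omega> - (\<integral>x. g x \<partial>P)\<bar> \<le> e)"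
    proof (intro bexI[of _ "A n - ?B"] conjI P ballI)
      fix \<omega> assume \<omega>: "\<omega> \<in> A n - ?B"
      then have "\<omega> \<in> space M" using sets.sets_into_space[OF A(1)] by auto
      then have 1: "\<bar>avg n ?R \<omega>\<bar> \<le> e / 3" using \<omega> by auto
      have 2: "\<bar>avg n (t k) \<omega> - (\<integral>x. t k x \<partial>P)\<bar> \<le> e / 3" using A \<omega> by auto
      have "\<bar>(\<integral>x. g x \<partial>P) - (\<integral>x. t k x \<partial>P)\<bar> = \<bar>\<integral>x. ?R x \<partial>P\<bar>" using g it by simp
      also have "\<dots> \<le> (\<integral>x. \<bar>?R x\<bar> \<partial>P)" by (rule integral_abs_bound)
      also have "\<dots> \<le> e / 3" using k by (simp add: d_def)
      finally have 3: "\<bar>(\<integral>x. g x \<partial>P) - (\<integral>x. t k x \<partial>P)\<bar> \<le> e / 3" .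
      have "avg n g \<omega> = avg n (t k) \<omega> + avg n ?R \<omega>" by (simp add: avg_add[symmetric])
      then show "\<bar>avg n g \<omega> - (\<integral>x. g x \<partial>P)\<bar> \<le> e" using 1 2 3 by linarith
    qed (use A in auto)
  qed
qed

text \<open>
  The one-dimensional central limit theorem, in terms of characteristic functions.  A degenerate
  summand, to which the classical theorem does not apply, vanishes almost surely.
\<close>

lemma char_scaled_avg_tendsto:
  assumes [measurable]: "g \<in> borel_measurable borel" and g2: "integrable P (\<lambda>x. (g x)\<^sup>2)" and g0: "(\<integral>x. g x \<partial>P) = 0"
  shows "(\<lambda>n. \<integral>\<omega>. iexp (sqrt (real n) * avg n g \<omega>) \<partial>M) \<longlonglongrightarrow> of_real (exp (- (\<integral>x. (g x)\<^sup>2 \<partial>P) / 2))"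
proof -
  interpret P: prob_space P by (rule prob_space_P)
  let ?v = "\<integral>x. (g x)\<^sup>2 \<partial>P"
  have v0: "?v \<ge> 0" by (intro integral_nonneg_AE) auto
  show ?thesis
  proof (cases "?v = 0")
    case True
    then have "AE x in P. (g x)\<^sup>2 = 0" using integral_nonneg_eq_0_iff_AE[OF g2] by auto
    then have "AE x in distr M borel (T i). g x = 0" for i unfolding law by simp
    then have "AE \<omega> in M. g (T i \<omega>) = 0" for i by (subst (asm) AE_distr_iff) auto
    then have "AE \<omega> in M. \<forall>i. g (T i \<omega>) = 0" by (simp add: AE_all_countable)
    then have "AE \<omega> in M. iexp (sqrt (real n) * avg n g \<omega>) = 1" for n by eventually_elim (simp add: avg_def)
    then have "(\<integral>\<omega>. iexp (sqrt (real n) * avg n g \<omega>) \<partial>M) = (\<integral>\<omega>. 1 \<partial>M)" for n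
      by (intro integral_cong_AE) auto
    then show ?thesis by (simp add: True prob_space)
  next
    case False
    then have v: "?v > 0" using v0 by linarith
    define s where "s = sqrt ?v"
    have s: "s > 0" "s\<^sup>2 = ?v" using v by (auto simp: s_def)
    let ?X = "\<lambda>i \<omega>. g (T i \<omega>)"
    have E0: "(\<integral>\<omega>. ?X i \<omega> \<partial>M) = 0" for i by (simp add: integral_T g0)
    have "weak_conv_m (\<lambda>n. distr M borel (\<lambda>\<omega>. (\<Sum>i<n. ?X i \<omega>) / sqrt (real n * s\<^sup>2))) std_normal_distribution"
    proof (rule central_limit_theorem_zero_mean[OF _ E0 s(1), where \<mu>="distr P borel g"])
      show "indep_vars (\<lambda>i. borel) ?X UNIV" by (rule indep_g) simp
      show "integrable M (\<lambda>\<omega>. (?X n \<omega>)\<^sup>2)" for n using g2 integrable_T[of "\<lambda>x. (g x)\<^sup>2" n] by simp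
      show "variance (?X n) = s\<^sup>2" for n using E0 integral_T[of "\<lambda>x. (g x)\<^sup>2" n] s by simp
      show "distr M borel (?X n) = distr P borel g" for n by (simp add: law[of n, symmetric] distr_distr o_def)
    qed
    then have "(\<lambda>n. char (distr M borel (\<lambda>\<omega>. (\<Sum>i<n. ?X i \<omega>) / sqrt (real n * s\<^sup>2))) s) \<longlonglongrightarrow> char std_normal_distribution s"
      by (intro levy_continuity1) (auto intro!: real_distribution_distr real_dist_normal_dist)
    moreover have "char std_normal_distribution s = of_real (exp (- ?v / 2))"
      by (simp add: char_std_normal_distribution s)
    moreover have "char (distr M borel (\<lambda>\<omega>. (\<Sum>i<n. ?X i \<omega>) / sqrt (real n * s\<^sup>2))) s
        = (\<integral>\<omega>. iexp (sqrt (real n) * avg n g \<omega>) \<partial>M)" for n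
    proof -
      have "s * ((\<Sum>i<n. ?X i \<omega>) / sqrt (real n * s\<^sup>2)) = sqrt (real n) * avg n g \<omega>" for \<omega>
        using s(1) by (cases "n = 0") (auto simp: real_sqrt_mult avg_def real_div_sqrt field_simps)
      then show ?thesis unfolding char_def by (subst integral_distr) auto
    qed
    ultimately show ?thesis by simp
  qed
qed

end

lemma matrix_add_mult: "(A + B) ** C = A ** C + B ** C" for A B :: "real^'n^'m" and C :: "real^'p^'n"
  by (simp add: vec_eq_iff matrix_matrix_mult_def sum.distrib distrib_right)

lemma matrix_diff_mult: "(A - B) ** C = A ** C - B ** C" for A B :: "real^'n^'m" and C :: "real^'p^'n"
  by (simp add: vec_eq_iff matrix_matrix_mult_def sum_subtractf left_diff_distrib)

lemma matrix_mult_diff: "A ** (B - C) = A ** B - A ** C" for A :: "real^'n^'m" and B C :: "real^'p^'n"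
  by (simp add: vec_eq_iff matrix_matrix_mult_def sum_subtractf right_diff_distrib)

section \<open>Matrices near the identity, positive definite matrices\<close>

lemma matrix_inv_right: "invertible A \<Longrightarrow> A ** matrix_inv A = mat 1"
  and matrix_inv_left: "invertible A \<Longrightarrow> matrix_inv A ** A = mat 1"
  for A :: "real^'n^'n"
  unfolding matrix_inv_def invertible_def by (metis (mono_tags, lifting) someI_ex)+

lemma matrix_inv_eqI:
  fixes A B :: "real^'n^'n"
  assumes "A ** B = mat 1"
  shows "matrix_inv A = B"
proof -
  have "invertible A" using assms invertible_right_inverse by blast
  then have "matrix_inv A = matrix_inv A ** (A ** B)" using assms by (simp add: matrix_mul_rid)
  also have "\<dots> = B" using \<open>invertible A\<close> by (simp add: matrix_mul_assoc matrix_inv_left matrix_mul_lid)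
  finally show ?thesis .
qed

lemma invertible_matrix_inv: "invertible A \<Longrightarrow> invertible (matrix_inv A)" for A :: "real^'n^'n"
  using matrix_inv_left matrix_inv_right invertible_def by blast

lemma matrix_inv_matrix_inv: "invertible A \<Longrightarrow> matrix_inv (matrix_inv A) = A" for A :: "real^'n^'n"
  by (rule matrix_inv_eqI) (rule matrix_inv_left)

lemma matrix_inv_mult:
  fixes A B :: "real^'n^'n"
  assumes "invertible A" "invertible B"
  shows "matrix_inv (A ** B) = matrix_inv B ** matrix_inv A"
proof (rule matrix_inv_eqI)
  have "(A ** B) ** (matrix_inv B ** matrix_inv A) = A ** (B ** matrix_inv B) ** matrix_inv A"
    by (simp only: matrix_mul_assoc)
  then show "(A ** B) ** (matrix_inv B ** matrix_inv A) = mat 1"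
    using assms by (simp add: matrix_inv_right matrix_mul_rid)
qed

lemma matrix_inv_scaleR:
  fixes A :: "real^'n^'n"
  assumes "invertible A" "c \<noteq> 0"
  shows "matrix_inv (c *\<^sub>R A) = (1 / c) *\<^sub>R matrix_inv A"
  using assms by (intro matrix_inv_eqI) (simp add: matrix_scalar_ac scalar_matrix_assoc[symmetric] matrix_inv_right)

lemma invertible_transpose: "invertible A \<Longrightarrow> invertible (transpose A)" for A :: "real^'n^'n"
  by (simp add: invertible_det_nz)

lemma matrix_inv_transpose:
  fixes A :: "real^'n^'n"
  assumes "invertible A"
  shows "matrix_inv (transpose A) = transpose (matrix_inv A)"
  using assms by (intro matrix_inv_eqI) (simp add: matrix_transpose_mul[symmetric] matrix_inv_left transpose_mat)

lemma det_matrix_inv: "invertible A \<Longrightarrow> det (matrix_inv A) = 1 / det A" for A :: "real^'n^'n"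
  using det_mul[of A "matrix_inv A"] by (simp add: matrix_inv_right invertible_det_nz field_simps)

lemma det_scaleR: "det (c *\<^sub>R A) = c ^ CARD('n) * det A" for A :: "real^'n^'n"
proof -
  have "c *\<^sub>R A = (\<chi> i. c *s A $ i)" by (simp add: vec_eq_iff)
  then show ?thesis using det_rows_mul[of "\<lambda>_. c" "\<lambda>i. A $ i"] by simp
qed

lemma inner_matrix_transpose: "x \<bullet> (A *v y) = (transpose A *v x) \<bullet> y" for A :: "real^'n^'m"
  by (simp add: dot_lmul_matrix[symmetric] inner_commute transpose_matrix_vector)

lemma trace_scaleR: "trace (c *\<^sub>R A) = c * trace A" for A :: "real^'n^'n"
  by (simp add: trace_def sum_distrib_left)

lemma trace_mult_eq_inner: "trace (A ** B) = transpose A \<bullet> B" for A B :: "real^'n^'n"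
proof -
  have "trace (A ** B) = (\<Sum>i\<in>UNIV. \<Sum>k\<in>UNIV. A $ i $ k * B $ k $ i)"
    by (simp add: trace_def matrix_matrix_mult_def)
  also have "\<dots> = (\<Sum>k\<in>UNIV. \<Sum>i\<in>UNIV. A $ i $ k * B $ k $ i)" by (rule sum.swap)
  finally show ?thesis by (simp add: inner_vec_def transpose_def)
qed

lemma norm_matrix_vector_mult_le: "norm (A *v x) \<le> norm A * norm x" for A :: "real^'n^'m"
proof -
  have "norm (A *v x) = L2_set (\<lambda>i. \<bar>A $ i \<bullet> x\<bar>) UNIV"
    by (simp add: norm_vec_def matrix_vector_mult_def inner_vec_def)
  also have "\<dots> \<le> L2_set (\<lambda>i. norm (A $ i) * norm x) UNIV"
    by (intro L2_set_mono) (auto simp: Cauchy_Schwarz_ineq2)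
  also have "\<dots> = norm A * norm x"
    by (simp add: norm_vec_def[of A] L2_set_left_distrib)
  finally show ?thesis .
qed

lemma norm_transpose: "norm (transpose A) = norm A" for A :: "real^'n^'m"
proof -
  have "(norm (transpose A))\<^sup>2 = (norm A)\<^sup>2"
    unfolding power2_norm_eq_inner by (simp add: inner_vec_def transpose_def) (rule sum.swap)
  then show ?thesis by simp
qed

lemma norm_matrix_mult_le: "norm (A ** B) \<le> norm A * norm B" for A :: "real^'n^'m" and B :: "real^'p^'n"
proof -
  have row: "(A ** B) $ i = transpose B *v (A $ i)" for i
    by (simp add: vec_eq_iff matrix_matrix_mult_def matrix_vector_mult_def transpose_def mult.commute)
  have "norm (A ** B) = L2_set (\<lambda>i. norm (transpose B *v (A $ i))) UNIV"
    by (simp add: norm_vec_def[of "A ** B"] row)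
  also have "\<dots> \<le> L2_set (\<lambda>i. norm B * norm (A $ i)) UNIV"
    using norm_matrix_vector_mult_le[of "transpose B"] by (intro L2_set_mono) (auto simp: norm_transpose)
  also have "\<dots> = norm A * norm B"
    by (simp add: norm_vec_def[of A] L2_set_right_distrib mult.commute)
  finally show ?thesis .
qed

lemma abs_trace_le: "\<bar>trace A\<bar> \<le> norm (mat 1 :: real^'n^'n) * norm A" for A :: "real^'n^'n"
  using trace_mult_eq_inner[of "mat 1" A] Cauchy_Schwarz_ineq2[of "mat 1 :: real^'n^'n" A]
  by (simp add: matrix_mul_lid transpose_mat)

lemma invertible_mat_1_plus:
  fixes H :: "real^'n^'n"
  assumes "norm H \<le> 1 / 2"
  shows "invertible (mat 1 + H)"
proof -
  have "x = 0" if "(mat 1 + H) *v x = 0" for x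
  proof -
    have "x = - (H *v x)" using that by (simp add: matrix_vector_mult_add_rdistrib eq_neg_iff_add_eq_0)
    then have "norm x = norm (H *v x)" by (metis norm_minus_cancel)
    also have "\<dots> \<le> 1 / 2 * norm x"
      using norm_matrix_vector_mult_le[of H x] mult_right_mono[OF assms norm_ge_zero, of x] by linarith
    finally show "x = 0" by simp
  qed
  then show ?thesis by (simp add: invertible_left_inverse matrix_left_invertible_ker)
qed

text \<open>The Neumann series, cut off after the constant and after the linear term.\<close>

lemma inv_mat_1_plus_expand:
  fixes H :: "real^'n^'n"
  assumes "norm H \<le> 1 / 2"
  shows "norm (matrix_inv (mat 1 + H)) \<le> 2 * norm (mat 1 :: real^'n^'n)"
    and "norm (matrix_inv (mat 1 + H) - mat 1 + H) \<le> 2 * norm (mat 1 :: real^'n^'n) * (norm H)\<^sup>2"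
proof -
  let ?J = "matrix_inv (mat 1 + H)"
  have inv: "invertible (mat 1 + H)" by (rule invertible_mat_1_plus[OF assms])
  have 1: "?J + H ** ?J = mat 1"
    using matrix_inv_right[OF inv] by (simp add: matrix_add_mult matrix_mul_lid)
  have 2: "?J + ?J ** H = mat 1"
    using matrix_inv_left[OF inv] by (simp add: matrix_add_ldistrib matrix_mul_rid)
  have "norm ?J \<le> norm (?J + H ** ?J) + norm (H ** ?J)"
    using norm_triangle_ineq4[of "?J + H ** ?J" "H ** ?J"] by simp
  also have "\<dots> \<le> norm (mat 1 :: real^'n^'n) + 1 / 2 * norm ?J"
    using 1 norm_matrix_mult_le[of H ?J] mult_right_mono[OF assms, of "norm ?J"] by simp
  finally show J: "norm ?J \<le> 2 * norm (mat 1 :: real^'n^'n)" by simp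
  have J1: "mat 1 - ?J = H ** ?J" using 1 by (simp only: diff_eq_eq add.commute)
  have J2: "?J = mat 1 - ?J ** H" using 2 by (simp add: eq_diff_eq)
  have b: "H ** ?J = H - H ** ?J ** H"
    by (subst J2) (simp add: matrix_mul_assoc[symmetric] matrix_mult_diff matrix_mul_rid)
  have "?J - mat 1 + H = H - H ** ?J" unfolding J1[symmetric] by simp
  also have "\<dots> = H ** ?J ** H" by (subst b) simp
  finally have "norm (?J - mat 1 + H) \<le> norm H * norm ?J * norm H"
    using norm_matrix_mult_le[of "H ** ?J" H] mult_right_mono[OF norm_matrix_mult_le[of H ?J], of "norm H"] by simp
  also have "\<dots> \<le> norm H * (2 * norm (mat 1 :: real^'n^'n)) * norm H"
    using J by (intro mult_right_mono mult_left_mono) auto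
  finally show "norm (?J - mat 1 + H) \<le> 2 * norm (mat 1 :: real^'n^'n) * (norm H)\<^sup>2"
    by (simp add: power2_eq_square mult_ac)
qed

text \<open>
  In the Leibniz expansion of the determinant, a permutation other than the identity moves at least
  two indices, so its contribution is of second order at the identity matrix.
\<close>

lemma det_has_derivative_at_mat_1:
  "(det has_derivative (trace :: real^'n^'n \<Rightarrow> real)) (at (mat 1))"
proof -
  have perm: "((\<lambda>A::real^'n^'n. of_int (sign p) * (\<Prod>i\<in>UNIV. A $ i $ p i)) has_derivative
      (\<lambda>H. if p = id then trace H else 0)) (at (mat 1))"
    if p: "p permutes (UNIV :: 'n set)" for p
  proof -
    have "((\<lambda>A::real^'n^'n. \<Prod>i\<in>UNIV. A $ i $ p i) has_derivative
        (\<lambda>H. \<Sum>i\<in>UNIV. H $ i $ p i * (\<Prod>j\<in>UNIV - {i}. (mat 1 :: real^'n^'n) $ j $ p j))) (at (mat 1))"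
      by (intro has_derivative_prod bounded_linear_imp_has_derivative bounded_linear_compose[OF bounded_linear_vec_nth bounded_linear_vec_nth])
    then have "((\<lambda>A::real^'n^'n. of_int (sign p) * (\<Prod>i\<in>UNIV. A $ i $ p i)) has_derivative
        (\<lambda>H. of_int (sign p) * (\<Sum>i\<in>UNIV. H $ i $ p i * (\<Prod>j\<in>UNIV - {i}. (mat 1 :: real^'n^'n) $ j $ p j)))) (at (mat 1))"
      by (rule has_derivative_mult_right)
    moreover have "of_int (sign p) * (\<Sum>i\<in>UNIV. H $ i $ p i * (\<Prod>j\<in>UNIV - {i}. (mat 1 :: real^'n^'n) $ j $ p j))
        = (if p = id then trace H else 0)" for H :: "real^'n^'n"
    proof (cases "p = id")
      case True
      then show ?thesis by (simp add: trace_def mat_def)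
    next
      case False
      have z: "(\<Prod>j\<in>UNIV - {i}. (mat 1 :: real^'n^'n) $ j $ p j) = 0" for i
      proof (rule ccontr)
        assume "(\<Prod>j\<in>UNIV - {i}. (mat 1 :: real^'n^'n) $ j $ p j) \<noteq> 0"
        then have fix_j: "p j = j" if "j \<noteq> i" for j using that by (auto simp: mat_def split: if_splits)
        have "p i = i"
        proof (rule ccontr)
          assume "p i \<noteq> i"
          then have "p (p i) = p i" by (rule fix_j)
          then show False using \<open>p i \<noteq> i\<close> permutes_inj[OF p] by (metis injD)
        qed
        then have "p j = j" for j using fix_j by (cases "j = i") auto
        then have "p = id" by (simp add: fun_eq_iff)
        then show False using False by simp
      qed
      show ?thesis using False by (simp only: z mult_zero_right sum.neutral_const if_False)
    qed
    ultimately show ?thesis by simp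
  qed
  have "((\<lambda>A::real^'n^'n. \<Sum>p | p permutes (UNIV::'n set). of_int (sign p) * (\<Prod>i\<in>UNIV. A $ i $ p i)) has_derivative
      (\<lambda>H. \<Sum>p | p permutes (UNIV::'n set). if p = id then trace H else 0)) (at (mat 1))"
    by (intro has_derivative_sum perm) auto
  moreover have "(\<Sum>p | p permutes (UNIV::'n set). if p = id then trace H else 0) = trace H" for H :: "real^'n^'n"
    by (subst sum.delta) (auto simp: permutes_id)
  ultimately show ?thesis by (simp add: det_def[abs_def])
qed

subsection \<open>Positive definite matrices\<close>

lemma PDS_invertible: "A \<in> PDS \<Longrightarrow> invertible A"
proof -
  assume A: "A \<in> PDS"
  have "x = 0" if "A *v x = 0" for x
    using A that by (force simp: PDS_def)
  then show ?thesis by (simp add: invertible_left_inverse matrix_left_invertible_ker)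
qed

lemma PDS_transpose: "A \<in> PDS \<Longrightarrow> transpose A = A"
  by (simp add: PDS_def)

lemma PDS_pos: "A \<in> PDS \<Longrightarrow> x \<noteq> 0 \<Longrightarrow> 0 < x \<bullet> (A *v x)"
  by (simp add: PDS_def)

text \<open>
  A maximal family of vectors that is orthonormal for the inner product given by \<open>A\<close> is a basis
  (otherwise a Gram-Schmidt step would enlarge it); its vectors are the rows of the inverse root.
\<close>

lemma PDS_orthonormalizing:
  fixes A :: "real^'n^'n"
  assumes A: "A \<in> PDS"
  obtains C :: "real^'n^'n" where "C ** A ** transpose C = mat 1"
proof -
  define ip where "ip x y = x \<bullet> (A *v y)" for x y
  have ip_sym: "ip x y = ip y x" for x y
    using inner_matrix_transpose[of x A y] PDS_transpose[OF A] by (simp add: ip_def inner_commute)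
  have ip_pos: "x \<noteq> 0 \<Longrightarrow> ip x x > 0" for x using PDS_pos[OF A] by (simp add: ip_def)
  have ip_lin: "ip x (y - z) = ip x y - ip x z" "ip x (c *\<^sub>R y) = c * ip x y" "ip x (\<Sum>b\<in>S. f b) = (\<Sum>b\<in>S. ip x (f b))"
    for x y z c S and f :: "real^'n \<Rightarrow> real^'n"
    by (auto simp: ip_def matrix_vector_mult_diff_distrib inner_diff_right matrix_vector_mult_scaleR
        linear_sum[OF matrix_vector_mul_linear] inner_sum_right)
  define on where "on S \<longleftrightarrow> finite S \<and> (\<forall>x\<in>S. \<forall>y\<in>S. ip x y = (if x = y then 1 else 0))" for S
  have indep: "independent S" if "on S" for S
  proof (rule independent_if_scalars_zero)
    show "finite S" using that by (simp add: on_def)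
    fix f x assume z: "(\<Sum>x\<in>S. f x *\<^sub>R x) = 0" and x: "x \<in> S"
    have "0 = ip x (\<Sum>x\<in>S. f x *\<^sub>R x)" by (simp add: z ip_def)
    also have "\<dots> = (\<Sum>y\<in>S. f y * ip x y)" by (simp add: ip_lin)
    also have "\<dots> = (\<Sum>y\<in>S. if x = y then f y else 0)"
      using that x by (intro sum.cong) (auto simp: on_def)
    also have "\<dots> = f x" using that x by (simp add: on_def)
    finally show "f x = 0" by simp
  qed
  have card: "card S \<le> CARD('n)" if "on S" for S
    using independent_bound[OF indep[OF that]] by (simp add: DIM_cart)
  have "on {}" by (simp add: on_def)
  then obtain S where S: "on S" "\<And>S'. on S' \<Longrightarrow> card S' \<le> card S"
    using ex_has_greatest_nat[of on "{}" card "CARD('n) + 1"] card by (metis le_imp_less_Suc Suc_eq_plus1)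
  have fin: "finite S" using S by (simp add: on_def)
  have span: "span S = UNIV"
  proof (rule ccontr)
    assume "span S \<noteq> UNIV"
    then obtain x where x: "x \<notin> span S" by auto
    define y where "y = x - (\<Sum>b\<in>S. ip b x *\<^sub>R b)"
    have "(\<Sum>b\<in>S. ip b x *\<^sub>R b) \<in> span S" by (intro span_sum span_scale span_base)
    then have "y \<noteq> 0" using x by (auto simp: y_def)
    then have yy: "ip y y > 0" by (rule ip_pos)
    have y0: "ip b y = 0" if "b \<in> S" for b
    proof -
      have "ip b (\<Sum>c\<in>S. ip c x *\<^sub>R c) = (\<Sum>c\<in>S. if b = c then ip c x else 0)"
        unfolding ip_lin using S(1) that by (intro sum.cong) (auto simp: on_def)
      also have "\<dots> = ip b x" using that fin by simp
      finally show ?thesis by (simp add: y_def ip_lin)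
    qed
    define w where "w = (1 / sqrt (ip y y)) *\<^sub>R y"
    have ww: "ip w w = 1"
    proof -
      have "ip w w = (1 / sqrt (ip y y)) * ((1 / sqrt (ip y y)) * ip y y)"
        unfolding w_def ip_lin by (subst ip_sym) (simp add: ip_lin)
      then show ?thesis using yy by (simp add: field_simps)
    qed
    have w0: "ip b w = 0" "ip w b = 0" if "b \<in> S" for b
      using y0[OF that] ip_sym[of w b] by (auto simp: w_def ip_lin)
    have "w \<notin> S" using w0 ww by force
    have "on (insert w S)" using S(1) ww w0 by (auto simp: on_def)
    from S(2)[OF this] show False using \<open>w \<notin> S\<close> fin by simp
  qed
  have "card S = CARD('n)"
    using dim_eq_card_independent[OF indep[OF S(1)]] span by (metis DIM_cart DIM_real dim_UNIV dim_span mult.right_neutral)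
  then obtain h :: "'n \<Rightarrow> real^'n" where h: "bij_betw h UNIV S"
    using fin finite_same_card_bij[of "UNIV :: 'n set" S] by auto
  define C where "C = (\<chi> i. h i)"
  have "(C ** A ** transpose C) $ i $ j = (mat 1 :: real^'n^'n) $ i $ j" for i j
  proof -
    have "(C ** A ** transpose C) $ i $ j = ip (h i) (h j)"
      unfolding matrix_mul_assoc[symmetric]
      by (simp add: C_def ip_def inner_vec_def matrix_matrix_mult_def matrix_vector_mult_def transpose_def)
    also have "\<dots> = (if i = j then 1 else 0)"
      using S(1) h by (auto simp: on_def bij_betw_def inj_on_def)
    finally show ?thesis by (simp add: mat_def)
  qed
  then show ?thesis using that[of C] by (simp add: vec_eq_iff)
qed

lemma PDS_square_root:
  fixes A :: "real^'n^'n"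
  assumes A: "A \<in> PDS"
  obtains B :: "real^'n^'n" where "invertible B" "B ** transpose B = A"
proof -
  obtain C :: "real^'n^'n" where C: "C ** A ** transpose C = mat 1" by (rule PDS_orthonormalizing[OF A])
  have "C ** (A ** transpose C) = mat 1" using C by (simp add: matrix_mul_assoc)
  then have inv: "invertible C" using invertible_right_inverse by blast
  let ?B = "matrix_inv C"
  have "?B ** transpose ?B = ?B ** (C ** A ** transpose C) ** transpose ?B"
    by (simp add: C matrix_mul_rid)
  also have "\<dots> = (?B ** C) ** A ** transpose (?B ** C)"
    by (simp add: matrix_mul_assoc matrix_transpose_mul)
  also have "\<dots> = A" by (simp add: matrix_inv_left[OF inv] transpose_mat matrix_mul_lid matrix_mul_rid)
  finally show ?thesis using that invertible_matrix_inv[OF inv] by blast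
qed

lemma PDS_mult_transpose:
  fixes B :: "real^'n^'n"
  assumes "invertible B"
  shows "B ** transpose B \<in> PDS"
proof -
  have "0 < x \<bullet> ((B ** transpose B) *v x)" if "x \<noteq> 0" for x
  proof -
    have "transpose B *v x \<noteq> 0"
      using invertible_transpose[OF assms] that
      by (metis invertible_left_inverse matrix_left_invertible_ker)
    moreover have "x \<bullet> ((B ** transpose B) *v x) = (transpose B *v x) \<bullet> (transpose B *v x)"
      by (simp add: matrix_vector_mul_assoc[symmetric] inner_matrix_transpose)
    ultimately show ?thesis by simp
  qed
  then show ?thesis by (simp add: PDS_def matrix_transpose_mul)
qed

lemma PDS_det_pos: "A \<in> PDS \<Longrightarrow> det A > 0"
proof -
  assume A: "A \<in> PDS"
  obtain B :: "real^'a^'a" where B: "invertible B" "B ** transpose B = A" by (rule PDS_square_root[OF A])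
  have "det A = (det B)\<^sup>2" unfolding B(2)[symmetric] by (simp add: det_mul power2_eq_square)
  then show ?thesis using B(1) by (simp add: invertible_det_nz)
qed

lemma PDS_matrix_inv: "A \<in> PDS \<Longrightarrow> matrix_inv A \<in> PDS"
proof -
  assume A: "A \<in> PDS"
  obtain B :: "real^'a^'a" where B: "invertible B" "B ** transpose B = A" by (rule PDS_square_root[OF A])
  let ?C = "transpose (matrix_inv B)"
  have "matrix_inv A = ?C ** transpose ?C"
    unfolding B(2)[symmetric] using B(1)
    by (simp add: matrix_inv_mult invertible_transpose matrix_inv_transpose)
  then show ?thesis using PDS_mult_transpose[OF invertible_transpose[OF invertible_matrix_inv[OF B(1)]]] by simp
qed

subsection \<open>Linear change of variables and elliptical densities\<close>

text \<open>
  A linear map is a product of elementary ones, and the determinant is multiplicative; for an elementary map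
  it suffices to look at boxes.
\<close>

lemma measure_linear_image_cart:
  fixes f :: "real^'n \<Rightarrow> real^'n"
  assumes "linear f"
  shows "\<forall>S\<in>lmeasurable. f ` S \<in> lmeasurable \<and> measure lebesgue (f ` S) = \<bar>det (matrix f)\<bar> * measure lebesgue S"
    (is "?P f")
proof (rule induct_linear_elementary[OF assms])
  fix f g :: "real^'n \<Rightarrow> real^'n" assume lin: "linear f" "linear g" and P: "?P f" "?P g"
  show "?P (f \<circ> g)"
    unfolding image_comp[symmetric] matrix_compose[OF lin(2,1)] det_mul abs_mult
    using P by auto
next
  fix f :: "real^'n \<Rightarrow> real^'n" and i assume f: "linear f" "\<And>x. f x $ i = 0"
  have "\<not> surj f" using f(2) by (metis one_neq_zero surjE vec_component)
  then have "\<not> inj f" using f(1) linear_injective_imp_surjective by blast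
  then have "negligible (f ` S)" for S
    using f(1) negligible_linear_singular_image by blast
  moreover have "det (matrix f) = 0"
    using f(1) \<open>\<not> inj f\<close> det_nz_iff_inj by blast
  ultimately show "?P f" by (simp add: negligible_iff_measure)
next
  fix c :: "'n \<Rightarrow> real"
  have "det (matrix (\<lambda>x. \<chi> i. c i * x $ i)) = prod c UNIV"
    by (subst det_diagonal) (auto simp: matrix_def axis_def)
  then show "?P (\<lambda>x. \<chi> i. c i * x $ i)"
    by (auto intro: measurable_stretch simp: measure_stretch)
next
  fix m n :: 'n assume "m \<noteq> n"
  let ?t = "Transposition.transpose m n"
  let ?h = "\<lambda>x :: real^'n. \<chi> i. x $ ?t i"
  have lin: "linear ?h" by (rule linearI) (simp_all add: vec_eq_iff)
  have img: "?h ` cbox a b = cbox (?h a) (?h b)" for a b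
  proof (intro equalityI subsetI)
    fix x assume "x \<in> cbox (?h a) (?h b)"
    then have "\<forall>i. a $ ?t i \<le> x $ i \<and> x $ i \<le> b $ ?t i" by (simp add: mem_box_cart)
    then have "?h x \<in> cbox a b" by (simp add: mem_box_cart) (metis transpose_involutory)
    then show "x \<in> ?h ` cbox a b" by (rule rev_image_eqI) (simp add: vec_eq_iff)
  qed (auto simp: mem_box_cart)
  have "measure lebesgue (?h ` cbox a b) = 1 * measure lebesgue (cbox a b)" for a b
  proof -
    have "cbox a b = {} \<longleftrightarrow> ?h ` cbox a b = {}" by simp
    moreover have "(\<Prod>i\<in>UNIV. b $ ?t i - a $ ?t i) = (\<Prod>i\<in>UNIV. b $ i - a $ i)"
      by (rule prod.reindex_bij_betw[of ?t]) (simp add: bij_transpose)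
    ultimately show ?thesis unfolding img by (simp add: content_cbox_if_cart)
  qed
  then have "?h ` S \<in> lmeasurable \<and> measure lebesgue (?h ` S) = measure lebesgue S" if "S \<in> lmeasurable" for S
    using measure_linear_sufficient[OF lin that, of 1] by simp
  moreover have "matrix ?h = (\<chi> i. (mat 1 :: real^'n^'n) $ ?t i)"
    by (simp add: vec_eq_iff matrix_def axis_def mat_def)
  then have "\<bar>det (matrix ?h)\<bar> = 1"
    using det_permute_rows[of ?t "mat 1 :: real^'n^'n"] \<open>m \<noteq> n\<close>
    by (simp add: permutes_swap_id sign_swap_id abs_mult)
  ultimately show "?P ?h" by simp
next
  fix m n :: 'n assume mn: "m \<noteq> n"
  let ?h = "\<lambda>x :: real^'n. \<chi> i. if i = m then x $ m + x $ n else x $ i"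
  have lin: "linear ?h" by (rule linearI) (auto simp: vec_eq_iff algebra_simps)
  have "measure lebesgue (?h ` cbox a b) = 1 * measure lebesgue (cbox a b)" for a b
  proof (cases "cbox a b = {}")
    case False
    define v where "v = - axis n (a $ n)"
    have "?h x = - ?h v + ?h (v + x)" for x
      unfolding linear_add[OF lin] by (simp only: add.assoc[symmetric] add.left_inverse add_0_left)
    then have "?h ` cbox a b = (+) (- ?h v) ` ?h ` cbox (v + a) (v + b)"
      unfolding cbox_translation image_comp o_def by (intro image_cong refl)
    then have "measure lebesgue (?h ` cbox a b) = measure lebesgue (?h ` cbox (v + a) (v + b))"
      by (simp only: measure_translation)
    also have "\<dots> = measure lebesgue (cbox (v + a) (v + b))"
    proof (rule measure_shear_interval[OF mn])
      show "cbox (v + a) (v + b) \<noteq> {}" using False by (simp add: cbox_translation)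
      show "0 \<le> (v + a) $ n" by (simp add: v_def axis_def)
    qed
    finally show ?thesis by (simp only: cbox_translation measure_translation mult_1)
  qed simp
  then have "?h ` S \<in> lmeasurable \<and> measure lebesgue (?h ` S) = measure lebesgue S" if "S \<in> lmeasurable" for S
    using measure_linear_sufficient[OF lin that, of 1] by simp
  moreover have "matrix ?h = (\<chi> k. if k = m then row m (mat 1) + 1 *s row n (mat 1) else row k (mat 1 :: real^'n^'n))"
    by (simp add: vec_eq_iff matrix_def axis_def mat_def row_def)
  then have "det (matrix ?h) = 1"
    using det_row_operation[OF mn, of "mat 1 :: real^'n^'n" 1] by simp
  ultimately show "?P ?h" by simp
qed

section \<open>Spherically symmetric distributions\<close>

text \<open>
  Rotation invariance determines the polynomial moments up to constants.  The law must not charge the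
  origin, where the scores are not differentiable.
\<close>

locale spherical_law = prob_space Z for Z :: "(real^'k) measure" +
  assumes sets_Z [simp, measurable_cong]: "sets Z = sets borel"
    and invariant: "\<And>U. orthogonal_transformation U \<Longrightarrow> distr Z borel U = Z"
    and no_atom: "emeasure Z {0} = 0"
begin

lemma space_Z [simp]: "space Z = UNIV"
  using sets_eq_imp_space_eq[OF sets_Z] by simp

lemma AE_nonzero: "AE z in Z. z \<noteq> 0"
  by (rule AE_I[of _ _ "{0}"]) (auto simp: no_atom)

lemma integral_invariant:
  fixes F :: "real^'k \<Rightarrow> real"
  assumes U: "orthogonal_transformation U" and F: "F \<in> borel_measurable borel"
  shows "(\<integral>z. F (U z) \<partial>Z) = (\<integral>z. F z \<partial>Z)"
proof -
  have "U \<in> borel_measurable borel"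
    using U by (intro borel_measurable_continuous_onI linear_continuous_on)
      (simp add: orthogonal_transformation_linear linear_conv_bounded_linear[symmetric])
  then have "(\<integral>z. F z \<partial>distr Z borel U) = (\<integral>z. F (U z) \<partial>Z)"
    using F by (subst integral_distr) auto
  then show ?thesis by (simp add: invariant[OF U])
qed

text \<open>
  A homogeneous moment depends on its direction only through the norm, as some orthogonal
  transformation carries any direction into any other.
\<close>

lemma power_moment_norm:
  fixes g :: "real \<Rightarrow> real"
  assumes [measurable]: "g \<in> borel_measurable borel"
  shows "\<exists>a. \<forall>x. (\<integral>z. g (norm z) * (z \<bullet> x) ^ p \<partial>Z) = a * norm x ^ p"
proof -
  define e :: "real^'k" where "e = axis undefined 1"
  have e: "norm e = 1" by (simp add: e_def norm_axis_1)
  define Q where "Q x = (\<integral>z. g (norm z) * (z \<bullet> x) ^ p \<partial>Z)" for x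
  have "Q x = Q e * norm x ^ p" for x
  proof -
    obtain U where U: "orthogonal_transformation U" "U (norm x *\<^sub>R e) = x"
      by (rule orthogonal_transformation_exists[of "norm x *\<^sub>R e" x]) (auto simp: e)
    have "Q x = (\<integral>z. g (norm (U z)) * (U z \<bullet> U (norm x *\<^sub>R e)) ^ p \<partial>Z)"
      unfolding Q_def U(2) using integral_invariant[OF U(1), of "\<lambda>z. g (norm z) * (z \<bullet> x) ^ p"] by simp
    also have "\<dots> = (\<integral>z. (g (norm z) * (z \<bullet> e) ^ p) * norm x ^ p \<partial>Z)"
      using U(1) by (simp add: orthogonal_transformation_norm orthogonal_transformation_def power_mult_distrib mult_ac)
    finally show ?thesis by (simp add: Q_def)
  qed
  then show ?thesis unfolding Q_def by blast
qed

lemma abs_inner_le: "\<bar>z \<bullet> x\<bar> \<le> norm z * norm x" for z x :: "real^'k"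
  by (rule Cauchy_Schwarz_ineq2)

lemma integrable_two:
  assumes [measurable]: "g \<in> borel_measurable borel" and i: "integrable Z (\<lambda>z. g (norm z) * norm z ^ 2)"
  shows "integrable Z (\<lambda>z. g (norm z) * ((z \<bullet> x) * (z \<bullet> y)))"
proof (rule Bochner_Integration.integrable_bound)
  show "integrable Z (\<lambda>z. (norm x * norm y) * (g (norm z) * norm z ^ 2))" using i by simp
  have "\<bar>z \<bullet> x\<bar> * \<bar>z \<bullet> y\<bar> \<le> (norm z * norm x) * (norm z * norm y)" for z :: "real^'k"
    by (intro mult_mono abs_inner_le) auto
  from mult_left_mono[OF this, of "\<bar>g (norm z)\<bar>" for z]
  show "AE z in Z. norm (g (norm z) * ((z \<bullet> x) * (z \<bullet> y))) \<le> norm ((norm x * norm y) * (g (norm z) * norm z ^ 2))"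
    by (intro AE_I2) (simp add: abs_mult power2_eq_square mult_ac)
qed measurable

lemma integrable_four:
  assumes [measurable]: "g \<in> borel_measurable borel" and i: "integrable Z (\<lambda>z. g (norm z) * norm z ^ 4)"
  shows "integrable Z (\<lambda>z. g (norm z) * ((z \<bullet> x1) * (z \<bullet> x2) * (z \<bullet> x3) * (z \<bullet> x4)))"
proof (rule Bochner_Integration.integrable_bound)
  show "integrable Z (\<lambda>z. (norm x1 * norm x2 * norm x3 * norm x4) * (g (norm z) * norm z ^ 4))" using i by simp
  have "\<bar>z \<bullet> x1\<bar> * \<bar>z \<bullet> x2\<bar> * \<bar>z \<bullet> x3\<bar> * \<bar>z \<bullet> x4\<bar> \<le> (norm z * norm x1) * (norm z * norm x2) * (norm z * norm x3) * (norm z * norm x4)" for z :: "real^'k"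
    by (intro mult_mono abs_inner_le) auto
  from mult_left_mono[OF this, of "\<bar>g (norm z)\<bar>" for z]
  show "AE z in Z. norm (g (norm z) * ((z \<bullet> x1) * (z \<bullet> x2) * (z \<bullet> x3) * (z \<bullet> x4))) \<le> norm ((norm x1 * norm x2 * norm x3 * norm x4) * (g (norm z) * norm z ^ 4))"
    by (intro AE_I2) (simp add: abs_mult power4_eq_xxxx mult_ac)
qed measurable

lemma norm_power2_coordinates: "norm z ^ 2 = (\<Sum>i\<in>UNIV. (z \<bullet> axis i 1) * (z \<bullet> axis i 1))" for z :: "real^'k"
  by (simp add: power2_norm_eq_inner inner_axis) (simp add: inner_vec_def)

text \<open>Polarization of the quadratic case; summation over the coordinates identifies the constant.\<close>

lemma second_moment:
  assumes [measurable]: "g \<in> borel_measurable borel" and i: "integrable Z (\<lambda>z. g (norm z) * norm z ^ 2)"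
  shows "(\<integral>z. g (norm z) * ((z \<bullet> x) * (z \<bullet> y)) \<partial>Z) = (\<integral>z. g (norm z) * norm z ^ 2 \<partial>Z) / real CARD('k) * (x \<bullet> y)"
proof -
  obtain a where a: "\<And>x. (\<integral>z. g (norm z) * (z \<bullet> x) ^ 2 \<partial>Z) = a * norm x ^ 2"
    using power_moment_norm[of g 2] by auto
  have pol: "(\<integral>z. g (norm z) * ((z \<bullet> x) * (z \<bullet> y)) \<partial>Z) = a * (x \<bullet> y)" for x y :: "real^'k"
  proof -
    have i2: "integrable Z (\<lambda>z. g (norm z) * (z \<bullet> v)\<^sup>2)" for v
      using integrable_two[OF assms, of v v] by (simp add: power2_eq_square)
    have eq: "(\<lambda>z. g (norm z) * ((z \<bullet> x) * (z \<bullet> y))) = (\<lambda>z. (g (norm z) * (z \<bullet> (x + y))\<^sup>2 - g (norm z) * (z \<bullet> (x - y))\<^sup>2) / 4)"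
      by (auto simp: fun_eq_iff inner_add_right inner_diff_right power2_eq_square algebra_simps)
    have "(\<integral>z. g (norm z) * ((z \<bullet> x) * (z \<bullet> y)) \<partial>Z) = (a * norm (x + y) ^ 2 - a * norm (x - y) ^ 2) / 4"
      unfolding eq using i2 by (simp add: a)
    then show ?thesis
      by (simp add: power2_norm_eq_inner inner_add_left inner_add_right inner_diff_left inner_diff_right inner_commute algebra_simps)
  qed
  have "(\<integral>z. g (norm z) * norm z ^ 2 \<partial>Z) = (\<Sum>i\<in>UNIV. \<integral>z. g (norm z) * ((z \<bullet> axis i 1) * (z \<bullet> axis i 1)) \<partial>Z)"
    unfolding norm_power2_coordinates sum_distrib_left
    by (intro Bochner_Integration.integral_sum integrable_two assms)
  also have "\<dots> = real CARD('k) * a" by (simp only: pol) (simp add: inner_axis_axis)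
  finally show ?thesis by (simp add: pol)
qed

lemma quadratic_moment:
  fixes A :: "real^'k^'k"
  assumes [measurable]: "g \<in> borel_measurable borel" and i: "integrable Z (\<lambda>z. g (norm z) * norm z ^ 2)"
  shows "(\<integral>z. g (norm z) * (z \<bullet> (A *v z)) \<partial>Z) = (\<integral>z. g (norm z) * norm z ^ 2 \<partial>Z) / real CARD('k) * trace A"
proof -
  have eq: "z \<bullet> (A *v z) = (\<Sum>i\<in>UNIV. (z \<bullet> axis i 1) * (z \<bullet> A $ i))" for z
    by (simp add: inner_axis) (simp add: inner_vec_def matrix_vector_mult_def mult.commute)
  have "(\<integral>z. g (norm z) * (z \<bullet> (A *v z)) \<partial>Z) = (\<Sum>i\<in>UNIV. \<integral>z. g (norm z) * ((z \<bullet> axis i 1) * (z \<bullet> A $ i)) \<partial>Z)"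
    unfolding eq sum_distrib_left by (intro Bochner_Integration.integral_sum integrable_two assms)
  also have "\<dots> = (\<integral>z. g (norm z) * norm z ^ 2 \<partial>Z) / real CARD('k) * (\<Sum>i\<in>UNIV. axis i 1 \<bullet> A $ i)"
    by (simp only: second_moment[OF assms] sum_distrib_left)
  also have "(\<Sum>i\<in>UNIV. axis i 1 \<bullet> A $ i) = trace A" by (simp add: trace_def inner_axis')
  finally show ?thesis .
qed

lemma polarization_four:
  fixes a b c d :: real
  shows "192 * (a * b * c * d) = (a+b+c+d)^4 - (a+b+c-d)^4 - (a+b-c+d)^4 + (a+b-c-d)^4
     - (a-b+c+d)^4 + (a-b+c-d)^4 + (a-b-c+d)^4 - (a-b-c-d)^4"
proof -
  have odd: "(x + d)^4 - (x - d)^4 = 8 * d * x^3 + 8 * d^3 * x" for x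
    by (simp add: power4_eq_xxxx power3_eq_cube algebra_simps)
  have cube: "(a+b+c)^3 - (a+b-c)^3 - (a-b+c)^3 + (a-b-c)^3 = 24 * (a * b * c)"
    by (simp add: power3_eq_cube algebra_simps)
  have "192 * (a * b * c * d) = 8 * d * (24 * (a * b * c))" by simp
  also have "\<dots> = (8 * d * (a+b+c)^3 + 8 * d^3 * (a+b+c)) - (8 * d * (a+b-c)^3 + 8 * d^3 * (a+b-c))
     - (8 * d * (a-b+c)^3 + 8 * d^3 * (a-b+c)) + (8 * d * (a-b-c)^3 + 8 * d^3 * (a-b-c))"
    unfolding cube[symmetric] by (simp only: right_diff_distrib distrib_left)
  finally show ?thesis unfolding odd[symmetric] by simp
qed

text \<open>
  The fourth moment in a single direction is a multiple of \<open>norm x ^ 4\<close>.  A product of four linear forms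
  is a combination of fourth powers, and the same combination of the values \<open>norm x ^ 4\<close> is the sum over the three pairings.
\<close>

lemma fourth_moment_four:
  assumes [measurable]: "g \<in> borel_measurable borel" and i: "integrable Z (\<lambda>z. g (norm z) * norm z ^ 4)"
  shows "\<exists>a. \<forall>x1 x2 x3 x4. (\<integral>z. g (norm z) * ((z \<bullet> x1) * (z \<bullet> x2) * (z \<bullet> x3) * (z \<bullet> x4)) \<partial>Z)
     = a * ((x1 \<bullet> x2) * (x3 \<bullet> x4) + (x1 \<bullet> x3) * (x2 \<bullet> x4) + (x1 \<bullet> x4) * (x2 \<bullet> x3))"
proof -
  obtain a where a: "\<And>x. (\<integral>z. g (norm z) * (z \<bullet> x) ^ 4 \<partial>Z) = a * norm x ^ 4"
    using power_moment_norm[of g 4] by auto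
  have i4: "integrable Z (\<lambda>z. g (norm z) * (z \<bullet> v) ^ 4)" for v
    using integrable_four[OF assms, of v v v v] by (simp add: power4_eq_xxxx mult_ac)
  have n4: "norm (w + d) ^ 4 - norm (w - d) ^ 4 = 8 * (w \<bullet> w + d \<bullet> d) * (w \<bullet> d)" for w d :: "real^'k"
  proof -
    have "norm (w + d) ^ 4 - norm (w - d) ^ 4 = ((norm (w + d))\<^sup>2)\<^sup>2 - ((norm (w - d))\<^sup>2)\<^sup>2"
      by (simp add: power_mult[symmetric])
    also have "\<dots> = (w \<bullet> w + d \<bullet> d + 2 * (w \<bullet> d))\<^sup>2 - (w \<bullet> w + d \<bullet> d - 2 * (w \<bullet> d))\<^sup>2"
      by (simp add: power2_norm_eq_inner inner_add_left inner_add_right inner_diff_left inner_diff_right inner_commute algebra_simps)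
    also have "\<dots> = 8 * (w \<bullet> w + d \<bullet> d) * (w \<bullet> d)" by (simp add: power2_eq_square algebra_simps)
    finally show ?thesis .
  qed
  have "(\<integral>z. g (norm z) * ((z \<bullet> x1) * (z \<bullet> x2) * (z \<bullet> x3) * (z \<bullet> x4)) \<partial>Z)
     = a / 3 * ((x1 \<bullet> x2) * (x3 \<bullet> x4) + (x1 \<bullet> x3) * (x2 \<bullet> x4) + (x1 \<bullet> x4) * (x2 \<bullet> x3))" for x1 x2 x3 x4
  proof -
    let ?G = "\<lambda>v z. g (norm z) * (z \<bullet> v) ^ 4"
    have "g (norm z) * ((z \<bullet> x1) * (z \<bullet> x2) * (z \<bullet> x3) * (z \<bullet> x4)) =
       (?G (x1+x2+x3+x4) z - ?G (x1+x2+x3-x4) z - ?G (x1+x2-x3+x4) z + ?G (x1+x2-x3-x4) z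
       - ?G (x1-x2+x3+x4) z + ?G (x1-x2+x3-x4) z + ?G (x1-x2-x3+x4) z - ?G (x1-x2-x3-x4) z) / 192" for z
    proof -
      have "g (norm z) * (192 * ((z \<bullet> x1) * (z \<bullet> x2) * (z \<bullet> x3) * (z \<bullet> x4))) =
       ?G (x1+x2+x3+x4) z - ?G (x1+x2+x3-x4) z - ?G (x1+x2-x3+x4) z + ?G (x1+x2-x3-x4) z
       - ?G (x1-x2+x3+x4) z + ?G (x1-x2+x3-x4) z + ?G (x1-x2-x3+x4) z - ?G (x1-x2-x3-x4) z"
        unfolding polarization_four inner_add_right inner_diff_right by (simp only: right_diff_distrib distrib_left)
      then show ?thesis by simp
    qed
    then have eq: "(\<lambda>z. g (norm z) * ((z \<bullet> x1) * (z \<bullet> x2) * (z \<bullet> x3) * (z \<bullet> x4))) = (\<lambda>z.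
       (?G (x1+x2+x3+x4) z - ?G (x1+x2+x3-x4) z - ?G (x1+x2-x3+x4) z + ?G (x1+x2-x3-x4) z
       - ?G (x1-x2+x3+x4) z + ?G (x1-x2+x3-x4) z + ?G (x1-x2-x3+x4) z - ?G (x1-x2-x3-x4) z) / 192)" by blast
    have "(\<integral>z. g (norm z) * ((z \<bullet> x1) * (z \<bullet> x2) * (z \<bullet> x3) * (z \<bullet> x4)) \<partial>Z) =
       (a * norm (x1+x2+x3+x4) ^ 4 - a * norm (x1+x2+x3-x4) ^ 4 - a * norm (x1+x2-x3+x4) ^ 4 + a * norm (x1+x2-x3-x4) ^ 4
       - a * norm (x1-x2+x3+x4) ^ 4 + a * norm (x1-x2+x3-x4) ^ 4 + a * norm (x1-x2-x3+x4) ^ 4 - a * norm (x1-x2-x3-x4) ^ 4) / 192"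
      unfolding eq by (simp add: i4 a)
    also have "\<dots> = a * ((norm (x1+x2+x3+x4) ^ 4 - norm (x1+x2+x3-x4) ^ 4) - (norm (x1+x2-x3+x4) ^ 4 - norm (x1+x2-x3-x4) ^ 4)
       - (norm (x1-x2+x3+x4) ^ 4 - norm (x1-x2+x3-x4) ^ 4) + (norm (x1-x2-x3+x4) ^ 4 - norm (x1-x2-x3-x4) ^ 4)) / 192"
      by (simp add: right_diff_distrib distrib_left)
    also have "\<dots> = a / 3 * ((x1 \<bullet> x2) * (x3 \<bullet> x4) + (x1 \<bullet> x3) * (x2 \<bullet> x4) + (x1 \<bullet> x4) * (x2 \<bullet> x3))"
      unfolding n4 inner_add_left inner_add_right inner_diff_left inner_diff_right
        inner_commute[of x2 x1] inner_commute[of x3 x1] inner_commute[of x4 x1]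
        inner_commute[of x3 x2] inner_commute[of x4 x2] inner_commute[of x4 x3]
      by (simp add: field_simps)
    finally show ?thesis .
  qed
  then show ?thesis by blast
qed

text \<open>Summation of the coordinatewise formula; the choice \<open>A = B = mat 1\<close> identifies the constant.\<close>

lemma fourth_moment:
  fixes A B :: "real^'k^'k"
  assumes [measurable]: "g \<in> borel_measurable borel" and i: "integrable Z (\<lambda>z. g (norm z) * norm z ^ 4)"
    and A: "transpose A = A"
  shows "(\<integral>z. g (norm z) * ((z \<bullet> (A *v z)) * (z \<bullet> (B *v z))) \<partial>Z)
    = (\<integral>z. g (norm z) * norm z ^ 4 \<partial>Z) / (real CARD('k) * (real CARD('k) + 2)) * (trace A * trace B + 2 * trace (A ** B))"
proof -
  obtain a where a: "\<And>x1 x2 x3 x4. (\<integral>z. g (norm z) * ((z \<bullet> x1) * (z \<bullet> x2) * (z \<bullet> x3) * (z \<bullet> x4)) \<partial>Z)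
     = a * ((x1 \<bullet> x2) * (x3 \<bullet> x4) + (x1 \<bullet> x3) * (x2 \<bullet> x4) + (x1 \<bullet> x4) * (x2 \<bullet> x3))"
    using fourth_moment_four[OF assms(1,2)] by blast
  have q: "z \<bullet> (A *v z) = (\<Sum>i\<in>UNIV. (z \<bullet> axis i 1) * (z \<bullet> A $ i))" for z and A :: "real^'k^'k"
    by (simp add: inner_axis) (simp add: inner_vec_def matrix_vector_mult_def mult.commute)
  have mom: "(\<integral>z. g (norm z) * ((z \<bullet> (A *v z)) * (z \<bullet> (B *v z))) \<partial>Z) = a * (trace A * trace B + 2 * trace (A ** B))"
    if A: "transpose A = A" for A B :: "real^'k^'k"
  proof -
    have eq: "(z \<bullet> (A *v z)) * (z \<bullet> (B *v z)) = (\<Sum>i\<in>UNIV. \<Sum>j\<in>UNIV. (z \<bullet> axis i 1) * (z \<bullet> A $ i) * (z \<bullet> axis j 1) * (z \<bullet> B $ j))" for z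
      unfolding q sum_product by (simp only: mult.assoc)
    have "(\<integral>z. g (norm z) * ((z \<bullet> (A *v z)) * (z \<bullet> (B *v z))) \<partial>Z)
      = (\<Sum>i\<in>UNIV. \<Sum>j\<in>UNIV. \<integral>z. g (norm z) * ((z \<bullet> axis i 1) * (z \<bullet> A $ i) * (z \<bullet> axis j 1) * (z \<bullet> B $ j)) \<partial>Z)"
      unfolding eq sum_distrib_left
      by (subst Bochner_Integration.integral_sum, intro Bochner_Integration.integrable_sum integrable_four assms,
          intro sum.cong refl Bochner_Integration.integral_sum integrable_four assms)
    also have "\<dots> = a * (\<Sum>i\<in>UNIV. \<Sum>j\<in>UNIV. A $ i $ i * B $ j $ j + (if j = i then 1 else 0) * (A $ i \<bullet> B $ j) + B $ j $ i * A $ i $ j)"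
      unfolding a sum_distrib_left[symmetric] by (simp add: inner_axis' inner_axis) (simp add: axis_def)
    also have "\<dots> = a * ((\<Sum>i\<in>UNIV. \<Sum>j\<in>UNIV. A $ i $ i * B $ j $ j) + (\<Sum>i\<in>UNIV. A $ i \<bullet> B $ i) + (\<Sum>i\<in>UNIV. \<Sum>j\<in>UNIV. A $ i $ j * B $ j $ i))"
      by (simp add: sum.distrib mult.commute if_distrib[of "\<lambda>c. c * _"] cong: if_cong)
    also have "(\<Sum>i\<in>UNIV. \<Sum>j\<in>UNIV. A $ i $ i * B $ j $ j) = trace A * trace B"
      by (simp add: trace_def sum_product)
    also have "(\<Sum>i\<in>UNIV. A $ i \<bullet> B $ i) = trace (A ** B)"
      unfolding trace_mult_eq_inner A by (simp add: inner_vec_def)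
    also have "(\<Sum>i\<in>UNIV. \<Sum>j\<in>UNIV. A $ i $ j * B $ j $ i) = trace (A ** B)"
      by (simp add: trace_def matrix_matrix_mult_def)
    finally show ?thesis by simp
  qed
  have "(\<integral>z. g (norm z) * norm z ^ 4 \<partial>Z) = (\<integral>z. g (norm z) * ((z \<bullet> (mat 1 *v z)) * (z \<bullet> (mat 1 *v z))) \<partial>Z)"
    by (simp add: power2_norm_eq_inner[symmetric] matrix_vector_mul_lid power_add[symmetric])
  also have "\<dots> = a * (real CARD('k) * (real CARD('k) + 2))"
    by (subst mom) (auto simp: transpose_mat matrix_mul_lid trace_I algebra_simps)
  finally show ?thesis using mom[OF A, of B] by (simp add: add_nonneg_eq_0_iff)
qed

lemma scaled:
  assumes "c > 0"
  shows "spherical_law (distr Z borel (\<lambda>z. c *\<^sub>R z))"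
proof -
  interpret D: prob_space "distr Z borel (\<lambda>z. c *\<^sub>R z)" by (rule prob_space_distr) simp
  show ?thesis
  proof
    fix U :: "real^'k \<Rightarrow> real^'k" assume U: "orthogonal_transformation U"
    then have lin: "linear U" by (simp add: orthogonal_transformation_linear)
    have [measurable]: "U \<in> borel_measurable borel"
      using lin by (intro borel_measurable_continuous_onI linear_continuous_on)
        (simp add: linear_conv_bounded_linear[symmetric])
    have "distr (distr Z borel (\<lambda>z. c *\<^sub>R z)) borel U = distr (distr Z borel U) borel (\<lambda>z. c *\<^sub>R z)"
      by (subst (1 2) distr_distr) (auto simp: o_def linear_scale[OF lin])
    then show "distr (distr Z borel (\<lambda>z. c *\<^sub>R z)) borel U = distr Z borel (\<lambda>z. c *\<^sub>R z)"
      by (simp add: invariant[OF U])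
  next
    have "(\<lambda>z::real^'k. c *\<^sub>R z) -` {0} = {0}" using assms by auto
    then show "emeasure (distr Z borel (\<lambda>z. c *\<^sub>R z)) {0} = 0"
      by (subst emeasure_distr) (auto simp: no_atom)
  qed simp
qed

end

lemma lborel_linear:
  fixes B :: "real^'n^'n"
  assumes B: "invertible B"
  shows "lborel = density (distr lborel borel (\<lambda>z. B *v z)) (\<lambda>_. ennreal \<bar>det B\<bar>)"
proof (rule lborel_eqI)
  have [measurable]: "(\<lambda>z. B *v z) \<in> borel_measurable borel"
    by (intro borel_measurable_continuous_onI matrix_vector_mult_linear_continuous_on)
  fix l u :: "real^'n" assume lu: "\<And>b. b \<in> Basis \<Longrightarrow> l \<bullet> b \<le> u \<bullet> b"
  let ?f = "\<lambda>x. matrix_inv B *v x"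
  have pre: "(\<lambda>z. B *v z) -` box l u = ?f ` box l u"
  proof (intro equalityI subsetI)
    fix z assume "z \<in> (\<lambda>z. B *v z) -` box l u"
    then show "z \<in> ?f ` box l u"
      by (intro image_eqI[of _ _ "B *v z"]) (auto simp: matrix_vector_mul_assoc matrix_inv_left[OF B] matrix_vector_mul_lid)
  next
    fix z assume "z \<in> ?f ` box l u"
    then show "z \<in> (\<lambda>z. B *v z) -` box l u"
      by (auto simp: matrix_vector_mul_assoc matrix_inv_right[OF B] matrix_vector_mul_lid)
  qed
  have lm: "?f ` box l u \<in> lmeasurable"
    using measure_linear_image_cart[of ?f] by auto
  have m: "measure lebesgue (?f ` box l u) = \<bar>1 / det B\<bar> * measure lebesgue (box l u)"
    using measure_linear_image_cart[of ?f] by (auto simp: matrix_of_matrix_vector_mul det_matrix_inv[OF B])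
  have bm: "(\<lambda>z. B *v z) -` box l u \<in> sets borel"
    using measurable_sets[of "\<lambda>z. B *v z" borel borel "box l u"] by simp
  have "emeasure lborel ((\<lambda>z. B *v z) -` box l u) = emeasure lebesgue ((\<lambda>z. B *v z) -` box l u)"
    using bm by simp
  also have "\<dots> = ennreal (\<bar>1 / det B\<bar> * measure lebesgue (box l u))"
    using lm unfolding pre m[symmetric] by (simp add: emeasure_eq_measure2)
  also have "measure lebesgue (box l u) = (\<Prod>b\<in>Basis. (u - l) \<bullet> b)"
    using lu by (simp add: measure_lborel_box_eq content_cbox_if measure_completion)
  finally have e: "emeasure lborel ((\<lambda>z. B *v z) -` box l u) = ennreal (\<bar>1 / det B\<bar> * (\<Prod>b\<in>Basis. (u - l) \<bullet> b))" .
  have d: "det B \<noteq> 0" using B by (simp add: invertible_det_nz)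
  have "0 \<le> (\<Prod>b\<in>(Basis :: (real^'n) set). (u - l) \<bullet> b)" using lu by (intro prod_nonneg) (simp add: inner_diff_left)
  then show "emeasure (density (distr lborel borel (\<lambda>z. B *v z)) (\<lambda>_. ennreal \<bar>det B\<bar>)) (box l u) = ennreal (\<Prod>b\<in>Basis. (u - l) \<bullet> b)"
    using d by (simp add: emeasure_density nn_integral_distr nn_integral_cmult emeasure_distr e ennreal_mult'[symmetric] abs_mult[symmetric])
qed simp

lemma nn_integral_affine:
  fixes B :: "real^'n^'n"
  assumes B: "invertible B" and [measurable]: "F \<in> borel_measurable borel"
  shows "(\<integral>\<^sup>+ y. F y \<partial>lborel) = (\<integral>\<^sup>+ z. ennreal \<bar>det B\<bar> * F (\<mu> + B *v z) \<partial>lborel)"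
proof -
  have [measurable]: "(\<lambda>z. B *v z) \<in> borel_measurable borel"
    by (intro borel_measurable_continuous_onI matrix_vector_mult_linear_continuous_on)
  have "(\<integral>\<^sup>+ y. F y \<partial>lborel) = (\<integral>\<^sup>+ y. F y \<partial>distr lborel borel ((+) \<mu>))" by (simp add: lborel_distr_plus)
  also have "\<dots> = (\<integral>\<^sup>+ y. F (\<mu> + y) \<partial>lborel)" by (simp add: nn_integral_distr)
  also have "\<dots> = (\<integral>\<^sup>+ y. F (\<mu> + y) \<partial>density (distr lborel borel (\<lambda>z. B *v z)) (\<lambda>_. ennreal \<bar>det B\<bar>))"
    by (subst lborel_linear[OF B]) simp
  also have "\<dots> = (\<integral>\<^sup>+ z. ennreal \<bar>det B\<bar> * F (\<mu> + B *v z) \<partial>lborel)"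
    by (simp add: nn_integral_density nn_integral_distr)
  finally show ?thesis .
qed

lemma ec_density_standard: "ec_density m 0 (mat 1) z = m (z \<bullet> z)"
proof -
  have "matrix_inv (mat 1 :: real^'a^'a) = mat 1" by (rule matrix_inv_eqI) (simp add: matrix_mul_lid)
  then show ?thesis by (simp add: ec_density_def matrix_vector_mul_lid)
qed

lemma ec_density_affine:
  fixes B :: "real^'n^'n"
  assumes B: "invertible B"
  shows "ec_density m \<mu> (B ** transpose B) (\<mu> + B *v z) = m (z \<bullet> z) / \<bar>det B\<bar>"
proof -
  have "(B *v z) \<bullet> (matrix_inv (B ** transpose B) *v (B *v z)) = z \<bullet> (transpose B *v (matrix_inv (B ** transpose B) *v (B *v z)))"
    by (simp only: inner_matrix_transpose[of z "transpose B"] transpose_transpose)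
  also have "\<dots> = z \<bullet> ((transpose B ** (matrix_inv (transpose B) ** matrix_inv B) ** B) *v z)"
    by (simp only: matrix_inv_mult[OF B invertible_transpose[OF B]] matrix_vector_mul_assoc matrix_mul_assoc)
  also have "transpose B ** (matrix_inv (transpose B) ** matrix_inv B) ** B = (transpose B ** matrix_inv (transpose B)) ** (matrix_inv B ** B)"
    by (simp only: matrix_mul_assoc)
  also have "\<dots> = mat 1" by (simp add: matrix_inv_left matrix_inv_right B invertible_transpose matrix_mul_lid)
  finally have 1: "(B *v z) \<bullet> (matrix_inv (B ** transpose B) *v (B *v z)) = z \<bullet> z" by (simp add: matrix_vector_mul_lid)
  have d: "det B \<noteq> 0" using B by (simp add: invertible_det_nz)
  have "det (B ** transpose B) powr (- 1 / 2) = (\<bar>det B\<bar> powr 2) powr (- 1 / 2)"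
    using d by (simp add: det_mul power2_eq_square[symmetric])
  also have "\<dots> = 1 / \<bar>det B\<bar>" using d by (simp only: powr_powr) (simp add: powr_minus_divide)
  finally show ?thesis by (simp add: ec_density_def 1)
qed

lemma profile_measurable:
  assumes "m \<in> borel_measurable (restrict_space borel {0..})"
  shows "(\<lambda>z::real^'n. m (z \<bullet> z)) \<in> borel_measurable borel"
  by (rule measurable_compose[OF _ assms]) (rule measurable_restrict_space2, auto)

text \<open>An orthogonal map preserves both Lebesgue measure and the density.\<close>

lemma spherical_law_ec:
  assumes m: "m \<in> borel_measurable (restrict_space borel {0..})"
    and tot: "(\<integral>\<^sup>+ z. ennreal (m (z \<bullet> z)) \<partial>(lborel :: (real^'k) measure)) = 1"
  shows "spherical_law (density lborel (\<lambda>z::real^'k. ennreal (ec_density m 0 (mat 1) z)))"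
    (is "spherical_law ?Z")
proof -
  note [measurable] = profile_measurable[OF m]
  interpret prob_space ?Z
    by standard (simp add: emeasure_density ec_density_standard tot)
  show ?thesis
  proof
    fix U :: "real^'k \<Rightarrow> real^'k" assume U: "orthogonal_transformation U"
    let ?B = "matrix U"
    have UB: "U = (\<lambda>z. ?B *v z)"
      using matrix_works[OF linear_matrix_vector_mul_eq[THEN iffD2, OF orthogonal_transformation_linear[OF U]]] by (simp add: fun_eq_iff)
    have om: "orthogonal_matrix ?B" using U by (simp add: orthogonal_transformation_matrix)
    then have inv: "invertible ?B" by (auto simp: orthogonal_matrix_def invertible_def)
    have d: "\<bar>det ?B\<bar> = 1" using det_orthogonal_matrix[OF om] by auto
    have [measurable]: "U \<in> borel_measurable borel"
      by (subst UB, intro borel_measurable_continuous_onI matrix_vector_mult_linear_continuous_on)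
    show "distr ?Z borel U = ?Z"
    proof (rule measure_eqI)
      fix A assume "A \<in> sets (distr ?Z borel U)"
      then have [measurable]: "A \<in> sets borel" by simp
      have "emeasure ?Z A = (\<integral>\<^sup>+ z. ennreal (m (z \<bullet> z)) * indicator A z \<partial>lborel)"
        by (simp add: emeasure_density ec_density_standard)
      also have "\<dots> = (\<integral>\<^sup>+ z. ennreal (m (U z \<bullet> U z)) * indicator A (U z) \<partial>lborel)"
        by (subst nn_integral_affine[OF inv, of _ 0]) (simp_all add: d UB[symmetric, THEN fun_cong])
      also have "\<dots> = (\<integral>\<^sup>+ z. ennreal (m (z \<bullet> z)) * indicator (U -` A) z \<partial>lborel)"
        using U by (simp add: orthogonal_transformation_def indicator_def)
      also have "\<dots> = emeasure (distr ?Z borel U) A"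
        using measurable_sets[of U borel borel A] by (simp add: emeasure_distr emeasure_density ec_density_standard)
      finally show "emeasure (distr ?Z borel U) A = emeasure ?Z A" by simp
    qed simp
  next
    have "AE z in lborel. z \<noteq> (0::real^'k)" by (rule AE_lborel_singleton)
    then have "AE z in lborel. ennreal (m (z \<bullet> z)) * indicator {0::real^'k} z = 0"
      by eventually_elim simp
    then show "emeasure ?Z {0} = 0"
      by (subst emeasure_density) (simp_all add: ec_density_standard nn_integral_0_iff_AE)
  qed simp
qed

text \<open>
  Standardizing the response turns the elliptical model into independence of a spherical error and
  the design.
\<close>

lemma conditional_density_standardized:
  fixes P :: "((real^'k) \<times> (real^'q^'k)) measure" and B :: "real^'k^'k"
  assumes P: "prob_space P" "sets P = sets borel"
    and m: "m \<in> borel_measurable (restrict_space borel {0..})" and m0: "\<And>t. 0 \<le> t \<Longrightarrow> 0 \<le> m t"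
    and cd: "conditional_density P (\<lambda>X. ec_density m (X *v \<beta>) (B ** transpose B))"
    and B: "invertible B"
  defines "Z \<equiv> density lborel (\<lambda>z::real^'k. ennreal (ec_density m 0 (mat 1) z))"
  shows "spherical_law Z"
    and "P = distr (Z \<Otimes>\<^sub>M distr P borel snd) borel (\<lambda>(z, X). (X *v \<beta> + B *v z, X))"
proof -
  note [measurable] = profile_measurable[OF m]
  have [measurable_cong]: "sets P = sets borel" by fact
  interpret P: prob_space P by fact
  have spP: "space P = UNIV" using sets_eq_imp_space_eq[OF P(2)] by simp
  have d: "\<bar>det B\<bar> > 0" using B by (simp add: invertible_det_nz)
  have ecm: "ec_density m \<mu> (B ** transpose B) \<in> borel_measurable borel" for \<mu> :: "real^'k"
  proof -
    have c: "(\<lambda>y. y \<bullet> (C *v y)) \<in> borel_measurable borel" for C :: "real^'k^'k"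
      by (intro borel_measurable_continuous_onI continuous_intros matrix_vector_mult_linear_continuous_on)
    have nn: "0 \<le> y \<bullet> (matrix_inv (B ** transpose B) *v y)" for y
      using PDS_pos[OF PDS_matrix_inv[OF PDS_mult_transpose[OF B]], of y] by (cases "y = 0") auto
    have c': "(\<lambda>y. (y - \<mu>) \<bullet> (matrix_inv (B ** transpose B) *v (y - \<mu>))) \<in> borel_measurable borel"
      by (rule measurable_compose[OF _ c]) simp
    have "(\<lambda>y. m ((y - \<mu>) \<bullet> (matrix_inv (B ** transpose B) *v (y - \<mu>)))) \<in> borel_measurable borel"
      by (rule measurable_compose[OF _ m]) (rule measurable_restrict_space2, auto simp: nn c')
    then show ?thesis unfolding ec_density_def[abs_def] by simp
  qed
  have cov: "(\<integral>\<^sup>+ y. F y * ennreal (ec_density m \<mu> (B ** transpose B) y) \<partial>lborel) = (\<integral>\<^sup>+ z. F (\<mu> + B *v z) * ennreal (m (z \<bullet> z)) \<partial>lborel)"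
    if [measurable]: "F \<in> borel_measurable borel" for F :: "real^'k \<Rightarrow> ennreal" and \<mu>
  proof -
    note ecm[measurable]
    have *: "ennreal \<bar>det B\<bar> * (F (\<mu> + B *v z) * ennreal (m (z \<bullet> z) / \<bar>det B\<bar>)) = F (\<mu> + B *v z) * ennreal (m (z \<bullet> z))" for z
    proof -
      have "ennreal \<bar>det B\<bar> * ennreal (m (z \<bullet> z) / \<bar>det B\<bar>) = ennreal (m (z \<bullet> z))"
        using d by (simp add: ennreal_mult'[symmetric])
      then show ?thesis by (metis mult.left_commute)
    qed
    show ?thesis
      by (subst nn_integral_affine[OF B, of _ \<mu>]) (simp_all add: ec_density_affine[OF B] *)
  qed
  have tot: "(\<integral>\<^sup>+ z. ennreal (m (z \<bullet> z)) \<partial>(lborel :: (real^'k) measure)) = 1"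
    using cov[of "\<lambda>_. 1" "undefined *v \<beta>"] cd by (simp add: conditional_density_def)
  show Z: "spherical_law Z" unfolding Z_def by (rule spherical_law_ec[OF m tot])
  then interpret Z: spherical_law Z .
  let ?Q = "distr P borel (snd :: _ \<Rightarrow> real^'q^'k)"
  have "snd \<in> measurable P borel"
    unfolding measurable_cong_sets[OF P(2) refl] by (intro borel_measurable_continuous_onI continuous_intros)
  then interpret Q: prob_space ?Q by (rule P.prob_space_distr)
  interpret ZQ: pair_prob_space Z ?Q ..
  let ?k = "\<lambda>(z :: real^'k, X :: real^'q^'k). (X *v \<beta> + B *v z, X)"
  have Xb: "continuous_on UNIV (\<lambda>p::(real^'k) \<times> (real^'q^'k). snd p *v \<beta>)"
    unfolding matrix_vector_mult_def by (intro continuous_intros)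
  have Bz: "continuous_on UNIV (\<lambda>p::(real^'k) \<times> (real^'q^'k). B *v fst p)"
    by (intro continuous_on_compose2[OF matrix_vector_mult_linear_continuous_on[of UNIV B]] continuous_intros) auto
  have kb: "?k \<in> borel_measurable borel"
    unfolding split_beta' by (intro borel_measurable_continuous_onI continuous_intros Xb Bz)
  have seq: "sets (Z \<Otimes>\<^sub>M ?Q) = sets borel"
    using sets_pair_measure_cong[OF Z.sets_Z sets_distr[of P borel snd]] by (simp only: borel_prod)
  have k: "?k \<in> measurable (Z \<Otimes>\<^sub>M ?Q) borel"
    unfolding measurable_cong_sets[OF seq refl] by (rule kb)
  have fibre: "(\<lambda>z. X *v \<beta> + B *v z) \<in> borel_measurable borel" for X :: "real^'q^'k"
    by (intro borel_measurable_continuous_onI continuous_intros matrix_vector_mult_linear_continuous_on)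
  show "P = distr (Z \<Otimes>\<^sub>M ?Q) borel ?k"
  proof (rule measure_eqI_generator_eq[where E="{A \<times> C |A C. A \<in> sets (borel :: (real^'k) measure) \<and> C \<in> sets (borel :: (real^'q^'k) measure)}" and \<Omega>=UNIV and A="\<lambda>_. UNIV"])
    show "Int_stable {A \<times> C |A C. A \<in> sets (borel :: (real^'k) measure) \<and> C \<in> sets (borel :: (real^'q^'k) measure)}"
      by (auto simp: Int_stable_def) (metis Times_Int_Times sets.Int)
    have gen: "sets (borel :: ((real^'k) \<times> (real^'q^'k)) measure) = sigma_sets UNIV {A \<times> C |A C. A \<in> sets borel \<and> C \<in> sets borel}"
      unfolding borel_prod[symmetric] by (simp add: sets_pair_measure)
    show "sets P = sigma_sets UNIV {A \<times> C |A C. A \<in> sets borel \<and> C \<in> sets borel}"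
      and "sets (distr (Z \<Otimes>\<^sub>M ?Q) borel ?k) = sigma_sets UNIV {A \<times> C |A C. A \<in> sets borel \<and> C \<in> sets borel}"
      using gen P(2) by auto
    show "range (\<lambda>_::nat. UNIV) \<subseteq> {A \<times> C |A C. A \<in> sets (borel :: (real^'k) measure) \<and> C \<in> sets (borel :: (real^'q^'k) measure)}"
      by (auto intro!: exI[of _ UNIV])
    fix S assume "S \<in> {A \<times> C |A C. A \<in> sets (borel :: (real^'k) measure) \<and> C \<in> sets (borel :: (real^'q^'k) measure)}"
    then obtain A C where S: "S = A \<times> C" and [measurable]: "A \<in> sets borel" "C \<in> sets borel" by auto
    have "emeasure (distr (Z \<Otimes>\<^sub>M ?Q) borel ?k) S = emeasure (Z \<Otimes>\<^sub>M ?Q) (?k -` S)"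
      using k S by (subst emeasure_distr) (auto simp: space_pair_measure borel_prod[symmetric])
    also have "\<dots> = (\<integral>\<^sup>+ X. emeasure Z ((\<lambda>z. (z, X)) -` (?k -` S)) \<partial>?Q)"
      using measurable_sets[OF k, of S] S
      by (intro ZQ.emeasure_pair_measure_alt2) (auto simp: space_pair_measure borel_prod[symmetric])
    also have "\<dots> = (\<integral>\<^sup>+ X. (\<integral>\<^sup>+ y. ennreal (ec_density m (X *v \<beta>) (B ** transpose B) y) * indicator A y \<partial>lborel) * indicator C X \<partial>?Q)"
    proof (intro nn_integral_cong)
      fix X :: "real^'q^'k"
      have pre: "(\<lambda>z. (z, X)) -` (?k -` S) = (if X \<in> C then (\<lambda>z. X *v \<beta> + B *v z) -` A else {})" by (auto simp: S)
      have [measurable]: "(\<lambda>z. X *v \<beta> + B *v z) -` A \<in> sets borel"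
        using measurable_sets[OF fibre[of X], of A] by simp
      have "emeasure Z ((\<lambda>z. X *v \<beta> + B *v z) -` A) = (\<integral>\<^sup>+ z. indicator A (X *v \<beta> + B *v z) * ennreal (m (z \<bullet> z)) \<partial>lborel)"
        unfolding Z_def by (simp add: emeasure_density ec_density_standard indicator_def mult.commute)
      also have "\<dots> = (\<integral>\<^sup>+ y. indicator A y * ennreal (ec_density m (X *v \<beta>) (B ** transpose B) y) \<partial>lborel)"
        by (subst cov) auto
      finally show "emeasure Z ((\<lambda>z. (z, X)) -` (?k -` S)) = (\<integral>\<^sup>+ y. ennreal (ec_density m (X *v \<beta>) (B ** transpose B) y) * indicator A y \<partial>lborel) * indicator C X"
        unfolding pre by (simp add: mult.commute)
    qed
    also have "\<dots> = emeasure P S" using cd unfolding conditional_density_def S by simp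
    finally show "emeasure P S = emeasure (distr (Z \<Otimes>\<^sub>M ?Q) borel ?k) S" by simp
  qed (auto simp: P.emeasure_eq_measure)
qed

section \<open>Stochastic expansion of averages at a random parameter\<close>

lemma linear_le_of_lipschitz:
  fixes f :: "'p::euclidean_space \<Rightarrow> real"
  assumes d: "(f has_derivative D) (at 0)"
    and \<delta>: "\<delta> > 0" and lip: "\<And>t. norm t \<le> \<delta> \<Longrightarrow> \<bar>f t - f 0\<bar> \<le> K * norm t"
  shows "\<bar>D t\<bar> \<le> K * norm t"
proof (cases "t = 0")
  case True
  then show ?thesis using linear_0[OF has_derivative_linear[OF d]] by simp
next
  case False
  interpret linear D by (rule has_derivative_linear[OF d])
  have nt: "norm t > 0" using False by simp
  show ?thesis
  proof (rule field_le_epsilon)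
    fix e :: real assume e: "e > 0"
    define e' where "e' = e / norm t"
    have e': "e' > 0" using e nt by (simp add: e'_def)
    obtain d' where d': "d' > 0" "\<And>y. norm y < d' \<Longrightarrow> \<bar>f y - f 0 - D y\<bar> \<le> e' * norm y"
      using d e' unfolding has_derivative_at_alt by (auto simp: norm_minus_commute)
    define s where "s = min \<delta> (d' / 2) / norm t"
    have s: "s > 0" using \<delta> d'(1) nt by (simp add: s_def)
    have ns: "norm (s *\<^sub>R t) = min \<delta> (d' / 2)" using s nt \<delta> d'(1) by (simp add: s_def)
    have "\<bar>f (s *\<^sub>R t) - f 0 - D (s *\<^sub>R t)\<bar> \<le> e' * norm (s *\<^sub>R t)" using ns d' by (intro d'(2)) auto
    moreover have "\<bar>f (s *\<^sub>R t) - f 0\<bar> \<le> K * norm (s *\<^sub>R t)" using ns by (intro lip) auto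
    ultimately have "\<bar>D (s *\<^sub>R t)\<bar> \<le> (K + e') * norm (s *\<^sub>R t)" unfolding distrib_right by linarith
    then have "s * \<bar>D t\<bar> \<le> s * ((K + e') * norm t)" using s by (simp add: scale abs_mult mult_ac)
    then have "\<bar>D t\<bar> \<le> (K + e') * norm t" using s by simp
    also have "\<dots> = K * norm t + e" using nt by (simp add: e'_def distrib_right)
    finally show "\<bar>D t\<bar> \<le> K * norm t + e" .
  qed
qed

context iid_sample begin

text \<open>
  The remainder of the first-order expansion of \<open>f x\<close> at \<open>0\<close>, relative to \<open>norm t\<close> and maximized
  over a small ball, is dominated by the Lipschitz constant and vanishes with the radius wherever
  \<open>f x\<close> is differentiable; so its expectation is small.  By continuity the maximum may be taken over
  a countable set, which keeps it measurable.
\<close>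

lemma small_remainder_bound:
  fixes f D :: "'a \<Rightarrow> 'p::euclidean_space \<Rightarrow> real"
  assumes f [measurable]: "\<And>t. (\<lambda>x. f x t) \<in> borel_measurable borel"
    and cont: "\<And>x. continuous_on UNIV (f x)"
    and \<delta>: "\<delta> > 0" and lip: "\<And>x t. norm t \<le> \<delta> \<Longrightarrow> \<bar>f x t - f x 0\<bar> \<le> K x * norm t"
    and K [measurable]: "K \<in> borel_measurable borel" "integrable P K"
    and D [measurable]: "\<And>t. (\<lambda>x. D x t) \<in> borel_measurable borel" and linD: "\<And>x. linear (D x)"
    and diff: "AE x in P. (f x has_derivative D x) (at 0)"
    and e: "e > 0"
  shows "\<exists>r>0. \<exists>h. h \<in> borel_measurable borel \<and> integrable P h \<and> (\<integral>x. h x \<partial>P) < e \<and>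
     (AE x in P. \<forall>t. norm t < r \<longrightarrow> \<bar>f x t - f x 0 - D x t\<bar> \<le> h x * norm t)"
proof -
  define rem where "rem x t = f x t - f x 0 - D x t" for x t
  have [measurable]: "(\<lambda>x. rem x t) \<in> borel_measurable borel" for t unfolding rem_def by measurable
  obtain C :: "'p set" where C: "countable C" "\<And>X. open X \<Longrightarrow> X \<noteq> {} \<Longrightarrow> \<exists>c\<in>C. c \<in> X"
    by (rule countable_dense_setE) blast
  define S where "S r = {t\<in>C. 0 < norm t \<and> norm t < r}" for r :: real
  have Sc: "countable (S r)" for r unfolding S_def using C(1) by (rule countable_subset[rotated]) auto
  define H where "H r x = (SUP t\<in>S r. ennreal (\<bar>rem x t\<bar> / norm t))" for r x
  have H_measurable [measurable]: "H r \<in> borel_measurable borel" for r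
    unfolding H_def by (intro borel_measurable_SUP Sc) measurable
  have K0: "AE x in P. \<forall>t. \<bar>D x t\<bar> \<le> K x * norm t"
    using diff by eventually_elim (use linear_le_of_lipschitz[OF _ \<delta> lip] in blast)
  have Kpos: "K x \<ge> 0" for x
  proof -
    have "\<delta> *\<^sub>R (SOME b. b \<in> Basis) \<noteq> (0::'p)" using \<delta> nonzero_Basis[OF SOME_Basis] by simp
    moreover have "norm (\<delta> *\<^sub>R (SOME b. b \<in> Basis) :: 'p) \<le> \<delta>" using \<delta> SOME_Basis by simp
    from lip[OF this, of x] have "0 \<le> K x * norm (\<delta> *\<^sub>R (SOME b. b \<in> Basis) :: 'p)" by linarith
    ultimately show ?thesis by (simp add: zero_le_mult_iff)
  qed
  have HK: "AE x in P. \<forall>r\<le>\<delta>. H r x \<le> ennreal (2 * K x)"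
    using K0
  proof eventually_elim
    case (elim x)
    show ?case unfolding H_def
    proof (intro allI impI SUP_least ennreal_leI)
      fix r t assume "r \<le> \<delta>" "t \<in> S r"
      then have t: "norm t > 0" "norm t \<le> \<delta>" by (auto simp: S_def)
      have "\<bar>rem x t\<bar> \<le> 2 * K x * norm t"
        using lip[OF t(2), of x] elim[THEN spec, of t] unfolding rem_def by linarith
      then show "\<bar>rem x t\<bar> / norm t \<le> 2 * K x" using t by (simp add: field_simps)
    qed
  qed
  have "(\<lambda>m. \<integral>\<^sup>+ x. H (\<delta> / Suc m) x \<partial>P) \<longlonglongrightarrow> (\<integral>\<^sup>+ x. 0 \<partial>P)"
  proof (rule nn_integral_dominated_convergence[where w="\<lambda>x. ennreal (2 * K x)"])
    show "AE x in P. H (\<delta> / Suc m) x \<le> ennreal (2 * K x)" for m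
      using HK by eventually_elim (use \<delta> in \<open>auto simp: divide_le_eq\<close>)
    have "integrable P (\<lambda>x. 2 * K x)" using K by simp
    then show "(\<integral>\<^sup>+ x. ennreal (2 * K x) \<partial>P) < \<infinity>"
      using Kpos by (subst nn_integral_eq_integral) auto
    show "AE x in P. (\<lambda>m. H (\<delta> / Suc m) x) \<longlonglongrightarrow> 0"
      using diff
    proof eventually_elim
      case (elim x)
      show ?case
      proof (rule order_tendstoI)
        fix a :: ennreal assume "0 < a"
        then obtain a' :: real where a': "a' > 0" "ennreal a' < a"
          by (metis dense ennreal_0 ennreal_cases ennreal_less_iff infinity_ennreal_def le_less top.not_eq_extremum)
        obtain d where d: "d > 0" "\<And>y. norm y < d \<Longrightarrow> \<bar>f x y - f x 0 - D x y\<bar> \<le> a' * norm y"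
          using elim a'(1) unfolding has_derivative_at_alt by (auto simp: norm_minus_commute)
        have "(\<lambda>m. \<delta> / real (Suc m)) \<longlonglongrightarrow> 0" by (rule LIMSEQ_Suc[OF lim_const_over_n])
        from order_tendstoD(2)[OF this d(1)]
        show "\<forall>\<^sub>F m in sequentially. H (\<delta> / Suc m) x < a"
        proof eventually_elim
          case (elim m)
          have "H (\<delta> / Suc m) x \<le> ennreal a'"
            unfolding H_def
          proof (intro SUP_least ennreal_leI)
            fix t assume "t \<in> S (\<delta> / Suc m)"
            then have t: "norm t > 0" "norm t < d" using elim by (auto simp: S_def)
            show "\<bar>rem x t\<bar> / norm t \<le> a'" using d(2)[OF t(2)] t(1) by (simp add: rem_def field_simps)
          qed
          then show ?case using a'(2) by (rule le_less_trans)
        qed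
      qed (simp add: not_less)
    qed
  qed auto
  from order_tendstoD(2)[OF this, of "ennreal e"] e
  obtain m where m: "(\<integral>\<^sup>+ x. H (\<delta> / Suc m) x \<partial>P) < ennreal e"
    by (auto simp: eventually_sequentially)
  define r where "r = \<delta> / Suc m"
  have r: "r > 0" "r \<le> \<delta>" using \<delta> by (auto simp: r_def divide_le_eq)
  define h where "h x = enn2real (H r x)" for x
  have hm: "h \<in> borel_measurable borel" unfolding h_def by measurable
  have fin: "AE x in P. H r x < \<top>"
    using HK r(2) by (auto elim!: eventually_mono intro: le_less_trans)
  have eq: "(\<integral>\<^sup>+ x. ennreal (h x) \<partial>P) = (\<integral>\<^sup>+ x. H r x \<partial>P)"
    by (rule nn_integral_cong_AE) (use fin in \<open>auto elim!: eventually_mono simp: h_def\<close>)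
  have hi: "integrable P h"
    by (rule integrableI_nonneg) (use hm m eq in \<open>auto simp: h_def r_def intro: less_trans\<close>)
  have "(\<integral>x. h x \<partial>P) = enn2real (\<integral>\<^sup>+ x. H r x \<partial>P)"
    unfolding eq[symmetric] by (rule integral_eq_nn_integral) (use hm in \<open>auto simp: h_def\<close>)
  also have "\<dots> < e" using m e by (metis r_def enn2real_ennreal enn2real_less_iff less_imp_le ennreal_less_top less_trans)
  finally have "(\<integral>x. h x \<partial>P) < e" .
  moreover have "AE x in P. \<forall>t. norm t < r \<longrightarrow> \<bar>f x t - f x 0 - D x t\<bar> \<le> h x * norm t"
    using fin
  proof eventually_elim
    case (elim x)
    have "continuous_on UNIV (D x)" using linD by (simp add: linear_continuous_on linear_conv_bounded_linear)
    then have cr: "continuous_on UNIV (\<lambda>t. \<bar>rem x t\<bar> - h x * norm t)"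
      unfolding rem_def by (intro continuous_intros cont)
    have le0: "\<bar>rem x t\<bar> - h x * norm t \<le> 0" if t: "norm t < r" for t
    proof (rule ccontr)
      assume neg: "\<not> ?thesis"
      have "open {t. 0 < \<bar>rem x t\<bar> - h x * norm t}"
        using cr by (intro open_Collect_less continuous_on_const)
      then have "open ({t. 0 < \<bar>rem x t\<bar> - h x * norm t} \<inter> ball 0 r)" by auto
      moreover have "t \<in> {t. 0 < \<bar>rem x t\<bar> - h x * norm t} \<inter> ball 0 r" using neg t by auto
      ultimately have "\<exists>c\<in>C. c \<in> {t. 0 < \<bar>rem x t\<bar> - h x * norm t} \<inter> ball 0 r"
        by (intro C(2)) blast+
      then obtain c where c: "c \<in> C" "0 < \<bar>rem x c\<bar> - h x * norm c" "norm c < r"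
        by auto
      have "rem x 0 = 0" using linear_0[OF linD[of x]] by (simp add: rem_def)
      then have "c \<noteq> 0" using c(2) by auto
      then have cS: "c \<in> S r" using c by (simp add: S_def)
      have "ennreal (\<bar>rem x c\<bar> / norm c) \<le> H r x" unfolding H_def using cS by (rule SUP_upper)
      also have "\<dots> = ennreal (h x)" using elim by (simp add: h_def)
      finally have "\<bar>rem x c\<bar> / norm c \<le> h x" by (simp add: h_def)
      then show False using c(2) \<open>c \<noteq> 0\<close> by (simp add: field_simps)
    qed
    then show ?case by (auto simp: rem_def)
  qed
  ultimately show ?thesis using r(1) hm hi by blast
qed

text \<open>
  On a ball that contains \<open>\<tau>\<close> with high probability, the remainder is at most the average of \<open>h\<close> times
  \<open>norm \<tau>\<close>, however \<open>\<tau>\<close> depends on the sample.  The linear part is an average of finitely many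
  coefficients, to which the law of large numbers applies.
\<close>

theorem avg_expansion:
  fixes f D :: "'a \<Rightarrow> 'p::euclidean_space \<Rightarrow> real"
  assumes f [measurable]: "\<And>t. (\<lambda>x. f x t) \<in> borel_measurable borel"
    and cont: "\<And>x. continuous_on UNIV (f x)"
    and \<delta>: "\<delta> > 0" and lip: "\<And>x t. norm t \<le> \<delta> \<Longrightarrow> \<bar>f x t - f x 0\<bar> \<le> K x * norm t"
    and K [measurable]: "K \<in> borel_measurable borel" "integrable P K"
    and D [measurable]: "\<And>t. (\<lambda>x. D x t) \<in> borel_measurable borel" and linD: "\<And>x. linear (D x)"
    and diff: "AE x in P. (f x has_derivative D x) (at 0)"
    and \<tau>: "\<And>e. e > 0 \<Longrightarrow> with_high_probability M (\<lambda>n \<omega>. norm (\<tau> n \<omega>) \<le> e)"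
    and e: "e > 0"
  shows "with_high_probability M (\<lambda>n \<omega>.
     \<bar>avg n (\<lambda>x. f x (\<tau> n \<omega>)) \<omega> - avg n (\<lambda>x. f x 0) \<omega> - (\<integral>x. D x (\<tau> n \<omega>) \<partial>P)\<bar> \<le> e * norm (\<tau> n \<omega>))"
proof -
  have e4: "e / 4 > 0" using e by simp
  obtain r h where r: "r > 0" and h: "h \<in> borel_measurable borel" "integrable P h" "(\<integral>x. h x \<partial>P) < e / 4"
    and hb: "AE x in P. \<forall>t. norm t < r \<longrightarrow> \<bar>f x t - f x 0 - D x t\<bar> \<le> h x * norm t"
    using small_remainder_bound[OF f cont \<delta> lip K D linD diff e4] by blast
  have K0: "AE x in P. \<forall>t. \<bar>D x t\<bar> \<le> K x * norm t"
    using diff by eventually_elim (use linear_le_of_lipschitz[OF _ \<delta> lip] in blast)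
  have Di: "integrable P (\<lambda>x. D x t)" for t
  proof (rule Bochner_Integration.integrable_bound)
    show "integrable P (\<lambda>x. K x * norm t)" using K by simp
    show "AE x in P. norm (D x t) \<le> norm (K x * norm t)"
      using K0 by eventually_elim (metis abs_ge_self order_trans real_norm_def)
  qed measurable
  define d where "d = e / (2 * DIM('p))"
  have d: "d > 0" using e by (simp add: d_def)
  have "with_high_probability M (\<lambda>n \<omega>. \<forall>b\<in>(Basis::'p set). \<bar>avg n (\<lambda>x. D x b) \<omega> - (\<integral>x. D x b \<partial>P)\<bar> \<le> d)"
    by (intro whp_all_finite weak_law_of_large_numbers Di d D) auto
  moreover have "with_high_probability M (\<lambda>n \<omega>. \<bar>avg n h \<omega> - (\<integral>x. h x \<partial>P)\<bar> \<le> e / 4)"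
    by (intro weak_law_of_large_numbers h e4)
  moreover have "with_high_probability M (\<lambda>n \<omega>. norm (\<tau> n \<omega>) \<le> r / 2)"
    by (rule \<tau>) (use r in auto)
  moreover have "with_high_probability M (\<lambda>n \<omega>. \<forall>i. \<forall>t. norm t < r \<longrightarrow> \<bar>f (T i \<omega>) t - f (T i \<omega>) 0 - D (T i \<omega>) t\<bar> \<le> h (T i \<omega>) * norm t)"
  proof (rule whp_AE, rule always_eventually, rule allI)
    have "AE \<omega> in M. \<forall>t. norm t < r \<longrightarrow> \<bar>f (T i \<omega>) t - f (T i \<omega>) 0 - D (T i \<omega>) t\<bar> \<le> h (T i \<omega>) * norm t" for i
      by (rule AE_distrD[OF T_measurable[of i]]) (simp only: law hb)
    then show "AE \<omega> in M. \<forall>i. \<forall>t. norm t < r \<longrightarrow> \<bar>f (T i \<omega>) t - f (T i \<omega>) 0 - D (T i \<omega>) t\<bar> \<le> h (T i \<omega>) * norm t"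
      by (simp add: AE_all_countable)
  qed
  ultimately have "with_high_probability M (\<lambda>n \<omega>.
     ((\<forall>b\<in>(Basis::'p set). \<bar>avg n (\<lambda>x. D x b) \<omega> - (\<integral>x. D x b \<partial>P)\<bar> \<le> d) \<and>
      \<bar>avg n h \<omega> - (\<integral>x. h x \<partial>P)\<bar> \<le> e / 4) \<and> (norm (\<tau> n \<omega>) \<le> r / 2 \<and>
      (\<forall>i. \<forall>t. norm t < r \<longrightarrow> \<bar>f (T i \<omega>) t - f (T i \<omega>) 0 - D (T i \<omega>) t\<bar> \<le> h (T i \<omega>) * norm t)))"
    by (intro whp_conj)
  then show ?thesis
  proof (rule whp_mono, elim conjE)
    fix n \<omega>
    assume B: "\<forall>b\<in>(Basis::'p set). \<bar>avg n (\<lambda>x. D x b) \<omega> - (\<integral>x. D x b \<partial>P)\<bar> \<le> d"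
      and A: "\<bar>avg n h \<omega> - (\<integral>x. h x \<partial>P)\<bar> \<le> e / 4"
      and tr: "norm (\<tau> n \<omega>) \<le> r / 2"
      and R: "\<forall>i. \<forall>t. norm t < r \<longrightarrow> \<bar>f (T i \<omega>) t - f (T i \<omega>) 0 - D (T i \<omega>) t\<bar> \<le> h (T i \<omega>) * norm t"
    let ?t = "\<tau> n \<omega>"
    have t: "norm ?t < r" using tr r by linarith
    have "\<bar>\<Sum>i<n. f (T i \<omega>) ?t - f (T i \<omega>) 0 - D (T i \<omega>) ?t\<bar> \<le> (\<Sum>i<n. h (T i \<omega>) * norm ?t)"
      by (rule order_trans[OF sum_abs], rule sum_mono) (use R t in auto)
    then have "\<bar>avg n (\<lambda>x. f x ?t - f x 0 - D x ?t) \<omega>\<bar> \<le> avg n h \<omega> * norm ?t"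
      unfolding avg_def abs_divide abs_of_nat by (simp add: sum_distrib_right[symmetric] divide_right_mono)
    also have "\<dots> \<le> e / 2 * norm ?t"
    proof (rule mult_right_mono)
      show "avg n h \<omega> \<le> e / 2" using A h(3) by linarith
    qed simp
    finally have 1: "\<bar>avg n (\<lambda>x. f x ?t - f x 0 - D x ?t) \<omega>\<bar> \<le> e / 2 * norm ?t" .
    have exp: "D x ?t = (\<Sum>b\<in>Basis. (?t \<bullet> b) * D x b)" for x
    proof -
      have "D x ?t = D x (\<Sum>b\<in>Basis. (?t \<bullet> b) *\<^sub>R b)" by (simp add: euclidean_representation)
      also have "\<dots> = (\<Sum>b\<in>Basis. (?t \<bullet> b) * D x b)"
        using linD[of x] by (simp add: linear_sum linear_scale)
      finally show ?thesis .
    qed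
    have a: "avg n (\<lambda>x. D x ?t) \<omega> = (\<Sum>b\<in>Basis. (?t \<bullet> b) * avg n (\<lambda>x. D x b) \<omega>)"
      unfolding avg_def exp by (subst sum.swap) (simp add: sum_distrib_left sum_divide_distrib)
    have i: "(\<integral>x. D x ?t \<partial>P) = (\<Sum>b\<in>Basis. (?t \<bullet> b) * (\<integral>x. D x b \<partial>P))"
      unfolding exp using Di by (subst Bochner_Integration.integral_sum) auto
    have "\<bar>avg n (\<lambda>x. D x ?t) \<omega> - (\<integral>x. D x ?t \<partial>P)\<bar> = \<bar>\<Sum>b\<in>Basis. (?t \<bullet> b) * (avg n (\<lambda>x. D x b) \<omega> - (\<integral>x. D x b \<partial>P))\<bar>"
      unfolding a i by (simp add: right_diff_distrib sum_subtractf)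
    also have "\<dots> \<le> (\<Sum>b\<in>(Basis::'p set). norm ?t * d)"
    proof (rule order_trans[OF sum_abs], rule sum_mono)
      fix b :: 'p assume b: "b \<in> Basis"
      show "\<bar>(?t \<bullet> b) * (avg n (\<lambda>x. D x b) \<omega> - (\<integral>x. D x b \<partial>P))\<bar> \<le> norm ?t * d"
        unfolding abs_mult using B b by (intro mult_mono Basis_le_norm) auto
    qed
    also have "\<dots> = e / 2 * norm ?t" by (simp add: d_def)
    finally have 2: "\<bar>avg n (\<lambda>x. D x ?t) \<omega> - (\<integral>x. D x ?t \<partial>P)\<bar> \<le> e / 2 * norm ?t" .
    have "avg n (\<lambda>x. f x ?t - f x 0 - D x ?t) \<omega> = avg n (\<lambda>x. f x ?t) \<omega> - avg n (\<lambda>x. f x 0) \<omega> - avg n (\<lambda>x. D x ?t) \<omega>"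
      by (simp add: avg_def sum_subtractf diff_divide_distrib)
    then show "\<bar>avg n (\<lambda>x. f x ?t) \<omega> - avg n (\<lambda>x. f x 0) \<omega> - (\<integral>x. D x ?t \<partial>P)\<bar> \<le> e * norm ?t"
      using 1 2 by linarith
  qed
qed

end

section \<open>Score functions\<close>

locale bounded_loss =
  fixes \<psi> \<psi>' :: "real \<Rightarrow> real" and c\<^sub>1 :: real
  assumes c1: "c\<^sub>1 > 0"
    and deriv: "\<And>s. (\<psi> has_real_derivative \<psi>' s) (at s)"
    and \<psi>'_cont: "continuous_on UNIV \<psi>'"
    and u_cont: "continuous_on UNIV (\<lambda>s. if s = 0 then \<psi>' 0 else \<psi> s / s)"
    and at_0: "\<psi> 0 = 0"
    and support: "\<And>s. s \<ge> c\<^sub>1 \<Longrightarrow> \<psi> s = 0" "\<And>s. s \<ge> c\<^sub>1 \<Longrightarrow> \<psi>' s = 0"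
begin

definition u :: "real \<Rightarrow> real" where "u s = (if s = 0 then \<psi>' 0 else \<psi> s / s)"

text \<open>This is \<open>s * u' s\<close>; in contrast to the derivative of \<open>u\<close> it is bounded at \<open>0\<close>.\<close>

definition w :: "real \<Rightarrow> real" where "w s = \<psi>' s - u s"

lemma u_continuous: "continuous_on UNIV u"
  using u_cont unfolding u_def[abs_def] .

lemma u_measurable [measurable]: "u \<in> borel_measurable borel"
  by (rule borel_measurable_continuous_onI[OF u_continuous])

lemma \<psi>'_measurable [measurable]: "\<psi>' \<in> borel_measurable borel"
  by (rule borel_measurable_continuous_onI[OF \<psi>'_cont])

lemma \<psi>_measurable [measurable]: "\<psi> \<in> borel_measurable borel"
  by (intro borel_measurable_continuous_onI DERIV_continuous_on[where D=\<psi>']) (use deriv in \<open>auto intro: has_field_derivative_at_within\<close>)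

lemma w_measurable [measurable]: "w \<in> borel_measurable borel"
  unfolding w_def[abs_def] by measurable

lemma mult_u: "s * u s = \<psi> s"
  by (simp add: u_def at_0)

lemma u_support: "s \<ge> c\<^sub>1 \<Longrightarrow> u s = 0"
  using c1 support by (simp add: u_def)

lemma u_has_derivative: "s > 0 \<Longrightarrow> (u has_real_derivative w s / s) (at s)"
proof -
  assume s: "s > 0"
  have "((\<lambda>s. \<psi> s / s) has_real_derivative (\<psi>' s * s - \<psi> s * 1) / (s * s)) (at s)"
    using s deriv[of s] by (intro DERIV_divide) auto
  moreover have "(\<psi>' s * s - \<psi> s * 1) / (s * s) = w s / s"
    using s by (simp add: w_def u_def field_simps)
  moreover have "\<forall>\<^sub>F x in nhds s. \<psi> x / x = u x"
    using s by (intro eventually_mono[OF eventually_nhds_in_open[of "{0<..}" s]]) (auto simp: u_def)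
  ultimately show ?thesis using DERIV_cong_ev[of s s "\<lambda>s. \<psi> s / s" u "w s / s" "w s / s"] by simp
qed

lemma bounds: "\<exists>C>0. \<forall>s\<ge>0. \<bar>u s\<bar> \<le> C \<and> \<bar>\<psi>' s\<bar> \<le> C"
proof -
  have "bounded (u ` {0..c\<^sub>1})" "bounded (\<psi>' ` {0..c\<^sub>1})"
    by (intro compact_imp_bounded compact_continuous_image continuous_on_subset[OF u_continuous]
        continuous_on_subset[OF \<psi>'_cont]; simp)+
  then obtain B1 B2 where "\<forall>s\<in>{0..c\<^sub>1}. \<bar>u s\<bar> \<le> B1" "\<forall>s\<in>{0..c\<^sub>1}. \<bar>\<psi>' s\<bar> \<le> B2"
    unfolding bounded_iff by auto
  then have B: "\<And>s. s \<in> {0..c\<^sub>1} \<Longrightarrow> \<bar>u s\<bar> \<le> B1" "\<And>s. s \<in> {0..c\<^sub>1} \<Longrightarrow> \<bar>\<psi>' s\<bar> \<le> B2"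
    by blast+
  define C where "C = \<bar>B1\<bar> + \<bar>B2\<bar> + 1"
  have "\<bar>u s\<bar> \<le> C \<and> \<bar>\<psi>' s\<bar> \<le> C" if "s \<ge> 0" for s
  proof (cases "s \<le> c\<^sub>1")
    case True
    then show ?thesis using B[of s] that unfolding C_def by auto
  next
    case False
    then show ?thesis using u_support[of s] support[of s] by (simp add: C_def)
  qed
  moreover have "C > 0" by (simp add: C_def)
  ultimately show ?thesis by blast
qed

definition C where "C = (SOME C. C > 0 \<and> (\<forall>s\<ge>0. \<bar>u s\<bar> \<le> C \<and> \<bar>\<psi>' s\<bar> \<le> C))"

lemma C: "C > 0" "s \<ge> 0 \<Longrightarrow> \<bar>u s\<bar> \<le> C" "s \<ge> 0 \<Longrightarrow> \<bar>\<psi>' s\<bar> \<le> C"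
  using someI_ex[OF bounds[simplified Bex_def]] unfolding C_def[symmetric] by auto

lemma w_bound: "s \<ge> 0 \<Longrightarrow> \<bar>w s\<bar> \<le> 2 * C"
  using C(2,3)[of s] unfolding w_def by linarith

lemma w_support: "s \<ge> c\<^sub>1 \<Longrightarrow> w s = 0"
  using u_support support by (simp add: w_def)

lemma \<psi>_lipschitz: "a \<ge> 0 \<Longrightarrow> b \<ge> 0 \<Longrightarrow> \<bar>\<psi> a - \<psi> b\<bar> \<le> C * \<bar>a - b\<bar>"
  using field_differentiable_bound[of "{0..}" \<psi> \<psi>' C a b] deriv C(3)
  by (auto intro: has_field_derivative_at_within)

text \<open>
  The weight \<open>u\<close> itself need not be Lipschitz at \<open>0\<close>; this product is, since \<open>s * u s\<close> is.
\<close>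

lemma mult_u_lipschitz:
  assumes "a \<ge> 0" "b \<ge> 0"
  shows "b * \<bar>u a - u b\<bar> \<le> 2 * C * \<bar>a - b\<bar>"
proof -
  have "b * \<bar>u a - u b\<bar> = \<bar>b * (u a - u b)\<bar>" using assms by (simp add: abs_mult)
  also have "b * (u a - u b) = (b - a) * u a + (\<psi> a - \<psi> b)"
    using mult_u[of a] mult_u[of b] by (simp add: algebra_simps)
  also have "\<bar>\<dots>\<bar> \<le> \<bar>b - a\<bar> * C + C * \<bar>a - b\<bar>"
    using \<psi>_lipschitz[OF assms] mult_left_mono[OF C(2)[OF assms(1)], of "\<bar>b - a\<bar>"]
    by (simp add: abs_mult[symmetric])
  also have "\<dots> = 2 * C * \<bar>a - b\<bar>" by (simp add: abs_minus_commute)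
  finally show ?thesis .
qed

end

lemma bounded_bilinear_matrix_vector: "bounded_bilinear (\<lambda>(A::real^'n^'m) x. A *v x)"
proof
  show "\<exists>K. \<forall>(A::real^'n^'m) x. norm (A *v x) \<le> norm A * norm x * K"
    using norm_matrix_vector_mult_le by (intro exI[of _ 1]) auto
qed (auto simp: matrix_vector_mult_add_rdistrib matrix_vector_right_distrib scaleR_matrix_vector_assoc[symmetric]
    matrix_vector_mult_scaleR)

lemmas continuous_on_matrix_vector [continuous_intros] =
  bounded_bilinear.continuous_on[OF bounded_bilinear_matrix_vector]

lemmas has_derivative_matrix_vector =
  bounded_bilinear.FDERIV[OF bounded_bilinear_matrix_vector]

text \<open>
  In standardized coordinates an observation is a pair \<open>(z, X)\<close> and a parameter a pair \<open>(b, E)\<close>: the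
  coefficient vector, and the deviation of the inverse covariance (in units of the scale) from the
  identity.  The true parameter is \<open>0\<close>.
\<close>

definition resid :: "(real^'k) \<times> (real^'q^'k) \<Rightarrow> (real^'q) \<times> (real^'k^'k) \<Rightarrow> real^'k" where
  "resid x t = fst x - snd x *v fst t"

definition wresid :: "(real^'k) \<times> (real^'q^'k) \<Rightarrow> (real^'q) \<times> (real^'k^'k) \<Rightarrow> real^'k" where
  "wresid x t = (mat 1 + snd t) *v resid x t"

definition sqdist :: "(real^'k) \<times> (real^'q^'k) \<Rightarrow> (real^'q) \<times> (real^'k^'k) \<Rightarrow> real" where
  "sqdist x t = resid x t \<bullet> wresid x t"

text \<open>
  The derivatives of the objective, up to the weight and a constant: \<open>b\<close> moves along \<open>h\<close>, the covariance
  along \<open>A\<close>.  The trace term of \<open>dir_shape\<close> comes from rescaling to determinant one.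
\<close>

definition dir_mean :: "real^'q \<Rightarrow> (real^'k) \<times> (real^'q^'k) \<Rightarrow> (real^'q) \<times> (real^'k^'k) \<Rightarrow> real" where
  "dir_mean h x t = (snd x *v h) \<bullet> wresid x t"

definition dir_shape :: "real^'k^'k \<Rightarrow> (real^'k) \<times> (real^'q^'k) \<Rightarrow> (real^'q) \<times> (real^'k^'k) \<Rightarrow> real" where
  "dir_shape A x t = wresid x t \<bullet> (A *v wresid x t) - sqdist x t * trace (A ** (mat 1 + snd t)) / real CARD('k)"

lemma wresid_alt: "wresid x t = resid x t + snd t *v resid x t"
  by (simp add: wresid_def matrix_vector_mult_add_rdistrib matrix_vector_mul_lid)

lemma at_true_parameter:
  "resid x 0 = fst x" "wresid x 0 = fst x" "sqdist x 0 = (norm (fst x))\<^sup>2"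
  "dir_mean h x 0 = (snd x *v h) \<bullet> fst x"
  "dir_shape A x 0 = fst x \<bullet> (A *v fst x) - (norm (fst x))\<^sup>2 * trace A / real CARD('k)"
  for x :: "(real^'k) \<times> (real^'q^'k)"
  by (simp_all add: resid_def wresid_def sqdist_def dir_mean_def dir_shape_def matrix_vector_mul_lid
      matrix_mul_rid power2_norm_eq_inner)

lemma continuous_on_param:
  fixes F :: "_ \<Rightarrow> (real^'k) \<times> (real^'q^'k)" and G :: "_ \<Rightarrow> (real^'q) \<times> (real^'k^'k)"
  assumes [continuous_intros]: "continuous_on S F" "continuous_on S G"
  shows "continuous_on S (\<lambda>p. resid (F p) (G p))" "continuous_on S (\<lambda>p. wresid (F p) (G p))"
    "continuous_on S (\<lambda>p. sqdist (F p) (G p))" "continuous_on S (\<lambda>p. dir_mean h (F p) (G p))"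
    "continuous_on S (\<lambda>p. dir_shape A (F p) (G p))"
proof -
  show 1 [continuous_intros]: "continuous_on S (\<lambda>p. resid (F p) (G p))"
    unfolding resid_def by (intro continuous_intros)
  show 2 [continuous_intros]: "continuous_on S (\<lambda>p. wresid (F p) (G p))"
    unfolding wresid_alt by (intro continuous_intros)
  show 3 [continuous_intros]: "continuous_on S (\<lambda>p. sqdist (F p) (G p))"
    unfolding sqdist_def by (intro continuous_intros)
  show "continuous_on S (\<lambda>p. dir_mean h (F p) (G p))"
    unfolding dir_mean_def by (intro continuous_intros)
  show "continuous_on S (\<lambda>p. dir_shape A (F p) (G p))"
    unfolding dir_shape_def trace_mult_eq_inner by (intro continuous_intros) auto
qed

lemma resid_has_derivative:
  "((\<lambda>t. resid x t) has_derivative (\<lambda>t. - (snd x *v fst t))) (at 0)"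
  unfolding resid_def
  by (rule has_derivative_eq_rhs[OF has_derivative_diff[OF has_derivative_const has_derivative_matrix_vector[OF has_derivative_const has_derivative_fst[OF has_derivative_ident]]]])
     (simp add: fun_eq_iff)

lemma wresid_has_derivative:
  "((\<lambda>t. wresid x t) has_derivative (\<lambda>t. snd t *v fst x - snd x *v fst t)) (at 0)"
  unfolding wresid_alt
  by (rule has_derivative_eq_rhs[OF has_derivative_add[OF resid_has_derivative has_derivative_matrix_vector[OF has_derivative_snd[OF has_derivative_ident] resid_has_derivative]]])
     (simp add: fun_eq_iff at_true_parameter)

lemma sqdist_has_derivative:
  "((\<lambda>t. sqdist x t) has_derivative (\<lambda>t. fst x \<bullet> (snd t *v fst x) - 2 * (fst x \<bullet> (snd x *v fst t)))) (at 0)"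
  unfolding sqdist_def
  by (rule has_derivative_eq_rhs[OF has_derivative_inner[OF resid_has_derivative wresid_has_derivative]])
     (simp add: fun_eq_iff at_true_parameter inner_diff_right inner_commute)

lemma dir_mean_has_derivative:
  "((\<lambda>t. dir_mean h x t) has_derivative (\<lambda>t. (snd x *v h) \<bullet> (snd t *v fst x - snd x *v fst t))) (at 0)"
  unfolding dir_mean_def
  by (rule has_derivative_inner_right[OF wresid_has_derivative])

lemma dir_shape_has_derivative:
  fixes x :: "(real^'k) \<times> (real^'q^'k)"
  shows "((\<lambda>t. dir_shape A x t) has_derivative (\<lambda>t.
     fst x \<bullet> (A *v (snd t *v fst x - snd x *v fst t)) + (snd t *v fst x - snd x *v fst t) \<bullet> (A *v fst x)
     - ((fst x \<bullet> (snd t *v fst x) - 2 * (fst x \<bullet> (snd x *v fst t))) * trace A + (norm (fst x))\<^sup>2 * trace (A ** snd t)) / real CARD('k))) (at 0)"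
proof -
  have 1: "((\<lambda>t. A *v wresid x t) has_derivative (\<lambda>t. A *v (snd t *v fst x - snd x *v fst t))) (at 0)"
    by (rule has_derivative_eq_rhs[OF has_derivative_matrix_vector[OF has_derivative_const wresid_has_derivative]])
       (simp add: fun_eq_iff)
  have 2: "((\<lambda>t. trace (A ** (mat 1 + snd t))) has_derivative (\<lambda>t. trace (A ** snd t))) (at (0 :: (real^'q) \<times> (real^'k^'k)))"
    unfolding trace_mult_eq_inner
    by (rule has_derivative_eq_rhs[OF has_derivative_inner_right[OF has_derivative_add[OF has_derivative_const has_derivative_snd[OF has_derivative_ident]]]]) simp
  show ?thesis
    unfolding dir_shape_def divide_inverse
    by (rule has_derivative_eq_rhs[OF has_derivative_diff[OF has_derivative_inner[OF wresid_has_derivative 1]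
          has_derivative_mult_left[OF has_derivative_mult[OF sqdist_has_derivative 2]]]])
       (simp add: fun_eq_iff at_true_parameter matrix_mul_rid algebra_simps)
qed

subsection \<open>Lipschitz bounds\<close>

lemma param_norm: "norm (fst t) \<le> norm t" "norm (snd t) \<le> norm t"
  by (metis norm_fst_le prod.collapse, metis norm_snd_le prod.collapse)

lemma resid_bounds:
  fixes x :: "(real^'k) \<times> (real^'q^'k)"
  assumes t: "norm t \<le> 1 / 2"
  shows "norm (resid x t - fst x) \<le> norm (snd x) * norm t"
    and "norm (wresid x t - fst x) \<le> (norm (snd x) + norm (resid x t)) * norm t"
    and "(norm (resid x t))\<^sup>2 / 2 \<le> sqdist x t"
    and "\<bar>sqdist x t - (norm (fst x))\<^sup>2\<bar> \<le> (norm (snd x) * (norm (resid x t) + norm (fst x)) + (norm (resid x t))\<^sup>2) * norm t"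
    and "0 \<le> sqdist x t"
    and "\<bar>sqrt (sqdist x t) - norm (fst x)\<bar> \<le> 2 * (norm (snd x) + norm (resid x t)) * norm t"
proof -
  let ?r = "resid x t"
  have Er: "norm (snd t *v ?r) \<le> norm t * norm ?r"
    using norm_matrix_vector_mult_le[of "snd t" ?r] mult_right_mono[OF param_norm(2)[of t] norm_ge_zero[of ?r]] by linarith
  show 1: "norm (?r - fst x) \<le> norm (snd x) * norm t"
    using norm_matrix_vector_mult_le[of "snd x" "fst t"] mult_left_mono[OF param_norm(1)[of t], of "norm (snd x)"]
    by (simp add: resid_def)
  have "wresid x t - fst x = (?r - fst x) + snd t *v ?r" by (simp add: wresid_alt)
  then have "norm (wresid x t - fst x) \<le> norm (?r - fst x) + norm (snd t *v ?r)" by (simp only: norm_triangle_ineq)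
  then show "norm (wresid x t - fst x) \<le> (norm (snd x) + norm ?r) * norm t"
    using 1 Er by (simp add: algebra_simps)
  have q: "sqdist x t = (norm ?r)\<^sup>2 + ?r \<bullet> (snd t *v ?r)"
    by (simp add: sqdist_def wresid_alt inner_add_right power2_norm_eq_inner)
  have rEr: "\<bar>?r \<bullet> (snd t *v ?r)\<bar> \<le> norm t * (norm ?r)\<^sup>2"
    using Cauchy_Schwarz_ineq2[of ?r "snd t *v ?r"] mult_left_mono[OF Er, of "norm ?r"]
    by (simp add: power2_eq_square mult_ac)
  also have "\<dots> \<le> 1 / 2 * (norm ?r)\<^sup>2" using t by (intro mult_right_mono) auto
  finally have half: "\<bar>?r \<bullet> (snd t *v ?r)\<bar> \<le> 1 / 2 * (norm ?r)\<^sup>2" .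
  then show low: "(norm ?r)\<^sup>2 / 2 \<le> sqdist x t" using q by (simp add: abs_le_iff)
  then show nn: "0 \<le> sqdist x t" by (rule order_trans[rotated]) simp
  have "(norm ?r)\<^sup>2 - (norm (fst x))\<^sup>2 = (norm ?r - norm (fst x)) * (norm ?r + norm (fst x))"
    by (simp add: power2_eq_square algebra_simps)
  moreover have "\<bar>norm ?r - norm (fst x)\<bar> \<le> norm (snd x) * norm t"
    using norm_triangle_ineq3[of ?r "fst x"] 1 by linarith
  ultimately have 2: "\<bar>(norm ?r)\<^sup>2 - (norm (fst x))\<^sup>2\<bar> \<le> (norm (snd x) * norm t) * (norm ?r + norm (fst x))"
    by (simp add: abs_mult mult_right_mono)
  have "\<bar>sqdist x t - (norm (fst x))\<^sup>2\<bar> \<le> \<bar>(norm ?r)\<^sup>2 - (norm (fst x))\<^sup>2\<bar> + \<bar>?r \<bullet> (snd t *v ?r)\<bar>"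
    unfolding q by linarith
  also have "\<dots> \<le> (norm (snd x) * norm t) * (norm ?r + norm (fst x)) + norm t * (norm ?r)\<^sup>2"
    using 2 rEr by (rule add_mono)
  finally show 3: "\<bar>sqdist x t - (norm (fst x))\<^sup>2\<bar> \<le> (norm (snd x) * (norm ?r + norm (fst x)) + (norm ?r)\<^sup>2) * norm t"
    by (simp add: algebra_simps)
  define d where "d = sqrt (sqdist x t)"
  have d: "d \<ge> 0" "d\<^sup>2 = sqdist x t" using nn by (auto simp: d_def)
  have "(norm ?r / 2)\<^sup>2 \<le> d\<^sup>2" using low d(2) by (simp add: power_divide) (smt (verit) zero_le_power2)
  then have rd: "norm ?r \<le> 2 * d" using d(1) by (simp add: abs_le_square_iff[symmetric])
  show "\<bar>sqrt (sqdist x t) - norm (fst x)\<bar> \<le> 2 * (norm (snd x) + norm ?r) * norm t"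
  proof (cases "d + norm (fst x) = 0")
    case True
    then have "d = 0" "norm (fst x) = 0" using d(1) norm_ge_zero[of "fst x"] by linarith+
    then show ?thesis unfolding d_def[symmetric] by simp
  next
    case False
    then have s: "d + norm (fst x) > 0" using d(1) norm_ge_zero[of "fst x"] by linarith
    have "\<bar>d - norm (fst x)\<bar> * (d + norm (fst x)) = \<bar>(d - norm (fst x)) * (d + norm (fst x))\<bar>"
      using s by (simp add: abs_mult)
    also have "\<dots> = \<bar>sqdist x t - (norm (fst x))\<^sup>2\<bar>"
      unfolding d(2)[symmetric] by (simp add: power2_eq_square algebra_simps)
    also have "\<dots> \<le> (norm (snd x) * (norm ?r + norm (fst x)) + (norm ?r)\<^sup>2) * norm t" by (rule 3)
    also have "\<dots> \<le> (norm (snd x) * (2 * (d + norm (fst x))) + norm ?r * (2 * (d + norm (fst x)))) * norm t"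
    proof (intro mult_right_mono add_mono mult_left_mono)
      show "(norm ?r)\<^sup>2 \<le> norm ?r * (2 * (d + norm (fst x)))"
        unfolding power2_eq_square using rd by (intro mult_left_mono) (auto intro: order_trans)
    qed (use rd in \<open>auto intro: order_trans\<close>)
    also have "\<dots> = (2 * (norm (snd x) + norm ?r) * norm t) * (d + norm (fst x))" by (simp add: algebra_simps)
    finally show ?thesis using s unfolding d_def[symmetric] by (rule mult_right_le_imp_le)
  qed
qed

context bounded_loss begin

definition score :: "((real^'k) \<times> (real^'q^'k) \<Rightarrow> (real^'q) \<times> (real^'k^'k) \<Rightarrow> real) \<Rightarrow>
   (real^'k) \<times> (real^'q^'k) \<Rightarrow> (real^'q) \<times> (real^'k^'k) \<Rightarrow> real" where
  "score b x t = u (sqrt (sqdist x t)) * b x t"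

text \<open>
  For \<open>norm t \<le> 1 / 2\<close>, if the weight is nonzero at one of the residuals \<open>resid x 0\<close> and \<open>resid x t\<close>, then
  both have norm at most \<open>radius x\<close>, as they differ by at most the norm of the design.
\<close>

definition radius :: "(real^'k) \<times> (real^'q^'k) \<Rightarrow> real" where
  "radius x = 2 * c\<^sub>1 + 1 + norm (snd x)"

text \<open>
  Outside the ball of radius \<open>radius x\<close> both weights vanish, so the residuals may be taken bounded.
\<close>

lemma score_lipschitz:
  fixes x :: "(real^'k) \<times> (real^'q^'k)"
  assumes L: "L \<ge> 0"
    and b0: "norm (fst x) \<le> radius x \<Longrightarrow> \<bar>b x 0\<bar> \<le> L * radius x * norm (fst x)"
    and bt: "norm (fst x) \<le> radius x \<Longrightarrow> norm (resid x t) \<le> radius x \<Longrightarrow> \<bar>b x t - b x 0\<bar> \<le> L * (radius x)\<^sup>2 * norm t"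
    and t: "norm t \<le> 1 / 2"
  shows "\<bar>score b x t - score b x 0\<bar> \<le> 9 * C * L * (radius x)\<^sup>2 * norm t"
proof -
  let ?r = "resid x t" and ?R = "radius x"
  define d where "d = sqrt (sqdist x t)"
  note rb = resid_bounds[OF t, of x]
  have d: "d \<ge> 0" "d\<^sup>2 = sqdist x t" using rb(5) by (auto simp: d_def)
  have X: "norm (snd x) \<le> ?R" "?R \<ge> 1" using c1 by (auto simp: radius_def)
  have nonneg: "0 \<le> 9 * C * L * ?R\<^sup>2 * norm t" using C(1) L by simp
  have d0: "sqrt (sqdist x 0) = norm (fst x)" by (simp add: at_true_parameter)
  show ?thesis
  proof (cases "d \<ge> c\<^sub>1 \<and> norm (fst x) \<ge> c\<^sub>1")
    case True
    then show ?thesis using nonneg by (simp add: score_def d0 d_def[symmetric] u_support)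
  next
    case False
    have "(norm ?r / 2)\<^sup>2 \<le> d\<^sup>2" using rb(3) d(2) by (simp add: power_divide) (smt (verit) zero_le_power2)
    then have rd: "norm ?r \<le> 2 * d" using d(1) by (simp add: abs_le_square_iff[symmetric])
    have Xt: "norm (snd x) * norm t \<le> norm (snd x)" using t by (intro mult_left_le) auto
    have diff: "norm ?r \<le> norm (fst x) + norm (snd x)" "norm (fst x) \<le> norm ?r + norm (snd x)"
      using rb(1) Xt norm_triangle_ineq2[of ?r "fst x"] norm_triangle_ineq3[of ?r "fst x"] by linarith+
    have R: "norm (fst x) \<le> ?R" "norm ?r \<le> ?R"
      using False rd diff c1 unfolding radius_def by linarith+
    have dd: "\<bar>d - norm (fst x)\<bar> \<le> 4 * ?R * norm t"
    proof -
      have "2 * (norm (snd x) + norm ?r) * norm t \<le> 2 * (?R + ?R) * norm t"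
        using X R by (intro mult_right_mono mult_left_mono add_mono) auto
      then show ?thesis using rb(6) unfolding d_def[symmetric] by simp
    qed
    have "score b x t - score b x 0 = u d * (b x t - b x 0) + (u d - u (norm (fst x))) * b x 0"
      by (simp add: score_def d0 d_def[symmetric] algebra_simps)
    also have "\<bar>\<dots>\<bar> \<le> \<bar>u d\<bar> * \<bar>b x t - b x 0\<bar> + \<bar>u d - u (norm (fst x))\<bar> * \<bar>b x 0\<bar>"
      unfolding abs_mult[symmetric] by (rule abs_triangle_ineq)
    also have "\<dots> \<le> C * (L * ?R\<^sup>2 * norm t) + \<bar>u d - u (norm (fst x))\<bar> * (L * ?R * norm (fst x))"
      using C(1) C(2)[OF d(1)] bt[OF R] b0[OF R(1)] by (intro add_mono mult_mono) auto
    also have "\<bar>u d - u (norm (fst x))\<bar> * (L * ?R * norm (fst x)) = L * ?R * (norm (fst x) * \<bar>u d - u (norm (fst x))\<bar>)"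
      by simp
    also have "\<dots> \<le> L * ?R * (2 * C * (4 * ?R * norm t))"
      using L X C(1) order_trans[OF mult_u_lipschitz[OF d(1) norm_ge_zero[of "fst x"]] mult_left_mono[OF dd, of "2 * C"]]
      by (intro mult_left_mono) auto
    also have "C * (L * ?R\<^sup>2 * norm t) + L * ?R * (2 * C * (4 * ?R * norm t)) = 9 * C * L * ?R\<^sup>2 * norm t"
      by (simp add: power2_eq_square algebra_simps)
    finally show ?thesis by simp
  qed
qed

lemma dir_mean_lipschitz:
  fixes x :: "(real^'k) \<times> (real^'q^'k)"
  assumes t: "norm t \<le> 1 / 2"
  shows "\<bar>score (dir_mean h) x t - score (dir_mean h) x 0\<bar> \<le> 9 * C * (2 * norm h) * (radius x)\<^sup>2 * norm t"
proof (rule score_lipschitz[OF _ _ _ t])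
  let ?R = "radius x"
  have X: "norm (snd x) \<le> ?R" "?R \<ge> 1" using c1 by (auto simp: radius_def)
  have Xh: "norm (snd x *v h) \<le> ?R * norm h"
    using norm_matrix_vector_mult_le[of "snd x" h] mult_right_mono[OF X(1), of "norm h"] by simp
  have "\<bar>dir_mean h x 0\<bar> \<le> (?R * norm h) * norm (fst x)"
    unfolding at_true_parameter
    using Cauchy_Schwarz_ineq2[of "snd x *v h" "fst x"] mult_right_mono[OF Xh, of "norm (fst x)"] by simp
  also have "\<dots> \<le> 2 * norm h * ?R * norm (fst x)" using X by simp
  finally show "\<bar>dir_mean h x 0\<bar> \<le> 2 * norm h * ?R * norm (fst x)" .
  assume r: "norm (resid x t) \<le> ?R"
  have "dir_mean h x t - dir_mean h x 0 = (snd x *v h) \<bullet> (wresid x t - fst x)"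
    by (simp add: at_true_parameter inner_diff_right) (simp add: dir_mean_def)
  also have "\<bar>\<dots>\<bar> \<le> norm (snd x *v h) * norm (wresid x t - fst x)" by (rule Cauchy_Schwarz_ineq2)
  also have "\<dots> \<le> (?R * norm h) * ((?R + ?R) * norm t)"
    using X r by (intro mult_mono Xh order_trans[OF resid_bounds(2)[OF t]]) auto
  finally show "\<bar>dir_mean h x t - dir_mean h x 0\<bar> \<le> 2 * norm h * ?R\<^sup>2 * norm t"
    by (simp add: power2_eq_square algebra_simps)
qed simp

lemma dir_shape_lipschitz:
  fixes x :: "(real^'k) \<times> (real^'q^'k)" and A :: "real^'k^'k"
  assumes t: "norm t \<le> 1 / 2"
  defines "N \<equiv> norm (mat 1 :: real^'k^'k)"
  defines "L \<equiv> norm A * (6 + 3 * N * (N + 1) + N)"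
  shows "\<bar>score (dir_shape A) x t - score (dir_shape A) x 0\<bar> \<le> 9 * C * L * (radius x)\<^sup>2 * norm t"
proof (rule score_lipschitz[OF _ _ _ t])
  let ?R = "radius x" and ?z = "fst x" and ?r = "resid x t" and ?y = "wresid x t" and ?k = "real CARD('k)"
  have X: "norm (snd x) \<le> ?R" "?R \<ge> 1" using c1 by (auto simp: radius_def)
  have k: "?k \<ge> 1" by simp
  have N: "N \<ge> 0" by (simp add: N_def)
  have trA: "\<bar>trace (A ** B)\<bar> \<le> N * (norm A * norm B)" for B
    using abs_trace_le[of "A ** B"] mult_left_mono[OF norm_matrix_mult_le[of A B], of N] N unfolding N_def by linarith
  have trA1: "\<bar>trace A\<bar> \<le> N * norm A" using abs_trace_le[of A] by (simp add: N_def)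
  show L0: "L \<ge> 0" unfolding L_def using N by (intro mult_nonneg_nonneg) auto
  have qA: "\<bar>v \<bullet> (A *v v')\<bar> \<le> norm A * (norm v * norm v')" for v v'
    using Cauchy_Schwarz_ineq2[of v "A *v v'"] mult_left_mono[OF norm_matrix_vector_mult_le[of A v'], of "norm v"]
    by (simp add: mult_ac)
  have divk: "\<bar>a / ?k\<bar> \<le> \<bar>a\<bar>" for a using k by (simp add: divide_le_eq mult_le_cancel_left1)
  {
    assume z: "norm ?z \<le> ?R"
    have "\<bar>dir_shape A x 0\<bar> \<le> \<bar>?z \<bullet> (A *v ?z)\<bar> + \<bar>(norm ?z)\<^sup>2 * trace A / ?k\<bar>"
      unfolding at_true_parameter by (rule abs_triangle_ineq4)
    also have "\<dots> \<le> norm A * (norm ?z * norm ?z) + (norm ?z)\<^sup>2 * (N * norm A)"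
      using qA[of ?z ?z] order_trans[OF divk[of "(norm ?z)\<^sup>2 * trace A"]] trA1
      by (intro add_mono) (auto simp: abs_mult mult_left_mono)
    also have "\<dots> = (norm A * (1 + N)) * (norm ?z * norm ?z)" by (simp add: power2_eq_square algebra_simps)
    also have "\<dots> \<le> L * (?R * norm ?z)"
      unfolding L_def using z N X by (intro mult_mono mult_left_mono mult_right_mono add_mono) auto
    finally show "\<bar>dir_shape A x 0\<bar> \<le> L * ?R * norm ?z" by simp
    assume r: "norm ?r \<le> ?R"
    have yz: "norm (?y - ?z) \<le> 2 * ?R * norm t"
      using X r by (intro order_trans[OF resid_bounds(2)[OF t]]) (auto intro!: mult_right_mono)
    have y: "norm ?y \<le> norm ?z + norm (?y - ?z)" using norm_triangle_ineq[of ?z "?y - ?z"] by simp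
    have "2 * ?R * norm t \<le> ?R" using t X by simp
    then have y: "norm ?y \<le> ?R + ?R" using y yz z by linarith
    have q: "\<bar>sqdist x t - (norm ?z)\<^sup>2\<bar> \<le> 3 * ?R\<^sup>2 * norm t"
    proof -
      have "(norm (snd x) * (norm ?r + norm ?z) + (norm ?r)\<^sup>2) * norm t \<le> (?R * (?R + ?R) + ?R\<^sup>2) * norm t"
        using X r z by (intro mult_right_mono add_mono mult_mono power_mono) auto
      then show ?thesis using resid_bounds(4)[OF t, of x] by (simp add: power2_eq_square algebra_simps)
    qed
    have nt: "norm (mat 1 + snd t) \<le> N + 1"
      using norm_triangle_ineq[of "mat 1" "snd t"] param_norm(2)[of t] t unfolding N_def by linarith
    have "dir_shape A x t - dir_shape A x 0 = (?y - ?z) \<bullet> (A *v ?y) + ?z \<bullet> (A *v (?y - ?z))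
       - ((sqdist x t - (norm ?z)\<^sup>2) * trace (A ** (mat 1 + snd t)) + (norm ?z)\<^sup>2 * trace (A ** snd t)) / ?k"
      unfolding at_true_parameter
      by (simp add: dir_shape_def inner_diff_left matrix_vector_mult_diff_distrib inner_diff_right
          matrix_add_ldistrib trace_add matrix_mul_rid add_divide_distrib diff_divide_distrib algebra_simps)
    also have "\<bar>\<dots>\<bar> \<le> \<bar>(?y - ?z) \<bullet> (A *v ?y)\<bar> + \<bar>?z \<bullet> (A *v (?y - ?z))\<bar>
       + (\<bar>(sqdist x t - (norm ?z)\<^sup>2) * trace (A ** (mat 1 + snd t))\<bar> + \<bar>(norm ?z)\<^sup>2 * trace (A ** snd t)\<bar>)"
      using divk[of "(sqdist x t - (norm ?z)\<^sup>2) * trace (A ** (mat 1 + snd t)) + (norm ?z)\<^sup>2 * trace (A ** snd t)"] by linarith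
    also have "\<dots> \<le> norm A * ((2 * ?R * norm t) * (?R + ?R)) + norm A * (?R * (2 * ?R * norm t))
       + ((3 * ?R\<^sup>2 * norm t) * (N * (norm A * (N + 1))) + ?R\<^sup>2 * (N * (norm A * norm t)))"
    proof (intro add_mono)
      show "\<bar>(?y - ?z) \<bullet> (A *v ?y)\<bar> \<le> norm A * ((2 * ?R * norm t) * (?R + ?R))"
        using yz y X by (intro order_trans[OF qA] mult_left_mono mult_mono) auto
      show "\<bar>?z \<bullet> (A *v (?y - ?z))\<bar> \<le> norm A * (?R * (2 * ?R * norm t))"
        using yz z X by (intro order_trans[OF qA] mult_left_mono mult_mono) auto
      show "\<bar>(sqdist x t - (norm ?z)\<^sup>2) * trace (A ** (mat 1 + snd t))\<bar> \<le> (3 * ?R\<^sup>2 * norm t) * (N * (norm A * (N + 1)))"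
        unfolding abs_mult using q N nt by (intro mult_mono order_trans[OF trA] mult_left_mono) auto
      show "\<bar>(norm ?z)\<^sup>2 * trace (A ** snd t)\<bar> \<le> ?R\<^sup>2 * (N * (norm A * norm t))"
        unfolding abs_mult using z N param_norm(2)[of t] X by (intro mult_mono order_trans[OF trA] mult_left_mono) (auto intro: power_mono)
    qed
    also have "\<dots> = norm A * (6 + 3 * N * (N + 1) + N) * ?R\<^sup>2 * norm t"
      by (simp add: power2_eq_square algebra_simps)
    finally show "\<bar>dir_shape A x t - dir_shape A x 0\<bar> \<le> L * ?R\<^sup>2 * norm t" unfolding L_def .
  }
qed

end

subsection \<open>Expected derivative and covariance of the scores\<close>

lemma matrix_vector_measurable [measurable]:
  assumes "f \<in> borel_measurable M" "g \<in> borel_measurable M"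
  shows "(\<lambda>x. (f x :: real^'n^'m) *v g x) \<in> borel_measurable M"
  using assms by (rule borel_measurable_continuous_Pair) (intro continuous_intros)

lemma fst_snd_measurable [measurable]:
  "(fst :: ('a::second_countable_topology \<times> 'b::second_countable_topology) \<Rightarrow> 'a) \<in> borel_measurable borel"
  "(snd :: ('a \<times> 'b) \<Rightarrow> 'b) \<in> borel_measurable borel"
  by (intro borel_measurable_continuous_onI continuous_intros)+

lemma matrix_vector_uminus: "A *v (- x) = - (A *v x)" for A :: "real^'n^'m"
  by (rule bounded_bilinear.minus_right[OF bounded_bilinear_matrix_vector])

context bounded_loss begin

text \<open>By the chain rule \<open>sqdist\<close> contributes its derivative divided by \<open>2 * norm (fst x)\<close>, and \<open>w s / s\<close> is the derivative of \<open>u\<close>.\<close>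

definition score_deriv :: "((real^'k) \<times> (real^'q^'k) \<Rightarrow> (real^'q) \<times> (real^'k^'k) \<Rightarrow> real) \<Rightarrow>
    ((real^'k) \<times> (real^'q^'k) \<Rightarrow> (real^'q) \<times> (real^'k^'k) \<Rightarrow> real) \<Rightarrow>
    (real^'k) \<times> (real^'q^'k) \<Rightarrow> (real^'q) \<times> (real^'k^'k) \<Rightarrow> real" where
  "score_deriv b b' x t = w (norm (fst x)) / (norm (fst x))\<^sup>2 / 2
      * (fst x \<bullet> (snd t *v fst x) - 2 * (fst x \<bullet> (snd x *v fst t))) * b x 0 + u (norm (fst x)) * b' x t"

definition dir_mean_deriv :: "real^'q \<Rightarrow> (real^'k) \<times> (real^'q^'k) \<Rightarrow> (real^'q) \<times> (real^'k^'k) \<Rightarrow> real" where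
  "dir_mean_deriv h x t = (snd x *v h) \<bullet> (snd t *v fst x - snd x *v fst t)"

definition dir_shape_deriv :: "real^'k^'k \<Rightarrow> (real^'k) \<times> (real^'q^'k) \<Rightarrow> (real^'q) \<times> (real^'k^'k) \<Rightarrow> real" where
  "dir_shape_deriv A x t = fst x \<bullet> (A *v (snd t *v fst x - snd x *v fst t)) + (snd t *v fst x - snd x *v fst t) \<bullet> (A *v fst x)
     - ((fst x \<bullet> (snd t *v fst x) - 2 * (fst x \<bullet> (snd x *v fst t))) * trace A + (norm (fst x))\<^sup>2 * trace (A ** snd t)) / real CARD('k)"

lemma score_has_derivative:
  assumes z: "fst x \<noteq> 0" and b: "((\<lambda>t. b x t) has_derivative b' x) (at 0)"
  shows "(score b x has_derivative score_deriv b b' x) (at 0)"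
proof -
  let ?d = "norm (fst x)"
  have d: "?d > 0" using z by simp
  have s: "sqrt (sqdist x 0) = ?d" by (simp add: at_true_parameter)
  have "((\<lambda>s. u (sqrt s)) has_real_derivative (w ?d / ?d) * (inverse (sqrt (sqdist x 0)) / 2)) (at (sqdist x 0))"
  proof (rule DERIV_chain2[where f=u and g=sqrt])
    show "(u has_real_derivative w ?d / ?d) (at (sqrt (sqdist x 0)))" unfolding s by (rule u_has_derivative[OF d])
    show "(sqrt has_real_derivative inverse (sqrt (sqdist x 0)) / 2) (at (sqdist x 0))"
      using d by (intro DERIV_real_sqrt) (simp add: at_true_parameter)
  qed
  from DERIV_compose_FDERIV[OF this sqdist_has_derivative]
  have 1: "((\<lambda>t. u (sqrt (sqdist x t))) has_derivative (\<lambda>t. (fst x \<bullet> (snd t *v fst x) - 2 * (fst x \<bullet> (snd x *v fst t))) * (w ?d / ?d * (inverse ?d / 2)))) (at 0)"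
    unfolding s .
  show ?thesis
    unfolding score_def[abs_def]
    by (rule has_derivative_eq_rhs[OF has_derivative_mult[OF 1 b]])
       (use d in \<open>simp add: fun_eq_iff score_deriv_def s field_simps power2_eq_square\<close>)
qed

lemma linear_score_deriv:
  assumes "linear (b' x)"
  shows "linear (score_deriv b b' x)"
proof -
  interpret linear "b' x" by fact
  show ?thesis
    unfolding score_deriv_def
    by (rule linearI) (simp_all add: add scale matrix_vector_mult_add_rdistrib matrix_vector_right_distrib
        inner_add_right scaleR_matrix_vector_assoc[symmetric] matrix_vector_mult_scaleR add_divide_distrib
        diff_divide_distrib algebra_simps)
qed

lemma linear_dir_mean_deriv: "linear (dir_mean_deriv h x)"
  using has_derivative_linear[OF dir_mean_has_derivative[of h x]] by (simp add: dir_mean_deriv_def[abs_def])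

lemma linear_dir_shape_deriv: "linear (dir_shape_deriv A x)"
  using has_derivative_linear[OF dir_shape_has_derivative[of A x]] by (simp add: dir_shape_deriv_def[abs_def])

lemma dir_deriv_measurable [measurable]:
  "(\<lambda>x. dir_mean_deriv h x t) \<in> borel_measurable borel" "(\<lambda>x. dir_shape_deriv A x t) \<in> borel_measurable borel"
  unfolding dir_mean_deriv_def dir_shape_deriv_def by measurable

lemma dir_measurable [measurable]:
  "(\<lambda>x. dir_mean h x t) \<in> borel_measurable borel" "(\<lambda>x. dir_shape A x t) \<in> borel_measurable borel"
  by (intro borel_measurable_continuous_onI continuous_on_param continuous_intros)+

lemma score_measurable:
  assumes [measurable]: "(\<lambda>x. b x t) \<in> borel_measurable borel"
  shows "(\<lambda>x. score b x t) \<in> borel_measurable borel"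
proof -
  have [measurable]: "(\<lambda>x. sqdist x t) \<in> borel_measurable borel"
    by (intro borel_measurable_continuous_onI continuous_on_param continuous_intros)
  show ?thesis unfolding score_def by measurable
qed

lemma score_deriv_measurable:
  assumes [measurable]: "(\<lambda>x. b x 0) \<in> borel_measurable borel" "(\<lambda>x. b' x t) \<in> borel_measurable borel"
  shows "(\<lambda>x. score_deriv b b' x t) \<in> borel_measurable borel"
  unfolding score_deriv_def by measurable

lemma score_continuous:
  assumes "continuous_on UNIV (b x)"
  shows "continuous_on UNIV (score b x)"
proof -
  have "continuous_on UNIV (\<lambda>t. sqrt (sqdist x t))"
    by (intro continuous_on_param continuous_intros)
  then have "continuous_on UNIV (\<lambda>t. u (sqrt (sqdist x t)))"
    by (rule continuous_on_compose2[OF u_continuous]) auto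
  then show ?thesis unfolding score_def[abs_def] using assms by (intro continuous_intros)
qed

end

locale score_model = spherical_law Z + Q: prob_space Q + bounded_loss \<psi> \<psi>' c\<^sub>1
  for Z :: "(real^'k) measure" and Q :: "(real^'q^'k) measure" and \<psi> \<psi>' c\<^sub>1 +
  assumes sets_Q [simp, measurable_cong]: "sets Q = sets borel"
    and design_moment: "integrable Q (\<lambda>X. (norm X)\<^sup>2)"
begin

sublocale ZQ: pair_prob_space Z Q ..

lemma sets_pair [measurable_cong, simp]: "sets (Z \<Otimes>\<^sub>M Q) = sets borel"
  using sets_pair_measure_cong[OF sets_Z sets_Q] by (simp only: borel_prod)

lemma space_Q [simp]: "space Q = UNIV"
  using sets_eq_imp_space_eq[OF sets_Q] by simp

lemma distr_snd: "distr (Z \<Otimes>\<^sub>M Q) borel snd = Q"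
proof (rule measure_eqI)
  fix A assume "A \<in> sets (distr (Z \<Otimes>\<^sub>M Q) borel snd)"
  then have A: "A \<in> sets borel" by simp
  have "emeasure (distr (Z \<Otimes>\<^sub>M Q) borel snd) A = emeasure (Z \<Otimes>\<^sub>M Q) (UNIV \<times> A)"
    using A by (subst emeasure_distr) (auto intro!: arg_cong[where f="emeasure _"] simp: space_pair_measure)
  also have "\<dots> = emeasure Z UNIV * emeasure Q A"
    using A sets.top[of Z] by (intro Q.emeasure_pair_measure_Times) auto
  also have "emeasure Z UNIV = 1" using emeasure_space_1 by simp
  finally show "emeasure (distr (Z \<Otimes>\<^sub>M Q) borel snd) A = emeasure Q A" by simp
qed simp

lemma integrable_of_design:
  assumes "integrable Q g" "g \<in> borel_measurable borel"
  shows "integrable (Z \<Otimes>\<^sub>M Q) (\<lambda>x. (g (snd x) :: real))"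
proof -
  have "integrable (distr (Z \<Otimes>\<^sub>M Q) borel snd) g" by (simp only: distr_snd assms(1))
  then show ?thesis using assms(2) by (subst (asm) integrable_distr_eq) auto
qed

lemma design_first_moment: "integrable Q norm"
  by (rule Q.square_integrable_imp_integrable[OF _ design_moment]) auto

lemma radius_moment: "integrable (Z \<Otimes>\<^sub>M Q) (\<lambda>x. (radius x)\<^sup>2)"
proof -
  have "integrable Q (\<lambda>X. (2 * c\<^sub>1 + 1 + norm X)\<^sup>2)"
    unfolding power2_sum using design_moment design_first_moment by auto
  from integrable_of_design[OF this] show ?thesis by (simp add: radius_def)
qed

lemma integral_pair:
  fixes F :: "_ \<Rightarrow> real"
  assumes "integrable (Z \<Otimes>\<^sub>M Q) F"
  shows "(\<integral>x. F x \<partial>(Z \<Otimes>\<^sub>M Q)) = (\<integral>X. (\<integral>z. F (z, X) \<partial>Z) \<partial>Q)"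
  using ZQ.integral_snd[of "\<lambda>z X. F (z, X)"] assms by simp

text \<open>A spherical law is symmetric, so odd terms drop out of every expectation.\<close>

lemma integral_even_part:
  fixes G H :: "real^'k \<Rightarrow> real"
  assumes "integrable Z G" and [measurable]: "G \<in> borel_measurable borel"
    and even: "\<And>z. G z + G (- z) = 2 * H z"
  shows "(\<integral>z. G z \<partial>Z) = (\<integral>z. H z \<partial>Z)"
proof -
  have U: "orthogonal_transformation (uminus :: real^'k \<Rightarrow> _)"
    by (simp add: orthogonal_transformation module_hom_uminus linear_uminus)
  have "integrable (distr Z borel uminus) G" unfolding invariant[OF U] by (rule assms)
  then have i: "integrable Z (\<lambda>z. G (- z))" using integrable_distr_eq[of uminus Z borel G] by simp
  have "2 * (\<integral>z. G z \<partial>Z) = (\<integral>z. G z \<partial>Z) + (\<integral>z. G (- z) \<partial>Z)"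
    using integral_invariant[OF U, of G] by simp
  also have "\<dots> = (\<integral>z. 2 * H z \<partial>Z)" using assms(1) i by (simp add: even[symmetric])
  finally show ?thesis by simp
qed

lemma integrable_compact_weight:
  assumes [measurable]: "g \<in> borel_measurable borel" and B: "\<And>s. s \<ge> 0 \<Longrightarrow> \<bar>g s\<bar> \<le> B" and supp: "\<And>s. s \<ge> c\<^sub>1 \<Longrightarrow> g s = 0"
  shows "integrable Z (\<lambda>z. g (norm z) * norm z ^ p)"
proof (rule integrable_const_bound[where B="B * c\<^sub>1 ^ p"])
  have "\<bar>g (norm z) * norm z ^ p\<bar> \<le> B * c\<^sub>1 ^ p" for z :: "real^'k"
  proof (cases "norm z \<ge> c\<^sub>1")
    case True
    then show ?thesis using supp B[of 0] c1 by simp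
  next
    case False
    then show ?thesis unfolding abs_mult using B[of "norm z"] B[of 0] by (intro mult_mono) (auto intro!: power_mono)
  qed
  then show "AE z in Z. norm (g (norm z) * norm z ^ p) \<le> B * c\<^sub>1 ^ p" by simp
qed measurable

lemma integrable_u: "integrable Z (\<lambda>z. u (norm z) * norm z ^ p)"
  by (rule integrable_compact_weight[where B=C]) (auto simp: C u_support)

lemma integrable_w: "integrable Z (\<lambda>z. w (norm z) * norm z ^ p)"
  by (rule integrable_compact_weight[where B="2 * C"]) (auto simp: w_bound w_support)

lemma integrable_u2: "integrable Z (\<lambda>z. (u (norm z))\<^sup>2 * norm z ^ p)"
proof (rule integrable_compact_weight[where g="\<lambda>s. (u s)\<^sup>2" and B="C\<^sup>2"])
  show "s \<ge> 0 \<Longrightarrow> \<bar>(u s)\<^sup>2\<bar> \<le> C\<^sup>2" for s using C(1) C(2)[of s] by (simp add: abs_le_square_iff[symmetric])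
qed (auto simp: u_support)

lemma AE_w_quotient: "AE z in Z. w (norm z) / (norm z)\<^sup>2 * norm z ^ (2 + p) = w (norm z) * norm z ^ p"
  using AE_nonzero by eventually_elim (simp add: power_add power2_eq_square)

lemma integrable_w_quotient: "integrable Z (\<lambda>z. w (norm z) / (norm z)\<^sup>2 * norm z ^ (2 + p))"
proof -
  have "AE z in Z. w (norm z) * norm z ^ p = w (norm z) / (norm z)\<^sup>2 * norm z ^ (2 + p)"
    using AE_w_quotient[of p] by eventually_elim simp
  then show ?thesis by (intro integrable_cong_AE_imp[OF integrable_w[of p]]) auto
qed

lemma integrable_w_quotient_0: "integrable Z (\<lambda>z. w (norm z) / (norm z)\<^sup>2 * (norm z)\<^sup>2)"
  using integrable_w_quotient[of 0] by (simp only: add.right_neutral)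

lemma integral_w_quotient: "(\<integral>z. w (norm z) / (norm z)\<^sup>2 * norm z ^ (2 + p) \<partial>Z) = (\<integral>z. w (norm z) * norm z ^ p \<partial>Z)"
  by (intro integral_cong_AE AE_w_quotient) auto

lemma integral_w_quotient_0: "(\<integral>z. w (norm z) / (norm z)\<^sup>2 * (norm z)\<^sup>2 \<partial>Z) = (\<integral>z. w (norm z) \<partial>Z)"
  using integral_w_quotient[of 0] by (simp only: add.right_neutral power_0 mult_1_right)

lemma score_deriv_bound:
  assumes b: "\<And>x. ((\<lambda>t. b x t) has_derivative b' x) (at 0)"
    and lip: "\<And>x t. norm t \<le> 1 / 2 \<Longrightarrow> \<bar>score b x t - score b x 0\<bar> \<le> K * (radius x)\<^sup>2 * norm t"
    and z: "fst x \<noteq> 0"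
  shows "\<bar>score_deriv b b' x t\<bar> \<le> K * (radius x)\<^sup>2 * norm t"
  by (rule linear_le_of_lipschitz[OF score_has_derivative[OF z b], where \<delta>="1/2"]) (use lip in auto)

lemma AE_fst_nonzero: "AE x in Z \<Otimes>\<^sub>M Q. fst x \<noteq> 0"
proof (rule AE_I[of _ _ "{0} \<times> UNIV"])
  show "emeasure (Z \<Otimes>\<^sub>M Q) ({0} \<times> UNIV) = 0"
    using sets.top[of Q] by (subst Q.emeasure_pair_measure_Times) (auto simp: no_atom)
  show "{0} \<times> UNIV \<in> sets (Z \<Otimes>\<^sub>M Q)" using sets.top[of Q] by (intro pair_measureI) auto
qed auto

lemma score_deriv_integrable:
  assumes b: "\<And>x. ((\<lambda>t. b x t) has_derivative b' x) (at 0)"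
    and lip: "\<And>x t. norm t \<le> 1 / 2 \<Longrightarrow> \<bar>score b x t - score b x 0\<bar> \<le> K * (radius x)\<^sup>2 * norm t"
    and [measurable]: "(\<lambda>x. score_deriv b b' x t) \<in> borel_measurable borel"
  shows "integrable (Z \<Otimes>\<^sub>M Q) (\<lambda>x. score_deriv b b' x t)" and "integrable Z (\<lambda>z. score_deriv b b' (z, X) t)"
proof -
  have "AE z in Z. norm (score_deriv b b' (z, X) t) \<le> K * (radius (0, X))\<^sup>2 * norm t" for X
    using AE_nonzero
  proof eventually_elim
    case (elim z)
    then show ?case using score_deriv_bound[OF b lip, of "(z, X)"] by (simp add: radius_def)
  qed
  moreover have "(\<lambda>z. score_deriv b b' (z, X) t) \<in> borel_measurable Z" for X
    by (rule measurable_compose[of "\<lambda>z. (z, X)" Z borel "\<lambda>x. score_deriv b b' x t"])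
       (auto intro!: borel_measurable_continuous_onI continuous_intros simp: measurable_cong_sets[OF sets_Z refl])
  ultimately show "integrable Z (\<lambda>z. score_deriv b b' (z, X) t)"
    by (intro integrable_const_bound)
  note nz = AE_fst_nonzero
  show "integrable (Z \<Otimes>\<^sub>M Q) (\<lambda>x. score_deriv b b' x t)"
  proof (rule Bochner_Integration.integrable_bound)
    show "integrable (Z \<Otimes>\<^sub>M Q) (\<lambda>x. K * (radius x)\<^sup>2 * norm t)"
      using radius_moment by auto
    show "AE x in Z \<Otimes>\<^sub>M Q. norm (score_deriv b b' x t) \<le> norm (K * (radius x)\<^sup>2 * norm t)"
      using nz
    proof eventually_elim
      case (elim x)
      show ?case using score_deriv_bound[OF b lip elim, of t] unfolding real_norm_def by linarith
    qed
  qed measurable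
qed

lemmas mean_deriv_facts = score_deriv_integrable[where b="dir_mean h" and b'="dir_mean_deriv h" and K="9 * C * (2 * norm h)" for h,
    OF dir_mean_has_derivative[folded dir_mean_deriv_def] dir_mean_lipschitz score_deriv_measurable[OF dir_measurable(1) dir_deriv_measurable(1)]]

lemmas shape_deriv_facts = score_deriv_integrable[where b="dir_shape A" and b'="dir_shape_deriv A"
    and K="9 * C * (norm A * (6 + 3 * norm (mat 1 :: real^'k^'k) * (norm (mat 1 :: real^'k^'k) + 1) + norm (mat 1 :: real^'k^'k)))" for A,
    OF dir_shape_has_derivative[folded dir_shape_deriv_def] dir_shape_lipschitz score_deriv_measurable[OF dir_measurable(2) dir_deriv_measurable(2)]]

text \<open>The factors by which the expected scores respond to the coefficients and to the shape.\<close>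

definition mean_gain :: real where
  "mean_gain = (\<integral>z. u (norm z) \<partial>Z) + (\<integral>z. w (norm z) \<partial>Z) / real CARD('k)"

definition shape_gain :: real where
  "shape_gain = (\<integral>z. w (norm z) * norm z ^ 2 \<partial>Z) / (real CARD('k) * (real CARD('k) + 2)) + (\<integral>z. u (norm z) * norm z ^ 2 \<partial>Z) / real CARD('k)"

text \<open>The terms that contain \<open>snd t\<close> are odd in the error and vanish, and the second moment of a spherical law is a multiple of the identity.\<close>

lemma expected_mean_deriv:
  "(\<integral>x. score_deriv (dir_mean h) (dir_mean_deriv h) x t \<partial>(Z \<Otimes>\<^sub>M Q))
     = - mean_gain * (\<integral>X. (X *v h) \<bullet> (X *v fst t) \<partial>Q)"
proof -
  have inner: "(\<integral>z. score_deriv (dir_mean h) (dir_mean_deriv h) (z, X) t \<partial>Z) = - mean_gain * ((X *v h) \<bullet> (X *v fst t))" for X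
  proof -
    let ?H = "\<lambda>z. - (w (norm z) / (norm z)\<^sup>2 * ((z \<bullet> (X *v fst t)) * (z \<bullet> (X *v h)))) - u (norm z) * ((X *v h) \<bullet> (X *v fst t))"
    have "(\<integral>z. score_deriv (dir_mean h) (dir_mean_deriv h) (z, X) t \<partial>Z) = (\<integral>z. ?H z \<partial>Z)"
    proof (rule integral_even_part)
      show "integrable Z (\<lambda>z. score_deriv (dir_mean h) (dir_mean_deriv h) (z, X) t)" by (rule mean_deriv_facts)
      show "(\<lambda>z. score_deriv (dir_mean h) (dir_mean_deriv h) (z, X) t) \<in> borel_measurable borel"
        unfolding score_deriv_def dir_mean_deriv_def at_true_parameter fst_conv snd_conv by measurable
      show "score_deriv (dir_mean h) (dir_mean_deriv h) (z, X) t + score_deriv (dir_mean h) (dir_mean_deriv h) (- z, X) t = 2 * ?H z" for z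
        unfolding score_deriv_def dir_mean_deriv_def at_true_parameter fst_conv snd_conv norm_minus_cancel
        by (simp add: matrix_vector_uminus inner_diff_right inner_commute algebra_simps)
    qed
    also have "\<dots> = - ((\<integral>z. w (norm z) / (norm z)\<^sup>2 * ((z \<bullet> (X *v fst t)) * (z \<bullet> (X *v h))) \<partial>Z)) - (\<integral>z. u (norm z) \<partial>Z) * ((X *v h) \<bullet> (X *v fst t))"
      using integrable_two[of "\<lambda>s. w s / s\<^sup>2", OF _ integrable_w_quotient_0] integrable_u[of 0] by simp
    also have "\<dots> = - mean_gain * ((X *v h) \<bullet> (X *v fst t))"
      by (subst second_moment[of "\<lambda>s. w s / s\<^sup>2", OF _ integrable_w_quotient_0], measurable)
         (simp only: integral_w_quotient_0, simp add: mean_gain_def inner_commute algebra_simps)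
    finally show ?thesis .
  qed
  have "(\<integral>x. score_deriv (dir_mean h) (dir_mean_deriv h) x t \<partial>(Z \<Otimes>\<^sub>M Q))
     = (\<integral>X. (\<integral>z. score_deriv (dir_mean h) (dir_mean_deriv h) (z, X) t \<partial>Z) \<partial>Q)"
    by (rule integral_pair[OF mean_deriv_facts(1)])
  also have "\<dots> = (\<integral>X. - mean_gain * ((X *v h) \<bullet> (X *v fst t)) \<partial>Q)"
    by (rule Bochner_Integration.integral_cong[OF refl inner])
  finally show ?thesis by simp
qed

text \<open>
  The terms that contain \<open>fst t\<close> are odd in the error and vanish.  The remaining fourth moments involve only
  \<open>trace (A ** E)\<close> and the product of the two traces; the trace term in \<open>dir_shape\<close> combines them to the deviator.
\<close>

lemma expected_shape_deriv:
  assumes A: "transpose A = A"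
  shows "(\<integral>x. score_deriv (dir_shape A) (dir_shape_deriv A) x t \<partial>(Z \<Otimes>\<^sub>M Q))
     = shape_gain * (trace (A ** snd t) - trace A * trace (snd t) / real CARD('k))"
proof -
  let ?k = "real CARD('k)" and ?E = "snd t"
  have "(\<integral>z. score_deriv (dir_shape A) (dir_shape_deriv A) (z, X) t \<partial>Z) = shape_gain * (trace (A ** ?E) - trace A * trace ?E / ?k)" for X
  proof -
    let ?w = "\<lambda>s. w s / s\<^sup>2"
    let ?W1 = "\<lambda>z. ?w (norm z) * ((z \<bullet> (A *v z)) * (z \<bullet> (?E *v z)))"
    let ?W2 = "\<lambda>z. ?w (norm z) * ((z \<bullet> (mat 1 *v z)) * (z \<bullet> (?E *v z)))"
    let ?U1 = "\<lambda>z. u (norm z) * (z \<bullet> ((A ** ?E) *v z))"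
    let ?U2 = "\<lambda>z. u (norm z) * (z \<bullet> (?E *v z))"
    let ?U3 = "\<lambda>z. u (norm z) * norm z ^ 2"
    let ?H = "\<lambda>z. ?W1 z / 2 - ?W2 z * (trace A / ?k / 2) + 2 * ?U1 z - ?U2 z * (trace A / ?k) - ?U3 z * (trace (A ** ?E) / ?k)"
    have ev: "(\<integral>z. score_deriv (dir_shape A) (dir_shape_deriv A) (z, X) t \<partial>Z) = (\<integral>z. ?H z \<partial>Z)"
    proof (rule integral_even_part)
      show "integrable Z (\<lambda>z. score_deriv (dir_shape A) (dir_shape_deriv A) (z, X) t)" by (rule shape_deriv_facts)
      show "(\<lambda>z. score_deriv (dir_shape A) (dir_shape_deriv A) (z, X) t) \<in> borel_measurable borel"
        unfolding score_deriv_def dir_shape_deriv_def at_true_parameter fst_conv snd_conv by measurable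
      show "score_deriv (dir_shape A) (dir_shape_deriv A) (z, X) t + score_deriv (dir_shape A) (dir_shape_deriv A) (- z, X) t = 2 * ?H z" for z
      proof -
        have s: "(?E *v z) \<bullet> (A *v z) = z \<bullet> ((A ** ?E) *v z)"
          using inner_matrix_transpose[of z A "?E *v z"] A by (simp add: matrix_vector_mul_assoc inner_commute)
        have s2: "z \<bullet> (A *v (?E *v z)) = z \<bullet> ((A ** ?E) *v z)" by (simp add: matrix_vector_mul_assoc)
        show ?thesis
          unfolding score_deriv_def dir_shape_deriv_def at_true_parameter fst_conv snd_conv norm_minus_cancel
          by (simp add: matrix_vector_uminus matrix_vector_mult_diff_distrib inner_diff_right inner_diff_left
              matrix_vector_mul_lid power2_norm_eq_inner[symmetric] s s2
              add_divide_distrib diff_divide_distrib algebra_simps)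
      qed
    qed
    have q4: "integrable Z (\<lambda>z. ?w (norm z) * norm z ^ 4)" using integrable_w_quotient[of 2] by simp
    have m4: "(\<integral>z. ?w (norm z) * norm z ^ 4 \<partial>Z) = (\<integral>z. w (norm z) * norm z ^ 2 \<partial>Z)" using integral_w_quotient[of 2] by simp
    have wm: "?w \<in> borel_measurable borel" by measurable
    have four: "integrable Z (\<lambda>z. ?w (norm z) * ((z \<bullet> (B *v z)) * (z \<bullet> (D *v z))))" for B D :: "real^'k^'k"
    proof (rule Bochner_Integration.integrable_bound)
      show "integrable Z (\<lambda>z. (norm B * norm D) * (?w (norm z) * norm z ^ 4))" using q4 by (rule integrable_mult_right)
      have "\<bar>z \<bullet> (B *v z)\<bar> \<le> norm B * (norm z)\<^sup>2" for z :: "real^'k" and B :: "real^'k^'k"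
        using Cauchy_Schwarz_ineq2[of z "B *v z"] mult_left_mono[OF norm_matrix_vector_mult_le[of B z], of "norm z"]
        by (simp add: power2_eq_square mult_ac)
      then have "\<bar>z \<bullet> (B *v z)\<bar> * \<bar>z \<bullet> (D *v z)\<bar> \<le> (norm B * (norm z)\<^sup>2) * (norm D * (norm z)\<^sup>2)" for z :: "real^'k"
        by (intro mult_mono) auto
      from mult_left_mono[OF this, of "\<bar>a\<bar>" for a]
      have "norm (a * ((z \<bullet> (B *v z)) * (z \<bullet> (D *v z)))) \<le> norm ((norm B * norm D) * (a * norm z ^ 4))" for a and z :: "real^'k"
        by (simp add: abs_mult power4_eq_xxxx power2_eq_square mult_ac)
      then show "AE z in Z. norm (?w (norm z) * ((z \<bullet> (B *v z)) * (z \<bullet> (D *v z)))) \<le> norm ((norm B * norm D) * (?w (norm z) * norm z ^ 4))"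
        by (intro AE_I2)
    qed measurable
    have two: "integrable Z (\<lambda>z. u (norm z) * (z \<bullet> (B *v z)))" for B :: "real^'k^'k"
    proof (rule Bochner_Integration.integrable_bound)
      show "integrable Z (\<lambda>z. norm B * (u (norm z) * norm z ^ 2))" using integrable_u[of 2] by simp
      have "\<bar>z \<bullet> (B *v z)\<bar> \<le> norm B * (norm z)\<^sup>2" for z :: "real^'k"
        using Cauchy_Schwarz_ineq2[of z "B *v z"] mult_left_mono[OF norm_matrix_vector_mult_le[of B z], of "norm z"]
        by (simp add: power2_eq_square mult_ac)
      from mult_left_mono[OF this, of "\<bar>u (norm z)\<bar>" for z]
      show "AE z in Z. norm (u (norm z) * (z \<bullet> (B *v z))) \<le> norm (norm B * (u (norm z) * norm z ^ 2))"
        by (intro AE_I2) (simp add: abs_mult mult_ac)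
    qed measurable
    have lin: "(\<integral>z. f1 z / 2 - f2 z * a + 2 * f3 z - f4 z * b - f5 z * c \<partial>Z)
        = (\<integral>z. f1 z \<partial>Z) / 2 - (\<integral>z. f2 z \<partial>Z) * a + 2 * (\<integral>z. f3 z \<partial>Z) - (\<integral>z. f4 z \<partial>Z) * b - (\<integral>z. f5 z \<partial>Z) * c"
      if "integrable Z f1" "integrable Z f2" "integrable Z f3" "integrable Z f4" "integrable Z f5"
      for f1 f2 f3 f4 f5 :: "real^'k \<Rightarrow> real" and a b c
      using that by simp
    have I1: "(\<integral>z. ?W1 z \<partial>Z) = (\<integral>z. w (norm z) * norm z ^ 2 \<partial>Z) / (?k * (?k + 2)) * (trace A * trace ?E + 2 * trace (A ** ?E))"
      using fourth_moment[OF wm q4 A, of ?E] unfolding m4 .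
    have I2: "(\<integral>z. ?W2 z \<partial>Z) = (\<integral>z. w (norm z) * norm z ^ 2 \<partial>Z) / (?k * (?k + 2)) * (?k * trace ?E + 2 * trace ?E)"
      using fourth_moment[OF wm q4, of "mat 1" ?E] unfolding m4 by (simp add: transpose_mat trace_I matrix_mul_lid)
    have I3: "(\<integral>z. ?U1 z \<partial>Z) = (\<integral>z. ?U3 z \<partial>Z) / ?k * trace (A ** ?E)"
      "(\<integral>z. ?U2 z \<partial>Z) = (\<integral>z. ?U3 z \<partial>Z) / ?k * trace ?E"
      by (intro quadratic_moment integrable_u; measurable)+
    have "(\<integral>z. ?H z \<partial>Z) = (\<integral>z. ?W1 z \<partial>Z) / 2 - (\<integral>z. ?W2 z \<partial>Z) * (trace A / ?k / 2) + 2 * (\<integral>z. ?U1 z \<partial>Z)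
       - (\<integral>z. ?U2 z \<partial>Z) * (trace A / ?k) - (\<integral>z. ?U3 z \<partial>Z) * (trace (A ** ?E) / ?k)"
      by (rule lin[OF four[of A ?E] four[of "mat 1" ?E] two[of "A ** ?E"] two[of ?E] integrable_u[of 2]])
    also have "\<dots> = shape_gain * (trace (A ** ?E) - trace A * trace ?E / ?k)"
    proof -
      have k: "?k \<noteq> 0" "?k + 2 \<noteq> 0" by (simp, linarith)
      define m where "m = (\<integral>z. w (norm z) * norm z ^ 2 \<partial>Z) / (?k * (?k + 2))"
      define n where "n = (\<integral>z. ?U3 z \<partial>Z)"
      have g: "shape_gain = m + n / ?k" by (simp add: shape_gain_def m_def n_def)
      show ?thesis unfolding I1 I2 I3 m_def[symmetric] n_def[symmetric] g using k(1) by (simp add: field_simps)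
    qed
    finally show ?thesis unfolding ev .
  qed
  note inner = this
  have "(\<integral>x. score_deriv (dir_shape A) (dir_shape_deriv A) x t \<partial>(Z \<Otimes>\<^sub>M Q))
     = (\<integral>X. (\<integral>z. score_deriv (dir_shape A) (dir_shape_deriv A) (z, X) t \<partial>Z) \<partial>Q)"
    by (rule integral_pair[OF shape_deriv_facts(1)])
  also have "\<dots> = (\<integral>X. shape_gain * (trace (A ** ?E) - trace A * trace ?E / ?k) \<partial>Q)"
    by (rule Bochner_Integration.integral_cong[OF refl inner])
  finally show ?thesis by (simp add: Q.prob_space[unfolded space_Q])
qed

lemma score_at_true_parameter:
  "score (dir_mean h) x 0 = u (norm (fst x)) * (fst x \<bullet> (snd x *v h))"
  "score (dir_shape A) x 0 = u (norm (fst x)) * (fst x \<bullet> ((A - (trace A / real CARD('k)) *\<^sub>R mat 1) *v fst x))"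
  for x :: "(real^'k) \<times> (real^'q^'k)"
proof -
  have s: "sqrt (sqdist x 0) = norm (fst x)" by (simp add: at_true_parameter(3))
  show "score (dir_mean h) x 0 = u (norm (fst x)) * (fst x \<bullet> (snd x *v h))"
    by (simp add: score_def s at_true_parameter(4) inner_commute)
  show "score (dir_shape A) x 0 = u (norm (fst x)) * (fst x \<bullet> ((A - (trace A / real CARD('k)) *\<^sub>R mat 1) *v fst x))"
    by (simp add: score_def s at_true_parameter(5) matrix_vector_mult_diff_rdistrib
        scaleR_matrix_vector_assoc[symmetric] matrix_vector_mul_lid inner_diff_right power2_norm_eq_inner[symmetric] mult.commute)
qed

text \<open>
  The mean component is odd in the error, hence centred and uncorrelated with the even shape component.
  The shape component is centred because it is the quadratic form of a matrix of trace zero.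
\<close>

lemma score_moments:
  fixes A :: "real^'k^'k" and h :: "real^'q" and a b :: real
  assumes A: "transpose A = A"
  defines "g \<equiv> \<lambda>x. a * score (dir_mean h) x 0 + b * score (dir_shape A) x 0"
  shows "g \<in> borel_measurable borel"
    and "integrable (Z \<Otimes>\<^sub>M Q) (\<lambda>x. (g x)\<^sup>2)"
    and "(\<integral>x. g x \<partial>(Z \<Otimes>\<^sub>M Q)) = 0"
    and "(\<integral>x. (g x)\<^sup>2 \<partial>(Z \<Otimes>\<^sub>M Q)) =
       a\<^sup>2 * ((\<integral>z. (\<psi> (norm z))\<^sup>2 \<partial>Z) / real CARD('k)) * (\<integral>X. (X *v h) \<bullet> (X *v h) \<partial>Q)
       + b\<^sup>2 * (2 * (\<integral>z. (\<psi> (norm z))\<^sup>2 * (norm z)\<^sup>2 \<partial>Z) / (real CARD('k) * (real CARD('k) + 2)))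
         * (trace (A ** A) - (trace A)\<^sup>2 / real CARD('k))"
proof -
  let ?k = "real CARD('k)"
  let ?A0 = "A - (trace A / ?k) *\<^sub>R mat 1"
  have g: "g x = a * (u (norm (fst x)) * (fst x \<bullet> (snd x *v h))) + b * (u (norm (fst x)) * (fst x \<bullet> (?A0 *v fst x)))" for x
    unfolding g_def score_at_true_parameter ..
  show gm [measurable]: "g \<in> borel_measurable borel"
    unfolding g[abs_def] by measurable
  have gX [measurable]: "(\<lambda>z. g (z, X)) \<in> borel_measurable borel" for X
    unfolding g fst_conv snd_conv by measurable
  define B where "B = \<bar>a\<bar> * (C * c\<^sub>1 * norm h) + \<bar>b\<bar> * (C * c\<^sub>1 * (norm ?A0 * c\<^sub>1))"
  have B0: "B \<ge> 0" unfolding B_def using C(1) c1 by auto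
  have gB: "\<bar>g x\<bar> \<le> B * radius x" for x
  proof (cases "norm (fst x) \<ge> c\<^sub>1")
    case True
    have "radius x \<ge> 0" using c1 by (simp add: radius_def)
    then show ?thesis using True B0 by (simp add: g u_support)
  next
    case False
    let ?z = "fst x" and ?R = "radius x"
    have R: "?R \<ge> 1" "norm (snd x) \<le> ?R" using c1 by (auto simp: radius_def)
    have 1: "\<bar>?z \<bullet> (snd x *v h)\<bar> \<le> c\<^sub>1 * (?R * norm h)"
      using False R less_imp_le[OF c1] by (intro order_trans[OF Cauchy_Schwarz_ineq2] mult_mono order_trans[OF norm_matrix_vector_mult_le]) (auto intro: mult_right_mono)
    have 2: "\<bar>?z \<bullet> (?A0 *v ?z)\<bar> \<le> c\<^sub>1 * (norm ?A0 * c\<^sub>1)"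
      using False c1 by (intro order_trans[OF Cauchy_Schwarz_ineq2] mult_mono order_trans[OF norm_matrix_vector_mult_le]) (auto intro: mult_left_mono)
    have nn: "0 \<le> \<bar>b\<bar> * (C * (c\<^sub>1 * (norm ?A0 * c\<^sub>1)))"
      using less_imp_le[OF c1] less_imp_le[OF C(1)] by simp
    have "\<bar>g x\<bar> \<le> \<bar>a\<bar> * (\<bar>u (norm ?z)\<bar> * \<bar>?z \<bullet> (snd x *v h)\<bar>) + \<bar>b\<bar> * (\<bar>u (norm ?z)\<bar> * \<bar>?z \<bullet> (?A0 *v ?z)\<bar>)"
      unfolding g abs_mult[symmetric] by (rule abs_triangle_ineq)
    also have "\<dots> \<le> \<bar>a\<bar> * (C * (c\<^sub>1 * (?R * norm h))) + \<bar>b\<bar> * (C * (c\<^sub>1 * (norm ?A0 * c\<^sub>1)))"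
      using 1 2 C by (intro add_mono mult_left_mono mult_mono) (auto intro: less_imp_le)
    also have "\<dots> \<le> \<bar>a\<bar> * (C * (c\<^sub>1 * (?R * norm h))) + \<bar>b\<bar> * (C * (c\<^sub>1 * (norm ?A0 * c\<^sub>1))) * ?R"
      using mult_left_mono[OF R(1) nn] by simp
    also have "\<dots> = B * ?R" by (simp add: B_def algebra_simps)
    finally show ?thesis .
  qed
  have g2B: "(g x)\<^sup>2 \<le> B\<^sup>2 * (radius x)\<^sup>2" for x
    using power_mono[OF gB[of x], of 2] by (simp add: power_mult_distrib)
  show i2: "integrable (Z \<Otimes>\<^sub>M Q) (\<lambda>x. (g x)\<^sup>2)"
  proof (rule Bochner_Integration.integrable_bound)
    show "integrable (Z \<Otimes>\<^sub>M Q) (\<lambda>x. B\<^sup>2 * (radius x)\<^sup>2)" using radius_moment by simp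
  qed (use g2B in auto)
  have i1: "integrable (Z \<Otimes>\<^sub>M Q) g"
    by (rule ZQ.P.square_integrable_imp_integrable[OF _ i2]) simp
  have gXi: "integrable Z (\<lambda>z. g (z, X))" for X
    by (rule integrable_const_bound[where B="B * radius (0, X)"]) (use gB[of "(_, X)"] in \<open>auto simp: radius_def\<close>)
  have gX2i: "integrable Z (\<lambda>z. (g (z, X))\<^sup>2)" for X
    by (rule integrable_const_bound[where B="B\<^sup>2 * (radius (0, X))\<^sup>2"]) (use g2B[of "(_, X)"] in \<open>auto simp: radius_def\<close>)
  have tr0: "trace ?A0 = 0"
    by (simp add: trace_sub trace_scaleR trace_I)
  have "(\<integral>z. g (z, X) \<partial>Z) = (\<integral>z. b * (u (norm z) * (z \<bullet> (?A0 *v z))) \<partial>Z)" for X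
    by (rule integral_even_part[OF gXi gX]) (simp add: g matrix_vector_uminus)
  also have "\<dots> = 0" using quadratic_moment[OF u_measurable integrable_u, of ?A0] by (simp add: tr0)
  finally show "(\<integral>x. g x \<partial>(Z \<Otimes>\<^sub>M Q)) = 0" by (simp add: integral_pair[OF i1])
  have um: "(\<lambda>s. (u s)\<^sup>2) \<in> borel_measurable borel" by measurable
  have i4: "integrable Z (\<lambda>z. (u (norm z))\<^sup>2 * ((z \<bullet> (?A0 *v z)) * (z \<bullet> (?A0 *v z))))"
  proof (rule Bochner_Integration.integrable_bound)
    show "integrable Z (\<lambda>z. (norm ?A0)\<^sup>2 * ((u (norm z))\<^sup>2 * norm z ^ 4))" using integrable_u2[of 4] by simp
    have "\<bar>z \<bullet> (?A0 *v z)\<bar> \<le> norm ?A0 * (norm z)\<^sup>2" for z :: "real^'k"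
      using Cauchy_Schwarz_ineq2[of z "?A0 *v z"] mult_left_mono[OF norm_matrix_vector_mult_le[of ?A0 z], of "norm z"]
      by (simp add: power2_eq_square mult_ac)
    then have "\<bar>z \<bullet> (?A0 *v z)\<bar> * \<bar>z \<bullet> (?A0 *v z)\<bar> \<le> (norm ?A0 * (norm z)\<^sup>2) * (norm ?A0 * (norm z)\<^sup>2)" for z :: "real^'k"
      by (intro mult_mono) auto
    from mult_left_mono[OF this, of "\<bar>r\<bar>" for r]
    have "norm (r * ((z \<bullet> (?A0 *v z)) * (z \<bullet> (?A0 *v z)))) \<le> norm ((norm ?A0)\<^sup>2 * (r * norm z ^ 4))" for r and z :: "real^'k"
      by (simp only: real_norm_def abs_mult abs_power2 abs_norm_cancel power_abs[symmetric])
         (simp add: power4_eq_xxxx power2_eq_square mult_ac)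
    then show "AE z in Z. norm ((u (norm z))\<^sup>2 * ((z \<bullet> (?A0 *v z)) * (z \<bullet> (?A0 *v z)))) \<le> norm ((norm ?A0)\<^sup>2 * ((u (norm z))\<^sup>2 * norm z ^ 4))"
      by (intro AE_I2)
  qed measurable
  have A0: "transpose ?A0 = ?A0"
    using A by (simp add: vec_eq_iff transpose_def mat_def)
  have trA0: "trace (?A0 ** ?A0) = trace (A ** A) - (trace A)\<^sup>2 / ?k"
    by (simp add: matrix_diff_mult matrix_mult_diff trace_sub scalar_matrix_assoc[symmetric] matrix_scalar_ac
        matrix_mul_lid matrix_mul_rid trace_scaleR trace_I power2_eq_square)
  define m where "m = (\<integral>z. (\<psi> (norm z))\<^sup>2 \<partial>Z)"
  define n where "n = (\<integral>z. (\<psi> (norm z))\<^sup>2 * (norm z)\<^sup>2 \<partial>Z)"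
  have m: "(\<integral>z. (u (norm z))\<^sup>2 * norm z ^ 2 \<partial>Z) = m"
    unfolding m_def by (simp add: mult_u[symmetric] power_mult_distrib mult.commute)
  have n: "(\<integral>z. (u (norm z))\<^sup>2 * norm z ^ 4 \<partial>Z) = n"
    unfolding n_def by (intro Bochner_Integration.integral_cong refl)
      (simp add: mult_u[symmetric] power_mult_distrib power4_eq_xxxx power2_eq_square mult_ac)
  have inner: "(\<integral>z. (g (z, X))\<^sup>2 \<partial>Z) = a\<^sup>2 * (m / ?k * ((X *v h) \<bullet> (X *v h))) + b\<^sup>2 * (n / (?k * (?k + 2)) * (2 * (trace (A ** A) - (trace A)\<^sup>2 / ?k)))" for X
  proof -
    have "(\<integral>z. (g (z, X))\<^sup>2 \<partial>Z) = (\<integral>z. a\<^sup>2 * ((u (norm z))\<^sup>2 * ((z \<bullet> (X *v h)) * (z \<bullet> (X *v h)))) + b\<^sup>2 * ((u (norm z))\<^sup>2 * ((z \<bullet> (?A0 *v z)) * (z \<bullet> (?A0 *v z)))) \<partial>Z)"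
    proof (rule integral_even_part[OF gX2i])
      show "(\<lambda>z. (g (z, X))\<^sup>2) \<in> borel_measurable borel" by measurable
      show "(g (z, X))\<^sup>2 + (g (- z, X))\<^sup>2 = 2 * (a\<^sup>2 * ((u (norm z))\<^sup>2 * ((z \<bullet> (X *v h)) * (z \<bullet> (X *v h)))) + b\<^sup>2 * ((u (norm z))\<^sup>2 * ((z \<bullet> (?A0 *v z)) * (z \<bullet> (?A0 *v z)))))" for z
      proof -
        have "?A0 *v (- z) = - (?A0 *v z)" by (rule matrix_vector_uminus)
        then have gs: "g (z, X) = a * (u (norm z) * (z \<bullet> (X *v h))) + b * (u (norm z) * (z \<bullet> (?A0 *v z)))"
          "g (- z, X) = - (a * (u (norm z) * (z \<bullet> (X *v h)))) + b * (u (norm z) * (z \<bullet> (?A0 *v z)))"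
          by (simp_all only: g fst_conv snd_conv norm_minus_cancel inner_minus_left inner_minus_right minus_minus mult_minus_right)
        show ?thesis unfolding gs by (simp add: power2_eq_square algebra_simps)
      qed
    qed
    also have "\<dots> = a\<^sup>2 * (\<integral>z. (u (norm z))\<^sup>2 * ((z \<bullet> (X *v h)) * (z \<bullet> (X *v h))) \<partial>Z) + b\<^sup>2 * (\<integral>z. (u (norm z))\<^sup>2 * ((z \<bullet> (?A0 *v z)) * (z \<bullet> (?A0 *v z))) \<partial>Z)"
      using i4 integrable_two[OF um integrable_u2, of "X *v h" "X *v h"] by simp
    also have "(\<integral>z. (u (norm z))\<^sup>2 * ((z \<bullet> (X *v h)) * (z \<bullet> (X *v h))) \<partial>Z) = m / ?k * ((X *v h) \<bullet> (X *v h))"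
      using second_moment[OF um integrable_u2, of "X *v h" "X *v h"] unfolding m .
    also have "(\<integral>z. (u (norm z))\<^sup>2 * ((z \<bullet> (?A0 *v z)) * (z \<bullet> (?A0 *v z))) \<partial>Z) = n / (?k * (?k + 2)) * (2 * (trace (A ** A) - (trace A)\<^sup>2 / ?k))"
      using fourth_moment[OF um integrable_u2 A0, of ?A0] unfolding n tr0 trA0 by simp
    finally show ?thesis .
  qed
  have hX: "integrable Q (\<lambda>X. (X *v h) \<bullet> (X *v h))"
  proof (rule Bochner_Integration.integrable_bound)
    show "integrable Q (\<lambda>X. (norm X)\<^sup>2 * (norm h)\<^sup>2)" using design_moment by simp
    show "AE X in Q. norm ((X *v h) \<bullet> (X *v h)) \<le> norm ((norm X)\<^sup>2 * (norm h)\<^sup>2)"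
      by (intro AE_I2) (simp add: power2_norm_eq_inner[symmetric] power_mult_distrib[symmetric] norm_matrix_vector_mult_le power_mono)
  qed measurable
  have out: "(\<integral>X. a\<^sup>2 * (m / ?k * ((X *v h) \<bullet> (X *v h))) + c \<partial>Q) = a\<^sup>2 * (m / ?k * (\<integral>X. (X *v h) \<bullet> (X *v h) \<partial>Q)) + c" for c
    using hX by (simp add: Q.prob_space[unfolded space_Q])
  show "(\<integral>x. (g x)\<^sup>2 \<partial>(Z \<Otimes>\<^sub>M Q)) =
       a\<^sup>2 * ((\<integral>z. (\<psi> (norm z))\<^sup>2 \<partial>Z) / ?k) * (\<integral>X. (X *v h) \<bullet> (X *v h) \<partial>Q)
       + b\<^sup>2 * (2 * (\<integral>z. (\<psi> (norm z))\<^sup>2 * (norm z)\<^sup>2 \<partial>Z) / (?k * (?k + 2))) * (trace (A ** A) - (trace A)\<^sup>2 / ?k)"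
    unfolding integral_pair[OF i2] inner m_def[symmetric] n_def[symmetric] out by (simp add: mult_ac)
qed

end

section \<open>First-order conditions at a local minimum\<close>

lemma integral_empirical_measure:
  fixes f :: "'a::topological_space \<Rightarrow> real"
  assumes n: "n > 0" and f: "f \<in> borel_measurable borel"
  shows "(\<integral>x. f x \<partial>empirical_measure n s) = (\<Sum>i<n. f (s i)) / real n"
proof -
  have "(\<integral>x. f x \<partial>empirical_measure n s) = (\<integral>i. f (s i) \<partial>uniform_count_measure {..<n})"
    unfolding empirical_measure_def using f by (intro integral_distr) auto
  also have "\<dots> = (\<Sum>i<n. f (s i)) / real n"
    using n by (simp add: uniform_count_measure_def lebesgue_integral_point_measure_finite sum_divide_distrib)
  finally show ?thesis .
qed

lemma local_min_on_path:
  fixes p :: "real \<Rightarrow> 'a::topological_space"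
  assumes lm: "local_min_on D f (p 0)" and cont: "isCont p 0" and D: "\<forall>\<^sub>F t in at 0. p t \<in> D"
  obtains d where "d > 0" "\<And>t. \<bar>t\<bar> < d \<Longrightarrow> f (p 0) \<le> f (p t)"
proof -
  obtain S where S: "open S" "p 0 \<in> S" "\<And>y. y \<in> S \<Longrightarrow> y \<noteq> p 0 \<Longrightarrow> y \<in> D \<Longrightarrow> f (p 0) \<le> f y"
    using lm unfolding local_min_on_def eventually_at_topological by blast
  have "\<forall>\<^sub>F t in at 0. p t \<in> S" using cont S(1,2) unfolding isCont_def by (rule topological_tendstoD)
  then have "\<forall>\<^sub>F t in at 0. f (p 0) \<le> f (p t)"
    using D by eventually_elim (use S(3) in force)
  then obtain d where "d > 0" "\<And>t. t \<noteq> 0 \<Longrightarrow> \<bar>t\<bar> < d \<Longrightarrow> f (p 0) \<le> f (p t)"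
    unfolding eventually_at by (auto simp: dist_real_def)
  then show ?thesis using that[of d] by (metis order_refl)
qed

lemma has_real_derivative_of_quadratic_bound:
  fixes f :: "real \<Rightarrow> real"
  assumes d: "d > 0" and b: "\<And>t. \<bar>t\<bar> < d \<Longrightarrow> \<bar>f t - f 0 - t * l\<bar> \<le> K * t\<^sup>2"
  shows "(f has_real_derivative l) (at 0)"
proof -
  have "((\<lambda>h. (f (0 + h) - f 0) / h - l) \<longlongrightarrow> 0) (at 0)"
  proof (rule Lim_null_comparison)
    show "\<forall>\<^sub>F h in at 0. norm ((f (0 + h) - f 0) / h - l) \<le> K * \<bar>h\<bar>"
      unfolding eventually_at
    proof (intro exI[of _ d] conjI d ballI impI)
      fix h :: real assume "h \<noteq> 0 \<and> dist h 0 < d"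
      then have h: "h \<noteq> 0" "\<bar>h\<bar> < d" by (auto simp: dist_real_def)
      have "(f (0 + h) - f 0) / h - l = (f h - f 0 - h * l) / h" using h(1) by (simp add: field_simps)
      then have "norm ((f (0 + h) - f 0) / h - l) = \<bar>f h - f 0 - h * l\<bar> / \<bar>h\<bar>" by simp
      also have "\<dots> \<le> K * h\<^sup>2 / \<bar>h\<bar>" using b[OF h(2)] by (rule divide_right_mono) simp
      also have "\<dots> = K * \<bar>h\<bar>" using h(1) by (simp add: power2_eq_square field_simps abs_mult_self_eq)
      finally show "norm ((f (0 + h) - f 0) / h - l) \<le> K * \<bar>h\<bar>" .
    qed
    have "((\<lambda>h. K * \<bar>h\<bar>) \<longlongrightarrow> K * \<bar>0\<bar>) (at (0::real))" by (intro tendsto_intros)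
    then show "((\<lambda>h. K * \<bar>h\<bar>) \<longlongrightarrow> 0) (at (0::real))" by simp
  qed
  then show ?thesis unfolding DERIV_def by (simp add: LIM_zero_iff)
qed

locale smooth_loss = bounded_loss \<psi> \<psi>' c\<^sub>1 for \<psi> \<psi>' c\<^sub>1 +
  fixes \<rho> :: "real \<Rightarrow> real"
  assumes \<rho>_0: "\<rho> 0 = 0" and \<rho>_deriv: "\<And>s. (\<rho> has_real_derivative \<psi> s) (at s)"
begin

lemma \<rho>_quadratic: "s \<ge> 0 \<Longrightarrow> \<bar>\<rho> s\<bar> \<le> C * s\<^sup>2"
proof -
  assume s: "s \<ge> 0"
  have "\<bar>\<rho> s - \<rho> 0\<bar> \<le> (C * s) * \<bar>s - 0\<bar>"
  proof (rule field_differentiable_bound[of "{0..s}" \<rho> \<psi> "C * s", unfolded real_norm_def])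
    fix x assume x: "x \<in> {0..s}"
    then show "(\<rho> has_real_derivative \<psi> x) (at x within {0..s})"
      using \<rho>_deriv by (auto intro: has_field_derivative_at_within)
    have "\<bar>x * u x\<bar> \<le> s * C" unfolding abs_mult using x C(2)[of x] by (intro mult_mono) auto
    then show "\<bar>\<psi> x\<bar> \<le> C * s" by (simp add: mult_u mult.commute)
  qed (use s in auto)
  then show ?thesis using s by (simp add: \<rho>_0 power2_eq_square)
qed

text \<open>
  The square root is not differentiable at \<open>0\<close>; there the quadratic growth of the loss takes over,
  since a nonnegative \<open>q\<close> that vanishes at \<open>0\<close> has derivative \<open>0\<close> as well.
\<close>

lemma \<rho>_sqrt_has_derivative:
  assumes q: "(q has_real_derivative q') (at 0)" and d: "d > 0" and nn: "\<And>t. \<bar>t\<bar> < d \<Longrightarrow> 0 \<le> q t"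
  shows "((\<lambda>t. \<rho> (sqrt (q t))) has_real_derivative u (sqrt (q 0)) / 2 * q') (at 0)"
proof (cases "q 0 = 0")
  case False
  then have q0: "q 0 > 0" using nn[of 0] d by (simp add: le_less)
  have "((\<lambda>t. \<rho> (sqrt (q t))) has_real_derivative \<psi> (sqrt (q 0)) * (inverse (sqrt (q 0)) / 2 * q')) (at 0)"
    by (intro DERIV_chain2[where f=\<rho>] \<rho>_deriv DERIV_chain2[where f=sqrt and g=q] DERIV_real_sqrt q q0)
  moreover have "\<psi> (sqrt (q 0)) * (inverse (sqrt (q 0)) / 2 * q') = u (sqrt (q 0)) / 2 * q'"
    using q0 by (simp add: u_def field_simps)
  ultimately show ?thesis by (simp only:)
next
  case True
  have q'0: "q' = 0"
    by (rule DERIV_local_min[OF q d]) (use nn True in auto)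
  have "((\<lambda>h. (\<rho> (sqrt (q (0 + h))) - \<rho> (sqrt (q 0))) / h) \<longlongrightarrow> 0) (at 0)"
  proof (rule Lim_null_comparison)
    show "\<forall>\<^sub>F h in at 0. norm ((\<rho> (sqrt (q (0 + h))) - \<rho> (sqrt (q 0))) / h) \<le> C * \<bar>(q (0 + h) - q 0) / h\<bar>"
      unfolding eventually_at
    proof (intro exI[of _ d] conjI d ballI impI)
      fix h :: real assume "h \<noteq> 0 \<and> dist h 0 < d"
      then have h: "h \<noteq> 0" "\<bar>h\<bar> < d" by (auto simp: dist_real_def)
      have "\<bar>\<rho> (sqrt (q h))\<bar> \<le> C * q h" using \<rho>_quadratic[of "sqrt (q h)"] nn[OF h(2)] by simp
      then have "\<bar>\<rho> (sqrt (q h))\<bar> / \<bar>h\<bar> \<le> C * q h / \<bar>h\<bar>" by (rule divide_right_mono) simp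
      then show "norm ((\<rho> (sqrt (q (0 + h))) - \<rho> (sqrt (q 0))) / h) \<le> C * \<bar>(q (0 + h) - q 0) / h\<bar>"
        using nn[OF h(2)] by (simp add: True \<rho>_0 abs_divide)
    qed
    have "((\<lambda>h. C * \<bar>(q (0 + h) - q 0) / h\<bar>) \<longlongrightarrow> C * \<bar>q'\<bar>) (at 0)"
      by (intro tendsto_intros) (use q in \<open>simp add: DERIV_def\<close>)
    then show "((\<lambda>h. C * \<bar>(q (0 + h) - q 0) / h\<bar>) \<longlongrightarrow> 0) (at 0)" by (simp add: q'0)
  qed
  then show ?thesis using q'0 by (simp add: DERIV_def)
qed

lemma sum_stationary:
  fixes q :: "nat \<Rightarrow> real \<Rightarrow> real"
  assumes q: "\<And>i. (q i has_real_derivative q' i) (at 0)" and d: "d > 0" and nn: "\<And>i t. \<bar>t\<bar> < d \<Longrightarrow> 0 \<le> q i t"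
    and min: "\<And>t. \<bar>t\<bar> < d \<Longrightarrow> (\<Sum>i<n. \<rho> (sqrt (q i 0))) \<le> (\<Sum>i<n. \<rho> (sqrt (q i t)))"
  shows "(\<Sum>i<n. u (sqrt (q i 0)) * q' i) = 0"
proof -
  have "((\<lambda>t. \<Sum>i<n. \<rho> (sqrt (q i t))) has_real_derivative (\<Sum>i<n. u (sqrt (q i 0)) / 2 * q' i)) (at 0)"
    by (intro DERIV_sum \<rho>_sqrt_has_derivative[OF q d nn])
  then have "(\<Sum>i<n. u (sqrt (q i 0)) / 2 * q' i) = 0"
    by (rule DERIV_local_min[OF _ d]) (use min in auto)
  then show ?thesis by (simp add: sum_divide_distrib[symmetric])
qed

end

lemma mahalanobis_scaled:
  assumes "\<sigma> > 0"
  shows "mahalanobis A r / \<sigma> = sqrt (r \<bullet> (matrix_inv A *v r) / \<sigma>\<^sup>2)"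
  using assms by (simp add: mahalanobis_def real_sqrt_divide)

lemma linear_combination_path:
  fixes L :: "'l::finite \<Rightarrow> real^'k^'k"
  shows "(\<Sum>j\<in>UNIV. (c *\<^sub>R (\<gamma> + t *\<^sub>R a)) $ j *\<^sub>R L j) = c *\<^sub>R ((\<Sum>j\<in>UNIV. \<gamma> $ j *\<^sub>R L j) + t *\<^sub>R (\<Sum>j\<in>UNIV. a $ j *\<^sub>R L j))"
  by (simp add: scaleR_sum_right sum.distrib scaleR_add_left scaleR_add_right mult.assoc)

lemma det_path_has_derivative:
  fixes J :: "real^'k^'k"
  shows "((\<lambda>t. det (mat 1 + t *\<^sub>R J)) has_real_derivative trace J) (at 0)"
proof -
  have 1: "((\<lambda>t. mat 1 + t *\<^sub>R J) has_derivative (\<lambda>t. t *\<^sub>R J)) (at 0)"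
    by (auto intro!: derivative_eq_intros)
  have "(det has_derivative trace) (at (mat 1 + 0 *\<^sub>R J))" by (simp add: det_has_derivative_at_mat_1)
  from diff_chain_at[OF 1 this]
  have "((\<lambda>t. det (mat 1 + t *\<^sub>R J)) has_derivative (\<lambda>t. trace (t *\<^sub>R J))) (at 0)"
    by (simp add: o_def)
  moreover have "(\<lambda>t. trace (t *\<^sub>R J)) = (*) (trace J)" by (simp add: fun_eq_iff trace_scaleR)
  ultimately show ?thesis by (simp add: has_field_derivative_def)
qed

lemma inverse_path_has_derivative:
  fixes J :: "real^'k^'k"
  shows "((\<lambda>t. r \<bullet> (matrix_inv (mat 1 + t *\<^sub>R J) *v v)) has_real_derivative - (r \<bullet> (J *v v))) (at 0)"
proof (rule has_real_derivative_of_quadratic_bound)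
  let ?N = "norm (mat 1 :: real^'k^'k)"
  show "1 / (2 * (norm J + 1)) > 0" by (simp add: add_nonneg_pos)
  fix t :: real assume t: "\<bar>t\<bar> < 1 / (2 * (norm J + 1))"
  have "norm (t *\<^sub>R J) \<le> \<bar>t\<bar> * (norm J + 1)" by (simp add: mult_left_mono)
  also have "\<dots> \<le> 1 / (2 * (norm J + 1)) * (norm J + 1)"
    using t by (intro mult_right_mono) auto
  also have "\<dots> = 1 / 2"
  proof -
    have "norm J + 1 > 0" by (simp add: add_nonneg_pos)
    then show ?thesis by simp
  qed
  finally have h: "norm (t *\<^sub>R J) \<le> 1 / 2" .
  let ?R = "matrix_inv (mat 1 + t *\<^sub>R J) - mat 1 + t *\<^sub>R J"
  have m0: "matrix_inv (mat 1 :: real^'k^'k) = mat 1" by (rule matrix_inv_eqI) (simp add: matrix_mul_lid)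
  have "r \<bullet> (matrix_inv (mat 1 + t *\<^sub>R J) *v v) - r \<bullet> (matrix_inv (mat 1 + 0 *\<^sub>R J) *v v) - t * - (r \<bullet> (J *v v)) = r \<bullet> (?R *v v)"
    by (simp add: m0 matrix_vector_mult_add_rdistrib matrix_vector_mult_diff_rdistrib inner_add_right inner_diff_right
        scaleR_matrix_vector_assoc[symmetric])
  also have "\<bar>\<dots>\<bar> \<le> norm r * (norm ?R * norm v)"
    by (rule order_trans[OF Cauchy_Schwarz_ineq2 mult_left_mono[OF norm_matrix_vector_mult_le]]) simp
  also have "\<dots> \<le> norm r * (2 * ?N * (norm (t *\<^sub>R J))\<^sup>2 * norm v)"
    by (intro mult_left_mono mult_right_mono inv_mat_1_plus_expand(2)[OF h]) auto
  also have "\<dots> = (norm r * 2 * ?N * (norm J)\<^sup>2 * norm v) * t\<^sup>2" by (simp add: power_mult_distrib)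
  finally show "\<bar>r \<bullet> (matrix_inv (mat 1 + t *\<^sub>R J) *v v) - r \<bullet> (matrix_inv (mat 1 + 0 *\<^sub>R J) *v v) - t * - (r \<bullet> (J *v v))\<bar>
    \<le> (norm r * 2 * ?N * (norm J)\<^sup>2 * norm v) * t\<^sup>2" .
qed

locale structured_fit = smooth_loss \<psi> \<psi>' c\<^sub>1 \<rho> for \<psi> \<psi>' c\<^sub>1 \<rho> +
  fixes \<Theta> :: "(real^'l::finite) set" and V :: "real^'l \<Rightarrow> real^'k^'k" and L :: "'l \<Rightarrow> real^'k^'k"
  assumes open_\<Theta>: "open \<Theta>" and V_PDS: "V ` \<Theta> \<subseteq> PDS"
    and V_linear: "\<And>\<gamma>. \<gamma> \<in> \<Theta> \<Longrightarrow> V \<gamma> = (\<Sum>j\<in>UNIV. \<gamma> $ j *\<^sub>R L j)"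
begin

definition comb :: "real^'l \<Rightarrow> real^'k^'k" where "comb a = (\<Sum>j\<in>UNIV. a $ j *\<^sub>R L j)"

lemma objective_empirical:
  fixes s :: "nat \<Rightarrow> (real^'k) \<times> (real^'q^'k)"
  assumes n: "n > 0" and \<sigma>: "\<sigma> (empirical_measure n s) > 0"
  shows "objective \<rho> \<sigma> (empirical_measure n s) \<beta> A =
    (\<Sum>i<n. \<rho> (sqrt ((fst (s i) - snd (s i) *v \<beta>) \<bullet> (matrix_inv A *v (fst (s i) - snd (s i) *v \<beta>)) / (\<sigma> (empirical_measure n s))\<^sup>2))) / real n"
proof -
  have "continuous_on UNIV \<rho>"
    using \<rho>_deriv by (intro DERIV_continuous_on) (auto intro: has_field_derivative_at_within)
  then have "continuous_on UNIV (\<lambda>x. \<rho> (sqrt ((fst x - snd x *v \<beta>) \<bullet> (matrix_inv A *v (fst x - snd x *v \<beta>)) / (\<sigma> (empirical_measure n s))\<^sup>2)))"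
    by (rule continuous_on_compose2) (use \<sigma> in \<open>auto intro!: continuous_intros\<close>)
  then show ?thesis
    unfolding objective_def mahalanobis_scaled[OF \<sigma>] split_beta'
    by (intro integral_empirical_measure n borel_measurable_continuous_onI)
qed

context
  fixes s :: "nat \<Rightarrow> (real^'k) \<times> (real^'q^'k)" and n :: nat and \<sigma> \<beta> \<gamma>
  assumes n: "n > 0" and \<sigma>: "\<sigma> (empirical_measure n s) > 0"
    and lm: "local_min_on (feasible \<Theta> V) (\<lambda>(\<beta>, \<gamma>). objective \<rho> \<sigma> (empirical_measure n s) \<beta> (V \<gamma>)) (\<beta>, \<gamma>)"
begin

private abbreviation (input) "sg \<equiv> \<sigma> (empirical_measure n s)"
private abbreviation (input) "W \<equiv> matrix_inv (V \<gamma>)"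
private abbreviation (input) "r i \<equiv> fst (s i) - snd (s i) *v \<beta>"

lemma feasible_min: "\<gamma> \<in> \<Theta>" "V \<gamma> \<in> PDS" "det (V \<gamma>) = 1"
  using lm by (auto simp: local_min_on_def feasible_def)

lemma stationary_mean:
  "(\<Sum>i<n. u (sqrt (r i \<bullet> (W *v r i) / sg\<^sup>2)) * (r i \<bullet> (W *v (snd (s i) *v h)))) = 0"
proof -
  let ?X = "\<lambda>i. snd (s i) *v h"
  define q where "q i t = (r i - t *\<^sub>R ?X i) \<bullet> (W *v (r i - t *\<^sub>R ?X i)) / sg\<^sup>2" for i t
  have Wsym: "x \<bullet> (W *v y) = y \<bullet> (W *v x)" for x y
    using inner_matrix_transpose[of x W y] PDS_transpose[OF PDS_matrix_inv[OF feasible_min(2)]] by (simp add: inner_commute)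
  have Wnn: "0 \<le> x \<bullet> (W *v x)" for x
    using PDS_pos[OF PDS_matrix_inv[OF feasible_min(2)], of x] by (cases "x = 0") auto
  have exp: "(x - t *\<^sub>R y) \<bullet> (W *v (x - t *\<^sub>R y)) = x \<bullet> (W *v x) - t * (2 * (x \<bullet> (W *v y))) + t * t * (y \<bullet> (W *v y))" for x y t
    using Wsym[of y x]
    by (simp add: matrix_vector_mult_diff_distrib matrix_vector_mult_scaleR inner_diff_left inner_diff_right algebra_simps)
  have qexp: "q i t = (r i \<bullet> (W *v r i) - t * (2 * (r i \<bullet> (W *v ?X i))) + t * t * (?X i \<bullet> (W *v ?X i))) / sg\<^sup>2" for i t
    unfolding q_def exp ..
  have dq: "(q i has_real_derivative - 2 * (r i \<bullet> (W *v ?X i)) / sg\<^sup>2) (at 0)" for i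
  proof -
    have "((\<lambda>t. A - t * B + t * t * D) has_real_derivative - B) (at 0)" for A B D :: real
      by (auto intro!: derivative_eq_intros)
    from DERIV_cdivide[OF this] show ?thesis unfolding qexp[abs_def] mult_minus_left by blast
  qed
  define F where "F = (\<lambda>(\<beta>, \<gamma>). objective \<rho> \<sigma> (empirical_measure n s) \<beta> (V \<gamma>))"
  define p where "p t = (\<beta> + t *\<^sub>R h, \<gamma>)" for t :: real
  have lm': "local_min_on (feasible \<Theta> V) F (p 0)" using lm by (simp add: p_def F_def)
  have obj: "F (p t) = (\<Sum>i<n. \<rho> (sqrt (q i t))) / real n" for t
  proof -
    have "fst (s i) - snd (s i) *v (\<beta> + t *\<^sub>R h) = r i - t *\<^sub>R ?X i" for i
      by (simp add: matrix_vector_right_distrib matrix_vector_mult_scaleR)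
    then show ?thesis
      unfolding F_def p_def split objective_empirical[of n \<sigma> s, OF n \<sigma>] q_def by presburger
  qed
  have contp: "isCont p 0" unfolding p_def by (intro continuous_intros)
  have "\<forall>\<^sub>F t in at 0. p t \<in> feasible \<Theta> V"
    using feasible_min by (intro always_eventually) (auto simp: p_def feasible_def)
  then obtain d where d: "d > 0" "\<And>t. \<bar>t\<bar> < d \<Longrightarrow> F (p 0) \<le> F (p t)"
    using local_min_on_path[OF lm' contp] by blast
  have "(\<Sum>i<n. u (sqrt (q i 0)) * (- 2 * (r i \<bullet> (W *v ?X i)) / sg\<^sup>2)) = 0"
  proof (rule sum_stationary[OF dq d(1)])
    show "0 \<le> q i t" for i t unfolding q_def using Wnn by simp
    show "\<bar>t\<bar> < d \<Longrightarrow> (\<Sum>i<n. \<rho> (sqrt (q i 0))) \<le> (\<Sum>i<n. \<rho> (sqrt (q i t)))" for t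
      using d(2)[of t] n unfolding obj by (simp add: divide_le_cancel)
  qed
  also have "(\<Sum>i<n. u (sqrt (q i 0)) * (- 2 * (r i \<bullet> (W *v ?X i)) / sg\<^sup>2))
      = - 2 / sg\<^sup>2 * (\<Sum>i<n. u (sqrt (r i \<bullet> (W *v r i) / sg\<^sup>2)) * (r i \<bullet> (W *v ?X i)))"
    by (simp add: q_def sum_distrib_left mult_ac)
  finally show ?thesis using \<sigma> by simp
qed

text \<open>
  Rescaling to determinant one keeps the path \<open>\<gamma> + t *\<^sub>R a\<close> inside the feasible set; this is where
  openness of \<open>\<Theta>\<close> and the linear structure enter.
\<close>

lemma stationary_shape:
  "(\<Sum>i<n. u (sqrt (r i \<bullet> (W *v r i) / sg\<^sup>2)) *
     ((r i \<bullet> (W *v r i)) * trace (W ** comb a) / real CARD('k) - r i \<bullet> (W *v (comb a *v (W *v r i))))) = 0"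
proof -
  let ?k = "real CARD('k)"
  have inv: "invertible (V \<gamma>)" by (rule PDS_invertible[OF feasible_min(2)])
  define J where "J = W ** comb a"
  define D where "D t = det (mat 1 + t *\<^sub>R J)" for t
  define c where "c t = D t powr (- 1 / ?k)" for t
  define g where "g t = c t *\<^sub>R (\<gamma> + t *\<^sub>R a)" for t
  have V\<gamma>: "V \<gamma> = comb \<gamma>" unfolding comb_def by (rule V_linear[OF feasible_min(1)])
  have path: "comb (\<gamma> + t *\<^sub>R a) = V \<gamma> ** (mat 1 + t *\<^sub>R J)" for t
  proof -
    have "comb (\<gamma> + t *\<^sub>R a) = V \<gamma> + t *\<^sub>R comb a"
      using linear_combination_path[where c=1 and \<gamma>=\<gamma> and t=t and a=a and L=L] by (simp add: comb_def V\<gamma>)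
    also have "t *\<^sub>R comb a = V \<gamma> ** (t *\<^sub>R J)"
      unfolding J_def by (simp add: matrix_scalar_ac matrix_mul_assoc matrix_inv_right[OF inv] matrix_mul_lid scalar_matrix_assoc[symmetric])
    finally show ?thesis by (simp add: matrix_add_ldistrib matrix_mul_rid)
  qed
  have combg: "comb (g t) = c t *\<^sub>R (V \<gamma> ** (mat 1 + t *\<^sub>R J))" for t
    using linear_combination_path[where c="c t" and \<gamma>=\<gamma> and t=t and a=a and L=L]
      linear_combination_path[where c=1 and \<gamma>=\<gamma> and t=t and a=a and L=L] path[of t]
    by (simp add: g_def comb_def)
  have dD: "(D has_real_derivative trace J) (at 0)" unfolding D_def by (rule det_path_has_derivative)
  have D0: "D 0 = 1" by (simp add: D_def det_I)
  have contD: "isCont D 0" using dD by (rule DERIV_isCont)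
  have contc: "isCont c 0" unfolding c_def using contD D0 by (intro continuous_intros) auto
  have contg: "isCont g 0" unfolding g_def using contc by (intro continuous_intros)
  have g0: "g 0 = \<gamma>" by (simp add: g_def c_def D0)
  have ev: "\<forall>\<^sub>F t in nhds 0. g t \<in> \<Theta> \<and> D t > 0 \<and> norm (t *\<^sub>R J) \<le> 1 / 2"
  proof (intro eventually_conj)
    show "\<forall>\<^sub>F t in nhds 0. g t \<in> \<Theta>"
      using contg open_\<Theta> feasible_min(1) g0 by (auto simp: isCont_def eventually_nhds_conv_at tendsto_def)
    show "\<forall>\<^sub>F t in nhds 0. D t > 0"
      using contD D0 order_tendstoD(1)[of D "D 0" "at 0" 0] by (auto simp: isCont_def eventually_nhds_conv_at)
    have "isCont (\<lambda>t. norm (t *\<^sub>R J)) 0" by (intro continuous_intros)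
    then have "\<forall>\<^sub>F t in at 0. norm (t *\<^sub>R J) < 1 / 2"
      unfolding isCont_def by (rule order_tendstoD(2)) simp
    then show "\<forall>\<^sub>F t in nhds 0. norm (t *\<^sub>R J) \<le> 1 / 2" by (auto simp: eventually_nhds_conv_at elim!: eventually_mono)
  qed
  then obtain d1 where d1: "d1 > 0" "\<And>t. \<bar>t\<bar> < d1 \<Longrightarrow> g t \<in> \<Theta> \<and> D t > 0 \<and> norm (t *\<^sub>R J) \<le> 1 / 2"
    unfolding eventually_nhds_metric by (auto simp: dist_real_def)
  have Vg: "V (g t) = c t *\<^sub>R (V \<gamma> ** (mat 1 + t *\<^sub>R J))" if "\<bar>t\<bar> < d1" for t
    using V_linear[of "g t"] d1(2)[OF that] combg[of t] by (simp add: comb_def)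
  have feas: "(\<beta>, g t) \<in> feasible \<Theta> V" if t: "\<bar>t\<bar> < d1" for t
  proof -
    have "det (V (g t)) = c t ^ CARD('k) * D t"
      unfolding Vg[OF t] det_scaleR det_mul D_def using feasible_min(3) by simp
    also have "c t ^ CARD('k) = c t powr ?k"
      using d1(2)[OF t] by (simp add: c_def powr_realpow)
    also have "c t powr ?k = D t powr (- 1)"
      unfolding c_def powr_powr by simp
    also have "\<dots> * D t = 1"
      using d1(2)[OF t] by (simp add: powr_minus)
    finally have "det (V (g t)) = 1" .
    moreover have "g t \<in> \<Theta>" using d1(2)[OF t] by blast
    ultimately show ?thesis using V_PDS by (simp add: feasible_def image_subset_iff)
  qed
  have invg: "matrix_inv (V (g t)) = D t powr (1 / ?k) *\<^sub>R (matrix_inv (mat 1 + t *\<^sub>R J) ** W)" if t: "\<bar>t\<bar> < d1" for t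
  proof -
    have i1: "invertible (mat 1 + t *\<^sub>R J)" using d1(2)[OF t] by (intro invertible_mat_1_plus) auto
    have "c t \<noteq> 0" using d1(2)[OF t] by (simp add: c_def)
    moreover have "1 / c t = D t powr (1 / ?k)" using d1(2)[OF t] by (simp add: c_def powr_minus field_simps)
    ultimately show ?thesis
      unfolding Vg[OF t] using inv i1 by (simp add: matrix_inv_scaleR matrix_inv_mult invertible_mult)
  qed
  define q where "q i t = D t powr (1 / ?k) * (r i \<bullet> (matrix_inv (mat 1 + t *\<^sub>R J) *v (W *v r i))) / sg\<^sup>2" for i t
  have m0: "matrix_inv (mat 1 :: real^'k^'k) = mat 1" by (rule matrix_inv_eqI) (simp add: matrix_mul_lid)
  have q0: "q i 0 = r i \<bullet> (W *v r i) / sg\<^sup>2" for i by (simp add: q_def D0 m0 matrix_vector_mul_lid)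
  have qV: "q i t = r i \<bullet> (matrix_inv (V (g t)) *v r i) / sg\<^sup>2" if "\<bar>t\<bar> < d1" for i t
    unfolding invg[OF that] q_def by (simp add: scaleR_matrix_vector_assoc[symmetric] matrix_vector_mul_assoc)
  have deriv: "((\<lambda>t. D t powr (1 / ?k) * (x \<bullet> (matrix_inv (mat 1 + t *\<^sub>R J) *v v)) / sg\<^sup>2) has_real_derivative
     ((x \<bullet> v) * trace J / ?k - x \<bullet> (J *v v)) / sg\<^sup>2) (at 0)" for x v :: "real^'k"
  proof -
    have "((\<lambda>t. D t powr (1 / ?k)) has_real_derivative (1 / ?k) * D 0 powr (1 / ?k - 1) * trace J) (at 0)"
      using dD D0 by (intro has_real_derivative_powr[THEN DERIV_chain2]) auto
    from DERIV_cdivide[OF DERIV_mult[OF this inverse_path_has_derivative[of x J v]], of "sg\<^sup>2"]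
    show ?thesis by (rule DERIV_cong) (simp add: D0 m0 matrix_vector_mul_lid algebra_simps)
  qed
  have dq: "(q i has_real_derivative ((r i \<bullet> (W *v r i)) * trace J / ?k - r i \<bullet> (J *v (W *v r i))) / sg\<^sup>2) (at 0)" for i
    unfolding q_def by (rule deriv)
  define F where "F = (\<lambda>(\<beta>, \<gamma>). objective \<rho> \<sigma> (empirical_measure n s) \<beta> (V \<gamma>))"
  define p where "p t = (\<beta>, g t)" for t :: real
  have lm': "local_min_on (feasible \<Theta> V) F (p 0)" using lm by (simp add: p_def F_def g0)
  have contp: "isCont p 0" unfolding p_def using contg by (intro continuous_intros)
  have "\<forall>\<^sub>F t in at 0. p t \<in> feasible \<Theta> V"
    unfolding eventually_at p_def using d1(1) feas by (intro exI[of _ d1]) (simp add: dist_real_def)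
  then obtain d2 where d2: "d2 > 0" "\<And>t. \<bar>t\<bar> < d2 \<Longrightarrow> F (p 0) \<le> F (p t)"
    using local_min_on_path[OF lm' contp] by blast
  have obj: "F (p t) = (\<Sum>i<n. \<rho> (sqrt (q i t))) / real n" if "\<bar>t\<bar> < d1" for t
    unfolding F_def p_def split objective_empirical[of n \<sigma> s, OF n \<sigma>] qV[OF that] ..
  define d where "d = min d1 d2"
  have d: "d > 0" using d1(1) d2(1) by (simp add: d_def)
  have "(\<Sum>i<n. u (sqrt (q i 0)) * (((r i \<bullet> (W *v r i)) * trace J / ?k - r i \<bullet> (J *v (W *v r i))) / sg\<^sup>2)) = 0"
  proof (rule sum_stationary[OF dq d])
    fix i t assume t: "\<bar>t\<bar> < d"
    then have t1: "\<bar>t\<bar> < d1" by (simp add: d_def)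
    have "V (g t) \<in> PDS" using d1(2)[OF t1] V_PDS by auto
    from PDS_pos[OF PDS_matrix_inv[OF this], of "r i"]
    have "0 \<le> r i \<bullet> (matrix_inv (V (g t)) *v r i)" by (cases "r i = 0") auto
    then show "0 \<le> q i t" unfolding qV[OF t1] by simp
  next
    fix t assume t: "\<bar>t\<bar> < d"
    then have "(\<Sum>i<n. \<rho> (sqrt (q i 0))) / real n \<le> (\<Sum>i<n. \<rho> (sqrt (q i t))) / real n"
      using d2(2)[of t] obj[of 0] obj[of t] d1(1) by (simp add: d_def)
    then show "(\<Sum>i<n. \<rho> (sqrt (q i 0))) \<le> (\<Sum>i<n. \<rho> (sqrt (q i t)))" using n by (simp add: divide_le_cancel)
  qed
  also have "(\<Sum>i<n. u (sqrt (q i 0)) * (((r i \<bullet> (W *v r i)) * trace J / ?k - r i \<bullet> (J *v (W *v r i))) / sg\<^sup>2))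
      = (\<Sum>i<n. u (sqrt (q i 0)) * ((r i \<bullet> (W *v r i)) * trace J / ?k - r i \<bullet> (J *v (W *v r i)))) / sg\<^sup>2"
    by (simp add: sum_divide_distrib)
  finally show ?thesis using \<sigma> unfolding q0 by (simp add: J_def matrix_vector_mul_assoc matrix_mul_assoc)
qed

end

end

section \<open>Asymptotic linearity\<close>

lemma (in prob_space) whp_small_of_root_n_bounded:
  assumes b: "bounded_in_probability M (\<lambda>n \<omega>. sqrt (real n) * X n \<omega>)"
    and [measurable]: "\<And>n. X n \<in> borel_measurable M" and e: "e > 0"
  shows "with_high_probability M (\<lambda>n \<omega>. \<bar>X n \<omega>\<bar> \<le> e)"
proof (rule whp_mult_bounded_in_probability[OF _ b _ e])
  fix r :: real assume r: "r > 0"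
  have "\<forall>\<^sub>F n in sequentially. sqrt (real n) \<ge> 1 / r"
    by (intro eventually_sequentiallyI[of "nat \<lceil>(1 / r)\<^sup>2\<rceil>"] real_le_rsqrt) linarith
  then have ev: "\<forall>\<^sub>F n in sequentially. \<forall>\<omega>\<in>space M. True \<longrightarrow> \<bar>X n \<omega>\<bar> \<le> r * \<bar>sqrt (real n) * X n \<omega>\<bar>"
  proof (rule eventually_mono, intro ballI impI)
    fix n \<omega> assume "1 / r \<le> sqrt (real n)"
    then have "1 \<le> r * sqrt (real n)" using r by (simp add: field_simps)
    from mult_right_mono[OF this, of "\<bar>X n \<omega>\<bar>"]
    show "\<bar>X n \<omega>\<bar> \<le> r * \<bar>sqrt (real n) * X n \<omega>\<bar>" by (simp add: abs_mult mult.assoc)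
  qed
  show "with_high_probability M (\<lambda>n \<omega>. \<bar>X n \<omega>\<bar> \<le> r * \<bar>sqrt (real n) * X n \<omega>\<bar>)"
    by (rule whp_eventually_mono[OF _ ev], rule whp_AE) simp
qed measurable

lemma (in prob_space) bounded_in_probability_cmult:
  assumes "bounded_in_probability M X"
  shows "bounded_in_probability M (\<lambda>n \<omega>. c * X n \<omega>)"
  unfolding bounded_in_probability_def
proof (intro allI impI)
  fix \<eta> :: real assume "\<eta> > 0"
  then obtain K where K: "\<forall>\<^sub>F n in sequentially. \<exists>A\<in>sets M. measure M A \<ge> 1 - \<eta> \<and> (\<forall>\<omega>\<in>A. \<bar>X n \<omega>\<bar> \<le> K)"
    using assms unfolding bounded_in_probability_def by blast
  show "\<exists>K. \<forall>\<^sub>F n in sequentially. \<exists>A\<in>sets M. 1 - \<eta> \<le> prob A \<and> (\<forall>\<omega>\<in>A. \<bar>c * X n \<omega>\<bar> \<le> K)"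
    by (rule exI[of _ "\<bar>c\<bar> * K"], rule eventually_mono[OF K]) (force simp: abs_mult intro: mult_left_mono)
qed

lemma (in prob_space) bounded_in_probability_sum:
  assumes "finite I" "\<And>i. i \<in> I \<Longrightarrow> bounded_in_probability M (X i)"
  shows "bounded_in_probability M (\<lambda>n \<omega>. \<Sum>i\<in>I. \<bar>X i n \<omega>\<bar>)"
  using assms
proof (induction I)
  case empty
  show ?case unfolding bounded_in_probability_def
    by (auto intro!: exI[of _ 0] always_eventually bexI[of _ "space M"] simp: prob_space)
next
  case (insert i I)
  then have "bounded_in_probability M (\<lambda>n \<omega>. \<bar>X i n \<omega>\<bar> + \<bar>\<Sum>i\<in>I. \<bar>X i n \<omega>\<bar>\<bar>)"
    by (intro bounded_in_probability_add) auto
  then show ?case using insert(1,2) by (simp add: sum_nonneg)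
qed

text \<open>
  If every linear functional of \<open>\<zeta> n\<close> is an average up to an error of smaller order than \<open>\<zeta> n\<close>
  itself, then first \<open>\<zeta> n\<close> is of order \<open>1 / sqrt n\<close> (apply the hypothesis to the basis vectors and
  absorb the error), and then the error is negligible on that scale.
\<close>

theorem (in iid_sample) char_of_asymptotically_linear:
  fixes \<zeta> :: "nat \<Rightarrow> 'w \<Rightarrow> 'p::euclidean_space" and g :: "'p \<Rightarrow> 'a \<Rightarrow> real"
  assumes [measurable]: "\<And>n. \<zeta> n \<in> borel_measurable M"
    and g [measurable]: "\<And>t. g t \<in> borel_measurable borel" and g2: "\<And>t. integrable P (\<lambda>x. (g t x)\<^sup>2)" and g0: "\<And>t. (\<integral>x. g t x \<partial>P) = 0"
    and s: "bounded_in_probability M (\<lambda>n \<omega>. sqrt (real n) * s n \<omega>)"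
    and lin: "\<And>t e. e > 0 \<Longrightarrow> with_high_probability M (\<lambda>n \<omega>. \<bar>t \<bullet> \<zeta> n \<omega> - avg n (g t) \<omega>\<bar> \<le> e * (norm (\<zeta> n \<omega>) + \<bar>s n \<omega>\<bar>))"
  shows "(\<lambda>n. \<integral>\<omega>. iexp (t \<bullet> (sqrt (real n) *\<^sub>R \<zeta> n \<omega>)) \<partial>M) \<longlonglongrightarrow> of_real (exp (- (\<integral>x. (g t x)\<^sup>2 \<partial>P) / 2))"
proof -
  define d where "d = 1 / (2 * real DIM('p))"
  have d: "d > 0" by (simp add: d_def)
  let ?Y = "\<lambda>n \<omega>. \<Sum>b\<in>(Basis::'p set). \<bar>avg n (g b) \<omega>\<bar>"
  have "with_high_probability M (\<lambda>n \<omega>. \<forall>b\<in>(Basis::'p set). \<bar>b \<bullet> \<zeta> n \<omega> - avg n (g b) \<omega>\<bar> \<le> d * (norm (\<zeta> n \<omega>) + \<bar>s n \<omega>\<bar>))"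
    by (intro whp_all_finite lin d) auto
  then have size: "with_high_probability M (\<lambda>n \<omega>. norm (\<zeta> n \<omega>) \<le> 2 * ?Y n \<omega> + \<bar>s n \<omega>\<bar>)"
  proof (rule whp_mono)
    fix n \<omega> assume A: "\<forall>b\<in>(Basis::'p set). \<bar>b \<bullet> \<zeta> n \<omega> - avg n (g b) \<omega>\<bar> \<le> d * (norm (\<zeta> n \<omega>) + \<bar>s n \<omega>\<bar>)"
    have "norm (\<zeta> n \<omega>) \<le> (\<Sum>b\<in>(Basis::'p set). \<bar>\<zeta> n \<omega> \<bullet> b\<bar>)" by (rule norm_le_l1)
    also have "\<dots> \<le> (\<Sum>b\<in>(Basis::'p set). \<bar>avg n (g b) \<omega>\<bar> + d * (norm (\<zeta> n \<omega>) + \<bar>s n \<omega>\<bar>))"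
    proof (rule sum_mono)
      fix b :: 'p assume "b \<in> Basis"
      with A have "\<bar>b \<bullet> \<zeta> n \<omega> - avg n (g b) \<omega>\<bar> \<le> d * (norm (\<zeta> n \<omega>) + \<bar>s n \<omega>\<bar>)" by blast
      then show "\<bar>\<zeta> n \<omega> \<bullet> b\<bar> \<le> \<bar>avg n (g b) \<omega>\<bar> + d * (norm (\<zeta> n \<omega>) + \<bar>s n \<omega>\<bar>)"
        unfolding inner_commute[of b] by linarith
    qed
    also have "\<dots> = ?Y n \<omega> + (norm (\<zeta> n \<omega>) + \<bar>s n \<omega>\<bar>) / 2" by (simp add: sum.distrib d_def)
    finally have *: "norm (\<zeta> n \<omega>) \<le> ?Y n \<omega> + (norm (\<zeta> n \<omega>) + \<bar>s n \<omega>\<bar>) / 2" .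
    have "(x::real) \<le> 2 * y + z" if "x \<le> y + (x + z) / 2" for x y z
      using that by (simp add: field_simps)
    from this[OF *] show "norm (\<zeta> n \<omega>) \<le> 2 * ?Y n \<omega> + \<bar>s n \<omega>\<bar>" .
  qed
  let ?Z = "\<lambda>n \<omega>. 2 * (\<bar>\<Sum>b\<in>(Basis::'p set). \<bar>sqrt (real n) * avg n (g b) \<omega>\<bar>\<bar> + \<bar>sqrt (real n) * s n \<omega>\<bar>)"
  have Z: "bounded_in_probability M ?Z"
    by (intro bounded_in_probability_cmult bounded_in_probability_add bounded_in_probability_sum
        bounded_in_probability_scaled_avg g g2 g0 s) auto
  have close: "with_high_probability M (\<lambda>n \<omega>. \<bar>t \<bullet> (sqrt (real n) *\<^sub>R \<zeta> n \<omega>) - sqrt (real n) * avg n (g t) \<omega>\<bar> \<le> e)"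
    if e: "e > 0" for e
  proof (rule whp_mult_bounded_in_probability[OF _ Z _ e])
    fix e :: real assume e: "e > 0"
    show "with_high_probability M (\<lambda>n \<omega>. \<bar>t \<bullet> (sqrt (real n) *\<^sub>R \<zeta> n \<omega>) - sqrt (real n) * avg n (g t) \<omega>\<bar> \<le> e * \<bar>?Z n \<omega>\<bar>)"
    proof (rule whp_mono[OF whp_conj[OF size lin[OF e, of t]]], elim conjE)
      fix n \<omega>
      assume 1: "norm (\<zeta> n \<omega>) \<le> 2 * ?Y n \<omega> + \<bar>s n \<omega>\<bar>"
        and 2: "\<bar>t \<bullet> \<zeta> n \<omega> - avg n (g t) \<omega>\<bar> \<le> e * (norm (\<zeta> n \<omega>) + \<bar>s n \<omega>\<bar>)"
      have "\<bar>t \<bullet> (sqrt (real n) *\<^sub>R \<zeta> n \<omega>) - sqrt (real n) * avg n (g t) \<omega>\<bar> = sqrt (real n) * \<bar>t \<bullet> \<zeta> n \<omega> - avg n (g t) \<omega>\<bar>"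
        by (simp add: right_diff_distrib[symmetric] abs_mult)
      also have "\<dots> \<le> sqrt (real n) * (e * (2 * ?Y n \<omega> + 2 * \<bar>s n \<omega>\<bar>))"
      proof (rule mult_left_mono)
        have "e * (norm (\<zeta> n \<omega>) + \<bar>s n \<omega>\<bar>) \<le> e * (2 * ?Y n \<omega> + 2 * \<bar>s n \<omega>\<bar>)"
          using 1 e by (intro mult_left_mono) auto
        then show "\<bar>t \<bullet> \<zeta> n \<omega> - avg n (g t) \<omega>\<bar> \<le> e * (2 * ?Y n \<omega> + 2 * \<bar>s n \<omega>\<bar>)" using 2 by linarith
      qed simp
      also have "\<dots> = e * \<bar>?Z n \<omega>\<bar>"
        by (simp add: sum_nonneg abs_mult sum_distrib_left[symmetric] algebra_simps)
      finally show "\<bar>t \<bullet> (sqrt (real n) *\<^sub>R \<zeta> n \<omega>) - sqrt (real n) * avg n (g t) \<omega>\<bar> \<le> e * \<bar>?Z n \<omega>\<bar>" .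
    qed
  qed measurable
  show ?thesis
    by (rule char_tendsto_of_whp_close[OF _ _ close char_scaled_avg_tendsto[OF g g2 g0]]) measurable
qed

subsection \<open>Linearization of the inverse shape\<close>

lemma deviator_bound:
  fixes A R :: "real^'k^'k"
  shows "\<bar>trace (A ** R) - trace A * trace R / real CARD('k)\<bar> \<le> (norm A + \<bar>trace A\<bar> * norm (mat 1 :: real^'k^'k)) * norm R"
proof -
  have "\<bar>trace (A ** R)\<bar> \<le> norm A * norm R"
    unfolding trace_mult_eq_inner using Cauchy_Schwarz_ineq2[of "transpose A" R] by (simp add: norm_transpose)
  moreover have "\<bar>trace A * trace R / real CARD('k)\<bar> \<le> \<bar>trace A\<bar> * (norm (mat 1 :: real^'k^'k) * norm R)"
  proof -
    have "\<bar>trace A * trace R / real CARD('k)\<bar> \<le> \<bar>trace A * trace R\<bar>"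
      by (simp add: divide_le_eq mult_le_cancel_left1)
    also have "\<dots> \<le> \<bar>trace A\<bar> * (norm (mat 1 :: real^'k^'k) * norm R)"
      unfolding abs_mult by (intro mult_left_mono abs_trace_le) simp
    finally show ?thesis .
  qed
  ultimately have "\<bar>trace (A ** R) - trace A * trace R / real CARD('k)\<bar> \<le> norm A * norm R + \<bar>trace A\<bar> * (norm (mat 1 :: real^'k^'k) * norm R)"
    using abs_triangle_ineq4[of "trace (A ** R)" "trace A * trace R / real CARD('k)"] by (rule_tac order_trans[OF _ add_mono])
  then show ?thesis by (simp add: algebra_simps)
qed

text \<open>
  The deviator of the inverse shape forgets the scale factor \<open>s\<close>: to first order the scale enters as a
  multiple of the identity.  On determinant one, the trace of \<open>H\<close> is of second order.
\<close>

lemma shape_linearization: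
  fixes A :: "real^'k^'k"
  assumes e: "e > 0"
  shows "\<exists>d>0. \<forall>H s. norm H \<le> d \<longrightarrow> \<bar>s - 1\<bar> \<le> d \<longrightarrow> det (mat 1 + H) = 1 \<longrightarrow>
    \<bar>trace (A ** (s *\<^sub>R matrix_inv (mat 1 + H) - mat 1)) - trace A * trace (s *\<^sub>R matrix_inv (mat 1 + H) - mat 1) / real CARD('k)
      + trace (A ** H)\<bar> \<le> e * norm H"
proof -
  let ?k = "real CARD('k)" and ?N = "norm (mat 1 :: real^'k^'k)"
  define c where "c = norm A + \<bar>trace A\<bar> * ?N"
  have c: "c \<ge> 0" by (simp add: c_def)
  define dev where "dev R = trace (A ** R) - trace A * trace R / ?k" for R
  have dev: "\<bar>dev R\<bar> \<le> c * norm R" for R unfolding dev_def c_def by (rule deviator_bound)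
  have dev_lin: "dev (R + S) = dev R + dev S" "dev (r *\<^sub>R R) = r * dev R" "dev (- R) = - dev R" for R S r
    using trace_scaleR[of "-1" R] trace_scaleR[of "-1" "A ** R"]
    by (auto simp: dev_def matrix_add_ldistrib trace_add matrix_scalar_ac scalar_matrix_assoc[symmetric] trace_scaleR
        trace_mult_eq_inner add_divide_distrib algebra_simps)
  have dev1: "dev (mat 1) = 0" by (simp add: dev_def matrix_mul_rid trace_I)
  define e' where "e' = e / (3 * (\<bar>trace A\<bar> + 1))"
  have e': "e' > 0" using e by (simp add: e'_def add_nonneg_pos)
  have "\<exists>d>0. \<forall>Y :: real^'k^'k. norm (Y - mat 1) < d \<longrightarrow> norm (det Y - det (mat 1 :: real^'k^'k) - trace (Y - mat 1)) \<le> e' * norm (Y - mat 1)"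
    by (rule conjunct2[OF det_has_derivative_at_mat_1[where 'n='k, unfolded has_derivative_at_alt], THEN spec[where x=e'], THEN mp, OF e'])
  then obtain d1 where d1: "d1 > 0" "\<And>Y :: real^'k^'k. norm (Y - mat 1) < d1 \<Longrightarrow> \<bar>det Y - det (mat 1 :: real^'k^'k) - trace (Y - mat 1)\<bar> \<le> e' * norm (Y - mat 1)"
    unfolding real_norm_def by auto
  define d where "d = Min {1 / 2, d1 / 2, e / (3 * (c + 1)), e / (12 * (c + 1) * (?N + 1))}"
  have c1: "c + 1 > 0" and N1: "?N + 1 > 0" using c by (auto intro: add_nonneg_pos)
  have d: "d > 0" unfolding d_def using d1(1) e c1 N1 by simp
  have dle: "d \<le> 1 / 2" "d \<le> d1 / 2" "d \<le> e / (3 * (c + 1))" "d \<le> e / (12 * (c + 1) * (?N + 1))"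
    unfolding d_def by (rule Min_le; simp)+
  have "\<bar>dev (s *\<^sub>R matrix_inv (mat 1 + H) - mat 1) + trace (A ** H)\<bar> \<le> e * norm H"
    if H: "norm H \<le> d" and s: "\<bar>s - 1\<bar> \<le> d" and det: "det (mat 1 + H) = 1" for H :: "real^'k^'k" and s
  proof -
    define R where "R = matrix_inv (mat 1 + H) - mat 1 + H"
    have h: "norm H \<le> 1 / 2" using H dle by linarith
    have R: "norm R \<le> 2 * ?N * (norm H)\<^sup>2" unfolding R_def by (rule inv_mat_1_plus_expand(2)[OF h])
    have "s *\<^sub>R matrix_inv (mat 1 + H) - mat 1 = s *\<^sub>R R + (- s) *\<^sub>R H + (s - 1) *\<^sub>R mat 1"
      by (simp add: R_def algebra_simps)
    then have "dev (s *\<^sub>R matrix_inv (mat 1 + H) - mat 1) = s * dev R + (- s) * dev H + (s - 1) * dev (mat 1)"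
      by (simp only: dev_lin)
    then have "dev (s *\<^sub>R matrix_inv (mat 1 + H) - mat 1) = s * dev R - s * dev H"
      by (simp add: dev1)
    moreover have "dev H = trace (A ** H) - trace A * trace H / ?k" by (simp only: dev_def)
    moreover have "(s - 1) * dev H = s * dev H - dev H" by (simp add: algebra_simps)
    ultimately have eq: "dev (s *\<^sub>R matrix_inv (mat 1 + H) - mat 1) + trace (A ** H) = s * dev R - (s - 1) * dev H + trace A * trace H / ?k"
      by linarith
    have 1: "\<bar>s * dev R\<bar> \<le> e / 3 * norm H"
    proof -
      have "\<bar>s * dev R\<bar> \<le> 2 * (c * (2 * ?N * (norm H)\<^sup>2))"
        unfolding abs_mult using s dle c R by (intro mult_mono order_trans[OF dev] mult_left_mono) auto
      also have "\<dots> = (4 * c * ?N * norm H) * norm H" by (simp add: power2_eq_square)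
      also have "\<dots> \<le> e / 3 * norm H"
      proof (rule mult_right_mono)
        have "4 * c * ?N * norm H \<le> 4 * (c + 1) * (?N + 1) * (e / (12 * (c + 1) * (?N + 1)))"
          using H dle(4) c by (intro mult_mono) auto
        also have "4 * a * b * (e / (12 * a * b)) = e / 3" if "a > 0" "b > 0" for a b :: real
          using that by simp
        note this[OF c1 N1]
        finally show "4 * c * ?N * norm H \<le> e / 3" .
      qed simp
      finally show ?thesis .
    qed
    have 2: "\<bar>(s - 1) * dev H\<bar> \<le> e / 3 * norm H"
    proof -
      have "\<bar>(s - 1) * dev H\<bar> \<le> e / (3 * (c + 1)) * ((c + 1) * norm H)"
        unfolding abs_mult using s dle(3) c1 by (intro mult_mono order_trans[OF dev] mult_right_mono) auto
      also have "e / (3 * a) * (a * norm H) = e / 3 * norm H" if "a > 0" for a :: real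
        using that by simp
      note this[OF c1]
      finally show ?thesis .
    qed
    have 3: "\<bar>trace A * trace H / ?k\<bar> \<le> e / 3 * norm H"
    proof -
      have "\<bar>trace H\<bar> \<le> e' * norm H" using d1(2)[of "mat 1 + H"] H dle d1(1) by (simp add: det det_I)
      then have "\<bar>trace A * trace H\<bar> \<le> (\<bar>trace A\<bar> + 1) * (e' * norm H)"
        unfolding abs_mult by (intro mult_mono) auto
      also have "\<dots> = e / 3 * norm H"
      proof -
        have "\<bar>trace A\<bar> + 1 > 0" by linarith
        moreover have "a * (e / (3 * a) * norm H) = e / 3 * norm H" if "a > 0" for a :: real
          using that by simp
        ultimately show ?thesis unfolding e'_def by blast
      qed
      finally have "\<bar>trace A * trace H\<bar> \<le> e / 3 * norm H" .
      moreover have "\<bar>trace A * trace H / ?k\<bar> \<le> \<bar>trace A * trace H\<bar>"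
        by (simp add: divide_le_eq mult_le_cancel_left1)
      ultimately show ?thesis by linarith
    qed
    show ?thesis unfolding eq using 1 2 3 by linarith
  qed
  then show ?thesis using d unfolding dev_def by blast
qed

lemma inverse_shape_size:
  fixes H :: "real^'k^'k"
  assumes h: "norm H \<le> 1 / 2" and s: "\<bar>s - 1\<bar> \<le> 1"
  shows "norm (s *\<^sub>R matrix_inv (mat 1 + H) - mat 1) \<le> 2 * (1 + norm (mat 1 :: real^'k^'k)) * norm H + norm (mat 1 :: real^'k^'k) * \<bar>s - 1\<bar>"
proof -
  let ?N = "norm (mat 1 :: real^'k^'k)"
  define R where "R = matrix_inv (mat 1 + H) - mat 1 + H"
  have R: "norm R \<le> 2 * ?N * (norm H)\<^sup>2" unfolding R_def by (rule inv_mat_1_plus_expand(2)[OF h])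
  also have "\<dots> \<le> ?N * norm H"
    using mult_left_mono[OF mult_right_mono[OF h norm_ge_zero[of H]], of "2 * ?N"] by (simp add: power2_eq_square)
  finally have R: "norm R \<le> ?N * norm H" .
  have "s *\<^sub>R matrix_inv (mat 1 + H) - mat 1 = s *\<^sub>R (R - H) + (s - 1) *\<^sub>R mat 1"
    by (simp add: R_def algebra_simps)
  then have "norm (s *\<^sub>R matrix_inv (mat 1 + H) - mat 1) \<le> norm (s *\<^sub>R (R - H)) + norm ((s - 1) *\<^sub>R (mat 1 :: real^'k^'k))"
    by (simp only: norm_triangle_ineq)
  also have "\<dots> = \<bar>s\<bar> * norm (R - H) + \<bar>s - 1\<bar> * ?N" by simp
  also have "\<dots> \<le> 2 * (?N * norm H + norm H) + \<bar>s - 1\<bar> * ?N"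
  proof (intro add_right_mono mult_mono)
    show "norm (R - H) \<le> ?N * norm H + norm H" using norm_triangle_ineq4[of R H] R by linarith
  qed (use s in auto)
  finally show ?thesis by (simp add: algebra_simps)
qed

subsection \<open>Multivariate normal laws\<close>

lemma multivariate_normal_facts:
  fixes S :: "real^'n^'n"
  assumes "multivariate_normal 0 S N"
  shows "prob_space N" "sets N = sets borel"
    "(\<integral>x. iexp (t \<bullet> x) \<partial>N) = of_real (exp (- (t \<bullet> (S *v t)) / 2))"
proof -
  obtain B :: "real^'n^'n" where B: "S = B ** transpose B" and N: "N = distr std_normal_vector borel (\<lambda>z. 0 + B *v z)"
    using assms unfolding multivariate_normal_def by blast
  have [measurable_cong]: "sets (std_normal_vector :: (real^'n) measure) = sets borel" by (simp add: std_normal_vector_eq)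
  interpret prob_space "std_normal_vector :: (real^'n) measure"
    unfolding std_normal_vector_eq by (rule prob_space_standard_gaussian)
  show "prob_space N" unfolding N by (rule prob_space_distr) measurable
  show "sets N = sets borel" by (simp add: N)
  have "(\<integral>x. iexp (t \<bullet> x) \<partial>N) = (\<integral>z. iexp ((transpose B *v t) \<bullet> z) \<partial>std_normal_vector)"
    unfolding N by (subst integral_distr) (auto simp: inner_matrix_transpose)
  also have "\<dots> = of_real (exp (- (norm (transpose B *v t))\<^sup>2 / 2))"
    unfolding std_normal_vector_eq by (rule char_standard_gaussian)
  also have "(norm (transpose B *v t))\<^sup>2 = t \<bullet> (S *v t)"
    by (simp add: B power2_norm_eq_inner matrix_vector_mul_assoc[symmetric] inner_matrix_transpose)
  finally show "(\<integral>x. iexp (t \<bullet> x) \<partial>N) = of_real (exp (- (t \<bullet> (S *v t)) / 2))" .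
qed

lemma multivariate_normal_exists:
  fixes B :: "real^'n^'n"
  assumes "S = B ** transpose B"
  shows "\<exists>N. multivariate_normal 0 S N"
  using assms unfolding multivariate_normal_def by blast

lemma char_pair_measure:
  fixes N1 :: "'a::euclidean_space measure" and N2 :: "'b::euclidean_space measure"
  assumes "prob_space N1" and [measurable_cong]: "sets N1 = sets borel" and "prob_space N2" and [measurable_cong]: "sets N2 = sets borel"
  shows "(\<integral>x. iexp (t \<bullet> x) \<partial>(N1 \<Otimes>\<^sub>M N2)) = (\<integral>x. iexp (fst t \<bullet> x) \<partial>N1) * (\<integral>x. iexp (snd t \<bullet> x) \<partial>N2)"
proof -
  interpret N1: prob_space N1 by fact
  interpret N2: prob_space N2 by fact
  interpret P: pair_prob_space N1 N2 ..
  have "integrable (N1 \<Otimes>\<^sub>M N2) (\<lambda>(x, y). iexp (fst t \<bullet> x) * iexp (snd t \<bullet> y))"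
    by (rule P.P.integrable_const_bound[where B=1]) (auto simp: split_beta' norm_mult)
  from P.integral_snd[OF this]
  have "(\<integral>x. iexp (fst t \<bullet> fst x) * iexp (snd t \<bullet> snd x) \<partial>(N1 \<Otimes>\<^sub>M N2)) = (\<integral>x. iexp (fst t \<bullet> x) \<partial>N1) * (\<integral>x. iexp (snd t \<bullet> x) \<partial>N2)"
    by (simp add: split_beta')
  moreover have "iexp (t \<bullet> x) = iexp (fst t \<bullet> fst x) * iexp (snd t \<bullet> snd x)" for x
    by (simp add: inner_prod_def exp_add[symmetric] algebra_simps)
  ultimately show ?thesis by simp
qed

text \<open>
  Independence in the limit and the two marginal laws all follow once the joint characteristic function
  converges to a product of Gaussian ones.
\<close>

theorem asymptotic_normality_of_char:
  fixes X :: "nat \<Rightarrow> 'w \<Rightarrow> real^'n" and Y :: "nat \<Rightarrow> 'w \<Rightarrow> real^'m"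
  assumes M: "prob_space M" and X [measurable]: "\<And>n. X n \<in> borel_measurable M" and Y [measurable]: "\<And>n. Y n \<in> borel_measurable M"
    and S1: "S1 = B1 ** transpose (B1 :: real^'n^'n)" and S2: "S2 = B2 ** transpose (B2 :: real^'m^'m)"
    and lim: "\<And>t1 t2. (\<lambda>n. \<integral>\<omega>. iexp ((t1, t2) \<bullet> (X n \<omega>, Y n \<omega>)) \<partial>M)
        \<longlonglongrightarrow> of_real (exp (- (t1 \<bullet> (S1 *v t1) + t2 \<bullet> (S2 *v t2)) / 2))"
  shows "asymptotically_independent M X Y \<and> asymptotically_normal M X 0 S1 \<and> asymptotically_normal M Y 0 S2"
proof -
  obtain N1 N2 where N1: "multivariate_normal 0 S1 N1" and N2: "multivariate_normal 0 S2 N2"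
    using multivariate_normal_exists[OF S1] multivariate_normal_exists[OF S2] by blast
  note f1 = multivariate_normal_facts[OF N1] and f2 = multivariate_normal_facts[OF N2]
  have [measurable_cong]: "sets N1 = sets borel" "sets N2 = sets borel" by (fact f1 f2)+
  have sets: "sets (N1 \<Otimes>\<^sub>M N2) = sets borel"
    using sets_pair_measure_cong[OF f1(2) f2(2)] by (simp only: borel_prod)
  have P: "prob_space (N1 \<Otimes>\<^sub>M N2)" using f1(1) f2(1) by (rule prob_space_pair)
  have joint: "converges_in_distribution M (\<lambda>n \<omega>. (X n \<omega>, Y n \<omega>)) (N1 \<Otimes>\<^sub>M N2)"
  proof (rule converges_in_distribution_of_char[OF M _ P sets])
    fix t :: "(real^'n) \<times> (real^'m)"
    have "(\<integral>x. iexp (t \<bullet> x) \<partial>(N1 \<Otimes>\<^sub>M N2)) = of_real (exp (- (fst t \<bullet> (S1 *v fst t) + snd t \<bullet> (S2 *v snd t)) / 2))"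
      by (subst char_pair_measure[OF f1(1,2) f2(1,2)]) (simp add: f1(3) f2(3) exp_add[symmetric] add_divide_distrib flip: of_real_mult)
    then show "(\<lambda>n. \<integral>\<omega>. iexp (t \<bullet> (X n \<omega>, Y n \<omega>)) \<partial>M) \<longlonglongrightarrow> (\<integral>x. iexp (t \<bullet> x) \<partial>(N1 \<Otimes>\<^sub>M N2))"
      using lim[of "fst t" "snd t"] by simp
  qed measurable
  have cX: "converges_in_distribution M X N1"
  proof (rule converges_in_distribution_of_char[OF M X f1(1,2)])
    fix t show "(\<lambda>n. \<integral>\<omega>. iexp (t \<bullet> X n \<omega>) \<partial>M) \<longlonglongrightarrow> (\<integral>x. iexp (t \<bullet> x) \<partial>N1)"
      using lim[of t 0] by (simp add: f1(3))
  qed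
  have cY: "converges_in_distribution M Y N2"
  proof (rule converges_in_distribution_of_char[OF M Y f2(1,2)])
    fix t show "(\<lambda>n. \<integral>\<omega>. iexp (t \<bullet> Y n \<omega>) \<partial>M) \<longlonglongrightarrow> (\<integral>x. iexp (t \<bullet> x) \<partial>N2)"
      using lim[of 0 t] by (simp add: f2(3))
  qed
  show ?thesis
    unfolding asymptotically_independent_def asymptotically_normal_def
    using f1(1,2) f2(1,2) joint cX cY N1 N2 by blast
qed

lemma outer_vector: "outer v *v x = (v \<bullet> x) *\<^sub>R v"
  by (simp add: vec_eq_iff outer_def matrix_vector_mult_def inner_vec_def sum_distrib_left sum_distrib_right mult_ac)

lemma PDS_scaled_root:
  fixes A :: "real^'n^'n"
  assumes "A \<in> PDS" "v \<ge> 0"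
  shows "\<exists>B :: real^'n^'n. v *\<^sub>R A = B ** transpose B"
proof -
  obtain B :: "real^'n^'n" where B: "B ** transpose B = A" by (rule PDS_square_root[OF assms(1)])
  have "(sqrt v *\<^sub>R B) ** transpose (sqrt v *\<^sub>R B) = v *\<^sub>R A"
    using assms(2) by (simp add: transpose_scalar matrix_scalar_ac scalar_matrix_assoc[symmetric] B)
  from this[symmetric] show ?thesis by blast
qed

text \<open>
  In coordinates in which \<open>K\<close> is the identity, the matrix is a multiple of the projection orthogonal to
  \<open>\<theta>\<close>, and a projection is its own root.
\<close>

lemma projected_root:
  fixes K :: "real^'n^'n"
  assumes K: "K \<in> PDS" and v: "v \<ge> 0" and k: "k > 0" and \<theta>: "\<theta> \<bullet> (K *v \<theta>) = k"
  shows "\<exists>B :: real^'n^'n. v *\<^sub>R (matrix_inv K - (1 / k) *\<^sub>R outer \<theta>) = B ** transpose B"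
proof -
  obtain C :: "real^'n^'n" where C: "invertible C" "C ** transpose C = matrix_inv K"
    by (rule PDS_square_root[OF PDS_matrix_inv[OF K]])
  define \<eta> where "\<eta> = matrix_inv C *v \<theta>"
  have C\<eta>: "C *v \<eta> = \<theta>" by (simp add: \<eta>_def matrix_vector_mul_assoc matrix_inv_right[OF C(1)] matrix_vector_mul_lid)
  have "K = matrix_inv (C ** transpose C)" unfolding C(2) by (simp add: matrix_inv_matrix_inv PDS_invertible[OF K])
  then have K': "K = transpose (matrix_inv C) ** matrix_inv C"
    by (simp add: matrix_inv_mult C(1) invertible_transpose matrix_inv_transpose)
  have \<eta>\<eta>: "\<eta> \<bullet> \<eta> = k"
    unfolding \<theta>[symmetric] K' by (simp only: \<eta>_def matrix_vector_mul_assoc[symmetric] inner_matrix_transpose[of \<theta>] transpose_transpose)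
  have oo: "outer \<eta> ** outer \<eta> = k *\<^sub>R outer \<eta>"
    unfolding \<eta>\<eta>[symmetric]
    by (simp add: matrix_eq matrix_vector_mul_assoc[symmetric] outer_vector scaleR_matrix_vector_assoc[symmetric] mult.commute)
  have ot: "transpose (outer \<eta>) = outer \<eta>" by (simp add: vec_eq_iff outer_def transpose_def mult.commute)
  have co: "C ** outer \<eta> ** transpose C = outer \<theta>"
    unfolding C\<eta>[symmetric] matrix_eq
    by (simp only: matrix_vector_mul_assoc[symmetric] outer_vector matrix_vector_mult_scaleR inner_matrix_transpose[of \<eta>] transpose_transpose) simp
  define \<pi> where "\<pi> = mat 1 - (1 / k) *\<^sub>R outer \<eta>"
  have \<pi>: "transpose \<pi> = \<pi>"
    using ot by (simp add: \<pi>_def vec_eq_iff transpose_def mat_def)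
  have \<pi>\<pi>: "\<pi> ** \<pi> = \<pi>"
    using k by (simp add: \<pi>_def matrix_diff_mult matrix_mult_diff matrix_mul_lid matrix_mul_rid matrix_scalar_ac
        scalar_matrix_assoc[symmetric] oo)
  define B where "B = sqrt v *\<^sub>R (C ** \<pi>)"
  have "v *\<^sub>R (C ** (\<pi> ** \<pi>) ** transpose C) = B ** transpose B"
    using v by (simp add: B_def transpose_scalar matrix_scalar_ac scalar_matrix_assoc[symmetric] matrix_transpose_mul \<pi> matrix_mul_assoc)
  moreover have "C ** (\<pi> ** \<pi>) ** transpose C = matrix_inv K - (1 / k) *\<^sub>R outer \<theta>"
    unfolding \<pi>\<pi> unfolding \<pi>_def
    by (simp add: matrix_diff_mult matrix_mult_diff matrix_mul_rid matrix_scalar_ac scalar_matrix_assoc[symmetric] co C(2))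
  ultimately have "v *\<^sub>R (matrix_inv K - (1 / k) *\<^sub>R outer \<theta>) = B ** transpose B" by simp
  then show ?thesis by blast
qed

section \<open>Standardization of the model\<close>

text \<open>
  The loss is minimal at \<open>0\<close> and maximal at \<open>c\<close>, so its derivative vanishes at both points.  The second
  derivative vanishes at \<open>c\<close> by continuity from the right.
\<close>

lemma smooth_loss_of_bounded_loss_function:
  fixes \<rho> \<rho>' \<rho>'' :: "real \<Rightarrow> real"
  assumes nn: "\<And>r. 0 \<le> \<rho> r" and \<rho>0: "\<rho> 0 = 0" and c: "0 < c"
    and const: "\<And>r. c \<le> r \<Longrightarrow> \<rho> r = \<rho> c" and mono: "strict_mono_on {0..c} \<rho>"
    and d1: "\<And>r. (\<rho> has_real_derivative \<rho>' r) (at r)" and d2: "\<And>r. (\<rho>' has_real_derivative \<rho>'' r) (at r)"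
    and cont: "continuous_on UNIV \<rho>''" and u: "continuous_on UNIV (\<lambda>r. if r = 0 then \<rho>'' 0 else \<rho>' r / r)"
  shows "smooth_loss \<rho>' \<rho>'' c \<rho>"
proof
  show "\<rho>' 0 = 0" by (rule DERIV_local_min[OF d1, of 1]) (use nn \<rho>0 in auto)
  have le: "\<rho> y \<le> \<rho> c" if "y > 0" for y
  proof (cases "y \<le> c")
    case True
    then show ?thesis using strict_mono_on_leD[OF mono, of y c] that c by simp
  next
    case False
    then have "\<rho> y = \<rho> c" by (intro const) simp
    then show ?thesis by (rule eq_refl)
  qed
  have out1: "\<rho>' s = 0" if "s > c" for s
  proof (rule DERIV_local_const[OF d1, of "s - c"])
    show "\<forall>y. \<bar>s - y\<bar> < s - c \<longrightarrow> \<rho> s = \<rho> y"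
      by (intro allI impI trans[OF const const[symmetric]]) linarith+
  qed (use that in simp)
  have at_c: "\<rho>' c = 0"
    by (rule DERIV_local_max[OF d1, of c]) (use c le in auto)
  then show z1: "\<rho>' s = 0" if "s \<ge> c" for s using out1[of s] that by (cases "s = c") auto
  have out2: "\<rho>'' s = 0" if "s > c" for s
  proof (rule DERIV_local_const[OF d2, of "s - c"])
    show "\<forall>y. \<bar>s - y\<bar> < s - c \<longrightarrow> \<rho>' s = \<rho>' y"
      by (intro allI impI trans[OF z1 z1[symmetric]]) linarith+
  qed (use that in simp)
  have "(\<rho>'' \<longlongrightarrow> \<rho>'' c) (at_right c)"
  proof -
    have "isCont \<rho>'' c" using cont by (simp add: continuous_on_eq_continuous_at)
    then show ?thesis unfolding isCont_def by (rule tendsto_within_subset) simp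
  qed
  moreover have "(\<rho>'' \<longlongrightarrow> 0) (at_right c)"
    by (rule tendsto_eventually[OF eventually_mono[OF eventually_at_right_less[of c]]]) (rule out2)
  ultimately have "\<rho>'' c = 0" by (rule tendsto_unique[rotated]) simp
  then show "\<rho>'' s = 0" if "s \<ge> c" for s using out2[of s] that by (cases "s = c") auto
qed (fact \<rho>0 c d1 d2 cont u)+

text \<open>Adjoints are kept in the form \<open>transpose A *v x\<close>, as produced by \<open>inner_matrix_transpose\<close>.\<close>

declare transpose_matrix_vector [simp del]

definition standardize :: "real \<Rightarrow> real^'k^'k \<Rightarrow> real^'q \<Rightarrow> (real^'k) \<times> (real^'q^'k) \<Rightarrow> (real^'k) \<times> (real^'q^'k)" where
  "standardize c B \<beta> x = (c *\<^sub>R (matrix_inv B *v (fst x - snd x *v \<beta>)), c *\<^sub>R (matrix_inv B ** snd x))"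

lemma bounded_bilinear_matrix_mult: "bounded_bilinear (\<lambda>(A::real^'n^'m) (B::real^'p^'n). A ** B)"
proof
  show "\<exists>K. \<forall>(A::real^'n^'m) (B::real^'p^'n). norm (A ** B) \<le> norm A * norm B * K"
    using norm_matrix_mult_le by (intro exI[of _ 1]) auto
qed (auto simp: matrix_add_mult matrix_add_ldistrib matrix_scalar_ac scalar_matrix_assoc[symmetric])

lemmas continuous_on_matrix_mult [continuous_intros] =
  bounded_bilinear.continuous_on[OF bounded_bilinear_matrix_mult]

lemma matrix_mult_measurable [measurable]:
  assumes "f \<in> borel_measurable M" "g \<in> borel_measurable M"
  shows "(\<lambda>x. (f x :: real^'n^'m) ** (g x :: real^'p^'n)) \<in> borel_measurable M"
  using assms by (rule borel_measurable_continuous_Pair) (intro continuous_intros)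

lemma standardize_measurable [measurable]: "standardize c B \<beta> \<in> borel_measurable borel"
  unfolding standardize_def[abs_def] by (intro borel_measurable_continuous_onI continuous_intros)

lemma law_standardize:
  fixes P :: "((real^'k) \<times> (real^'q^'k)) measure"
  assumes B: "invertible B" and Z: "prob_space Z" "sets Z = sets borel" and P: "prob_space P" "sets P = sets borel"
    and eq: "P = distr (Z \<Otimes>\<^sub>M distr P borel snd) borel (\<lambda>(z, X). (X *v \<beta> + B *v z, X))"
  shows "distr P borel (standardize c B \<beta>)
    = distr Z borel (\<lambda>z. c *\<^sub>R z) \<Otimes>\<^sub>M distr (distr P borel snd) borel (\<lambda>X. c *\<^sub>R (matrix_inv B ** X))"
proof -
  let ?Q = "distr P borel (snd :: _ \<Rightarrow> real^'q^'k)"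
  interpret Z: prob_space Z by fact
  interpret P: prob_space P by fact
  have [measurable_cong]: "sets P = sets borel" "sets Z = sets borel" by fact+
  have "snd \<in> measurable P borel" by measurable
  then interpret Q: prob_space ?Q by (rule P.prob_space_distr)
  interpret ZQ: pair_prob_space Z ?Q ..
  let ?k = "\<lambda>(z :: real^'k, X :: real^'q^'k). (X *v \<beta> + B *v z, X)"
  have seq: "sets (Z \<Otimes>\<^sub>M ?Q) = sets borel"
    using sets_pair_measure_cong[OF Z(2) sets_distr[of P borel snd]] by (simp only: borel_prod)
  have k: "?k \<in> measurable (Z \<Otimes>\<^sub>M ?Q) borel"
    unfolding measurable_cong_sets[OF seq refl] split_beta' by (intro borel_measurable_continuous_onI continuous_intros)
  have comp: "standardize c B \<beta> \<circ> ?k = (\<lambda>(z, X). (c *\<^sub>R z, c *\<^sub>R (matrix_inv B ** X)))"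
    by (auto simp: fun_eq_iff standardize_def matrix_vector_mul_assoc matrix_inv_left[OF B] matrix_vector_mul_lid)
  have "distr P borel (standardize c B \<beta>) = distr (distr (Z \<Otimes>\<^sub>M ?Q) borel ?k) borel (standardize c B \<beta>)"
    using eq by (rule arg_cong)
  also have "\<dots> = distr (Z \<Otimes>\<^sub>M ?Q) borel (\<lambda>(z, X). (c *\<^sub>R z, c *\<^sub>R (matrix_inv B ** X)))"
    unfolding comp[symmetric] by (rule distr_distr[OF _ k]) measurable
  also have "\<dots> = distr (Z \<Otimes>\<^sub>M ?Q) (borel \<Otimes>\<^sub>M borel) (\<lambda>(z, X). (c *\<^sub>R z, c *\<^sub>R (matrix_inv B ** X)))"
    by (simp only: borel_prod)
  also have "\<dots> = distr Z borel (\<lambda>z. c *\<^sub>R z) \<Otimes>\<^sub>M distr ?Q borel (\<lambda>X. c *\<^sub>R (matrix_inv B ** X))"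
  proof (rule pair_measure_distr[symmetric])
    have "(\<lambda>X. c *\<^sub>R (matrix_inv B ** X)) \<in> measurable ?Q borel" by measurable
    then interpret QQ: prob_space "distr ?Q borel (\<lambda>X. c *\<^sub>R (matrix_inv B ** X))" by (rule Q.prob_space_distr)
    show "sigma_finite_measure (distr ?Q borel (\<lambda>X. c *\<^sub>R (matrix_inv B ** X)))" ..
  qed measurable
  finally show ?thesis .
qed

lemma matrix_mult_scaleR: "A ** (r *\<^sub>R B) = r *\<^sub>R (A ** B :: real^'p^'m)"
  by (simp add: matrix_scalar_ac scalar_matrix_assoc[symmetric])

text \<open>The standardized directions are the gradients of the original objective, up to a constant factor.\<close>

lemma standardized_directions:
  fixes y :: "real^'k" and X :: "real^'q^'k" and W A :: "real^'k^'k" and \<beta> \<beta>' :: "real^'q"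
  assumes B: "invertible B" and c: "c > 0" and \<sigma>: "\<sigma> > 0"
  defines "x \<equiv> standardize c B \<beta>' (y, X)"
    and "t \<equiv> (\<beta> - \<beta>', (1 / (c\<^sup>2 * \<sigma>\<^sup>2)) *\<^sub>R (transpose B ** W ** B) - mat 1)"
    and "r \<equiv> y - X *v \<beta>"
  shows "sqdist x t = r \<bullet> (W *v r) / \<sigma>\<^sup>2"
    and "dir_mean h x t = (X *v h) \<bullet> (W *v r) / \<sigma>\<^sup>2"
    and "dir_shape (matrix_inv B ** A ** transpose (matrix_inv B)) x t
       = ((W *v r) \<bullet> (A *v (W *v r)) - (r \<bullet> (W *v r)) * trace (W ** A) / real CARD('k)) / (c\<^sup>2 * (\<sigma>\<^sup>2)\<^sup>2)"
proof -
  let ?i = "matrix_inv B"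
  have res: "resid x t = c *\<^sub>R (?i *v r)"
  proof -
    have "resid x t = c *\<^sub>R (?i *v (y - X *v \<beta>')) - c *\<^sub>R (?i *v (X *v (\<beta> - \<beta>')))"
      by (simp add: resid_def x_def t_def standardize_def scaleR_matrix_vector_assoc[symmetric] matrix_vector_mul_assoc)
    also have "\<dots> = c *\<^sub>R (?i *v ((y - X *v \<beta>') - X *v (\<beta> - \<beta>')))"
      by (simp only: matrix_vector_mult_diff_distrib scaleR_diff_right)
    also have "(y - X *v \<beta>') - X *v (\<beta> - \<beta>') = r" by (simp add: r_def matrix_vector_mult_diff_distrib)
    finally show ?thesis .
  qed
  have snd_t: "mat 1 + snd t = (1 / (c\<^sup>2 * \<sigma>\<^sup>2)) *\<^sub>R (transpose B ** W ** B)" by (simp add: t_def)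
  have wr: "wresid x t = (1 / (c * \<sigma>\<^sup>2)) *\<^sub>R (transpose B *v (W *v r))"
  proof -
    have "wresid x t = (1 / (c\<^sup>2 * \<sigma>\<^sup>2) * c) *\<^sub>R ((transpose B ** W ** B) *v (?i *v r))"
      unfolding wresid_def res snd_t
      by (simp only: scaleR_matrix_vector_assoc[symmetric] matrix_vector_mult_scaleR scaleR_scaleR mult.commute)
    also have "(transpose B ** W ** B) *v (?i *v r) = transpose B *v (W *v r)"
      by (simp add: matrix_vector_mul_assoc matrix_mul_assoc[symmetric] matrix_inv_right[OF B] matrix_mul_rid)
    also have "1 / (c\<^sup>2 * \<sigma>\<^sup>2) * c = 1 / (c * \<sigma>\<^sup>2)" using c by (simp add: power2_eq_square)
    finally show ?thesis .
  qed
  have Bt: "(?i *v v) \<bullet> (transpose B *v v') = v \<bullet> v'" for v v'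
    by (simp only: inner_matrix_transpose transpose_transpose matrix_vector_mul_assoc matrix_inv_right[OF B] matrix_vector_mul_lid)
  have iB: "transpose ?i *v (transpose B *v v) = v" for v
    by (simp only: matrix_vector_mul_assoc matrix_transpose_mul[symmetric] matrix_inv_right[OF B] transpose_mat matrix_vector_mul_lid)
  show sq: "sqdist x t = r \<bullet> (W *v r) / \<sigma>\<^sup>2"
    unfolding sqdist_def res wr using c by (simp add: Bt)
  have sx: "snd x *v h = c *\<^sub>R (?i *v (X *v h))"
    by (simp add: x_def standardize_def scaleR_matrix_vector_assoc[symmetric] matrix_vector_mul_assoc)
  show "dir_mean h x t = (X *v h) \<bullet> (W *v r) / \<sigma>\<^sup>2"
    unfolding dir_mean_def sx wr using c by (simp add: Bt)
  have quad: "wresid x t \<bullet> ((?i ** A ** transpose ?i) *v wresid x t) = (1 / (c * \<sigma>\<^sup>2))\<^sup>2 * ((W *v r) \<bullet> (A *v (W *v r)))"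
  proof -
    have "v \<bullet> ((?i ** A ** transpose ?i) *v v) = (transpose ?i *v v) \<bullet> (A *v (transpose ?i *v v))" for v
      by (simp only: matrix_vector_mul_assoc[symmetric] inner_matrix_transpose[of v ?i])
    then show ?thesis
      unfolding wr by (simp only: matrix_vector_mult_scaleR iB power2_eq_square inner_scaleR_left inner_scaleR_right mult.assoc)
  qed
  have tr: "trace ((?i ** A ** transpose ?i) ** (mat 1 + snd t)) = trace (W ** A) / (c\<^sup>2 * \<sigma>\<^sup>2)"
  proof -
    have "(?i ** A ** transpose ?i) ** (transpose B ** W ** B) = ?i ** (A ** (transpose ?i ** transpose B) ** W ** B)"
      by (simp only: matrix_mul_assoc)
    also have "transpose ?i ** transpose B = mat 1"
      by (simp only: matrix_transpose_mul[symmetric] matrix_inv_right[OF B] transpose_mat)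
    finally have "trace ((?i ** A ** transpose ?i) ** (transpose B ** W ** B)) = trace (?i ** (A ** mat 1 ** W ** B))"
      by (rule arg_cong)
    also have "\<dots> = trace ((A ** mat 1 ** W ** B) ** ?i)" by (rule trace_mul_sym)
    also have "\<dots> = trace (A ** W ** (B ** ?i))" by (simp only: matrix_mul_rid matrix_mul_assoc)
    also have "\<dots> = trace (A ** W)" by (simp only: matrix_inv_right[OF B] matrix_mul_rid)
    also have "\<dots> = trace (W ** A)" by (rule trace_mul_sym)
    finally show ?thesis
      unfolding snd_t by (simp only: matrix_mult_scaleR trace_scaleR times_divide_eq_left mult_1)
  qed
  show "dir_shape (?i ** A ** transpose ?i) x t
       = ((W *v r) \<bullet> (A *v (W *v r)) - (r \<bullet> (W *v r)) * trace (W ** A) / real CARD('k)) / (c\<^sup>2 * (\<sigma>\<^sup>2)\<^sup>2)"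
    unfolding dir_shape_def quad tr sq using c \<sigma>
    by (simp add: power_mult_distrib power_divide diff_divide_distrib power2_eq_square mult.commute mult.left_commute)
qed

context structured_fit begin

lemma comb_add: "comb (a + b) = comb a + comb b"
  and comb_scaleR: "comb (e *\<^sub>R a) = e *\<^sub>R comb a"
  by (simp_all add: comb_def scaleR_add_left sum.distrib scaleR_sum_right)

text \<open>The score equations: the first-order conditions in standardized coordinates.\<close>

lemma standardized_score_equations:
  fixes s :: "nat \<Rightarrow> (real^'k) \<times> (real^'q^'k)" and \<beta> \<beta>' :: "real^'q"
  assumes n: "n > 0" and \<sigma>: "\<sigma> (empirical_measure n s) > 0"
    and lm: "local_min_on (feasible \<Theta> V) (\<lambda>(\<beta>, \<gamma>). objective \<rho> \<sigma> (empirical_measure n s) \<beta> (V \<gamma>)) (\<beta>, \<gamma>)"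
    and B: "invertible B" and c: "c > 0"
  defines "t \<equiv> (\<beta> - \<beta>', (1 / (c\<^sup>2 * (\<sigma> (empirical_measure n s))\<^sup>2)) *\<^sub>R (transpose B ** matrix_inv (V \<gamma>) ** B) - mat 1)"
  shows "(\<Sum>i<n. score (dir_mean h) (standardize c B \<beta>' (s i)) t) = 0"
    and "(\<Sum>i<n. score (dir_shape (matrix_inv B ** comb a ** transpose (matrix_inv B))) (standardize c B \<beta>' (s i)) t) = 0"
proof -
  let ?W = "matrix_inv (V \<gamma>)" and ?s = "\<sigma> (empirical_measure n s)"
  let ?r = "\<lambda>i. fst (s i) - snd (s i) *v \<beta>"
  have PDS: "V \<gamma> \<in> PDS" by (rule feasible_min(2)[OF n \<sigma> lm])
  have Wsym: "x \<bullet> (?W *v y) = (?W *v x) \<bullet> y" for x y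
    using inner_matrix_transpose[of x ?W y] PDS_transpose[OF PDS_matrix_inv[OF PDS]] by simp
  note d = standardized_directions[OF B c \<sigma>, where \<beta>=\<beta> and \<beta>'=\<beta>' and W="?W", folded t_def]
  have sc: "sqdist (standardize c B \<beta>' (s i)) t = ?r i \<bullet> (?W *v ?r i) / ?s\<^sup>2"
    "dir_mean h (standardize c B \<beta>' (s i)) t = (snd (s i) *v h) \<bullet> (?W *v ?r i) / ?s\<^sup>2"
    "dir_shape (matrix_inv B ** A ** transpose (matrix_inv B)) (standardize c B \<beta>' (s i)) t
       = ((?W *v ?r i) \<bullet> (A *v (?W *v ?r i)) - (?r i \<bullet> (?W *v ?r i)) * trace (?W ** A) / real CARD('k)) / (c\<^sup>2 * (?s\<^sup>2)\<^sup>2)" for i h A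
    using d[where y="fst (s i)" and X="snd (s i)"] by simp_all
  have "(\<Sum>i<n. score (dir_mean h) (standardize c B \<beta>' (s i)) t)
      = (\<Sum>i<n. u (sqrt (?r i \<bullet> (?W *v ?r i) / ?s\<^sup>2)) * (?r i \<bullet> (?W *v (snd (s i) *v h)))) / ?s\<^sup>2"
    unfolding score_def sc sum_divide_distrib Wsym[of "?r _" "snd _ *v h"]
    by (simp add: inner_commute)
  then show "(\<Sum>i<n. score (dir_mean h) (standardize c B \<beta>' (s i)) t) = 0"
    using stationary_mean[OF n \<sigma> lm, of h] by simp
  have "(\<Sum>i<n. score (dir_shape (matrix_inv B ** comb a ** transpose (matrix_inv B))) (standardize c B \<beta>' (s i)) t)
      = (\<Sum>i<n. - (u (sqrt (?r i \<bullet> (?W *v ?r i) / ?s\<^sup>2)) *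
          ((?r i \<bullet> (?W *v ?r i)) * trace (?W ** comb a) / real CARD('k) - ?r i \<bullet> (?W *v (comb a *v (?W *v ?r i)))))) / (c\<^sup>2 * (?s\<^sup>2)\<^sup>2)"
    unfolding score_def sc sum_divide_distrib
  proof (rule sum.cong[OF refl])
    fix i
    have "?r i \<bullet> (?W *v (comb a *v (?W *v ?r i))) = (?W *v ?r i) \<bullet> (comb a *v (?W *v ?r i))" by (rule Wsym)
    then show "u (sqrt (?r i \<bullet> (?W *v ?r i) / ?s\<^sup>2)) * (((?W *v ?r i) \<bullet> (comb a *v (?W *v ?r i)) - ?r i \<bullet> (?W *v ?r i) * trace (?W ** comb a) / real CARD('k)) / (c\<^sup>2 * (?s\<^sup>2)\<^sup>2))
      = - (u (sqrt (?r i \<bullet> (?W *v ?r i) / ?s\<^sup>2)) * (?r i \<bullet> (?W *v ?r i) * trace (?W ** comb a) / real CARD('k) - ?r i \<bullet> (?W *v (comb a *v (?W *v ?r i))))) / (c\<^sup>2 * (?s\<^sup>2)\<^sup>2)"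
      by (simp only: mult_minus_right[symmetric] minus_diff_eq times_divide_eq_right)
  qed
  then show "(\<Sum>i<n. score (dir_shape (matrix_inv B ** comb a ** transpose (matrix_inv B))) (standardize c B \<beta>' (s i)) t) = 0"
    using stationary_shape[OF n \<sigma> lm, of a] by (simp add: sum_negf)
qed

end

section \<open>Linearization of the estimating equations\<close>

locale score_sample = score_model Z Q \<psi> \<psi>' c\<^sub>1 + S: iid_sample M T "Z \<Otimes>\<^sub>M Q"
  for Z :: "(real^'k) measure" and Q :: "(real^'q^'k) measure" and \<psi> \<psi>' c\<^sub>1 and M :: "'w measure" and T
begin

lemma solved_expansion:
  fixes a c d r :: real
  assumes "\<bar>a - c - d\<bar> \<le> r \<and> a = 0"
  shows "\<bar>d + c\<bar> \<le> r" "\<bar>- d - c\<bar> \<le> r"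
  using assms by linarith+

text \<open>At a root of the averaged score, the expected derivative must cancel the averaged score at the truth.\<close>

lemma mean_equation_linearization:
  assumes small: "\<And>e. e > 0 \<Longrightarrow> with_high_probability M (\<lambda>n \<omega>. norm (\<tau> n \<omega>) \<le> e)"
    and eq: "with_high_probability M (\<lambda>n \<omega>. S.avg n (\<lambda>x. score (dir_mean h) x (\<tau> n \<omega>)) \<omega> = 0)"
    and e: "e > 0"
  shows "with_high_probability M (\<lambda>n \<omega>.
    \<bar>mean_gain * (\<integral>X. (X *v h) \<bullet> (X *v fst (\<tau> n \<omega>)) \<partial>Q) - S.avg n (\<lambda>x. score (dir_mean h) x 0) \<omega>\<bar> \<le> e * norm (\<tau> n \<omega>))"
proof -
  have "with_high_probability M (\<lambda>n \<omega>. \<bar>S.avg n (\<lambda>x. score (dir_mean h) x (\<tau> n \<omega>)) \<omega> - S.avg n (\<lambda>x. score (dir_mean h) x 0) \<omega>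
      - (\<integral>x. score_deriv (dir_mean h) (dir_mean_deriv h) x (\<tau> n \<omega>) \<partial>(Z \<Otimes>\<^sub>M Q))\<bar> \<le> e * norm (\<tau> n \<omega>))"
  proof (rule S.avg_expansion[where \<delta>="1 / 2" and K="\<lambda>x. 9 * C * (2 * norm h) * (radius x)\<^sup>2"])
    show "(\<lambda>x. 9 * C * (2 * norm h) * (radius x)\<^sup>2) \<in> borel_measurable borel"
      unfolding radius_def by measurable
    show "AE x in Z \<Otimes>\<^sub>M Q. (score (dir_mean h) x has_derivative score_deriv (dir_mean h) (dir_mean_deriv h) x) (at 0)"
      using AE_fst_nonzero
    proof eventually_elim
      fix x :: "(real^'k) \<times> (real^'q^'k)" assume "fst x \<noteq> 0"
      then show "(score (dir_mean h) x has_derivative score_deriv (dir_mean h) (dir_mean_deriv h) x) (at 0)"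
        by (rule score_has_derivative[OF _ dir_mean_has_derivative[folded dir_mean_deriv_def]])
    qed
    show "(\<lambda>x. score (dir_mean h) x t) \<in> borel_measurable borel" for t
      by (intro score_measurable dir_measurable)
    show "continuous_on UNIV (score (dir_mean h) x)" for x
      by (intro score_continuous continuous_on_param continuous_intros)
    show "\<bar>score (dir_mean h) x t - score (dir_mean h) x 0\<bar> \<le> 9 * C * (2 * norm h) * (radius x)\<^sup>2 * norm t" if "norm t \<le> 1 / 2" for x t
      by (rule dir_mean_lipschitz[OF that])
    show "integrable (Z \<Otimes>\<^sub>M Q) (\<lambda>x. 9 * C * (2 * norm h) * (radius x)\<^sup>2)"
      by (intro integrable_mult_right radius_moment)
    show "(\<lambda>x. score_deriv (dir_mean h) (dir_mean_deriv h) x t) \<in> borel_measurable borel" for t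
      by (intro score_deriv_measurable dir_measurable dir_deriv_measurable)
    show "linear (score_deriv (dir_mean h) (dir_mean_deriv h) x)" for x
      by (intro linear_score_deriv linear_dir_mean_deriv)
  qed (fact small e | simp)+
  from S.whp_conj[OF this eq] show ?thesis
  proof (rule S.whp_mono)
    fix n \<omega>
    assume "\<bar>S.avg n (\<lambda>x. score (dir_mean h) x (\<tau> n \<omega>)) \<omega> - S.avg n (\<lambda>x. score (dir_mean h) x 0) \<omega>
      - (\<integral>x. score_deriv (dir_mean h) (dir_mean_deriv h) x (\<tau> n \<omega>) \<partial>(Z \<Otimes>\<^sub>M Q))\<bar> \<le> e * norm (\<tau> n \<omega>)
      \<and> S.avg n (\<lambda>x. score (dir_mean h) x (\<tau> n \<omega>)) \<omega> = 0"
    from solved_expansion(2)[OF this]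
    show "\<bar>mean_gain * (\<integral>X. (X *v h) \<bullet> (X *v fst (\<tau> n \<omega>)) \<partial>Q)
      - S.avg n (\<lambda>x. score (dir_mean h) x 0) \<omega>\<bar> \<le> e * norm (\<tau> n \<omega>)"
      unfolding expected_mean_deriv mult_minus_left minus_minus .
  qed
qed

lemma shape_equation_linearization:
  fixes A :: "real^'k^'k"
  assumes small: "\<And>e. e > 0 \<Longrightarrow> with_high_probability M (\<lambda>n \<omega>. norm (\<tau> n \<omega>) \<le> e)"
    and eq: "with_high_probability M (\<lambda>n \<omega>. S.avg n (\<lambda>x. score (dir_shape A) x (\<tau> n \<omega>)) \<omega> = 0)"
    and A: "transpose A = A" and e: "e > 0"
  shows "with_high_probability M (\<lambda>n \<omega>.
    \<bar>shape_gain * (trace (A ** snd (\<tau> n \<omega>)) - trace A * trace (snd (\<tau> n \<omega>)) / real CARD('k))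
      + S.avg n (\<lambda>x. score (dir_shape A) x 0) \<omega>\<bar> \<le> e * norm (\<tau> n \<omega>))"
proof -
  define K where "K = 9 * C * (norm A * (6 + 3 * norm (mat 1 :: real^'k^'k) * (norm (mat 1 :: real^'k^'k) + 1) + norm (mat 1 :: real^'k^'k)))"
  have "with_high_probability M (\<lambda>n \<omega>. \<bar>S.avg n (\<lambda>x. score (dir_shape A) x (\<tau> n \<omega>)) \<omega> - S.avg n (\<lambda>x. score (dir_shape A) x 0) \<omega>
      - (\<integral>x. score_deriv (dir_shape A) (dir_shape_deriv A) x (\<tau> n \<omega>) \<partial>(Z \<Otimes>\<^sub>M Q))\<bar> \<le> e * norm (\<tau> n \<omega>))"
  proof (rule S.avg_expansion[where \<delta>="1 / 2" and K="\<lambda>x. K * (radius x)\<^sup>2"])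
    show "(\<lambda>x. K * (radius x)\<^sup>2) \<in> borel_measurable borel"
      unfolding radius_def by measurable
    show "AE x in Z \<Otimes>\<^sub>M Q. (score (dir_shape A) x has_derivative score_deriv (dir_shape A) (dir_shape_deriv A) x) (at 0)"
      using AE_fst_nonzero
    proof eventually_elim
      fix x :: "(real^'k) \<times> (real^'q^'k)" assume "fst x \<noteq> 0"
      then show "(score (dir_shape A) x has_derivative score_deriv (dir_shape A) (dir_shape_deriv A) x) (at 0)"
        by (rule score_has_derivative[OF _ dir_shape_has_derivative[folded dir_shape_deriv_def]])
    qed
    show "(\<lambda>x. score (dir_shape A) x t) \<in> borel_measurable borel" for t
      by (intro score_measurable dir_measurable)
    show "continuous_on UNIV (score (dir_shape A) x)" for x
      by (intro score_continuous continuous_on_param continuous_intros)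
    show "\<bar>score (dir_shape A) x t - score (dir_shape A) x 0\<bar> \<le> K * (radius x)\<^sup>2 * norm t" if "norm t \<le> 1 / 2" for x t
      unfolding K_def by (rule dir_shape_lipschitz[OF that])
    show "integrable (Z \<Otimes>\<^sub>M Q) (\<lambda>x. K * (radius x)\<^sup>2)"
      by (intro integrable_mult_right radius_moment)
    show "(\<lambda>x. score_deriv (dir_shape A) (dir_shape_deriv A) x t) \<in> borel_measurable borel" for t
      by (intro score_deriv_measurable dir_measurable dir_deriv_measurable)
    show "linear (score_deriv (dir_shape A) (dir_shape_deriv A) x)" for x
      by (intro linear_score_deriv linear_dir_shape_deriv)
  qed (fact small e | simp)+
  from S.whp_conj[OF this eq] show ?thesis
  proof (rule S.whp_mono)
    fix n \<omega>
    assume "\<bar>S.avg n (\<lambda>x. score (dir_shape A) x (\<tau> n \<omega>)) \<omega> - S.avg n (\<lambda>x. score (dir_shape A) x 0) \<omega>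
      - (\<integral>x. score_deriv (dir_shape A) (dir_shape_deriv A) x (\<tau> n \<omega>) \<partial>(Z \<Otimes>\<^sub>M Q))\<bar> \<le> e * norm (\<tau> n \<omega>)
      \<and> S.avg n (\<lambda>x. score (dir_shape A) x (\<tau> n \<omega>)) \<omega> = 0"
    from solved_expansion(1)[OF this]
    show "\<bar>shape_gain * (trace (A ** snd (\<tau> n \<omega>)) - trace A * trace (snd (\<tau> n \<omega>)) / real CARD('k))
      + S.avg n (\<lambda>x. score (dir_shape A) x 0) \<omega>\<bar> \<le> e * norm (\<tau> n \<omega>)"
      unfolding expected_shape_deriv[OF A] .
  qed
qed

end

text \<open>
  The estimation errors \<open>b\<close> and \<open>\<delta>\<close> solve the standardized equations at a parameter whose shape part is the
  inverse of \<open>mat 1 + \<kappa> *\<^sub>R N \<delta>\<close>, up to a scale factor.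
\<close>

locale estimating_equations = score_sample Z Q \<psi> \<psi>' c\<^sub>1 M T
  for Z :: "(real^'k) measure" and Q :: "(real^'q^'k) measure" and \<psi> \<psi>' c\<^sub>1 and M :: "'w measure" and T +
  fixes N :: "real^'l \<Rightarrow> real^'k^'k" and \<kappa> :: real and G :: "real^'q \<Rightarrow> real^'q" and F :: "real^'l \<Rightarrow> real^'l"
    and b :: "nat \<Rightarrow> 'w \<Rightarrow> real^'q" and \<delta> :: "nat \<Rightarrow> 'w \<Rightarrow> real^'l" and ratio err :: "nat \<Rightarrow> 'w \<Rightarrow> real" and K :: real
    and \<tau> :: "nat \<Rightarrow> 'w \<Rightarrow> (real^'q) \<times> (real^'k^'k)"
  assumes linear_N: "linear N" and N_sym: "\<And>a. transpose (N a) = N a" and \<kappa>: "\<kappa> > 0"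
    and G: "\<And>t d. (\<integral>X. (X *v G t) \<bullet> (X *v d) \<partial>Q) = t \<bullet> d"
    and F: "\<And>t d. trace (N (F t) ** N d) = t \<bullet> d"
    and gains: "mean_gain \<noteq> 0" "shape_gain \<noteq> 0"
    and b_measurable [measurable]: "\<And>n. b n \<in> borel_measurable M"
    and \<delta>_measurable [measurable]: "\<And>n. \<delta> n \<in> borel_measurable M"
    and err_measurable [measurable]: "\<And>n. err n \<in> borel_measurable M"
    and consistent: "\<And>e. e > 0 \<Longrightarrow> with_high_probability M (\<lambda>n \<omega>. norm (b n \<omega>, \<delta> n \<omega>) \<le> e)"
    and err: "bounded_in_probability M (\<lambda>n \<omega>. sqrt (real n) * err n \<omega>)"
    and ratio: "with_high_probability M (\<lambda>n \<omega>. \<bar>ratio n \<omega> - 1\<bar> \<le> K * \<bar>err n \<omega>\<bar>)"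
    and det_1: "with_high_probability M (\<lambda>n \<omega>. det (mat 1 + \<kappa> *\<^sub>R N (\<delta> n \<omega>)) = 1)"
    and \<tau>_def: "\<And>n \<omega>. \<tau> n \<omega> = (b n \<omega>, ratio n \<omega> *\<^sub>R matrix_inv (mat 1 + \<kappa> *\<^sub>R N (\<delta> n \<omega>)) - mat 1)"
    and mean_eq: "\<And>h. with_high_probability M (\<lambda>n \<omega>. S.avg n (\<lambda>x. score (dir_mean h) x (\<tau> n \<omega>)) \<omega> = 0)"
    and shape_eq: "\<And>a. with_high_probability M (\<lambda>n \<omega>. S.avg n (\<lambda>x. score (dir_shape (N a)) x (\<tau> n \<omega>)) \<omega> = 0)"
begin

lemma err_small: "e > 0 \<Longrightarrow> with_high_probability M (\<lambda>n \<omega>. \<bar>err n \<omega>\<bar> \<le> e)"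
  by (rule S.whp_small_of_root_n_bounded[OF err err_measurable])

lemma ratio_close: 
  assumes e: "e > 0"
  shows "with_high_probability M (\<lambda>n \<omega>. \<bar>ratio n \<omega> - 1\<bar> \<le> e)"
proof -
  have "e / (\<bar>K\<bar> + 1) > 0" using e by (simp add: add_nonneg_pos)
  from S.whp_conj[OF ratio err_small[OF this]] show ?thesis
  proof (rule S.whp_mono)
    fix n \<omega> assume A: "\<bar>ratio n \<omega> - 1\<bar> \<le> K * \<bar>err n \<omega>\<bar> \<and> \<bar>err n \<omega>\<bar> \<le> e / (\<bar>K\<bar> + 1)"
    then have "\<bar>ratio n \<omega> - 1\<bar> \<le> (\<bar>K\<bar> + 1) * \<bar>err n \<omega>\<bar>"
      using mult_right_mono[of K "\<bar>K\<bar> + 1" "\<bar>err n \<omega>\<bar>"] by linarith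
    also have "\<dots> \<le> (\<bar>K\<bar> + 1) * (e / (\<bar>K\<bar> + 1))" using A by (intro mult_left_mono) auto
    also have "\<dots> = e" by simp
    finally show "\<bar>ratio n \<omega> - 1\<bar> \<le> e" .
  qed
qed

lemma N_bounded: obtains B where "B > 0" "\<And>a. norm (\<kappa> *\<^sub>R N a) \<le> B * norm a"
proof -
  have "linear (\<lambda>a. \<kappa> *\<^sub>R N a)" by (rule linear_compose_scale_right[OF linear_N])
  from linear_bounded_pos[OF this] show ?thesis using that by blast
qed

lemma perturbation_small: 
  assumes e: "e > 0"
  shows "with_high_probability M (\<lambda>n \<omega>. norm (\<kappa> *\<^sub>R N (\<delta> n \<omega>)) \<le> e)"
proof -
  obtain B where B: "B > 0" "\<And>a. norm (\<kappa> *\<^sub>R N a) \<le> B * norm a" using N_bounded by blast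
  have "e / B > 0" using e B by simp
  from consistent[OF this] show ?thesis
  proof (rule S.whp_mono)
    fix n \<omega> assume A: "norm (b n \<omega>, \<delta> n \<omega>) \<le> e / B"
    have "norm (\<kappa> *\<^sub>R N (\<delta> n \<omega>)) \<le> B * norm (\<delta> n \<omega>)" by (rule B)
    also have "\<dots> \<le> B * (e / B)" using A B(1) norm_snd_le[of "\<delta> n \<omega>" "b n \<omega>"] by (intro mult_left_mono) auto
    also have "\<dots> = e" using B by simp
    finally show "norm (\<kappa> *\<^sub>R N (\<delta> n \<omega>)) \<le> e" .
  qed
qed

lemma parameter_size:
  obtains B where "B > 0" "with_high_probability M (\<lambda>n \<omega>. norm (\<tau> n \<omega>) \<le> B * (norm (b n \<omega>, \<delta> n \<omega>) + \<bar>err n \<omega>\<bar>))"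
proof -
  obtain B where B: "B > 0" "\<And>a. norm (\<kappa> *\<^sub>R N a) \<le> B * norm a" using N_bounded by blast
  let ?N = "norm (mat 1 :: real^'k^'k)"
  define D where "D = 1 + 2 * (1 + ?N) * B + ?N * \<bar>K\<bar>"
  have D: "D > 0" unfolding D_def using B by (intro add_pos_nonneg) auto
  have "with_high_probability M (\<lambda>n \<omega>. norm (\<kappa> *\<^sub>R N (\<delta> n \<omega>)) \<le> 1 / 2 \<and> \<bar>ratio n \<omega> - 1\<bar> \<le> 1 \<and> \<bar>ratio n \<omega> - 1\<bar> \<le> K * \<bar>err n \<omega>\<bar>)"
    by (intro S.whp_conj perturbation_small ratio_close ratio) auto
  then have "with_high_probability M (\<lambda>n \<omega>. norm (\<tau> n \<omega>) \<le> D * (norm (b n \<omega>, \<delta> n \<omega>) + \<bar>err n \<omega>\<bar>))"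
  proof (rule S.whp_mono)
    fix n \<omega> assume A: "norm (\<kappa> *\<^sub>R N (\<delta> n \<omega>)) \<le> 1 / 2 \<and> \<bar>ratio n \<omega> - 1\<bar> \<le> 1 \<and> \<bar>ratio n \<omega> - 1\<bar> \<le> K * \<bar>err n \<omega>\<bar>"
    define z where "z = norm (b n \<omega>, \<delta> n \<omega>)"
    have z: "norm (b n \<omega>) \<le> z" "norm (\<delta> n \<omega>) \<le> z" "z \<ge> 0"
      using norm_fst_le[of "b n \<omega>" "\<delta> n \<omega>"] norm_snd_le[of "\<delta> n \<omega>" "b n \<omega>"] by (auto simp: z_def)
    have "norm (\<tau> n \<omega>) \<le> norm (b n \<omega>) + norm (ratio n \<omega> *\<^sub>R matrix_inv (mat 1 + \<kappa> *\<^sub>R N (\<delta> n \<omega>)) - mat 1)"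
      unfolding \<tau>_def by (rule norm_Pair_le)
    also have "\<dots> \<le> z + (2 * (1 + ?N) * norm (\<kappa> *\<^sub>R N (\<delta> n \<omega>)) + ?N * \<bar>ratio n \<omega> - 1\<bar>)"
      using A z(1) by (intro add_mono inverse_shape_size) auto
    also have "\<dots> \<le> z + (2 * (1 + ?N) * (B * z) + ?N * (\<bar>K\<bar> * \<bar>err n \<omega>\<bar>))"
    proof (intro add_mono mult_left_mono order_refl)
      show "norm (\<kappa> *\<^sub>R N (\<delta> n \<omega>)) \<le> B * z" using B(2)[of "\<delta> n \<omega>"] mult_left_mono[OF z(2), of B] B(1) by linarith
      show "\<bar>ratio n \<omega> - 1\<bar> \<le> \<bar>K\<bar> * \<bar>err n \<omega>\<bar>" using A mult_right_mono[of K "\<bar>K\<bar>" "\<bar>err n \<omega>\<bar>"] by linarith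
    qed auto
    also have "\<dots> \<le> D * (z + \<bar>err n \<omega>\<bar>)"
    proof -
      define p q where "p = 2 * (1 + ?N) * B" and "q = ?N * \<bar>K\<bar>"
      have "p \<ge> 0" "q \<ge> 0" using B by (auto simp: p_def q_def)
      then have "0 \<le> q * z" "0 \<le> p * \<bar>err n \<omega>\<bar>" using z by auto
      then have "z + (p * z + q * \<bar>err n \<omega>\<bar>) \<le> (1 + p + q) * (z + \<bar>err n \<omega>\<bar>)"
        by (simp add: algebra_simps)
      then show ?thesis by (simp add: D_def p_def q_def mult.assoc)
    qed
    finally show "norm (\<tau> n \<omega>) \<le> D * (norm (b n \<omega>, \<delta> n \<omega>) + \<bar>err n \<omega>\<bar>)" unfolding z_def .
  qed
  with D show ?thesis using that by blast
qed

lemma parameter_small: 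
  assumes e: "e > 0"
  shows "with_high_probability M (\<lambda>n \<omega>. norm (\<tau> n \<omega>) \<le> e)"
proof -
  obtain B where B: "B > 0" "with_high_probability M (\<lambda>n \<omega>. norm (\<tau> n \<omega>) \<le> B * (norm (b n \<omega>, \<delta> n \<omega>) + \<bar>err n \<omega>\<bar>))"
    by (rule parameter_size)
  have e': "e / (2 * B) > 0" using e B by simp
  from S.whp_conj[OF B(2) S.whp_conj[OF consistent[OF e'] err_small[OF e']]] show ?thesis
  proof (rule S.whp_mono)
    fix n \<omega> assume A: "norm (\<tau> n \<omega>) \<le> B * (norm (b n \<omega>, \<delta> n \<omega>) + \<bar>err n \<omega>\<bar>) \<and> norm (b n \<omega>, \<delta> n \<omega>) \<le> e / (2 * B) \<and> \<bar>err n \<omega>\<bar> \<le> e / (2 * B)"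
    have "norm (\<tau> n \<omega>) \<le> B * (norm (b n \<omega>, \<delta> n \<omega>) + \<bar>err n \<omega>\<bar>)" using A by simp
    also have "\<dots> \<le> B * (e / (2 * B) + e / (2 * B))" using A B(1) by (intro mult_left_mono add_mono) auto
    also have "\<dots> = e" using B(1) by simp
    finally show "norm (\<tau> n \<omega>) \<le> e" .
  qed
qed

text \<open>
  The influence function of the functional \<open>t\<close>: \<open>G\<close> and \<open>F\<close> turn \<open>t\<close> into the directions that the
  expected derivatives pair with the errors to give \<open>t\<close>.
\<close>

definition influence :: "(real^'q) \<times> (real^'l) \<Rightarrow> (real^'k) \<times> (real^'q^'k) \<Rightarrow> real" where
  "influence t x = (1 / mean_gain) * score (dir_mean (G (fst t))) x 0
     + (1 / (shape_gain * \<kappa>)) * score (dir_shape (N (F (snd t)))) x 0"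

lemma mean_error_linear:
  assumes e: "e > 0"
  shows "with_high_probability M (\<lambda>n \<omega>. \<bar>t \<bullet> b n \<omega> - (1 / mean_gain) * S.avg n (\<lambda>x. score (dir_mean (G t)) x 0) \<omega>\<bar>
    \<le> e * (norm (b n \<omega>, \<delta> n \<omega>) + \<bar>err n \<omega>\<bar>))"
proof -
  obtain B where B: "B > 0" "with_high_probability M (\<lambda>n \<omega>. norm (\<tau> n \<omega>) \<le> B * (norm (b n \<omega>, \<delta> n \<omega>) + \<bar>err n \<omega>\<bar>))"
    by (rule parameter_size)
  define e' where "e' = e * \<bar>mean_gain\<bar> / B"
  have e': "e' > 0" using e B gains by (simp add: e'_def)
  from S.whp_conj[OF B(2) mean_equation_linearization[OF parameter_small mean_eq e', of "G t"]] show ?thesis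
  proof (rule S.whp_mono)
    fix n \<omega>
    let ?a = "S.avg n (\<lambda>x. score (dir_mean (G t)) x 0) \<omega>" and ?z = "norm (b n \<omega>, \<delta> n \<omega>) + \<bar>err n \<omega>\<bar>"
    assume A: "norm (\<tau> n \<omega>) \<le> B * ?z \<and> \<bar>mean_gain * (\<integral>X. (X *v G t) \<bullet> (X *v fst (\<tau> n \<omega>)) \<partial>Q) - ?a\<bar> \<le> e' * norm (\<tau> n \<omega>)"
    have "t \<bullet> b n \<omega> - (1 / mean_gain) * ?a = (mean_gain * (t \<bullet> b n \<omega>) - ?a) / mean_gain"
      using gains(1) by (simp add: diff_divide_distrib)
    then have "\<bar>t \<bullet> b n \<omega> - (1 / mean_gain) * ?a\<bar> = \<bar>mean_gain * (t \<bullet> b n \<omega>) - ?a\<bar> / \<bar>mean_gain\<bar>" by simp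
    also have "\<dots> \<le> (e' * (B * ?z)) / \<bar>mean_gain\<bar>"
    proof (rule divide_right_mono)
      have "\<bar>mean_gain * (t \<bullet> b n \<omega>) - ?a\<bar> \<le> e' * norm (\<tau> n \<omega>)"
        using A unfolding G by (simp add: \<tau>_def)
      also have "\<dots> \<le> e' * (B * ?z)" using A e' by (intro mult_left_mono) auto
      finally show "\<bar>mean_gain * (t \<bullet> b n \<omega>) - ?a\<bar> \<le> e' * (B * ?z)" .
    qed simp
    also have "\<dots> = e * ?z" unfolding e'_def using B gains by simp
    finally show "\<bar>t \<bullet> b n \<omega> - (1 / mean_gain) * ?a\<bar> \<le> e * ?z" .
  qed
qed

text \<open>
  \<open>shape_linearization\<close> replaces the deviator of \<open>snd \<tau>\<close> by a multiple of \<open>t \<bullet> \<delta>\<close>, from which the scale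
  ratio has disappeared.
\<close>

lemma shape_error_linear:
  assumes e: "e > 0"
  shows "with_high_probability M (\<lambda>n \<omega>. \<bar>t \<bullet> \<delta> n \<omega> - (1 / (shape_gain * \<kappa>)) * S.avg n (\<lambda>x. score (dir_shape (N (F t))) x 0) \<omega>\<bar>
    \<le> e * (norm (b n \<omega>, \<delta> n \<omega>) + \<bar>err n \<omega>\<bar>))"
proof -
  obtain B where B: "B > 0" "with_high_probability M (\<lambda>n \<omega>. norm (\<tau> n \<omega>) \<le> B * (norm (b n \<omega>, \<delta> n \<omega>) + \<bar>err n \<omega>\<bar>))"
    by (rule parameter_size)
  obtain B' where B': "B' > 0" "\<And>a. norm (\<kappa> *\<^sub>R N a) \<le> B' * norm a" using N_bounded by blast
  define A where "A = N (F t)"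
  define dev where "dev E = trace (A ** E) - trace A * trace E / real CARD('k)" for E :: "real^'k^'k"
  define e' where "e' = e * \<bar>shape_gain\<bar> * \<kappa> / (2 * B)"
  have e': "e' > 0" using e B gains \<kappa> by (simp add: e'_def)
  define e'' where "e'' = e * \<kappa> / (2 * B')"
  have e'': "e'' > 0" using e B' \<kappa> by (simp add: e''_def)
  obtain d where d: "d > 0" "\<And>H s. norm H \<le> d \<Longrightarrow> \<bar>s - 1\<bar> \<le> d \<Longrightarrow> det (mat 1 + H) = 1 \<Longrightarrow>
      \<bar>dev (s *\<^sub>R matrix_inv (mat 1 + H) - mat 1) + trace (A ** H)\<bar> \<le> e'' * norm H"
    using shape_linearization[OF e'', of A] unfolding dev_def by blast
  have lin: "with_high_probability M (\<lambda>n \<omega>. \<bar>shape_gain * dev (snd (\<tau> n \<omega>)) + S.avg n (\<lambda>x. score (dir_shape A) x 0) \<omega>\<bar> \<le> e' * norm (\<tau> n \<omega>))"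
    unfolding dev_def A_def by (rule shape_equation_linearization[OF parameter_small shape_eq N_sym e'])
  from S.whp_conj[OF B(2) S.whp_conj[OF lin S.whp_conj[OF perturbation_small[OF d(1)] S.whp_conj[OF ratio_close[OF d(1)] det_1]]]] show ?thesis
  proof (rule S.whp_mono)
    fix n \<omega>
    let ?a = "S.avg n (\<lambda>x. score (dir_shape A) x 0) \<omega>" and ?z = "norm (b n \<omega>, \<delta> n \<omega>) + \<bar>err n \<omega>\<bar>"
    let ?H = "\<kappa> *\<^sub>R N (\<delta> n \<omega>)"
    assume E: "norm (\<tau> n \<omega>) \<le> B * ?z \<and> \<bar>shape_gain * dev (snd (\<tau> n \<omega>)) + ?a\<bar> \<le> e' * norm (\<tau> n \<omega>)
      \<and> norm ?H \<le> d \<and> \<bar>ratio n \<omega> - 1\<bar> \<le> d \<and> det (mat 1 + ?H) = 1"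
    have tr: "trace (A ** ?H) = \<kappa> * (t \<bullet> \<delta> n \<omega>)" by (simp add: A_def matrix_mult_scaleR trace_scaleR F)
    have 1: "\<bar>dev (snd (\<tau> n \<omega>)) + \<kappa> * (t \<bullet> \<delta> n \<omega>)\<bar> \<le> e'' * norm ?H"
      unfolding \<tau>_def snd_conv tr[symmetric] using E by (intro d(2)) auto
    have "e'' * norm ?H \<le> e'' * (B' * ?z)"
    proof (rule mult_left_mono)
      have "norm ?H \<le> B' * norm (\<delta> n \<omega>)" by (rule B')
      also have "\<dots> \<le> B' * ?z" using norm_snd_le[of "\<delta> n \<omega>" "b n \<omega>"] B'(1) by (intro mult_left_mono) auto
      finally show "norm ?H \<le> B' * ?z" .
    qed (use e'' in simp)
    with 1 have 1: "\<bar>dev (snd (\<tau> n \<omega>)) + \<kappa> * (t \<bullet> \<delta> n \<omega>)\<bar> \<le> e'' * (B' * ?z)" by linarith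
    have 2: "\<bar>shape_gain * dev (snd (\<tau> n \<omega>)) + ?a\<bar> \<le> e' * (B * ?z)"
      using E mult_left_mono[of "norm (\<tau> n \<omega>)" "B * ?z" e'] e' by linarith
    have k: "shape_gain * \<kappa> \<noteq> 0" using gains \<kappa> by simp
    have "t \<bullet> \<delta> n \<omega> - (1 / (shape_gain * \<kappa>)) * ?a
      = (shape_gain * (dev (snd (\<tau> n \<omega>)) + \<kappa> * (t \<bullet> \<delta> n \<omega>)) - (shape_gain * dev (snd (\<tau> n \<omega>)) + ?a)) / (shape_gain * \<kappa>)"
      using k by (simp add: field_simps)
    then have "\<bar>t \<bullet> \<delta> n \<omega> - (1 / (shape_gain * \<kappa>)) * ?a\<bar>
      = \<bar>shape_gain * (dev (snd (\<tau> n \<omega>)) + \<kappa> * (t \<bullet> \<delta> n \<omega>)) - (shape_gain * dev (snd (\<tau> n \<omega>)) + ?a)\<bar> / (\<bar>shape_gain\<bar> * \<kappa>)"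
      using \<kappa> by (simp add: abs_mult)
    also have "\<dots> \<le> (\<bar>shape_gain\<bar> * (e'' * (B' * ?z)) + e' * (B * ?z)) / (\<bar>shape_gain\<bar> * \<kappa>)"
    proof (rule divide_right_mono)
      have "\<bar>shape_gain * (dev (snd (\<tau> n \<omega>)) + \<kappa> * (t \<bullet> \<delta> n \<omega>))\<bar> \<le> \<bar>shape_gain\<bar> * (e'' * (B' * ?z))"
        unfolding abs_mult by (rule mult_left_mono[OF 1]) simp
      then show "\<bar>shape_gain * (dev (snd (\<tau> n \<omega>)) + \<kappa> * (t \<bullet> \<delta> n \<omega>)) - (shape_gain * dev (snd (\<tau> n \<omega>)) + ?a)\<bar>
        \<le> \<bar>shape_gain\<bar> * (e'' * (B' * ?z)) + e' * (B * ?z)" using 2 by linarith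
    qed (use \<kappa> in simp)
    also have "\<dots> = e * ?z"
    proof -
      have "e'' * (B' * ?z) = e * \<kappa> * ?z / 2" unfolding e''_def using B' by simp
      moreover have "e' * (B * ?z) = \<bar>shape_gain\<bar> * (e * \<kappa> * ?z / 2)" unfolding e'_def using B by simp
      moreover have "(g * (e * \<kappa> * z / 2) + g * (e * \<kappa> * z / 2)) / (g * \<kappa>) = e * z" if "g \<noteq> 0" for g z :: real
        using that \<kappa> by simp
      ultimately show ?thesis using gains(2) by (metis abs_eq_0)
    qed
    finally show "\<bar>t \<bullet> \<delta> n \<omega> - (1 / (shape_gain * \<kappa>)) * S.avg n (\<lambda>x. score (dir_shape (N (F t))) x 0) \<omega>\<bar> \<le> e * ?z"
      unfolding A_def .
  qed
qed

text \<open>The variance of the limit is the second moment of the influence function.\<close>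

theorem char_limit:
  "(\<lambda>n. \<integral>\<omega>. iexp (t \<bullet> (sqrt (real n) *\<^sub>R (b n \<omega>, \<delta> n \<omega>))) \<partial>M) \<longlonglongrightarrow> of_real (exp (- (
     (\<integral>z. (\<psi> (norm z))\<^sup>2 \<partial>Z) / (real CARD('k) * mean_gain\<^sup>2) * (fst t \<bullet> G (fst t))
   + 2 * (\<integral>z. (\<psi> (norm z))\<^sup>2 * (norm z)\<^sup>2 \<partial>Z) / (real CARD('k) * (real CARD('k) + 2) * (shape_gain * \<kappa>)\<^sup>2)
       * (snd t \<bullet> F (snd t) - (trace (N (F (snd t))))\<^sup>2 / real CARD('k))) / 2))"
proof -
  have g: "influence t \<in> borel_measurable borel" "integrable (Z \<Otimes>\<^sub>M Q) (\<lambda>x. (influence t x)\<^sup>2)"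
    "(\<integral>x. influence t x \<partial>(Z \<Otimes>\<^sub>M Q)) = 0" for t
    unfolding influence_def by (rule score_moments[OF N_sym])+
  have "(\<lambda>n. \<integral>\<omega>. iexp (t \<bullet> (sqrt (real n) *\<^sub>R (b n \<omega>, \<delta> n \<omega>))) \<partial>M) \<longlonglongrightarrow> of_real (exp (- (\<integral>x. (influence t x)\<^sup>2 \<partial>(Z \<Otimes>\<^sub>M Q)) / 2))"
  proof (rule S.char_of_asymptotically_linear[OF _ g err])
    fix t :: "(real^'q) \<times> (real^'l)" and e :: real assume e: "e > 0"
    then have "e / 2 > 0" by simp
    from S.whp_conj[OF mean_error_linear[OF this, of "fst t"] shape_error_linear[OF this, of "snd t"]]
    show "with_high_probability M (\<lambda>n \<omega>. \<bar>t \<bullet> (b n \<omega>, \<delta> n \<omega>) - S.avg n (influence t) \<omega>\<bar> \<le> e * (norm (b n \<omega>, \<delta> n \<omega>) + \<bar>err n \<omega>\<bar>))"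
    proof (rule S.whp_mono)
      fix n \<omega>
      assume A: "\<bar>fst t \<bullet> b n \<omega> - (1 / mean_gain) * S.avg n (\<lambda>x. score (dir_mean (G (fst t))) x 0) \<omega>\<bar> \<le> e / 2 * (norm (b n \<omega>, \<delta> n \<omega>) + \<bar>err n \<omega>\<bar>)
        \<and> \<bar>snd t \<bullet> \<delta> n \<omega> - (1 / (shape_gain * \<kappa>)) * S.avg n (\<lambda>x. score (dir_shape (N (F (snd t)))) x 0) \<omega>\<bar> \<le> e / 2 * (norm (b n \<omega>, \<delta> n \<omega>) + \<bar>err n \<omega>\<bar>)"
      have "S.avg n (influence t) \<omega> = (1 / mean_gain) * S.avg n (\<lambda>x. score (dir_mean (G (fst t))) x 0) \<omega>
          + (1 / (shape_gain * \<kappa>)) * S.avg n (\<lambda>x. score (dir_shape (N (F (snd t)))) x 0) \<omega>"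
        unfolding influence_def[abs_def] by (simp only: S.avg_add S.avg_cmult)
      moreover have "t \<bullet> (b n \<omega>, \<delta> n \<omega>) = fst t \<bullet> b n \<omega> + snd t \<bullet> \<delta> n \<omega>" by (simp add: inner_prod_def)
      moreover have "e * (norm (b n \<omega>, \<delta> n \<omega>) + \<bar>err n \<omega>\<bar>) = e / 2 * (norm (b n \<omega>, \<delta> n \<omega>) + \<bar>err n \<omega>\<bar>) + e / 2 * (norm (b n \<omega>, \<delta> n \<omega>) + \<bar>err n \<omega>\<bar>)"
        by simp
      moreover have "\<bar>p + q - (x + y)\<bar> \<le> r" if "\<bar>p - x\<bar> \<le> s \<and> \<bar>q - y\<bar> \<le> s" "r = s + s" for p q x y r s :: real
        using that by linarith
      note this[OF A]
      ultimately show "\<bar>t \<bullet> (b n \<omega>, \<delta> n \<omega>) - S.avg n (influence t) \<omega>\<bar> \<le> e * (norm (b n \<omega>, \<delta> n \<omega>) + \<bar>err n \<omega>\<bar>)"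
        by (simp only:)
    qed
  qed measurable
  also have "(\<integral>x. (influence t x)\<^sup>2 \<partial>(Z \<Otimes>\<^sub>M Q)) =
     (\<integral>z. (\<psi> (norm z))\<^sup>2 \<partial>Z) / (real CARD('k) * mean_gain\<^sup>2) * (fst t \<bullet> G (fst t))
   + 2 * (\<integral>z. (\<psi> (norm z))\<^sup>2 * (norm z)\<^sup>2 \<partial>Z) / (real CARD('k) * (real CARD('k) + 2) * (shape_gain * \<kappa>)\<^sup>2)
       * (snd t \<bullet> F (snd t) - (trace (N (F (snd t))))\<^sup>2 / real CARD('k))"
    unfolding influence_def score_moments(4)[OF N_sym] G F
    by (simp add: power_divide power_mult_distrib mult.commute mult.left_commute)
  finally show ?thesis .
qed

end

section \<open>The information matrices\<close>

lemma inner_vec_cols: "vec_cols A \<bullet> vec_cols B = A \<bullet> B" for A B :: "real^'n^'m"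
proof -
  have "vec_cols A \<bullet> vec_cols B = (\<Sum>p\<in>UNIV \<times> UNIV. A $ snd p $ fst p * B $ snd p $ fst p)"
    by (simp add: inner_vec_def vec_cols_def)
  also have "\<dots> = (\<Sum>j\<in>UNIV. \<Sum>i\<in>UNIV. A $ i $ j * B $ i $ j)"
    by (simp only: sum.cartesian_product split_beta')
  also have "\<dots> = A \<bullet> B" by (subst sum.swap) (simp add: inner_vec_def)
  finally show ?thesis .
qed

lemma kronecker_mult_vec_cols:
  fixes A :: "real^'m^'k" and B :: "real^'b^'a" and D :: "real^'m^'b"
  shows "kronecker A B *v vec_cols D = vec_cols (B ** D ** transpose A)"
proof (subst vec_eq_iff, rule allI)
  fix p :: "'k \<times> 'a"
  have "(kronecker A B *v vec_cols D) $ p = (\<Sum>r\<in>UNIV \<times> UNIV. A $ fst p $ fst r * B $ snd p $ snd r * D $ snd r $ fst r)"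
    by (simp add: matrix_vector_mult_def kronecker_def vec_cols_def)
  also have "\<dots> = (\<Sum>c\<in>UNIV. \<Sum>d\<in>UNIV. A $ fst p $ c * B $ snd p $ d * D $ d $ c)"
    by (simp only: sum.cartesian_product split_beta')
  also have "\<dots> = (\<Sum>c\<in>UNIV. (\<Sum>d\<in>UNIV. B $ snd p $ d * D $ d $ c) * A $ fst p $ c)"
    by (simp add: sum_distrib_left mult.commute mult.left_commute)
  also have "\<dots> = vec_cols (B ** D ** transpose A) $ p"
    by (simp add: vec_cols_def matrix_matrix_mult_def transpose_def)
  finally show "(kronecker A B *v vec_cols D) $ p = vec_cols (B ** D ** transpose A) $ p" .
qed

lemma matrix_inv_mult_transpose:
  fixes B :: "real^'n^'n"
  assumes "invertible B"
  shows "matrix_inv (B ** transpose B) = transpose (matrix_inv B) ** matrix_inv B"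
  by (simp only: matrix_inv_mult[OF assms invertible_transpose[OF assms]] matrix_inv_transpose[OF assms])

lemma matrix_eq_of_inner:
  fixes A B :: "real^'n^'m"
  assumes "\<And>a d. a \<bullet> (A *v d) = a \<bullet> (B *v d)"
  shows "A = B"
proof -
  have "A *v d = B *v d" for d
    by (rule vector_eq_ldot[THEN iffD1]) (simp add: assms)
  then show ?thesis by (simp add: matrix_eq)
qed

lemma bounded_linear_transpose: "bounded_linear (transpose :: real^'n^'m \<Rightarrow> real^'m^'n)"
  by (intro linear_conv_bounded_linear[THEN iffD1] linearI) (simp_all add: transpose_def vec_eq_iff)

lemma matrix_scaleR_mult: "(r *\<^sub>R A) ** B = r *\<^sub>R (A ** B)" for A :: "real^'n^'m" and B :: "real^'p^'n"
  by (simp add: scalar_matrix_assoc[symmetric])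

context structured_fit begin

definition std_comb :: "real^'k^'k \<Rightarrow> real^'l \<Rightarrow> real^'k^'k" where
  "std_comb B a = matrix_inv B ** comb a ** transpose (matrix_inv B)"

lemma linear_std_comb: "linear (std_comb B)"
  by (rule linearI) (simp_all only: std_comb_def comb_add comb_scaleR matrix_add_ldistrib matrix_add_mult matrix_mult_scaleR matrix_scaleR_mult)

lemma vec_matrix_mult: "vec_matrix L *v a = vec_cols (comb a)"
  by (simp add: vec_eq_iff matrix_vector_mult_def vec_matrix_def vec_cols_def comb_def mult.commute)

lemma comb_in_domain: "\<gamma> \<in> \<Theta> \<Longrightarrow> comb \<gamma> = V \<gamma>"
  by (simp add: comb_def V_linear)

lemma std_comb_in_domain:
  assumes B: "invertible B" and \<gamma>: "\<gamma> \<in> \<Theta>" and V: "V \<gamma> = e *\<^sub>R (B ** transpose B)"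
  shows "std_comb B \<gamma> = e *\<^sub>R mat 1"
proof -
  have "transpose B ** transpose (matrix_inv B) = mat 1"
    by (simp only: matrix_transpose_mul[symmetric] matrix_inv_left[OF B] transpose_mat)
  then have "matrix_inv B ** (B ** transpose B) ** transpose (matrix_inv B) = mat 1"
    by (simp only: matrix_mul_assoc matrix_inv_left[OF B] matrix_mul_lid)
  then show ?thesis
    unfolding std_comb_def comb_in_domain[OF \<gamma>] V by (simp only: matrix_mult_scaleR matrix_scaleR_mult)
qed

text \<open>\<open>\<Theta>\<close> is open, so a combination that vanishes could be added to a parameter without changing its covariance.\<close>

lemma comb_injective:
  assumes inj: "inj_on V \<Theta>" and \<theta>: "\<theta> \<in> \<Theta>" and a: "comb a = 0"
  shows "a = 0"
proof (rule ccontr)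
  assume a0: "a \<noteq> 0"
  obtain e where e: "e > 0" "ball \<theta> e \<subseteq> \<Theta>" using open_\<Theta> \<theta> by (meson openE)
  define d where "d = e / (2 * norm a)"
  have d: "d > 0" using e a0 by (simp add: d_def)
  have "norm (d *\<^sub>R a) = e / 2" using d a0 e by (simp add: d_def)
  then have "\<theta> + d *\<^sub>R a \<in> ball \<theta> e" using e by (simp add: dist_norm)
  then have in\<Theta>: "\<theta> + d *\<^sub>R a \<in> \<Theta>" using e by blast
  have "V (\<theta> + d *\<^sub>R a) = V \<theta>"
    unfolding comb_in_domain[OF in\<Theta>, symmetric] comb_in_domain[OF \<theta>, symmetric] comb_add comb_scaleR a by simp
  then have "\<theta> + d *\<^sub>R a = \<theta>" by (rule inj_onD[OF inj _ in\<Theta> \<theta>])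
  then show False using d a0 by simp
qed

context
  fixes B :: "real^'k^'k"
  assumes B: "invertible B" and L_sym: "\<And>j. transpose (L j) = L j"
begin

lemma transpose_comb: "transpose (comb a) = comb a"
proof -
  have "comb a $ i $ j = comb a $ j $ i" for i j
    unfolding comb_def using L_sym by (auto simp: transpose_def vec_eq_iff intro!: sum.cong)
  then show ?thesis by (simp add: transpose_def vec_eq_iff)
qed

lemma transpose_std_comb: "transpose (std_comb B a) = std_comb B a"
  by (simp only: std_comb_def matrix_transpose_mul transpose_transpose transpose_comb matrix_mul_assoc)

private abbreviation (input) "gram \<equiv> transpose (vec_matrix L) ** kronecker (matrix_inv (B ** transpose B)) (matrix_inv (B ** transpose B)) ** vec_matrix L"

lemma trace_std_comb: "trace (std_comb B a ** std_comb B d) = a \<bullet> (gram *v d)"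
proof -
  let ?W = "matrix_inv (B ** transpose B)" and ?i = "matrix_inv B"
  have W: "?W = transpose ?i ** ?i" by (rule matrix_inv_mult_transpose[OF B])
  have "a \<bullet> (gram *v d) = (vec_matrix L *v a) \<bullet> (kronecker ?W ?W *v (vec_matrix L *v d))"
    by (simp only: matrix_vector_mul_assoc[symmetric] inner_matrix_transpose[of a "transpose _"] transpose_transpose)
  also have "\<dots> = comb a \<bullet> (?W ** comb d ** transpose ?W)"
    by (simp only: vec_matrix_mult kronecker_mult_vec_cols inner_vec_cols)
  also have "\<dots> = trace (comb a ** (?W ** comb d ** transpose ?W))"
    by (simp only: trace_mult_eq_inner transpose_comb)
  also have "comb a ** (?W ** comb d ** transpose ?W) = (comb a ** transpose ?i ** (?i ** comb d ** transpose ?i)) ** ?i"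
    by (simp only: W matrix_transpose_mul transpose_transpose matrix_mul_assoc)
  also have "trace \<dots> = trace (?i ** (comb a ** transpose ?i ** (?i ** comb d ** transpose ?i)))"
    by (rule trace_mul_sym)
  also have "\<dots> = trace (std_comb B a ** std_comb B d)" by (simp only: std_comb_def matrix_mul_assoc)
  finally show ?thesis by simp
qed

text \<open>Its quadratic form is the squared Frobenius norm of the standardized combination.\<close>

lemma gram_PDS:
  assumes inj: "inj_on V \<Theta>" and \<theta>: "\<theta> \<in> \<Theta>"
  shows "gram \<in> PDS"
  unfolding PDS_def
proof (intro CollectI conjI allI impI)
  have "a \<bullet> (transpose gram *v d) = a \<bullet> (gram *v d)" for a d
  proof -
    have "a \<bullet> (transpose gram *v d) = d \<bullet> (gram *v a)"
      by (simp only: inner_matrix_transpose[of a] transpose_transpose inner_commute)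
    then show ?thesis unfolding trace_std_comb[symmetric] by (simp only: trace_mul_sym[of "std_comb B d"])
  qed
  then show "transpose gram = gram" by (rule matrix_eq_of_inner)
next
  fix a :: "real^'l" assume "a \<noteq> 0"
  then have "comb a \<noteq> 0" using comb_injective[OF inj \<theta>] by blast
  have "std_comb B a \<noteq> 0"
  proof
    assume "std_comb B a = 0"
    then have "B ** std_comb B a ** transpose B = 0" by (simp add: vec_eq_iff matrix_matrix_mult_def)
    moreover have "B ** std_comb B a ** transpose B = (B ** matrix_inv B) ** comb a ** transpose (B ** matrix_inv B)"
      by (simp only: std_comb_def matrix_transpose_mul matrix_mul_assoc)
    ultimately show False
      using \<open>comb a \<noteq> 0\<close> by (simp only: matrix_inv_right[OF B] transpose_mat matrix_mul_lid matrix_mul_rid)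
  qed
  then have "0 < std_comb B a \<bullet> std_comb B a" by simp
  also have "\<dots> = a \<bullet> (gram *v a)"
    unfolding trace_std_comb[symmetric] by (simp only: trace_mult_eq_inner transpose_std_comb)
  finally show "0 < a \<bullet> (gram *v a)" .
qed

end

text \<open>On the determinant one surface, the estimated shape is a perturbation of the identity in standardized coordinates.\<close>

lemma standardized_shape:
  fixes B :: "real^'k^'k"
  assumes B: "invertible B" and \<gamma>: "\<gamma> \<in> \<Theta>" and det: "det (V \<gamma>) = 1"
    and \<gamma>': "\<gamma>' \<in> \<Theta>" "V \<gamma>' = (1 / \<kappa>) *\<^sub>R (B ** transpose B)" and \<kappa>: "\<kappa> > 0" "\<kappa> ^ CARD('k) = det (B ** transpose B)"
  shows "det (mat 1 + \<kappa> *\<^sub>R std_comb B (\<gamma> - \<gamma>')) = 1"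
    and "matrix_inv (mat 1 + \<kappa> *\<^sub>R std_comb B (\<gamma> - \<gamma>')) = (1 / \<kappa>) *\<^sub>R (transpose B ** matrix_inv (V \<gamma>) ** B)"
proof -
  let ?i = "matrix_inv B"
  have "std_comb B (\<gamma> - \<gamma>') = std_comb B \<gamma> - (1 / \<kappa>) *\<^sub>R mat 1"
    using linear_diff[OF linear_std_comb, of B \<gamma> \<gamma>'] by (simp only: std_comb_in_domain[OF B \<gamma>'])
  then have eq: "mat 1 + \<kappa> *\<^sub>R std_comb B (\<gamma> - \<gamma>') = \<kappa> *\<^sub>R (?i ** V \<gamma> ** transpose ?i)"
    using \<kappa> by (simp add: scaleR_diff_right std_comb_def comb_in_domain[OF \<gamma>])
  have PDS: "V \<gamma> \<in> PDS" using V_PDS \<gamma> by blast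
  have dB: "det B \<noteq> 0" using B by (simp add: invertible_det_nz)
  show "det (mat 1 + \<kappa> *\<^sub>R std_comb B (\<gamma> - \<gamma>')) = 1"
    unfolding eq det_scaleR \<kappa>(2) det_mul det_transpose det det_matrix_inv[OF B] using dB by simp
  have i: "invertible ?i" by (rule invertible_matrix_inv[OF B])
  have "matrix_inv (?i ** V \<gamma> ** transpose ?i) = transpose B ** matrix_inv (V \<gamma>) ** B"
    by (simp only: matrix_inv_mult[OF invertible_mult[OF i PDS_invertible[OF PDS]] invertible_transpose[OF i]]
        matrix_inv_mult[OF i PDS_invertible[OF PDS]] matrix_inv_transpose[OF i] matrix_inv_matrix_inv[OF B] matrix_mul_assoc)
  moreover have "invertible (?i ** V \<gamma> ** transpose ?i)"
    by (intro invertible_mult i PDS_invertible[OF PDS] invertible_transpose)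
  ultimately show "matrix_inv (mat 1 + \<kappa> *\<^sub>R std_comb B (\<gamma> - \<gamma>')) = (1 / \<kappa>) *\<^sub>R (transpose B ** matrix_inv (V \<gamma>) ** B)"
    unfolding eq using \<kappa>(1) by (simp add: matrix_inv_scaleR)
qed

end

context
  fixes P :: "((real^'k) \<times> (real^'q^'k)) measure" and W :: "real^'k^'k"
  assumes P: "prob_space P" "sets P = sets borel" and moment: "integrable P (\<lambda>x. (norm x)\<^sup>2)" and W: "W \<in> PDS"
begin

private abbreviation (input) "design_gram \<equiv> (\<integral>x. transpose (snd x) ** W ** snd x \<partial>P)"

lemma design_gram_integrable: "integrable P (\<lambda>x. transpose (snd x) ** W ** snd x)"
proof (rule Bochner_Integration.integrable_bound)
  show "integrable P (\<lambda>x. norm W * (norm x)\<^sup>2)" using moment by simp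
  have "continuous_on UNIV (\<lambda>x::(real^'k) \<times> (real^'q^'k). transpose (snd x) ** W ** snd x)"
    by (intro continuous_on_matrix_mult bounded_linear.continuous_on[OF bounded_linear_transpose] continuous_on_snd continuous_on_const continuous_on_id)
  then have "(\<lambda>x::(real^'k) \<times> (real^'q^'k). transpose (snd x) ** W ** snd x) \<in> borel_measurable borel"
    by (rule borel_measurable_continuous_onI)
  then show "(\<lambda>x. transpose (snd x) ** W ** snd x) \<in> borel_measurable P"
    by (simp only: measurable_cong_sets[OF P(2) refl])
  show "AE x in P. norm (transpose (snd x) ** W ** snd x) \<le> norm (norm W * (norm x)\<^sup>2)"
  proof (rule AE_I2)
    fix x :: "(real^'k) \<times> (real^'q^'k)"
    have "norm (transpose (snd x) ** W ** snd x) \<le> norm (transpose (snd x) ** W) * norm (snd x)" by (rule norm_matrix_mult_le)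
    also have "\<dots> \<le> (norm (snd x) * norm W) * norm (snd x)"
      using norm_matrix_mult_le[of "transpose (snd x)" W] by (intro mult_right_mono) (auto simp: norm_transpose)
    also have "\<dots> = norm W * (norm (snd x))\<^sup>2" by (simp add: power2_eq_square)
    also have "\<dots> \<le> norm W * (norm x)\<^sup>2"
      using norm_snd_le[of "snd x" "fst x"] by (intro mult_left_mono power_mono) auto
    finally show "norm (transpose (snd x) ** W ** snd x) \<le> norm (norm W * (norm x)\<^sup>2)" by simp
  qed
qed

lemma inner_design_gram_pointwise:
  "h \<bullet> ((transpose X ** W ** X) *v b) = (X *v h) \<bullet> (W *v (X *v b))"
  by (simp only: matrix_vector_mul_assoc[symmetric] inner_matrix_transpose[of h "transpose X"] transpose_transpose)

lemma inner_design_gram: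
  "integrable P (\<lambda>x. (snd x *v h) \<bullet> (W *v (snd x *v b)))"
  "h \<bullet> (design_gram *v b) = (\<integral>x. (snd x *v h) \<bullet> (W *v (snd x *v b)) \<partial>P)"
proof -
  have bl: "bounded_linear (\<lambda>A :: real^'q^'q. h \<bullet> (A *v b))"
    by (rule bounded_linear_compose[OF bounded_linear_inner_right bounded_bilinear.bounded_linear_left[OF bounded_bilinear_matrix_vector]])
  from integrable_bounded_linear[OF bl design_gram_integrable]
  show "integrable P (\<lambda>x. (snd x *v h) \<bullet> (W *v (snd x *v b)))" unfolding inner_design_gram_pointwise .
  from integral_bounded_linear[OF bl design_gram_integrable]
  show "h \<bullet> (design_gram *v b) = (\<integral>x. (snd x *v h) \<bullet> (W *v (snd x *v b)) \<partial>P)" unfolding inner_design_gram_pointwise by simp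
qed

text \<open>
  If the quadratic form vanishes at \<open>h\<close>, then \<open>X *v h = 0\<close> almost surely.  For \<open>k \<ge> q\<close> this contradicts the rank of
  \<open>X\<close>; for \<open>k < q\<close> it makes \<open>h\<close> a null vector of the expected Gram matrix.
\<close>

lemma design_gram_PDS:
  assumes rank: "AE x in P. full_rank (snd x)" and wide: "CARD('k) < CARD('q) \<Longrightarrow> invertible design_gram"
  shows "design_gram \<in> PDS"
  unfolding PDS_def
proof (intro CollectI conjI allI impI)
  have Wsym: "x \<bullet> (W *v y) = y \<bullet> (W *v x)" for x y
    using inner_matrix_transpose[of x W y] PDS_transpose[OF W] by (simp add: inner_commute)
  have "a \<bullet> (transpose design_gram *v d) = a \<bullet> (design_gram *v d)" for a d
  proof -
    have "a \<bullet> (transpose design_gram *v d) = d \<bullet> (design_gram *v a)"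
      by (simp only: inner_matrix_transpose[of a] transpose_transpose inner_commute)
    then show ?thesis unfolding inner_design_gram(2) by (simp only: Wsym[of "_ *v d"])
  qed
  then show "transpose design_gram = design_gram" by (rule matrix_eq_of_inner)
next
  interpret prob_space P by (rule P)
  fix h :: "real^'q" assume h: "h \<noteq> 0"
  have nn: "0 \<le> x \<bullet> (W *v x)" for x using PDS_pos[OF W, of x] by (cases "x = 0") auto
  have "0 \<noteq> (\<integral>x. (snd x *v h) \<bullet> (W *v (snd x *v h)) \<partial>P)"
  proof
    assume "0 = (\<integral>x. (snd x *v h) \<bullet> (W *v (snd x *v h)) \<partial>P)"
    then have "AE x in P. (snd x *v h) \<bullet> (W *v (snd x *v h)) = 0"
      using integral_nonneg_eq_0_iff_AE[OF inner_design_gram(1)] nn by simp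
    then have z: "AE x in P. snd x *v h = 0"
      by eventually_elim (use PDS_pos[OF W] in force)
    show False
    proof (cases "CARD('k) < CARD('q)")
      case True
      have "b \<bullet> (design_gram *v h) = 0" for b
      proof -
        have "(\<integral>x. (snd x *v b) \<bullet> (W *v (snd x *v h)) \<partial>P) = (\<integral>x. 0 \<partial>P)"
        proof (rule integral_cong_AE)
          show "AE x in P. (snd x *v b) \<bullet> (W *v (snd x *v h)) = 0" using z by eventually_elim simp
          show "(\<lambda>x. (snd x *v b) \<bullet> (W *v (snd x *v h))) \<in> borel_measurable P" using inner_design_gram(1) by (rule borel_measurable_integrable)
        qed simp
        then show ?thesis unfolding inner_design_gram(2) by simp
      qed
      then have "design_gram *v h = 0" using inner_eq_zero_iff[of "design_gram *v h"] by blast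
      then have "matrix_inv design_gram *v (design_gram *v h) = 0" by simp
      then show False using h by (simp only: matrix_vector_mul_assoc matrix_inv_left[OF wide[OF True]] matrix_vector_mul_lid)
    next
      case False
      have "AE x in P. False" using z rank
      proof eventually_elim
        fix x :: "(real^'k) \<times> (real^'q^'k)" assume x: "snd x *v h = 0" "full_rank (snd x)"
        then have "rank (snd x) = CARD('q)" using False by (simp add: full_rank_def min_def)
        then have "inj ((*v) (snd x))" by (simp add: full_rank_injective)
        then show False using x(1) h by (metis injD matrix_vector_mult_0_right)
      qed
      then show False by simp
    qed
  qed
  moreover have "0 \<le> (\<integral>x. (snd x *v h) \<bullet> (W *v (snd x *v h)) \<partial>P)" by (intro integral_nonneg_AE) (simp add: nn)
  ultimately show "0 < h \<bullet> (design_gram *v h)" unfolding inner_design_gram(2) by linarith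
qed

end

section \<open>Asymptotic normality of the structured estimators\<close>

context score_model begin

lemma mean_gain_eq:
  "mean_gain = (\<integral>z. (1 - 1 / real CARD('k)) * (\<psi> (norm z) / norm z) + 1 / real CARD('k) * \<psi>' (norm z) \<partial>Z)"
proof -
  let ?k = "real CARD('k)"
  have i: "integrable Z (\<lambda>z. u (norm z))" "integrable Z (\<lambda>z. w (norm z))"
    using integrable_u[of 0] integrable_w[of 0] by simp_all
  have "mean_gain = (\<integral>z. u (norm z) + w (norm z) / ?k \<partial>Z)"
    unfolding mean_gain_def using i by simp
  also have "\<dots> = (\<integral>z. (1 - 1 / ?k) * (\<psi> (norm z) / norm z) + 1 / ?k * \<psi>' (norm z) \<partial>Z)"
  proof (rule integral_cong_AE)
    show "AE z in Z. u (norm z) + w (norm z) / ?k = (1 - 1 / ?k) * (\<psi> (norm z) / norm z) + 1 / ?k * \<psi>' (norm z)"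
      using AE_nonzero
    proof eventually_elim
      case (elim z)
      then have "\<psi> (norm z) / norm z = u (norm z)" by (simp add: u_def)
      then show ?case by (simp add: w_def field_simps)
    qed
  qed measurable
  finally show ?thesis .
qed

lemma shape_gain_eq:
  "real CARD('k) * shape_gain
    = (\<integral>z. \<psi>' (norm z) * (norm z)\<^sup>2 + (real CARD('k) + 1) * \<psi> (norm z) * norm z \<partial>Z) / (real CARD('k) + 2)"
proof -
  let ?k = "real CARD('k)"
  define p q where "p = (\<integral>z. w (norm z) * norm z ^ 2 \<partial>Z)" and "q = (\<integral>z. u (norm z) * norm z ^ 2 \<partial>Z)"
  have k: "?k \<noteq> 0" "?k + 2 \<noteq> 0" by (simp, linarith)
  have "\<psi>' r * r\<^sup>2 + (?k + 1) * \<psi> r * r = w r * r ^ 2 + (?k + 2) * (u r * r ^ 2)" for r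
    unfolding w_def mult_u[of r, symmetric] by (simp add: algebra_simps power2_eq_square)
  then have "(\<integral>z. \<psi>' (norm z) * (norm z)\<^sup>2 + (?k + 1) * \<psi> (norm z) * norm z \<partial>Z)
      = (\<integral>z. w (norm z) * norm z ^ 2 + (?k + 2) * (u (norm z) * norm z ^ 2) \<partial>Z)" by simp
  also have "\<dots> = p + (?k + 2) * q"
    unfolding p_def q_def using integrable_u[of 2] integrable_w[of 2] by simp
  finally have "(\<integral>z. \<psi>' (norm z) * (norm z)\<^sup>2 + (?k + 1) * \<psi> (norm z) * norm z \<partial>Z) = p + (?k + 2) * q" .
  moreover have "shape_gain = p / (?k * (?k + 2)) + q / ?k" by (simp add: shape_gain_def p_def q_def)
  moreover have "a * (p / (a * b) + q / a) = (p + b * q) / b" if "a \<noteq> 0" "b \<noteq> 0" for a b :: real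
    using that by (simp add: add_divide_distrib distrib_left)
  note this[OF k]
  ultimately show ?thesis by (simp only:)
qed

end

lemma ec_expectation_scaled:
  fixes f :: "real \<Rightarrow> real"
  assumes [measurable]: "f \<in> borel_measurable borel" and c: "c \<ge> 0"
  shows "ec_expectation m (\<lambda>z::real^'k. f (c * norm z))
    = (\<integral>z. f (norm z) \<partial>distr (density lborel (\<lambda>z::real^'k. ennreal (ec_density m 0 (mat 1) z))) borel (\<lambda>z. c *\<^sub>R z))"
  using c by (simp add: ec_expectation_def integral_distr)

lemma scale_ratio_bound:
  fixes s s' :: real
  assumes s: "s > 0" and d: "\<bar>s' - s\<bar> \<le> s / 2"
  shows "\<bar>(s / s')\<^sup>2 - 1\<bar> \<le> 10 / s * \<bar>s' - s\<bar>"
proof -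
  \<comment> \<open>The constant \<open>10\<close> is the quotient of the bounds \<open>s + s' \<le> 5 / 2 * s\<close> and \<open>s'\<^sup>2 \<ge> s\<^sup>2 / 4\<close>.\<close>
  have s': "s / 2 \<le> s'" "s' \<le> 3 / 2 * s" "s' > 0" using s abs_le_D1[OF d] abs_le_D2[OF d] by linarith+
  have "(s / s')\<^sup>2 - 1 = (s - s') * ((s + s') / s'\<^sup>2)"
    using s' by (simp add: field_simps power2_eq_square)
  then have "\<bar>(s / s')\<^sup>2 - 1\<bar> = \<bar>s' - s\<bar> * ((s + s') / s'\<^sup>2)"
    using s s' by (simp add: abs_mult abs_minus_commute)
  also have "\<dots> \<le> \<bar>s' - s\<bar> * (10 / s)"
  proof (rule mult_left_mono)
    have "(s / 2)\<^sup>2 \<le> s'\<^sup>2" using s s' by (intro power_mono) auto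
    then have "(s + s') / s'\<^sup>2 \<le> (5 / 2 * s) / (s / 2)\<^sup>2" using s s' by (intro frac_le) auto
    also have "\<dots> = 10 / s" using s by (simp add: field_simps power2_eq_square)
    finally show "(s + s') / s'\<^sup>2 \<le> 10 / s" .
  qed simp
  finally show ?thesis by (simp add: mult.commute)
qed

lemma standardized_design_moments:
  fixes P :: "((real^'k) \<times> (real^'q^'k)) measure" and B :: "real^'k^'k" and c :: real
  assumes P: "prob_space P" "sets P = sets borel" and moment: "integrable P (\<lambda>x. (norm x)\<^sup>2)" and B: "invertible B"
  defines "Q \<equiv> distr (distr P borel snd) borel (\<lambda>X. c *\<^sub>R (matrix_inv B ** X))"
  shows "prob_space Q" "sets Q = sets borel" "integrable Q (\<lambda>X. (norm X)\<^sup>2)"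
    and "(\<integral>X. (X *v h) \<bullet> (X *v d) \<partial>Q) = c\<^sup>2 * (h \<bullet> ((\<integral>x. transpose (snd x) ** matrix_inv (B ** transpose B) ** snd x \<partial>P) *v d))"
proof -
  interpret prob_space P by fact
  have [measurable_cong]: "sets P = sets borel" by fact
  let ?f = "\<lambda>x :: (real^'k) \<times> (real^'q^'k). c *\<^sub>R (matrix_inv B ** snd x)"
  have f: "?f \<in> measurable P borel"
    unfolding measurable_cong_sets[OF P(2) refl] by (intro borel_measurable_continuous_onI continuous_intros)
  have snd: "snd \<in> measurable P borel"
    unfolding measurable_cong_sets[OF P(2) refl] by (rule fst_snd_measurable(2))
  have mult: "(\<lambda>X :: real^'q^'k. c *\<^sub>R (matrix_inv B ** X)) \<in> measurable borel borel"
    by (intro borel_measurable_continuous_onI continuous_intros)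
  have Q: "Q = distr P borel ?f"
    unfolding Q_def by (simp add: distr_distr[OF mult snd] comp_def)
  show "prob_space Q" unfolding Q by (rule prob_space_distr[OF f])
  show "sets Q = sets borel" by (simp add: Q)
  show "integrable Q (\<lambda>X. (norm X)\<^sup>2)"
    unfolding Q
  proof (subst integrable_distr_eq[OF f], measurable, rule Bochner_Integration.integrable_bound)
    show "integrable P (\<lambda>x. (\<bar>c\<bar> * norm (matrix_inv B))\<^sup>2 * (norm x)\<^sup>2)" using moment by simp
    show "AE x in P. norm ((norm (?f x))\<^sup>2) \<le> norm ((\<bar>c\<bar> * norm (matrix_inv B))\<^sup>2 * (norm x)\<^sup>2)"
    proof (rule AE_I2)
      fix x :: "(real^'k) \<times> (real^'q^'k)"
      have "norm (matrix_inv B ** snd x) \<le> norm (matrix_inv B) * norm (snd x)" by (rule norm_matrix_mult_le)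
      also have "\<dots> \<le> norm (matrix_inv B) * norm x"
        using norm_snd_le[of "snd x" "fst x"] by (intro mult_left_mono) simp_all
      finally have "norm (?f x) \<le> \<bar>c\<bar> * (norm (matrix_inv B) * norm x)"
        unfolding norm_scaleR by (rule mult_left_mono) simp
      then have "(norm (?f x))\<^sup>2 \<le> (\<bar>c\<bar> * (norm (matrix_inv B) * norm x))\<^sup>2" by (rule power_mono) simp
      then show "norm ((norm (?f x))\<^sup>2) \<le> norm ((\<bar>c\<bar> * norm (matrix_inv B))\<^sup>2 * (norm x)\<^sup>2)"
        by (simp only: real_norm_def abs_power2 abs_mult power_mult_distrib mult.assoc)
    qed
    show "(\<lambda>x. (norm (?f x))\<^sup>2) \<in> borel_measurable P"
      by (rule measurable_compose[OF f, of "\<lambda>X. (norm X)\<^sup>2"]) measurable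
  qed
  have W: "matrix_inv (B ** transpose B) \<in> PDS" by (intro PDS_matrix_inv PDS_mult_transpose B)
  have "(\<integral>X. (X *v h) \<bullet> (X *v d) \<partial>Q) = (\<integral>x. (?f x *v h) \<bullet> (?f x *v d) \<partial>P)"
    unfolding Q by (rule integral_distr[OF f]) measurable
  also have "\<dots> = (\<integral>x. c\<^sup>2 * ((snd x *v h) \<bullet> (matrix_inv (B ** transpose B) *v (snd x *v d))) \<partial>P)"
  proof (rule Bochner_Integration.integral_cong[OF refl])
    fix x :: "(real^'k) \<times> (real^'q^'k)"
    have "(?f x *v h) \<bullet> (?f x *v d) = c\<^sup>2 * ((matrix_inv B *v (snd x *v h)) \<bullet> (matrix_inv B *v (snd x *v d)))"
      by (simp only: scaleR_matrix_vector_assoc[symmetric] matrix_vector_mul_assoc[symmetric] inner_scaleR_left inner_scaleR_right power2_eq_square mult.assoc)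
    also have "(matrix_inv B *v (snd x *v h)) \<bullet> (matrix_inv B *v (snd x *v d)) = (snd x *v h) \<bullet> (matrix_inv (B ** transpose B) *v (snd x *v d))"
      by (simp only: matrix_inv_mult_transpose[OF B] matrix_vector_mul_assoc[symmetric] inner_matrix_transpose[of "snd x *v h" "transpose _"] transpose_transpose)
    finally show "(?f x *v h) \<bullet> (?f x *v d) = c\<^sup>2 * ((snd x *v h) \<bullet> (matrix_inv (B ** transpose B) *v (snd x *v d)))" .
  qed
  also have "\<dots> = c\<^sup>2 * (h \<bullet> ((\<integral>x. transpose (snd x) ** matrix_inv (B ** transpose B) ** snd x \<partial>P) *v d))"
    unfolding inner_design_gram(2)[OF P moment W] by (rule integral_mult_right_zero)
  finally show "(\<integral>X. (X *v h) \<bullet> (X *v d) \<partial>Q) = c\<^sup>2 * (h \<bullet> ((\<integral>x. transpose (snd x) ** matrix_inv (B ** transpose B) ** snd x \<partial>P) *v d))" .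
qed

lemma PDS_inverse_inner: "A \<in> PDS \<Longrightarrow> (matrix_inv A *v t) \<bullet> (A *v d) = t \<bullet> d"
  by (simp only: inner_matrix_transpose PDS_transpose matrix_vector_mul_assoc matrix_inv_right[OF PDS_invertible] matrix_vector_mul_lid)

theorem theorem8:
  fixes M :: "'w measure"
    and P :: "('k::finite, 'q::finite) obs measure"
    and s :: "nat \<Rightarrow> 'w \<Rightarrow> ('k, 'q) obs"
    and \<Theta> :: "(real^'l::finite) set"
    and V :: "real^'l \<Rightarrow> real^'k^'k"
    and L :: "'l \<Rightarrow> real^'k^'k"
    and \<rho>\<^sub>0 \<rho>\<^sub>1 \<rho>\<^sub>1' \<rho>\<^sub>1'' m :: "real \<Rightarrow> real"
    and b\<^sub>0 c\<^sub>1 c\<^sub>\<sigma> \<alpha>\<^sub>1 \<gamma>\<^sub>1 \<sigma>\<^sub>1 :: real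
    and \<beta>\<^sub>0 :: "('k, 'q) obs measure \<Rightarrow> real^'q"
    and \<theta>\<^sub>0 :: "('k, 'q) obs measure \<Rightarrow> real^'l"
    and \<sigma> :: "('k, 'q) obs measure \<Rightarrow> real"
    and \<beta>\<^sub>s \<beta>\<^sub>P :: "real^'q"
    and \<theta>\<^sub>s \<gamma>\<^sub>P :: "real^'l"
    and \<Sigma> :: "real^'k^'k"
    and \<beta>\<^sub>n :: "nat \<Rightarrow> 'w \<Rightarrow> real^'q"
    and \<gamma>\<^sub>n :: "nat \<Rightarrow> 'w \<Rightarrow> real^'l"
    and \<P> :: "nat \<Rightarrow> 'w \<Rightarrow> ('k, 'q) obs measure"
  assumes "prob_space P" and "sets P = sets borel"
    and "prob_space M"
    and "prob_space.indep_vars M (\<lambda>_. borel) s UNIV"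
    and "\<And>i. distr M borel (s i) = P"
    and "\<And>n \<omega>. \<P> n \<omega> = empirical_measure n (\<lambda>i. s i \<omega>)"
    \<comment> \<open>covariance structure\<close>
    and "open \<Theta>" and "V ` \<Theta> \<subseteq> PDS" and "inj_on V \<Theta>" and "C2_on \<Theta> V"
    and "\<And>j. transpose (L j) = L j"
    and "\<And>\<gamma>. \<gamma> \<in> \<Theta> \<Longrightarrow> V \<gamma> = (\<Sum>j\<in>UNIV. \<gamma> $ j *\<^sub>R L j)"
    \<comment> \<open>elliptically contoured model\<close>
    and "\<theta>\<^sub>s \<in> \<Theta>" and "\<Sigma> = V \<theta>\<^sub>s"
    and "m \<in> borel_measurable (restrict_space borel {0..})" and "\<And>t. 0 \<le> t \<Longrightarrow> 0 \<le> m t"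
    and "conditional_density P (\<lambda>X. ec_density m (X *v \<beta>\<^sub>s) \<Sigma>)"
    and "integrable P (\<lambda>x. (norm x)\<^sup>2)"
    \<comment> \<open>loss functions\<close>
    and "\<And>r. 0 \<le> \<rho>\<^sub>0 r" and "0 < b\<^sub>0" and "ereal b\<^sub>0 < (SUP r. ereal (\<rho>\<^sub>0 r))"
    and "\<And>r. 0 \<le> \<rho>\<^sub>1 r" and "\<And>r. \<rho>\<^sub>1 (- r) = \<rho>\<^sub>1 r" and "\<rho>\<^sub>1 0 = 0"
    and "0 < c\<^sub>1" and "\<And>r. c\<^sub>1 \<le> r \<Longrightarrow> \<rho>\<^sub>1 r = \<rho>\<^sub>1 c\<^sub>1" and "strict_mono_on {0..c\<^sub>1} \<rho>\<^sub>1"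
    and "\<And>r. (\<rho>\<^sub>1 has_real_derivative \<rho>\<^sub>1' r) (at r)"
    and "\<And>r. (\<rho>\<^sub>1' has_real_derivative \<rho>\<^sub>1'' r) (at r)"
    and "continuous_on UNIV \<rho>\<^sub>1''"
    \<comment> \<open>\<open>u\<^sub>1\<close>, extended to 0 by the limit of \<open>\<rho>\<^sub>1' r / r\<close>\<close>
    and "continuous_on UNIV (\<lambda>r. if r = 0 then \<rho>\<^sub>1'' 0 else \<rho>\<^sub>1' r / r)"
    and "bounded_variation (\<lambda>r. if r = 0 then \<rho>\<^sub>1'' 0 else \<rho>\<^sub>1' r / r)"
    \<comment> \<open>initial functionals and scale\<close>
    and "\<And>Q. prob_space Q \<Longrightarrow> sets Q = sets borel \<Longrightarrow> \<theta>\<^sub>0 Q \<in> \<Theta>"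
    and "scale_solution \<rho>\<^sub>0 b\<^sub>0 V \<beta>\<^sub>0 \<theta>\<^sub>0 P (\<sigma> P)"
    and "\<forall>\<^sub>F n in sequentially. AE \<omega> in M. scale_solution \<rho>\<^sub>0 b\<^sub>0 V \<beta>\<^sub>0 \<theta>\<^sub>0 (\<P> n \<omega>) (\<sigma> (\<P> n \<omega>))"
    and "\<And>n. (\<lambda>\<omega>. \<sigma> (\<P> n \<omega>)) \<in> borel_measurable M"
    and "O_P M (\<lambda>n. 1 / sqrt (real n)) (\<lambda>n \<omega>. \<sigma> (\<P> n \<omega>) - \<sigma> P)"
    \<comment> \<open>local minima\<close>
    and "\<And>n. \<beta>\<^sub>n n \<in> borel_measurable M" and "\<And>n. \<gamma>\<^sub>n n \<in> borel_measurable M"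
    and "\<forall>\<^sub>F n in sequentially. AE \<omega> in M.
           local_min_on (feasible \<Theta> V) (\<lambda>(\<beta>, \<gamma>). objective \<rho>\<^sub>1 \<sigma> (\<P> n \<omega>) \<beta> (V \<gamma>))
             (\<beta>\<^sub>n n \<omega>, \<gamma>\<^sub>n n \<omega>)"
    and "local_min_on (feasible \<Theta> V) (\<lambda>(\<beta>, \<gamma>). objective \<rho>\<^sub>1 \<sigma> P \<beta> (V \<gamma>)) (\<beta>\<^sub>P, \<gamma>\<^sub>P)"
    and "converges_in_probability M (\<lambda>n \<omega>. (\<beta>\<^sub>n n \<omega>, \<gamma>\<^sub>n n \<omega>)) (\<beta>\<^sub>P, \<gamma>\<^sub>P)"
    and "\<beta>\<^sub>P = \<beta>\<^sub>s" and "V \<gamma>\<^sub>P = shape \<Sigma>"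
    \<comment> \<open>constants\<close>
    and "c\<^sub>\<sigma> = det \<Sigma> powr (1 / (2 * real CARD('k))) / \<sigma> P"
    and "\<alpha>\<^sub>1 = ec_expectation m (\<lambda>z::real^'k.
           (1 - 1 / real CARD('k)) * (\<rho>\<^sub>1' (c\<^sub>\<sigma> * norm z) / (c\<^sub>\<sigma> * norm z))
           + 1 / real CARD('k) * \<rho>\<^sub>1'' (c\<^sub>\<sigma> * norm z))"
    and "\<gamma>\<^sub>1 = ec_expectation m (\<lambda>z::real^'k.
           \<rho>\<^sub>1'' (c\<^sub>\<sigma> * norm z) * (c\<^sub>\<sigma> * norm z)\<^sup>2
           + (real CARD('k) + 1) * \<rho>\<^sub>1' (c\<^sub>\<sigma> * norm z) * (c\<^sub>\<sigma> * norm z))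
           / (real CARD('k) + 2)"
    and "\<sigma>\<^sub>1 = real CARD('k) * ec_expectation m (\<lambda>z::real^'k.
           (\<rho>\<^sub>1' (c\<^sub>\<sigma> * norm z))\<^sup>2 * (c\<^sub>\<sigma> * norm z)\<^sup>2)
           / ((real CARD('k) + 2) * \<gamma>\<^sub>1\<^sup>2)"
    and "\<alpha>\<^sub>1 \<noteq> 0" and "0 < \<gamma>\<^sub>1"
    \<comment> \<open>full rank; for \<open>k < q\<close> the rank condition alone does not make the expectation non-singular\<close>
    and "AE x in P. full_rank (snd x)"
    and "CARD('k) < CARD('q) \<Longrightarrow>
           invertible (\<integral>x. transpose (snd x) ** matrix_inv \<Sigma> ** snd x \<partial>P)"
    and "full_rank (vec_matrix L)"
  shows "asymptotically_independent M
           (\<lambda>n \<omega>. sqrt (real n) *\<^sub>R (\<beta>\<^sub>n n \<omega> - \<beta>\<^sub>s)) (\<lambda>n \<omega>. sqrt (real n) *\<^sub>R (\<gamma>\<^sub>n n \<omega> - \<gamma>\<^sub>P))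
       \<and> asymptotically_normal M (\<lambda>n \<omega>. sqrt (real n) *\<^sub>R (\<beta>\<^sub>n n \<omega> - \<beta>\<^sub>s)) 0
           ((ec_expectation m (\<lambda>z::real^'k. (\<rho>\<^sub>1' (c\<^sub>\<sigma> * norm z))\<^sup>2)
              / (c\<^sub>\<sigma>\<^sup>2 * real CARD('k) * \<alpha>\<^sub>1\<^sup>2))
            *\<^sub>R matrix_inv (\<integral>x. transpose (snd x) ** matrix_inv \<Sigma> ** snd x \<partial>P))
       \<and> asymptotically_normal M (\<lambda>n \<omega>. sqrt (real n) *\<^sub>R (\<gamma>\<^sub>n n \<omega> - \<gamma>\<^sub>P)) 0
           ((2 * \<sigma>\<^sub>1 / det \<Sigma> powr (2 / real CARD('k)))
            *\<^sub>R (matrix_inv (transpose (vec_matrix L)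
                    ** kronecker (matrix_inv \<Sigma>) (matrix_inv \<Sigma>) ** vec_matrix L)
                - (1 / real CARD('k)) *\<^sub>R outer \<theta>\<^sub>s))"
proof -
  let ?k = "real CARD('k)"
  interpret M: prob_space M by (rule assms(3))
  have loss: "smooth_loss \<rho>\<^sub>1' \<rho>\<^sub>1'' c\<^sub>1 \<rho>\<^sub>1"
    by (rule smooth_loss_of_bounded_loss_function[OF assms(22,24,25,26,27,28,29,30,31)])
  interpret fit: structured_fit \<rho>\<^sub>1' \<rho>\<^sub>1'' c\<^sub>1 \<rho>\<^sub>1 \<Theta> V L
    by (rule structured_fit.intro[OF loss structured_fit_axioms.intro[OF assms(7,8,12)]])

  have \<Sigma>: "\<Sigma> \<in> PDS" using assms(8,13,14) by blast
  obtain B :: "real^'k^'k" where B: "invertible B" and BB: "B ** transpose B = \<Sigma>" by (rule PDS_square_root[OF \<Sigma>])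
  \<comment> \<open>\<open>\<Sigma> = \<kappa> *\<^sub>R shape \<Sigma>\<close>\<close>
  define \<kappa> where "\<kappa> = det \<Sigma> powr (1 / ?k)"
  have det\<Sigma>: "det \<Sigma> > 0" by (rule PDS_det_pos[OF \<Sigma>])
  have \<kappa>: "\<kappa> > 0" using det\<Sigma> by (simp add: \<kappa>_def)
  have \<kappa>_power: "\<kappa> ^ CARD('k) = det \<Sigma>"
    unfolding \<kappa>_def using det\<Sigma> by (simp add: powr_realpow[symmetric] powr_powr)
  have \<kappa>_square: "det \<Sigma> powr (2 / ?k) = \<kappa>\<^sup>2"
    unfolding \<kappa>_def power2_eq_square powr_add[symmetric] by simp
  have \<sigma>P: "\<sigma> P > 0" using assms(34) by (simp add: scale_solution_def)
  have c: "c\<^sub>\<sigma> > 0" using det\<Sigma> \<sigma>P by (simp add: assms(45))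
  have c_square: "c\<^sub>\<sigma>\<^sup>2 = \<kappa> / (\<sigma> P)\<^sup>2"
    unfolding assms(45) \<kappa>_def power2_eq_square times_divide_times_eq powr_add[symmetric] by (simp add: field_simps)

  define Z where "Z = distr (density lborel (\<lambda>z::real^'k. ennreal (ec_density m 0 (mat 1) z))) borel (\<lambda>z. c\<^sub>\<sigma> *\<^sub>R z)"
  define Q where "Q = distr (distr P borel snd) borel (\<lambda>X :: real^'q^'k. c\<^sub>\<sigma> *\<^sub>R (matrix_inv B ** X))"
  define T where "T i \<omega> = standardize c\<^sub>\<sigma> B \<beta>\<^sub>s (s i \<omega>)" for i \<omega>
  \<comment> \<open>The error is scaled by \<open>c\<^sub>\<sigma>\<close>, so that the loss function acts on \<open>norm z\<close> directly and the expectations in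
    the theorem become integrals over \<open>Z\<close>.\<close>
  note model = conditional_density_standardized[OF assms(1,2,15,16) assms(17)[unfolded BB[symmetric]] B]
  interpret Z0: spherical_law "density lborel (\<lambda>z::real^'k. ennreal (ec_density m 0 (mat 1) z))" by (rule model(1))
  have Z: "spherical_law Z" unfolding Z_def by (rule Z0.scaled[OF c])
  note design = standardized_design_moments[OF assms(1,2,18) B, of c\<^sub>\<sigma>, folded Q_def, unfolded BB]
  have s_measurable: "s i \<in> borel_measurable M" for i
    using assms(4) unfolding M.indep_vars_def by simp
  have law: "distr M borel (T i) = Z \<Otimes>\<^sub>M Q" for i
  proof -
    have "distr M borel (T i) = distr (distr M borel (s i)) borel (standardize c\<^sub>\<sigma> B \<beta>\<^sub>s)"
      unfolding T_def[abs_def] by (subst distr_distr[OF standardize_measurable s_measurable]) (simp add: comp_def)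
    also have "\<dots> = Z \<Otimes>\<^sub>M Q"
      unfolding assms(5) Z_def Q_def by (rule law_standardize[OF B Z0.prob_space_axioms Z0.sets_Z assms(1,2) model(2)])
    finally show ?thesis .
  qed
  have indep: "M.indep_vars (\<lambda>_. borel) T UNIV"
    unfolding T_def[abs_def] by (rule M.indep_vars_compose2[OF assms(4)]) (rule standardize_measurable)
  interpret S: score_sample Z Q \<rho>\<^sub>1' \<rho>\<^sub>1'' c\<^sub>1 M T
    by (intro score_sample.intro score_model.intro score_model_axioms.intro iid_sample.intro iid_sample_axioms.intro
        Z design(1,2,3) fit.bounded_loss_axioms assms(3) indep law)

  have M0: "(\<integral>x. transpose (snd x) ** matrix_inv \<Sigma> ** snd x \<partial>P) \<in> PDS" (is "?M0 \<in> _")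
    by (rule design_gram_PDS[OF assms(1,2,18) PDS_matrix_inv[OF \<Sigma>] assms(51,52)])
  have K: "transpose (vec_matrix L) ** kronecker (matrix_inv \<Sigma>) (matrix_inv \<Sigma>) ** vec_matrix L \<in> PDS" (is "?K \<in> _")
    by (rule fit.gram_PDS[OF B assms(11,9,13), unfolded BB])
  have trace_gram: "trace (fit.std_comb B a ** fit.std_comb B d) = a \<bullet> (?K *v d)" for a d
    by (rule fit.trace_std_comb[OF B assms(11), unfolded BB])
  have at_truth: "fit.std_comb B \<theta>\<^sub>s = mat 1"
    using fit.std_comb_in_domain[OF B assms(13), of 1] by (simp add: BB assms(14))

  \<comment> \<open>\<open>G\<close> and \<open>F\<close> invert the two information matrices.\<close>
  define G where "G t = (1 / c\<^sub>\<sigma>\<^sup>2) *\<^sub>R (matrix_inv ?M0 *v t)" for t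
  define F where "F t = matrix_inv ?K *v t" for t
  have F: "trace (fit.std_comb B (F t) ** fit.std_comb B d) = t \<bullet> d" for t d
    unfolding trace_gram F_def by (rule PDS_inverse_inner[OF K])

  have profile: "ec_expectation m (\<lambda>z::real^'k. f (c\<^sub>\<sigma> * norm z)) = (\<integral>z. f (norm z) \<partial>Z)" if "f \<in> borel_measurable borel" for f :: "real \<Rightarrow> real"
    unfolding Z_def using that c by (intro ec_expectation_scaled) auto
  define I\<^sub>2 I\<^sub>4 where "I\<^sub>2 = (\<integral>z. (\<rho>\<^sub>1' (norm z))\<^sup>2 \<partial>Z)" and "I\<^sub>4 = (\<integral>z. (\<rho>\<^sub>1' (norm z))\<^sup>2 * (norm z)\<^sup>2 \<partial>Z)"
  have mean_gain: "S.mean_gain = \<alpha>\<^sub>1"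
    unfolding assms(46) S.mean_gain_eq by (rule profile[symmetric]) measurable
  have shape_gain: "?k * S.shape_gain = \<gamma>\<^sub>1"
    unfolding assms(47) S.shape_gain_eq by (rule arg_cong[where f="\<lambda>x. x / _"], rule profile[symmetric]) measurable
  have I2: "ec_expectation m (\<lambda>z::real^'k. (\<rho>\<^sub>1' (c\<^sub>\<sigma> * norm z))\<^sup>2) = I\<^sub>2"
    unfolding I\<^sub>2_def by (rule profile) measurable
  have I4: "\<sigma>\<^sub>1 = ?k * I\<^sub>4 / ((?k + 2) * \<gamma>\<^sub>1\<^sup>2)"
    unfolding assms(48) I\<^sub>4_def by (rule arg_cong[where f="\<lambda>x. ?k * x / _"], rule profile) measurable
  have I_nonneg: "I\<^sub>2 \<ge> 0" "I\<^sub>4 \<ge> 0" unfolding I\<^sub>2_def I\<^sub>4_def by (intro integral_nonneg_AE; simp)+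
  have shape_gain_0: "S.shape_gain \<noteq> 0" using shape_gain assms(50) by auto

  define b where "b n \<omega> = \<beta>\<^sub>n n \<omega> - \<beta>\<^sub>s" for n \<omega>
  define \<delta> where "\<delta> n \<omega> = \<gamma>\<^sub>n n \<omega> - \<gamma>\<^sub>P" for n \<omega>
  define err where "err n \<omega> = \<sigma> (\<P> n \<omega>) - \<sigma> P" for n \<omega>
  define ratio where "ratio n \<omega> = (\<sigma> P / \<sigma> (\<P> n \<omega>))\<^sup>2" for n \<omega>
  define \<tau> where "\<tau> n \<omega> = (b n \<omega>, ratio n \<omega> *\<^sub>R matrix_inv (mat 1 + \<kappa> *\<^sub>R fit.std_comb B (\<delta> n \<omega>)) - mat 1)" for n \<omega>
  \<comment> \<open>On this event the fit is a local minimum with a positive scale, so that the standardized score equations hold.\<close>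
  define good where "good n \<omega> \<longleftrightarrow> n > 0 \<and> \<sigma> (\<P> n \<omega>) > 0 \<and>
      local_min_on (feasible \<Theta> V) (\<lambda>(\<beta>, \<gamma>). objective \<rho>\<^sub>1 \<sigma> (\<P> n \<omega>) \<beta> (V \<gamma>)) (\<beta>\<^sub>n n \<omega>, \<gamma>\<^sub>n n \<omega>)" for n \<omega>
  have good: "with_high_probability M good"
  proof (rule M.whp_AE)
    show "\<forall>\<^sub>F n in sequentially. AE \<omega> in M. good n \<omega>"
      using assms(35,40) eventually_gt_at_top[of 0]
    proof eventually_elim
      case (elim n)
      from elim(1,2) show ?case
        by eventually_elim (use elim(3) in \<open>simp add: good_def scale_solution_def\<close>)
    qed
  qed
  have \<gamma>P: "\<gamma>\<^sub>P \<in> \<Theta>" using assms(41) by (simp add: local_min_on_def feasible_def)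
  have V_\<gamma>P: "V \<gamma>\<^sub>P = (1 / \<kappa>) *\<^sub>R (B ** transpose B)" by (simp add: assms(44) shape_def \<kappa>_def BB)
  have det_1: "det (mat 1 + \<kappa> *\<^sub>R fit.std_comb B (\<delta> n \<omega>)) = 1"
    and \<tau>_good: "\<tau> n \<omega> = (\<beta>\<^sub>n n \<omega> - \<beta>\<^sub>s, (1 / (c\<^sub>\<sigma>\<^sup>2 * (\<sigma> (empirical_measure n (\<lambda>i. s i \<omega>)))\<^sup>2)) *\<^sub>R
        (transpose B ** matrix_inv (V (\<gamma>\<^sub>n n \<omega>)) ** B) - mat 1)"
    and mean_eq: "S.S.avg n (\<lambda>x. fit.score (dir_mean h) x (\<tau> n \<omega>)) \<omega> = 0"
    and shape_eq: "S.S.avg n (\<lambda>x. fit.score (dir_shape (fit.std_comb B a)) x (\<tau> n \<omega>)) \<omega> = 0"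
    if "good n \<omega>" for n \<omega> h a
  proof -
    have n: "n > 0" and \<sigma>n: "\<sigma> (empirical_measure n (\<lambda>i. s i \<omega>)) > 0"
      and lm: "local_min_on (feasible \<Theta> V) (\<lambda>(\<beta>, \<gamma>). objective \<rho>\<^sub>1 \<sigma> (empirical_measure n (\<lambda>i. s i \<omega>)) \<beta> (V \<gamma>)) (\<beta>\<^sub>n n \<omega>, \<gamma>\<^sub>n n \<omega>)"
      using that unfolding good_def assms(6) by blast+
    note shape = fit.standardized_shape[OF B fit.feasible_min(1)[OF n \<sigma>n lm] fit.feasible_min(3)[OF n \<sigma>n lm] \<gamma>P V_\<gamma>P \<kappa>, unfolded BB, OF \<kappa>_power, folded \<delta>_def]
    show "det (mat 1 + \<kappa> *\<^sub>R fit.std_comb B (\<delta> n \<omega>)) = 1" by (rule shape(1))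
    have "ratio n \<omega> * (1 / \<kappa>) = 1 / (c\<^sub>\<sigma>\<^sup>2 * (\<sigma> (empirical_measure n (\<lambda>i. s i \<omega>)))\<^sup>2)"
      unfolding ratio_def c_square assms(6) power_divide using \<kappa> \<sigma>P \<sigma>n by simp
    then show \<tau>: "\<tau> n \<omega> = (\<beta>\<^sub>n n \<omega> - \<beta>\<^sub>s, (1 / (c\<^sub>\<sigma>\<^sup>2 * (\<sigma> (empirical_measure n (\<lambda>i. s i \<omega>)))\<^sup>2)) *\<^sub>R
        (transpose B ** matrix_inv (V (\<gamma>\<^sub>n n \<omega>)) ** B) - mat 1)"
      unfolding \<tau>_def b_def shape(2) by (simp only: scaleR_scaleR)
    note eqs = fit.standardized_score_equations[OF n \<sigma>n lm B c, where \<beta>'=\<beta>\<^sub>s, folded \<tau>]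
    show "S.S.avg n (\<lambda>x. fit.score (dir_mean h) x (\<tau> n \<omega>)) \<omega> = 0"
      unfolding S.S.avg_def T_def eqs(1) by simp
    show "S.S.avg n (\<lambda>x. fit.score (dir_shape (fit.std_comb B a)) x (\<tau> n \<omega>)) \<omega> = 0"
      unfolding S.S.avg_def T_def fit.std_comb_def eqs(2) by simp
  qed
  have err_measurable: "err n \<in> borel_measurable M" for n
    unfolding err_def[abs_def] using assms(36)[of n] by measurable
  have root_n: "bounded_in_probability M (\<lambda>n \<omega>. sqrt (real n) * err n \<omega>)"
    by (rule M.bounded_in_probability_O_P[OF assms(37)[folded err_def] err_measurable])
  have meas: "\<beta>\<^sub>n n \<in> borel_measurable M" "\<gamma>\<^sub>n n \<in> borel_measurable M" for n by (rule assms(38,39))+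

  interpret E: estimating_equations Z Q \<rho>\<^sub>1' \<rho>\<^sub>1'' c\<^sub>1 M T "fit.std_comb B" \<kappa> G F b \<delta> ratio err "10 / \<sigma> P" \<tau>
  proof (intro estimating_equations.intro estimating_equations_axioms.intro S.score_sample_axioms)
    show "linear (fit.std_comb B)" by (rule fit.linear_std_comb)
    show "transpose (fit.std_comb B a) = fit.std_comb B a" for a by (rule fit.transpose_std_comb[OF B assms(11)])
    show "\<kappa> > 0" by (rule \<kappa>)
    show "(\<integral>X. (X *v G t) \<bullet> (X *v d) \<partial>Q) = t \<bullet> d" for t d
      unfolding design(4) G_def using c by (simp add: PDS_inverse_inner[OF M0])
    show "trace (fit.std_comb B (F t) ** fit.std_comb B d) = t \<bullet> d" for t d by (rule F)
    show "S.mean_gain \<noteq> 0" using mean_gain assms(49) by simp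
    show "S.shape_gain \<noteq> 0" by (rule shape_gain_0)
    show "b n \<in> borel_measurable M" for n unfolding b_def[abs_def] using meas by measurable
    show "\<delta> n \<in> borel_measurable M" for n unfolding \<delta>_def[abs_def] using meas by measurable
    show "err n \<in> borel_measurable M" for n by (rule err_measurable)
    show "with_high_probability M (\<lambda>n \<omega>. norm (b n \<omega>, \<delta> n \<omega>) \<le> e)" if "e > 0" for e
    proof (rule M.whp_mono[OF M.whp_converges_in_probability[OF assms(42) _ that]])
      show "(\<lambda>\<omega>. (\<beta>\<^sub>n n \<omega>, \<gamma>\<^sub>n n \<omega>)) \<in> borel_measurable M" for n using meas by (rule borel_measurable_Pair)
    qed (simp add: dist_norm b_def \<delta>_def assms(43))
    show "bounded_in_probability M (\<lambda>n \<omega>. sqrt (real n) * err n \<omega>)" by (rule root_n)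
    show "with_high_probability M (\<lambda>n \<omega>. \<bar>ratio n \<omega> - 1\<bar> \<le> 10 / \<sigma> P * \<bar>err n \<omega>\<bar>)"
    proof (rule M.whp_mono[OF M.whp_small_of_root_n_bounded[OF root_n err_measurable]])
      show "\<sigma> P / 2 > 0" using \<sigma>P by simp
    qed (simp only: ratio_def err_def scale_ratio_bound[OF \<sigma>P])
    show "with_high_probability M (\<lambda>n \<omega>. det (mat 1 + \<kappa> *\<^sub>R fit.std_comb B (\<delta> n \<omega>)) = 1)"
      by (rule M.whp_mono[OF good det_1])
    show "\<tau> n \<omega> = (b n \<omega>, ratio n \<omega> *\<^sub>R matrix_inv (mat 1 + \<kappa> *\<^sub>R fit.std_comb B (\<delta> n \<omega>)) - mat 1)" for n \<omega>
      by (rule \<tau>_def)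
    show "with_high_probability M (\<lambda>n \<omega>. S.S.avg n (\<lambda>x. fit.score (dir_mean h) x (\<tau> n \<omega>)) \<omega> = 0)" for h
      by (rule M.whp_mono[OF good mean_eq])
    show "with_high_probability M (\<lambda>n \<omega>. S.S.avg n (\<lambda>x. fit.score (dir_shape (fit.std_comb B a)) x (\<tau> n \<omega>)) \<omega> = 0)" for a
      by (rule M.whp_mono[OF good shape_eq])
  qed

  define S\<^sub>1 where "S\<^sub>1 = (ec_expectation m (\<lambda>z::real^'k. (\<rho>\<^sub>1' (c\<^sub>\<sigma> * norm z))\<^sup>2) / (c\<^sub>\<sigma>\<^sup>2 * ?k * \<alpha>\<^sub>1\<^sup>2)) *\<^sub>R matrix_inv ?M0"
  define S\<^sub>2 where "S\<^sub>2 = (2 * \<sigma>\<^sub>1 / det \<Sigma> powr (2 / ?k)) *\<^sub>R (matrix_inv ?K - (1 / ?k) *\<^sub>R outer \<theta>\<^sub>s)"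
  have form1: "t \<bullet> (S\<^sub>1 *v t) = I\<^sub>2 / (?k * S.mean_gain\<^sup>2) * (t \<bullet> G t)" for t
    unfolding S\<^sub>1_def I2 mean_gain G_def
    by (simp add: scaleR_matrix_vector_assoc[symmetric] mult.commute mult.left_commute)
  have form2: "t \<bullet> (S\<^sub>2 *v t) = 2 * I\<^sub>4 / (?k * (?k + 2) * (S.shape_gain * \<kappa>)\<^sup>2)
      * (t \<bullet> F t - (trace (fit.std_comb B (F t)))\<^sup>2 / ?k)" for t
  proof -
    \<comment> \<open>The trace is the pairing with the identity, and the identity is the standardized combination of \<open>\<theta>\<^sub>s\<close>; this is
      the source of the rank-one correction.\<close>
    have "trace (fit.std_comb B (F t)) = t \<bullet> \<theta>\<^sub>s"
      using F[of t \<theta>\<^sub>s] by (simp add: at_truth matrix_mul_rid)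
    then have "t \<bullet> (S\<^sub>2 *v t) = 2 * \<sigma>\<^sub>1 / \<kappa>\<^sup>2 * (t \<bullet> F t - (trace (fit.std_comb B (F t)))\<^sup>2 / ?k)"
      unfolding S\<^sub>2_def \<kappa>_square F_def
      by (simp add: scaleR_matrix_vector_assoc[symmetric] matrix_vector_mult_diff_rdistrib outer_vector inner_diff_right
          inner_commute power2_eq_square)
    moreover have "2 * \<sigma>\<^sub>1 / \<kappa>\<^sup>2 = 2 * I\<^sub>4 / (?k * (?k + 2) * (S.shape_gain * \<kappa>)\<^sup>2)"
      unfolding I4 shape_gain[symmetric] using shape_gain_0 \<kappa>
      by (simp add: power_mult_distrib power2_eq_square)
    ultimately show ?thesis by simp
  qed
  have "I\<^sub>2 / (c\<^sub>\<sigma>\<^sup>2 * ?k * \<alpha>\<^sub>1\<^sup>2) \<ge> 0" using I_nonneg by simp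
  from PDS_scaled_root[OF PDS_matrix_inv[OF M0] this]
  obtain B1 :: "real^'q^'q" where B1: "S\<^sub>1 = B1 ** transpose B1" unfolding S\<^sub>1_def I2 by blast
  have "\<theta>\<^sub>s \<bullet> (?K *v \<theta>\<^sub>s) = ?k"
    unfolding trace_gram[symmetric] at_truth by (simp add: matrix_mul_lid trace_I)
  moreover have "2 * \<sigma>\<^sub>1 / det \<Sigma> powr (2 / ?k) \<ge> 0" unfolding I4 using I_nonneg by simp
  ultimately have "\<exists>B :: real^'l^'l. S\<^sub>2 = B ** transpose B"
    unfolding S\<^sub>2_def by (intro projected_root[OF K]) simp_all
  then obtain B2 :: "real^'l^'l" where B2: "S\<^sub>2 = B2 ** transpose B2" by blast
  show ?thesis
    unfolding S\<^sub>1_def[symmetric] S\<^sub>2_def[symmetric]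
  proof (rule asymptotic_normality_of_char[OF assms(3) _ _ B1 B2])
    show "(\<lambda>\<omega>. sqrt (real n) *\<^sub>R (\<beta>\<^sub>n n \<omega> - \<beta>\<^sub>s)) \<in> borel_measurable M"
      "(\<lambda>\<omega>. sqrt (real n) *\<^sub>R (\<gamma>\<^sub>n n \<omega> - \<gamma>\<^sub>P)) \<in> borel_measurable M" for n using meas by measurable
    fix t1 t2
    show "(\<lambda>n. \<integral>\<omega>. iexp ((t1, t2) \<bullet> (sqrt (real n) *\<^sub>R (\<beta>\<^sub>n n \<omega> - \<beta>\<^sub>s), sqrt (real n) *\<^sub>R (\<gamma>\<^sub>n n \<omega> - \<gamma>\<^sub>P))) \<partial>M)
      \<longlonglongrightarrow> of_real (exp (- (t1 \<bullet> (S\<^sub>1 *v t1) + t2 \<bullet> (S\<^sub>2 *v t2)) / 2))"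
      unfolding form1 form2
      using E.char_limit[of "(t1, t2)"] by (simp only: scaleR_Pair fst_conv snd_conv b_def \<delta>_def I\<^sub>2_def I\<^sub>4_def)
  qed
qed

end
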